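(* Let $d\in\{1,2,3\}$ and $\varepsilon>0$. Let $m$ and $\mu_n$, $n\in\mathbb{N}$, be finite real-valued Radon measures on $\mathbb{R}^d$ such that $(\mu_n)_{n\in\mathbb{N}}$ converges to $m$ weakly and $\sup_{n\in\mathbb{N}}\|\mu_n\|<\infty$. Then for all sufficiently large $\alpha>0$ there exist finite constants $C_1=C_1(\varepsilon,\alpha)$ and $C_2=C_2(\varepsilon,\alpha)$, not depending on $n$, such that for all $n\in\mathbb{N}$ $$\begin{aligned}&\left\|(-\Delta+\varepsilon^2\Delta^2+\mu_n+\alpha)^{-1}-(-\Delta+\varepsilon^2\Delta^2+m+\alpha)^{-1}\right\|^2\\ &\quad\le C_1\int\int\left|\int g_{0,1}(y-a)\,g_{\varepsilon,\alpha}(x-y)\,(m-\mu_n)(dy)\right|^2da\,dx\\ &\qquad+C_2\int\int\left|\int g_{0,1}(y-a)\,g_{\varepsilon,\alpha}(x-y)\,(m-\mu_n)(dy)\right|^2da\,|m|(dx),\end{aligned}$$ where $\|\cdot\|$ on the left-hand side is the operator norm in $L^2(\mathbb{R}^d,dx)$.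
   Context: For a finite real-valued (signed) Radon measure $\mu$ on $\mathbb{R}^d$ with Hahn-Jordan decomposition $\mu=\mu^+-\mu^-$, put $|\mu|=\mu^++\mu^-$ and $\|\mu\|=\mu^+(\mathbb{R}^d)+\mu^-(\mathbb{R}^d)$. Weak convergence $\mu_n\to m$ means $\int f\,d\mu_n\to\int f\,dm$ for every bounded continuous $f$. For $d\le3$ every $f\in H^2(\mathbb{R}^d)$ has a unique continuous representative $\tilde f$. $-\Delta+\varepsilon^2\Delta^2+\mu$ denotes the lower semibounded self-adjoint operator in $L^2(\mathbb{R}^d,dx)$ associated to the lower semibounded closed quadratic form $$\mathcal{E}_\varepsilon^\mu(f,f)=\varepsilon^2(\Delta f,\Delta f)+(\nabla f,\nabla f)+\int|\tilde f|^2\,d\mu,\qquad f\in H^2(\mathbb{R}^d).$$ For $\varepsilon,\alpha>0$, $g_{\varepsilon,\alpha}$ is the continuous function such that $g_{\varepsilon,\alpha}(x-y)$ is the integral kernel of $(-\Delta+\varepsilon^2\Delta^2+\alpha)^{-1}$ in $L^2(\mathbb{R}^d,dx)$, i.e. $g_{\varepsilon,\alpha}(x)=(2\pi)^{-d}\int e^{ip\cdot x}(\varepsilon^2|p|^4+|p|^2+\alpha)^{-1}dp$. $g_{0,1}$ is the Green function of $-\Delta+1$ on $\mathbb{R}^d$, i.e. $g_{0,1}(x-y)$ is the integral kernel of $(-\Delta+1)^{-1}$; it is nonnegative and continuous on $\mathbb{R}^d\setminus\{0\}$. For each $x$ the innermost integral over $y$ is defined and finite for Lebesgue-almost every $a\in\mathbb{R}^d$;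 it is set to $0$ where undefined. *)

theory Defs
  imports "HOL-Analysis.Analysis"
begin

section \<open>Finite signed measures\<close>

text \<open>
  A finite signed measure is a countably additive real set function on the Borel sets; its values
  elsewhere are irrelevant. On a Euclidean space every finite Borel measure is Radon.
\<close>

definition signed_measure :: "('a::topological_space set \<Rightarrow> real) \<Rightarrow> bool" where
  "signed_measure \<mu> \<longleftrightarrow>
     (\<forall>A. range A \<subseteq> sets borel \<longrightarrow> disjoint_family A \<longrightarrow> (\<lambda>i::nat. \<mu> (A i)) sums \<mu> (\<Union>i. A i))"

text \<open>A Hahn set is unique only up to null sets, but the Jordan decomposition does not depend on
  the choice.\<close>

definition hahn_set :: "('a::topological_space set \<Rightarrow> real) \<Rightarrow> 'a set" where
  "hahn_set \<mu> = (SOME P. P \<in> sets borel \<and>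
     (\<forall>A \<in> sets borel. (A \<subseteq> P \<longrightarrow> \<mu> A \<ge> 0) \<and> (A \<inter> P = {} \<longrightarrow> \<mu> A \<le> 0)))"

definition pos_part :: "('a::topological_space set \<Rightarrow> real) \<Rightarrow> 'a measure" where
  "pos_part \<mu> = measure_of UNIV (sets borel) (\<lambda>A. ennreal (\<mu> (A \<inter> hahn_set \<mu>)))"

definition neg_part :: "('a::topological_space set \<Rightarrow> real) \<Rightarrow> 'a measure" where
  "neg_part \<mu> = measure_of UNIV (sets borel) (\<lambda>A. ennreal (- \<mu> (A - hahn_set \<mu>)))"

definition abs_measure :: "('a::topological_space set \<Rightarrow> real) \<Rightarrow> 'a measure" where
  "abs_measure \<mu> = measure_of UNIV (sets borel)
     (\<lambda>A. emeasure (pos_part \<mu>) A + emeasure (neg_part \<mu>) A)"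

definition total_mass :: "('a::topological_space set \<Rightarrow> real) \<Rightarrow> real" where
  "total_mass \<mu> = measure (pos_part \<mu>) UNIV + measure (neg_part \<mu>) UNIV"

definition signed_integral ::
    "('a::topological_space set \<Rightarrow> real) \<Rightarrow> ('a \<Rightarrow> 'b::{banach, second_countable_topology}) \<Rightarrow> 'b" where
  "signed_integral \<mu> f =
     (if integrable (pos_part \<mu>) f \<and> integrable (neg_part \<mu>) f
      then integral\<^sup>L (pos_part \<mu>) f - integral\<^sup>L (neg_part \<mu>) f else 0)"

definition weakly_converges ::
    "(nat \<Rightarrow> 'a::topological_space set \<Rightarrow> real) \<Rightarrow> ('a set \<Rightarrow> real) \<Rightarrow> bool" where
  "weakly_converges \<mu> m \<longleftrightarrow>
     (\<forall>f :: 'a \<Rightarrow> real. continuous_on UNIV f \<longrightarrow> bounded (range f) \<longrightarrow>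
        (\<lambda>n. signed_integral (\<mu> n) f) \<longlonglongrightarrow> signed_integral m f)"


section \<open>The complex Hilbert space \<open>L\<^sup>2(dx)\<close>\<close>

text \<open>Elements of \<open>L\<^sup>2\<close> are represented by Borel functions; equality of classes is equality almost
  everywhere. The inner product is linear in the first argument.\<close>

definition L2 :: "('a::euclidean_space \<Rightarrow> complex) set" where
  "L2 = {f \<in> borel_measurable lborel. integrable lborel (\<lambda>x. (norm (f x))\<^sup>2)}"

definition l2_inner :: "('a::euclidean_space \<Rightarrow> complex) \<Rightarrow> ('a \<Rightarrow> complex) \<Rightarrow> complex" where
  "l2_inner f g = (LINT x|lborel. f x * cnj (g x))"

definition l2_norm :: "('a::euclidean_space \<Rightarrow> complex) \<Rightarrow> real" where
  "l2_norm f = sqrt (LINT x|lborel. (norm (f x))\<^sup>2)"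

definition op_norm :: "(('a::euclidean_space \<Rightarrow> complex) \<Rightarrow> ('a \<Rightarrow> complex)) \<Rightarrow> ennreal" where
  "op_norm T = (SUP f \<in> {f \<in> L2. l2_norm f \<le> 1}. ennreal (l2_norm (T f)))"


section \<open>The Sobolev space \<open>H\<^sup>2\<close>\<close>

primrec Ck :: "nat \<Rightarrow> ('a::euclidean_space \<Rightarrow> real) \<Rightarrow> bool" where
  "Ck 0 \<phi> \<longleftrightarrow> continuous_on UNIV \<phi>"
| "Ck (Suc k) \<phi> \<longleftrightarrow> (\<forall>x. \<phi> differentiable (at x)) \<and>
     (\<forall>i\<in>Basis. Ck k (\<lambda>x. frechet_derivative \<phi> (at x) i))"

definition test_fun :: "('a::euclidean_space \<Rightarrow> real) \<Rightarrow> bool" where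
  "test_fun \<phi> \<longleftrightarrow> (\<forall>k. Ck k \<phi>) \<and> compact (closure {x. \<phi> x \<noteq> 0})"

definition has_weak_deriv ::
    "'a::euclidean_space \<Rightarrow> ('a \<Rightarrow> complex) \<Rightarrow> ('a \<Rightarrow> complex) \<Rightarrow> bool" where
  "has_weak_deriv i f g \<longleftrightarrow>
     (\<forall>\<phi>. test_fun \<phi> \<longrightarrow>
        (LINT x|lborel. frechet_derivative \<phi> (at x) i *\<^sub>R f x) = - (LINT x|lborel. \<phi> x *\<^sub>R g x))"

definition H2 :: "('a::euclidean_space \<Rightarrow> complex) set" where
  "H2 = {f \<in> L2. \<forall>i\<in>Basis. \<exists>g\<in>L2. has_weak_deriv i f g \<and>
           (\<forall>j\<in>Basis. \<exists>h\<in>L2. has_weak_deriv j g h)}"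

text \<open>The weak derivative is determined up to a null set.\<close>

definition weak_deriv :: "'a::euclidean_space \<Rightarrow> ('a \<Rightarrow> complex) \<Rightarrow> 'a \<Rightarrow> complex" where
  "weak_deriv i f = (SOME g. g \<in> L2 \<and> has_weak_deriv i f g)"

definition laplacian :: "('a::euclidean_space \<Rightarrow> complex) \<Rightarrow> 'a \<Rightarrow> complex" where
  "laplacian f = (\<lambda>x. \<Sum>i\<in>Basis. weak_deriv i (weak_deriv i f) x)"

definition cont_rep :: "('a::euclidean_space \<Rightarrow> complex) \<Rightarrow> 'a \<Rightarrow> complex" where
  "cont_rep f = (THE h. continuous_on UNIV h \<and> (AE x in lborel. h x = f x))"


section \<open>Forms, associated operators and resolvents\<close>

text \<open>The sesquilinear form obtained from the quadratic form by polarization.\<close>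

definition energy_form ::
    "real \<Rightarrow> ('a::euclidean_space set \<Rightarrow> real) \<Rightarrow> ('a \<Rightarrow> complex) \<Rightarrow> ('a \<Rightarrow> complex) \<Rightarrow> complex" where
  "energy_form \<epsilon> \<mu> f h =
     complex_of_real (\<epsilon>\<^sup>2) * l2_inner (laplacian f) (laplacian h)
     + (\<Sum>i\<in>Basis. l2_inner (weak_deriv i f) (weak_deriv i h))
     + signed_integral \<mu> (\<lambda>x. cont_rep f x * cnj (cont_rep h x))"

text \<open>Unbounded operators are given by their graphs. The operator associated with a lower
  semibounded closed form \<open>E\<close> with domain \<open>D\<close> is the one of the first representation theorem:
  \<open>f\<close> is in the operator domain with value \<open>g\<close> iff \<open>E(f,h) = (g,h)\<close> for all \<open>h\<close> in \<open>D\<close>.\<close>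

definition form_operator ::
    "('a::euclidean_space \<Rightarrow> complex) set \<Rightarrow> (('a \<Rightarrow> complex) \<Rightarrow> ('a \<Rightarrow> complex) \<Rightarrow> complex)
      \<Rightarrow> (('a \<Rightarrow> complex) \<times> ('a \<Rightarrow> complex)) set" where
  "form_operator D E = {(f, g). f \<in> D \<and> g \<in> L2 \<and> (\<forall>h\<in>D. E f h = l2_inner g h)}"

definition schroedinger ::
    "real \<Rightarrow> ('a::euclidean_space set \<Rightarrow> real) \<Rightarrow> (('a \<Rightarrow> complex) \<times> ('a \<Rightarrow> complex)) set" where
  "schroedinger \<epsilon> \<mu> = form_operator H2 (energy_form \<epsilon> \<mu>)"

definition shifted ::
    "(('a::euclidean_space \<Rightarrow> complex) \<times> ('a \<Rightarrow> complex)) set \<Rightarrow> real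
      \<Rightarrow> (('a \<Rightarrow> complex) \<times> ('a \<Rightarrow> complex)) set" where
  "shifted A \<alpha> = {(f, g). (f, \<lambda>x. g x - complex_of_real \<alpha> * f x) \<in> A}"

definition boundedly_invertible ::
    "(('a::euclidean_space \<Rightarrow> complex) \<times> ('a \<Rightarrow> complex)) set \<Rightarrow> bool" where
  "boundedly_invertible A \<longleftrightarrow>
     (\<exists>C. \<forall>g\<in>L2. \<exists>f\<in>L2. (f, g) \<in> A \<and> l2_norm f \<le> C * l2_norm g \<and>
        (\<forall>f'. (f', g) \<in> A \<longrightarrow> (AE x in lborel. f' x = f x)))"

text \<open>Where the inverse exists, its value is chosen up to a null set.\<close>

definition op_inverse ::
    "(('a::euclidean_space \<Rightarrow> complex) \<times> ('a \<Rightarrow> complex)) set \<Rightarrow> ('a \<Rightarrow> complex) \<Rightarrow> 'a \<Rightarrow> complex" where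
  "op_inverse A g = (SOME f. (f, g) \<in> A)"

definition resolvent ::
    "(('a::euclidean_space \<Rightarrow> complex) \<times> ('a \<Rightarrow> complex)) set \<Rightarrow> real \<Rightarrow> ('a \<Rightarrow> complex) \<Rightarrow> 'a \<Rightarrow> complex" where
  "resolvent A \<alpha> = op_inverse (shifted A \<alpha>)"


section \<open>Green functions\<close>

text \<open>The integrand is integrable for \<open>\<epsilon>, \<alpha> > 0\<close> in dimension at most three; the value is real.\<close>

definition green_eps :: "real \<Rightarrow> real \<Rightarrow> 'a::euclidean_space \<Rightarrow> complex" where
  "green_eps \<epsilon> \<alpha> x = complex_of_real (1 / (2 * pi) ^ DIM('a)) *
     (LINT p|lborel. cis (p \<bullet> x) / complex_of_real (\<epsilon>\<^sup>2 * norm p ^ 4 + (norm p)\<^sup>2 + \<alpha>))"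

text \<open>\<open>-\<Delta> + 1\<close> is the self-adjoint operator with domain \<open>H\<^sup>2\<close>.\<close>

definition is_green_01 :: "('a::euclidean_space \<Rightarrow> real) \<Rightarrow> bool" where
  "is_green_01 G \<longleftrightarrow>
     continuous_on (- {0}) G \<and> (\<forall>x. 0 \<le> G x) \<and>
     (\<forall>f\<in>L2.
        (AE x in lborel. integrable lborel (\<lambda>y. G (x - y) *\<^sub>R f y)) \<and>
        (let u = (\<lambda>x. LINT y|lborel. G (x - y) *\<^sub>R f y) in
          u \<in> H2 \<and> (AE x in lborel. - laplacian u x + u x = f x)))"

text \<open>Only the value at the origin is not determined by the defining property (for dimension two
  and three \<open>G\<close> has a pole there). Changing it alters
  \<open>\<integral> G (y - a) k(y) \<nu>(dy)\<close> only for \<open>a\<close> among the countably many atoms of \<open>\<nu>\<close>.\<close>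

definition green_01 :: "'a::euclidean_space \<Rightarrow> real" where
  "green_01 = (SOME G. is_green_01 G)"

end

theory Submission
  imports Defs "HOL-Probability.Probability"
begin

text \<open>
  The kernel of \<open>(-\<Delta> + \<epsilon>\<^sup>2\<Delta>\<^sup>2 + \<alpha>)\<^sup>-\<^sup>1\<close> is \<open>k(x) = \<integral> s(t) p\<^sub>t(x) dt\<close>, where \<open>p\<^sub>t\<close> is the heat kernel and
  \<open>s\<close> solves \<open>\<epsilon>\<^sup>2 s'' + s' + \<alpha> s = 0\<close>, and \<open>g\<^sub>0\<^sub>1\<close> is obtained in the same way from \<open>exp (-t)\<close>; integration by
  parts in \<open>t\<close> replaces the Fourier transform throughout. As \<open>\<alpha>\<close> grows, \<open>sup \<bar>k\<bar>\<close> tends to \<open>0\<close>, and so does the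
  constant \<open>B\<close> in \<open>\<bar>h(y)\<bar>\<^sup>2 \<le> B E(h,h)\<close>, where \<open>E\<close> is the form of the unperturbed operator plus \<open>\<alpha>\<close>. Once \<open>B\<close>
  times all total masses is at most \<open>1/2\<close>, the equation \<open>u = k * f - k * (u \<mu>)\<close> has a solution by Banach's fixed
  point theorem, and the perturbed forms are coercive, which gives uniqueness and bounds uniform in \<open>n\<close>.

  Let \<open>u\<close> and \<open>v\<close> be the resolvents of \<open>m\<close> and \<open>\<mu>\<^sub>n\<close> applied to \<open>f\<close>, and \<open>F = k * (v (m - \<mu>\<^sub>n))\<close>. Then
  \<open>z = v - u - F\<close> is the weak solution of the equation for \<open>m\<close> with data \<open>- F m\<close>, so its norm is controlled by that of
  \<open>F\<close> in \<open>L\<^sup>2(\<bar>m\<bar>)\<close>. Writing \<open>v = g\<^sub>0\<^sub>1 * \<phi>\<close> with \<open>\<phi> = v - \<Delta>v\<close> makes \<open>F(x)\<close> the integral of \<open>\<phi>\<close> against the double kernel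
  of the theorem, and the Cauchy-Schwarz inequality in \<open>a\<close> concludes.
\<close>

section \<open>Square-integrable functions\<close>

text \<open>One identity, \<open>E0_pot\<close>, carries most of the argument: the unperturbed form
  of a potential \<open>pot s M g\<close> against \<open>h\<close> is the integral over
  \<open>M\<close> of \<open>g\<close> times the conjugate of the continuous representative of
  \<open>h\<close>. With Lebesgue measure it solves the free equation, with the Jordan parts of
  \<mu> it produces the perturbation term, and with a Dirac measure it represents point evaluation,
  whence the constant \<open>B\<close>. It follows by integrating the equation of \<open>s\<close>
  against the heat flow of \<open>h\<close>; the boundary term at time 0 is \<open>h\<close> itself.
  Signed measures offer no positivity, so smallness replaces it: one bound on the kernel makes the
  fixed point map contract by 1/2 and bounds the measure term by half of the energy. The fixed point
  is sought among bounded continuous functions, where a measure can act pointwise; membership in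
  \<open>H2\<close> comes afterwards. \<open>H2\<close> is defined by weak derivatives but is always
  reached through the heat flow: \<open>w\<close> is the Laplacian of \<open>v\<close> as soon as
  \<open>conv (heat' r) v = conv (heat r) w\<close> for all positive \<open>r\<close>.\<close>

lemma borel_measurable_cnj [measurable (raw)]:
  "f \<in> borel_measurable M \<Longrightarrow> (\<lambda>x. cnj (f x)) \<in> borel_measurable M"
  by (rule borel_measurable_continuous_on[of cnj f]) (auto intro: continuous_intros)

lemma ennreal_power2_le_imp_le:
  assumes "a\<^sup>2 \<le> (ennreal r)\<^sup>2" "0 \<le> r"
  shows "a \<le> ennreal r"
proof (cases a)
  case (real q)
  have "ennreal (q\<^sup>2) \<le> ennreal (r\<^sup>2)"
    using assms(1) unfolding real(2) by (simp only: ennreal_power[OF real(1)] ennreal_power[OF assms(2)])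
  then have "q\<^sup>2 \<le> r\<^sup>2" by simp
  then have "q \<le> r" by (rule power2_le_imp_le) (rule assms(2))
  then show ?thesis unfolding real(2) by (rule ennreal_leI)
next
  case top
  have "(\<top>::ennreal) \<le> ennreal (r\<^sup>2)"
    using assms(1) unfolding top ennreal_power[OF assms(2)] by (simp add: power2_eq_square ennreal_top_mult)
  then show ?thesis by (simp add: top_unique)
qed

lemma L2_iff:
  "f \<in> L2 \<longleftrightarrow> f \<in> borel_measurable borel \<and> (\<integral>\<^sup>+x. ennreal ((norm (f x))\<^sup>2) \<partial>lborel) < \<infinity>"
proof -
  have "integrable lborel (\<lambda>x. (norm (f x))\<^sup>2) \<longleftrightarrow> (\<integral>\<^sup>+x. ennreal ((norm (f x))\<^sup>2) \<partial>lborel) < \<infinity>"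
    if "f \<in> borel_measurable borel"
    using that by (subst integrable_iff_bounded) auto
  then show ?thesis by (auto simp: L2_def)
qed

lemma L2_measurable: "f \<in> L2 \<Longrightarrow> f \<in> borel_measurable borel"
  by (simp add: L2_iff)

lemma L2_square_integrable: "f \<in> L2 \<Longrightarrow> integrable lborel (\<lambda>x. (norm (f x))\<^sup>2)"
  by (simp add: L2_def)

lemma L2_bounded_by:
  assumes "g \<in> L2" "f \<in> borel_measurable borel" "AE x in lborel. norm (f x) \<le> C * norm (g x)"
  shows "f \<in> L2"
proof -
  have "integrable lborel (\<lambda>x. (norm (f x))\<^sup>2)"
  proof (rule Bochner_Integration.integrable_bound[OF integrable_mult_right[OF L2_square_integrable[OF assms(1)], of "C\<^sup>2"]])
    show "AE x in lborel. norm ((norm (f x))\<^sup>2) \<le> norm (C\<^sup>2 * (norm (g x))\<^sup>2)"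
      using assms(3)
    proof eventually_elim
      case (elim x)
      then have "(norm (f x))\<^sup>2 \<le> (C * norm (g x))\<^sup>2" by (intro power_mono) auto
      then show ?case by (simp add: power_mult_distrib)
    qed
  qed (use assms in auto)
  then show ?thesis using assms by (simp add: L2_def)
qed

lemma L2_0 [simp]: "(\<lambda>x. 0) \<in> L2"
  by (simp add: L2_def)

lemma L2_add:
  assumes "f \<in> L2" "g \<in> L2" shows "(\<lambda>x. f x + g x) \<in> L2"
proof -
  have [measurable]: "f \<in> borel_measurable borel" "g \<in> borel_measurable borel"
    using assms by (auto simp: L2_measurable)
  have "integrable lborel (\<lambda>x. 2 * (norm (f x))\<^sup>2 + 2 * (norm (g x))\<^sup>2)"
    using assms by (intro Bochner_Integration.integrable_add integrable_mult_right) (auto intro: L2_square_integrable)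
  then have "integrable lborel (\<lambda>x. (norm (f x + g x))\<^sup>2)"
  proof (rule Bochner_Integration.integrable_bound)
    show "AE x in lborel. norm ((norm (f x + g x))\<^sup>2) \<le> norm (2 * (norm (f x))\<^sup>2 + 2 * (norm (g x))\<^sup>2)"
    proof (rule AE_I2)
      fix x
      have "(norm (f x + g x))\<^sup>2 \<le> (norm (f x) + norm (g x))\<^sup>2"
        by (intro power_mono norm_triangle_ineq) auto
      also have "\<dots> \<le> 2 * (norm (f x))\<^sup>2 + 2 * (norm (g x))\<^sup>2"
        using sum_squares_bound[of "norm (f x)" "norm (g x)"] by (simp add: power2_sum)
      finally show "norm ((norm (f x + g x))\<^sup>2) \<le> norm (2 * (norm (f x))\<^sup>2 + 2 * (norm (g x))\<^sup>2)" by simp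
    qed
  qed auto
  then show ?thesis by (simp add: L2_def)
qed

lemma L2_scale: "f \<in> L2 \<Longrightarrow> (\<lambda>x. c * f x) \<in> L2"
  by (rule L2_bounded_by[where C = "norm c" and g = f]) (use L2_measurable[of f] in \<open>auto simp: norm_mult\<close>)

lemma L2_uminus: "f \<in> L2 \<Longrightarrow> (\<lambda>x. - f x) \<in> L2"
  using L2_scale[of f "-1"] by simp

lemma L2_diff: "f \<in> L2 \<Longrightarrow> g \<in> L2 \<Longrightarrow> (\<lambda>x. f x - g x) \<in> L2"
  using L2_add[of f "\<lambda>x. - g x"] L2_uminus[of g] by simp

lemma L2_cnj: "f \<in> L2 \<Longrightarrow> (\<lambda>x. cnj (f x)) \<in> L2"
  by (rule L2_bounded_by[where C = 1 and g = f]) (use L2_measurable[of f] in auto)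

lemma L2_sum: "(\<And>i. i \<in> I \<Longrightarrow> f i \<in> L2) \<Longrightarrow> (\<lambda>x. \<Sum>i\<in>I. f i x) \<in> L2"
  by (induction I rule: infinite_finite_induct) (auto intro: L2_add)

lemma l2_norm_nonneg [simp]: "0 \<le> l2_norm f"
  by (simp add: l2_norm_def)

lemma l2_norm_0 [simp]: "l2_norm (\<lambda>x. 0) = 0"
  by (simp add: l2_norm_def)

lemma l2_norm_square: "(l2_norm f)\<^sup>2 = (LINT x|lborel. (norm (f x))\<^sup>2)"
  by (simp add: l2_norm_def)

lemma nn_l2_norm: "f \<in> L2 \<Longrightarrow> (\<integral>\<^sup>+x. ennreal ((norm (f x))\<^sup>2) \<partial>lborel) = ennreal ((l2_norm f)\<^sup>2)"
  unfolding l2_norm_square by (intro nn_integral_eq_integral L2_square_integrable) auto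

text \<open>Formulated with the nonnegative integral so that integrability of products is a
  consequence and need not be known beforehand.\<close>

lemma nn_cauchy_schwarz_L2:
  assumes "f \<in> L2" "g \<in> L2"
  shows "(\<integral>\<^sup>+x. ennreal (norm (f x) * norm (g x)) \<partial>lborel) \<le> ennreal (l2_norm f * l2_norm g)"
proof -
  have [measurable]: "f \<in> borel_measurable borel" "g \<in> borel_measurable borel"
    using assms by (auto simp: L2_measurable)
  have "(\<integral>\<^sup>+x. ennreal (norm (f x) * norm (g x)) \<partial>lborel)\<^sup>2
      = (\<integral>\<^sup>+x. ennreal (norm (f x)) * ennreal (norm (g x)) \<partial>lborel)\<^sup>2"
    by (simp add: ennreal_mult)
  also have "\<dots> \<le> (\<integral>\<^sup>+x. (ennreal (norm (f x)))\<^sup>2 \<partial>lborel) * (\<integral>\<^sup>+x. (ennreal (norm (g x)))\<^sup>2 \<partial>lborel)"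
    by (rule Cauchy_Schwarz_nn_integral) auto
  also have "\<dots> = ennreal ((l2_norm f)\<^sup>2) * ennreal ((l2_norm g)\<^sup>2)"
    using assms by (simp add: ennreal_power nn_l2_norm)
  also have "\<dots> = (ennreal (l2_norm f * l2_norm g))\<^sup>2"
    by (simp add: ennreal_power ennreal_mult[symmetric] power_mult_distrib)
  finally show ?thesis by (rule ennreal_power2_le_imp_le) simp
qed

lemma L2_mult_integrable:
  assumes "f \<in> L2" "g \<in> L2"
  shows "integrable lborel (\<lambda>x. f x * g x)"
proof -
  have [measurable]: "f \<in> borel_measurable borel" "g \<in> borel_measurable borel"
    using assms by (auto simp: L2_measurable)
  show ?thesis
    using le_less_trans[OF nn_cauchy_schwarz_L2[OF assms]]
    by (subst integrable_iff_bounded) (auto simp: norm_mult)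
qed

lemma L2_inner_integrable:
  "f \<in> L2 \<Longrightarrow> g \<in> L2 \<Longrightarrow> integrable lborel (\<lambda>x. f x * cnj (g x))"
  by (intro L2_mult_integrable L2_cnj)

lemma cauchy_schwarz_L2:
  assumes "f \<in> L2" "g \<in> L2"
  shows "norm (LINT x|lborel. f x * g x) \<le> l2_norm f * l2_norm g"
proof -
  have "ennreal (norm (LINT x|lborel. f x * g x)) \<le> (\<integral>\<^sup>+x. ennreal (norm (f x * g x)) \<partial>lborel)"
    by (rule integral_norm_bound_ennreal) (rule L2_mult_integrable[OF assms])
  also have "\<dots> \<le> ennreal (l2_norm f * l2_norm g)"
    using nn_cauchy_schwarz_L2[OF assms] by (simp add: norm_mult)
  finally show ?thesis by simp
qed

lemma l2_norm_cnj [simp]: "l2_norm (\<lambda>x. cnj (f x)) = l2_norm f"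
  by (simp add: l2_norm_def)

lemma l2_norm_uminus [simp]: "l2_norm (\<lambda>x. - f x) = l2_norm f"
  by (simp add: l2_norm_def)

lemma l2_norm_minus_commute: "l2_norm (\<lambda>x. f x - g x) = l2_norm (\<lambda>x. g x - f x)"
  by (simp add: l2_norm_def norm_minus_commute)

lemma l2_inner_cauchy_schwarz: "f \<in> L2 \<Longrightarrow> g \<in> L2 \<Longrightarrow> norm (l2_inner f g) \<le> l2_norm f * l2_norm g"
  unfolding l2_inner_def using cauchy_schwarz_L2[OF _ L2_cnj, of f g] by simp

lemma l2_inner_self: "l2_inner f f = complex_of_real ((l2_norm f)\<^sup>2)"
proof -
  have "f x * cnj (f x) = complex_of_real ((norm (f x))\<^sup>2)" for x
    by (rule complex_norm_square[symmetric])
  then have "l2_inner f f = (LINT x|lborel. complex_of_real ((norm (f x))\<^sup>2))"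
    by (simp add: l2_inner_def del: of_real_power)
  also have "\<dots> = complex_of_real ((l2_norm f)\<^sup>2)"
    unfolding l2_norm_square by (rule integral_complex_of_real)
  finally show ?thesis .
qed

lemma l2_inner_add_left:
  "\<lbrakk>f \<in> L2; g \<in> L2; h \<in> L2\<rbrakk> \<Longrightarrow> l2_inner (\<lambda>x. f x + g x) h = l2_inner f h + l2_inner g h"
  unfolding l2_inner_def distrib_right
  by (intro Bochner_Integration.integral_add L2_inner_integrable)

lemma l2_inner_diff_left:
  "\<lbrakk>f \<in> L2; g \<in> L2; h \<in> L2\<rbrakk> \<Longrightarrow> l2_inner (\<lambda>x. f x - g x) h = l2_inner f h - l2_inner g h"
  unfolding l2_inner_def left_diff_distrib
  by (intro Bochner_Integration.integral_diff L2_inner_integrable)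

lemma l2_inner_scale_left: "l2_inner (\<lambda>x. c * f x) h = c * l2_inner f h"
  by (simp add: l2_inner_def mult.assoc)

lemma l2_inner_uminus_left: "l2_inner (\<lambda>x. - f x) h = - l2_inner f h"
  by (simp add: l2_inner_def)

lemma l2_inner_commute: "l2_inner f g = cnj (l2_inner g f)"
proof -
  have "cnj (l2_inner g f) = (LINT x|lborel. cnj (g x * cnj (f x)))"
    unfolding l2_inner_def by (rule Bochner_Integration.integral_cnj[symmetric])
  then show ?thesis by (simp add: l2_inner_def mult.commute del: Bochner_Integration.integral_cnj)
qed

lemma l2_inner_sum_left:
  "\<lbrakk>\<And>i. i \<in> I \<Longrightarrow> f i \<in> L2; h \<in> L2\<rbrakk> \<Longrightarrow> l2_inner (\<lambda>x. \<Sum>i\<in>I. f i x) h = (\<Sum>i\<in>I. l2_inner (f i) h)"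
  by (induction I rule: infinite_finite_induct) (auto simp: l2_inner_add_left L2_sum, auto simp: l2_inner_def)

lemma l2_inner_add_right:
  "\<lbrakk>f \<in> L2; g \<in> L2; h \<in> L2\<rbrakk> \<Longrightarrow> l2_inner h (\<lambda>x. f x + g x) = l2_inner h f + l2_inner h g"
  using l2_inner_add_left[of f g h]
  by (subst (1 2 3) l2_inner_commute) simp

lemma l2_inner_sum_right:
  "\<lbrakk>\<And>i. i \<in> I \<Longrightarrow> f i \<in> L2; h \<in> L2\<rbrakk> \<Longrightarrow> l2_inner h (\<lambda>x. \<Sum>i\<in>I. f i x) = (\<Sum>i\<in>I. l2_inner h (f i))"
  by (subst (1 2) l2_inner_commute) (simp add: l2_inner_sum_left)

lemma l2_inner_cong_AE:
  assumes "f \<in> borel_measurable borel" "f' \<in> borel_measurable borel"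
    "g \<in> borel_measurable borel" "g' \<in> borel_measurable borel"
    "AE x in lborel. f x = f' x" "AE x in lborel. g x = g' x"
  shows "l2_inner f g = l2_inner f' g'"
proof -
  have [measurable]: "f \<in> borel_measurable borel" "f' \<in> borel_measurable borel"
    "g \<in> borel_measurable borel" "g' \<in> borel_measurable borel" by fact+
  show ?thesis
    unfolding l2_inner_def by (rule integral_cong_AE) (use assms(5,6) in auto)
qed

lemma l2_norm_triangle:
  assumes "f \<in> L2" "g \<in> L2"
  shows "l2_norm (\<lambda>x. f x + g x) \<le> l2_norm f + l2_norm g"
proof (rule power2_le_imp_le)
  have "complex_of_real ((l2_norm (\<lambda>x. f x + g x))\<^sup>2)
      = of_real ((l2_norm f)\<^sup>2) + of_real ((l2_norm g)\<^sup>2) + (l2_inner f g + l2_inner g f)"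
    using assms unfolding l2_inner_self[symmetric]
    by (simp add: l2_inner_add_left l2_inner_add_right L2_add)
  then have "(l2_norm (\<lambda>x. f x + g x))\<^sup>2 = Re (of_real ((l2_norm f)\<^sup>2) + of_real ((l2_norm g)\<^sup>2) + (l2_inner f g + l2_inner g f))"
    by (metis Re_complex_of_real)
  also have "\<dots> = (l2_norm f)\<^sup>2 + (l2_norm g)\<^sup>2 + Re (l2_inner f g + l2_inner g f)"
    by simp
  also have "Re (l2_inner f g + l2_inner g f) = 2 * Re (l2_inner f g)"
    by (subst l2_inner_commute[of g f]) simp
  also have "\<dots> \<le> 2 * (l2_norm f * l2_norm g)"
    using l2_inner_cauchy_schwarz[OF assms] complex_Re_le_cmod[of "l2_inner f g"] by linarith
  finally show "(l2_norm (\<lambda>x. f x + g x))\<^sup>2 \<le> (l2_norm f + l2_norm g)\<^sup>2"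
    by (simp add: power2_sum)
qed simp

lemma l2_norm_triangle_diff:
  assumes "f \<in> L2" "g \<in> L2"
  shows "l2_norm (\<lambda>x. f x - g x) \<le> l2_norm f + l2_norm g"
  using l2_norm_triangle[OF assms(1) L2_uminus[OF assms(2)]] by simp

lemma l2_norm_eq_0_iff:
  assumes "f \<in> L2"
  shows "l2_norm f = 0 \<longleftrightarrow> (AE x in lborel. f x = 0)"
  using integral_nonneg_eq_0_iff_AE[OF L2_square_integrable[OF assms]]
  by (simp add: l2_norm_def)

lemma tendsto_l2_pairing:
  assumes "f \<in> L2" "h \<in> L2" "\<And>n. g n \<in> L2"
    and "(\<lambda>n. l2_norm (\<lambda>x. g n x - f x)) \<longlonglongrightarrow> 0"
  shows "(\<lambda>n::nat. LINT x|lborel. g n x * h x) \<longlonglongrightarrow> (LINT x|lborel. f x * h x)"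
proof (rule LIM_zero_cancel, rule Lim_null_comparison)
  have "norm ((LINT x|lborel. g n x * h x) - (LINT x|lborel. f x * h x)) \<le> l2_norm (\<lambda>x. g n x - f x) * l2_norm h" for n
    using cauchy_schwarz_L2[OF L2_diff[OF assms(3)[of n] assms(1)] assms(2)]
    by (simp add: left_diff_distrib Bochner_Integration.integral_diff L2_mult_integrable assms)
  then show "\<forall>\<^sub>F n in sequentially. norm ((LINT x|lborel. g n x * h x) - (LINT x|lborel. f x * h x))
      \<le> l2_norm (\<lambda>x. g n x - f x) * l2_norm h" by simp
  show "(\<lambda>n. l2_norm (\<lambda>x. g n x - f x) * l2_norm h) \<longlonglongrightarrow> 0"
    using tendsto_mult_left_zero[OF assms(4)] by simp
qed

lemma tendsto_l2_norm_dominated: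
  fixes f :: "'a::euclidean_space \<Rightarrow> complex"
  assumes "f \<in> borel_measurable borel" "\<And>n. g n \<in> borel_measurable borel"
    and lim: "AE x in lborel. (\<lambda>n. g n x) \<longlonglongrightarrow> f x"
    and dom: "\<And>n. AE x in lborel. norm (g n x - f x) \<le> D x"
    and D: "integrable lborel (\<lambda>x. (D x)\<^sup>2)"
  shows "(\<lambda>n. l2_norm (\<lambda>x. g n x - f x)) \<longlonglongrightarrow> 0"
proof -
  have [measurable]: "f \<in> borel_measurable borel" "\<And>n. g n \<in> borel_measurable borel" by fact+
  have "(\<lambda>n. LINT x|lborel. (norm (g n x - f x))\<^sup>2) \<longlonglongrightarrow> (LINT (x::'a)|lborel. 0)"
  proof (rule integral_dominated_convergence[where w = "\<lambda>x. (D x)\<^sup>2"])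
    show "AE x in lborel. (\<lambda>n. (norm (g n x - f x))\<^sup>2) \<longlonglongrightarrow> 0"
      using lim
    proof eventually_elim
      case (elim x)
      then have "(\<lambda>n. (norm (g n x - f x))\<^sup>2) \<longlonglongrightarrow> (norm (f x - f x))\<^sup>2"
        by (intro tendsto_intros)
      then show ?case by simp
    qed
    show "AE x in lborel. norm ((norm (g n x - f x))\<^sup>2) \<le> (D x)\<^sup>2" for n
      using dom[of n] by eventually_elim (auto intro: power_mono)
  qed (use D in auto)
  then have "(\<lambda>n. sqrt (LINT x|lborel. (norm (g n x - f x))\<^sup>2)) \<longlonglongrightarrow> sqrt 0"
    by (intro tendsto_real_sqrt) simp
  then show ?thesis by (simp add: l2_norm_def)
qed

lemma L2_indicator_ball:
  "(\<lambda>x::'a::euclidean_space. complex_of_real (indicator (ball 0 R) x)) \<in> L2"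
proof -
  have "integrable lborel (\<lambda>x::'a. indicator (ball 0 R) x :: real)"
    by (intro integrable_real_indicator emeasure_lborel_ball_finite) auto
  moreover have "(norm (complex_of_real (indicator (ball 0 R) x)))\<^sup>2 = indicator (ball 0 R) x" for x :: 'a
    by (simp split: split_indicator)
  ultimately show ?thesis by (simp add: L2_def)
qed

section \<open>Gaussian integrals\<close>

text \<open>Separation of variables: \<open>lborel\<close> on a Euclidean space is the image of the
  product of one-dimensional Lebesgue measures under recombination of coordinates.\<close>

lemma lborel_integrable_prod:
  fixes f :: "'a::euclidean_space \<Rightarrow> real \<Rightarrow> complex"
  assumes "\<And>b. b \<in> Basis \<Longrightarrow> integrable lborel (f b)"
  shows "integrable lborel (\<lambda>x::'a. \<Prod>b\<in>Basis. f b (x \<bullet> b))"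
    and "(LINT x|lborel. (\<Prod>b\<in>Basis. f b ((x::'a) \<bullet> b))) = (\<Prod>b\<in>Basis. LINT x|lborel. f b x)"
proof -
  interpret product_sigma_finite "\<lambda>b::'a. lborel :: real measure"
    by standard
  have [measurable]: "f b \<in> borel_measurable borel" if "b \<in> Basis" for b
    using assms[OF that] by auto
  have m: "(\<lambda>g. \<Sum>b\<in>Basis. g b *\<^sub>R b) \<in> (\<Pi>\<^sub>M b\<in>(Basis::'a set). lborel) \<rightarrow>\<^sub>M borel"
    by measurable
  have eq: "(\<Prod>b\<in>Basis. f b ((\<Sum>c\<in>Basis. g c *\<^sub>R c) \<bullet> b)) = (\<Prod>b\<in>Basis. f b (g b))" for g
    by (intro prod.cong refl) (simp add: inner_sum_left_Basis)
  have meas: "(\<lambda>x::'a. \<Prod>b\<in>Basis. f b (x \<bullet> b)) \<in> borel_measurable borel"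
    by measurable
  have "integrable (\<Pi>\<^sub>M b\<in>(Basis::'a set). lborel) (\<lambda>g. \<Prod>b\<in>Basis. f b (g b))"
    by (rule product_integrable_prod) (use assms in auto)
  then show "integrable lborel (\<lambda>x::'a. \<Prod>b\<in>Basis. f b (x \<bullet> b))"
    by (subst lborel_eq, subst integrable_distr_eq[OF m meas]) (simp add: eq)
  have "(LINT g|(\<Pi>\<^sub>M b\<in>(Basis::'a set). lborel). (\<Prod>b\<in>Basis. f b (g b))) = (\<Prod>b\<in>Basis. LINT x|lborel. f b x)"
    by (rule product_integral_prod) (use assms in auto)
  then show "(LINT x|lborel. (\<Prod>b\<in>Basis. f b ((x::'a) \<bullet> b))) = (\<Prod>b\<in>Basis. LINT x|lborel. f b x)"
    by (subst lborel_eq, subst integral_distr[OF m meas]) (simp add: eq)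
qed

text \<open>The substitution p = u / c with c = sqrt (2 t) turns t p^2 into u^2 / 2, so the integral
  is a multiple of the characteristic function of the standard normal distribution at x / c.\<close>

lemma gauss_fourier_real:
  assumes t: "t > 0"
  shows "integrable lborel (\<lambda>p. cis (p * x) * complex_of_real (exp (- t * p\<^sup>2)))"
    and "(LINT p|lborel. cis (p * x) * complex_of_real (exp (- t * p\<^sup>2)))
      = complex_of_real (sqrt (pi / t) * exp (- x\<^sup>2 / (4 * t)))"
proof -
  define c where "c = sqrt (2 * t)"
  have c: "c > 0" "c\<^sup>2 = 2 * t" using t by (auto simp: c_def)
  define F where "F p = cis (p * x) * complex_of_real (exp (- t * p\<^sup>2))" for p
  have F_eq: "F (0 + (1 / c) * u) = complex_of_real (sqrt (2 * pi)) * (std_normal_density u *\<^sub>R cis ((x / c) * u))" for u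
  proof -
    have "t * ((1 / c) * u)\<^sup>2 = u\<^sup>2 / 2"
      using c t by (simp add: power_mult_distrib power_divide)
    then show ?thesis
      by (simp add: F_def std_normal_density_def scaleR_conv_of_real mult.commute)
  qed
  have int_std: "integrable lborel (\<lambda>u. std_normal_density u *\<^sub>R cis ((x / c) * u))"
  proof (rule Bochner_Integration.integrable_bound[OF integrable_normal_density[of 1 0]])
    show "AE u in lborel. norm (std_normal_density u *\<^sub>R cis (x / c * u)) \<le> norm (std_normal_density u)"
      by simp
  qed (auto simp: cis_conv_exp)
  then have "integrable lborel (\<lambda>u. F (0 + (1 / c) * u))"
    unfolding F_eq by (rule integrable_mult_right)
  then show "integrable lborel F"
    using lborel_integrable_real_affine_iff[of "1 / c" F 0] c by simp
  have "(LINT u|lborel. std_normal_density u *\<^sub>R cis ((x / c) * u)) = char std_normal_distribution (x / c)"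
    unfolding char_def by (subst integral_density) (auto simp: cis_conv_exp normal_density_nonneg mult.commute)
  also have "\<dots> = complex_of_real (exp (- ((x / c)\<^sup>2) / 2))"
    by (simp add: char_std_normal_distribution)
  also have "- ((x / c)\<^sup>2) / 2 = - x\<^sup>2 / (4 * t)"
    using c by (simp add: power_divide)
  finally have ch: "(LINT u|lborel. std_normal_density u *\<^sub>R cis ((x / c) * u)) = complex_of_real (exp (- x\<^sup>2 / (4 * t)))" .
  have "(LINT p|lborel. F p) = \<bar>1 / c\<bar> *\<^sub>R (LINT u|lborel. F (0 + (1 / c) * u))"
    by (rule lborel_integral_real_affine) (use c in auto)
  also have "\<dots> = (1 / c) *\<^sub>R (complex_of_real (sqrt (2 * pi)) * complex_of_real (exp (- x\<^sup>2 / (4 * t))))"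
    unfolding F_eq Bochner_Integration.integral_mult_right_zero ch using c by simp
  also have "\<dots> = complex_of_real (sqrt (2 * pi) / c * exp (- x\<^sup>2 / (4 * t)))"
    by (simp add: scaleR_conv_of_real)
  also have "sqrt (2 * pi) / c = sqrt (pi / t)"
    by (simp add: c_def real_sqrt_divide[symmetric])
  finally show "(LINT p|lborel. F p) = complex_of_real (sqrt (pi / t) * exp (- x\<^sup>2 / (4 * t)))" .
qed

lemma gauss_fourier:
  fixes x :: "'a::euclidean_space"
  assumes t: "t > 0"
  shows "integrable lborel (\<lambda>p. cis (p \<bullet> x) * complex_of_real (exp (- t * (p \<bullet> p))))"
    and "(LINT p|lborel. cis (p \<bullet> x) * complex_of_real (exp (- t * (p \<bullet> p))))
      = complex_of_real ((pi / t) powr (real DIM('a) / 2) * exp (- (x \<bullet> x) / (4 * t)))"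
proof -
  define f where "f b p = cis (p * (x \<bullet> b)) * complex_of_real (exp (- t * p\<^sup>2))" for b p
  have eq: "cis (p \<bullet> x) * complex_of_real (exp (- t * (p \<bullet> p))) = (\<Prod>b\<in>Basis. f b (p \<bullet> b))" for p :: 'a
  proof -
    have "(\<Prod>b\<in>Basis. f b (p \<bullet> b)) = (\<Prod>b\<in>Basis. exp (\<i> * of_real ((p \<bullet> b) * (x \<bullet> b)))) * of_real (\<Prod>b\<in>Basis. exp (- t * (p \<bullet> b)\<^sup>2))"
      by (simp add: f_def prod.distrib cis_conv_exp)
    also have "\<dots> = exp (\<i> * of_real (\<Sum>b\<in>Basis. (p \<bullet> b) * (x \<bullet> b))) * of_real (exp (- t * (\<Sum>b\<in>Basis. (p \<bullet> b) * (p \<bullet> b))))"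
      unfolding exp_sum[OF finite_Basis, symmetric] by (simp add: sum_distrib_left power2_eq_square sum_negf)
    also have "\<dots> = cis (p \<bullet> x) * complex_of_real (exp (- t * (p \<bullet> p)))"
      by (simp add: cis_conv_exp euclidean_inner[symmetric])
    finally show ?thesis by simp
  qed
  have int: "integrable lborel (f b)" for b
    unfolding f_def by (rule gauss_fourier_real[OF t])
  show "integrable lborel (\<lambda>p. cis (p \<bullet> x) * complex_of_real (exp (- t * (p \<bullet> p))))"
    unfolding eq by (rule lborel_integrable_prod) (rule int)
  have "(LINT p|lborel. cis (p \<bullet> x) * complex_of_real (exp (- t * (p \<bullet> p))))
      = (\<Prod>b\<in>Basis. complex_of_real (sqrt (pi / t) * exp (- (x \<bullet> b)\<^sup>2 / (4 * t))))"
    unfolding eq by (subst lborel_integrable_prod(2)[OF int], unfold f_def gauss_fourier_real(2)[OF t]) simp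
  also have "\<dots> = complex_of_real (sqrt (pi / t) ^ DIM('a) * (\<Prod>b\<in>Basis. exp (- (x \<bullet> b)\<^sup>2 / (4 * t))))"
    by (simp add: prod.distrib)
  also have "(\<Prod>b\<in>Basis. exp (- (x \<bullet> b)\<^sup>2 / (4 * t))) = exp (- (x \<bullet> x) / (4 * t))"
    unfolding exp_sum[OF finite_Basis, symmetric]
    by (subst euclidean_inner[of x x]) (simp add: sum_divide_distrib sum_negf power2_eq_square)
  also have "sqrt (pi / t) ^ DIM('a) = (pi / t) powr (real DIM('a) / 2)"
    using t by (simp add: powr_half_sqrt[symmetric] powr_powr powr_realpow[symmetric])
  finally show "(LINT p|lborel. cis (p \<bullet> x) * complex_of_real (exp (- t * (p \<bullet> p))))
      = complex_of_real ((pi / t) powr (real DIM('a) / 2) * exp (- (x \<bullet> x) / (4 * t)))" .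
qed

lemma gauss_integral:
  assumes "c > 0"
  shows "integrable lborel (\<lambda>x::'a::euclidean_space. exp (- (c * (x \<bullet> x))))"
    and "(LINT x|lborel. exp (- (c * ((x::'a) \<bullet> x)))) = (pi / c) powr (real DIM('a) / 2)"
proof -
  have "integrable lborel (\<lambda>x::'a. complex_of_real (exp (- (c * (x \<bullet> x)))))"
    using gauss_fourier(1)[OF assms, of "0::'a"] by simp
  then show "integrable lborel (\<lambda>x::'a::euclidean_space. exp (- (c * (x \<bullet> x))))"
    by (subst (asm) complex_of_real_integrable_eq)
  have "complex_of_real (LINT x|lborel. exp (- (c * ((x::'a) \<bullet> x)))) = complex_of_real ((pi / c) powr (real DIM('a) / 2))"
    using gauss_fourier(2)[OF assms, of "0::'a"] by simp
  then show "(LINT x|lborel. exp (- (c * ((x::'a) \<bullet> x)))) = (pi / c) powr (real DIM('a) / 2)"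
    by (simp only: of_real_eq_iff)
qed

section \<open>Completeness of \<open>L2\<close> and density of continuous functions of Gaussian
  decay\<close>

text \<open>Multiplication by the Gaussian \<open>w\<close> maps Cauchy sequences of
  \<open>L2\<close> to Cauchy sequences of L1, which have subsequences converging almost everywhere.
  Since \<open>w\<close> has no zeros, the factor can be divided out again, and Fatou's lemma turns
  the pointwise limit into a limit in norm.\<close>

lemma L2_complete:
  fixes f :: "nat \<Rightarrow> 'a::euclidean_space \<Rightarrow> complex"
  assumes f: "\<And>n. f n \<in> L2"
    and C: "\<And>e. e > 0 \<Longrightarrow> \<exists>N. \<forall>i\<ge>N. \<forall>j\<ge>N. l2_norm (\<lambda>x. f i x - f j x) < e"
  shows "\<exists>g\<in>L2. (\<lambda>n. l2_norm (\<lambda>x. f n x - g x)) \<longlonglongrightarrow> 0"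
proof -
  have [measurable]: "f n \<in> borel_measurable borel" for n
    using f by (rule L2_measurable)
  define w :: "'a \<Rightarrow> complex" where "w = (\<lambda>x. complex_of_real (exp (- (norm x)\<^sup>2)))"
  have "(norm (w x))\<^sup>2 = exp (- 2 * (x \<bullet> x))" for x
    by (simp add: w_def dot_square_norm exp_double[symmetric])
  then have wL2: "w \<in> L2"
    using gauss_integral(1)[of 2, where 'a='a] by (simp add: L2_def w_def)
  define s where "s n x = f n x * w x" for n x
  have s_int: "integrable lborel (s n)" for n
    unfolding s_def by (rule L2_mult_integrable[OF f wL2])
  have s_cauchy: "\<exists>N. \<forall>i\<ge>N. \<forall>j\<ge>N. LINT x|lborel. norm (s i x - s j x) < e" if e: "e > 0" for e
  proof -
    have "e / (l2_norm w + 1) > 0" using e by (simp add: add_nonneg_pos)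
    from C[OF this] obtain N where N: "\<And>i j. i \<ge> N \<Longrightarrow> j \<ge> N \<Longrightarrow> l2_norm (\<lambda>x. f i x - f j x) < e / (l2_norm w + 1)"
      by blast
    have "LINT x|lborel. norm (s i x - s j x) < e" if "i \<ge> N" "j \<ge> N" for i j
    proof -
      have "ennreal (LINT x|lborel. norm (s i x - s j x)) = (\<integral>\<^sup>+x. ennreal (norm (f i x - f j x) * norm (w x)) \<partial>lborel)"
      proof (subst nn_integral_eq_integral[symmetric])
        show "integrable lborel (\<lambda>x. norm (s i x - s j x))"
          by (intro integrable_norm Bochner_Integration.integrable_diff s_int)
      qed (auto simp: s_def left_diff_distrib[symmetric] norm_mult)
      also have "\<dots> \<le> ennreal (l2_norm (\<lambda>x. f i x - f j x) * l2_norm w)"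
        by (rule nn_cauchy_schwarz_L2[OF L2_diff[OF f f] wL2])
      finally have "LINT x|lborel. norm (s i x - s j x) \<le> l2_norm (\<lambda>x. f i x - f j x) * l2_norm w"
        by simp
      also have "\<dots> \<le> e / (l2_norm w + 1) * l2_norm w"
        using N[OF that] by (intro mult_right_mono) auto
      also have "\<dots> < e"
        using e l2_norm_nonneg[of w] by (simp add: field_simps add_pos_nonneg)
      finally show ?thesis .
    qed
    then show ?thesis by blast
  qed
  obtain r where r: "strict_mono r" "AE x in lborel. Cauchy (\<lambda>i. s (r i) x)"
    using cauchy_L1_AE_cauchy_subseq[OF s_int s_cauchy] by blast
  define g where "g x = (if Cauchy (\<lambda>i. f (r i) x) then lim (\<lambda>i. f (r i) x) else 0)" for x
  have [measurable]: "g \<in> borel_measurable borel"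
    unfolding g_def by measurable
  have lim: "AE x in lborel. (\<lambda>i. f (r i) x) \<longlonglongrightarrow> g x"
    using r(2)
  proof eventually_elim
    case (elim x)
    have "w x \<noteq> 0" by (simp add: w_def)
    have "Cauchy (\<lambda>i. f (r i) x)"
    proof -
      from elim obtain L where "(\<lambda>i. s (r i) x) \<longlonglongrightarrow> L"
        using Cauchy_convergent convergent_def by blast
      then have "(\<lambda>i. inverse (w x) * s (r i) x) \<longlonglongrightarrow> inverse (w x) * L"
        by (intro tendsto_intros)
      then have "convergent (\<lambda>i. inverse (w x) * s (r i) x)"
        by (rule convergentI)
      then show ?thesis
        using \<open>w x \<noteq> 0\<close> by (simp add: s_def mult.commute[of _ "w x"] mult.assoc[symmetric] convergent_Cauchy)
    qed
    then show ?case
      by (simp add: g_def Cauchy_convergent_iff convergent_LIMSEQ_iff)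
  qed
  \<comment> \<open>Fatou's lemma along the subsequence \<open>r\<close>: the distance to the
    pointwise limit is at most the Cauchy bound.\<close>
  have est: "(\<integral>\<^sup>+x. ennreal ((norm (f n x - g x))\<^sup>2) \<partial>lborel) \<le> ennreal (e\<^sup>2)"
    if N: "\<And>i j. i \<ge> N \<Longrightarrow> j \<ge> N \<Longrightarrow> l2_norm (\<lambda>x. f i x - f j x) < e" and "n \<ge> N" for n N e
  proof -
    have "(\<integral>\<^sup>+x. ennreal ((norm (f n x - g x))\<^sup>2) \<partial>lborel)
        = (\<integral>\<^sup>+x. liminf (\<lambda>i. ennreal ((norm (f n x - f (r i) x))\<^sup>2)) \<partial>lborel)"
    proof (rule nn_integral_cong_AE)
      show "AE x in lborel. ennreal ((norm (f n x - g x))\<^sup>2) = liminf (\<lambda>i. ennreal ((norm (f n x - f (r i) x))\<^sup>2))"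
        using lim
      proof eventually_elim
        case (elim x)
        then have "(\<lambda>i. ennreal ((norm (f n x - f (r i) x))\<^sup>2)) \<longlonglongrightarrow> ennreal ((norm (f n x - g x))\<^sup>2)"
          by (intro tendsto_intros tendsto_ennrealI)
        then show ?case by (rule lim_imp_Liminf[symmetric, rotated]) simp
      qed
    qed
    also have "\<dots> \<le> liminf (\<lambda>i. \<integral>\<^sup>+x. ennreal ((norm (f n x - f (r i) x))\<^sup>2) \<partial>lborel)"
      by (rule nn_integral_liminf) auto
    also have "\<dots> = liminf (\<lambda>i. ennreal ((l2_norm (\<lambda>x. f n x - f (r i) x))\<^sup>2))"
      using nn_l2_norm[OF L2_diff[OF f f]] by simp
    also have "\<dots> \<le> limsup (\<lambda>i. ennreal ((l2_norm (\<lambda>x. f n x - f (r i) x))\<^sup>2))"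
      by (rule Liminf_le_Limsup) simp
    also have "\<dots> \<le> ennreal (e\<^sup>2)"
    proof (rule Limsup_bounded)
      show "\<forall>\<^sub>F i in sequentially. ennreal ((l2_norm (\<lambda>x. f n x - f (r i) x))\<^sup>2) \<le> ennreal (e\<^sup>2)"
        using eventually_ge_at_top[of N]
      proof eventually_elim
        case (elim i)
        then have "r i \<ge> N" using seq_suble[OF r(1), of i] by linarith
        from N[OF \<open>n \<ge> N\<close> this] show ?case by (intro ennreal_leI power_mono) auto
      qed
    qed
    finally show ?thesis .
  qed
  obtain N1 where "\<And>i j. i \<ge> N1 \<Longrightarrow> j \<ge> N1 \<Longrightarrow> l2_norm (\<lambda>x. f i x - f j x) < 1"
    using C[of 1] by auto
  then have "(\<integral>\<^sup>+x. ennreal ((norm (f N1 x - g x))\<^sup>2) \<partial>lborel) \<le> ennreal (1\<^sup>2)"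
    by (intro est) auto
  then have "(\<integral>\<^sup>+x. ennreal ((norm (f N1 x - g x))\<^sup>2) \<partial>lborel) < \<infinity>"
    by (rule le_less_trans) simp
  then have "(\<lambda>x. f N1 x - g x) \<in> L2" by (simp add: L2_iff)
  from L2_diff[OF f[of N1] this] have g: "g \<in> L2" by simp
  have "(\<lambda>n. l2_norm (\<lambda>x. f n x - g x)) \<longlonglongrightarrow> 0"
  proof (rule LIMSEQ_I)
    fix e :: real assume "e > 0"
    then obtain N where N: "\<And>i j. i \<ge> N \<Longrightarrow> j \<ge> N \<Longrightarrow> l2_norm (\<lambda>x. f i x - f j x) < e / 2"
      using C[of "e / 2"] by auto
    have "l2_norm (\<lambda>x. f n x - g x) < e" if "n \<ge> N" for n
    proof -
      have "ennreal ((l2_norm (\<lambda>x. f n x - g x))\<^sup>2) \<le> ennreal ((e / 2)\<^sup>2)"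
        using est[OF N that] nn_l2_norm[OF L2_diff[OF f[of n] g]] by simp
      then have "(l2_norm (\<lambda>x. f n x - g x))\<^sup>2 \<le> (e / 2)\<^sup>2" by (simp del: power_divide)
      then have "l2_norm (\<lambda>x. f n x - g x) \<le> e / 2"
        by (rule power2_le_imp_le) (use \<open>e > 0\<close> in simp)
      then show ?thesis using \<open>e > 0\<close> by linarith
    qed
    then show "\<exists>N. \<forall>n\<ge>N. norm (l2_norm (\<lambda>x. f n x - g x) - 0) < e"
      by auto
  qed
  then show ?thesis using g by blast
qed


text \<open>Truncate \<open>f\<close> in height and in space, approximate the truncation almost
  everywhere by continuous functions, and clip these at a Gaussian envelope so that convergence
  becomes dominated. The Gaussian bound on the approximants is what the continuity of convolutions
  and the small-time limit of the heat flow rely on.\<close>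

lemma L2_dense_continuous:
  fixes f :: "'a::euclidean_space \<Rightarrow> complex"
  assumes f: "f \<in> L2" and e: "e > 0"
  obtains \<phi> C where "continuous_on UNIV \<phi>" "\<And>x. norm (\<phi> x) \<le> C * exp (- (x \<bullet> x))"
    "\<phi> \<in> L2" "l2_norm (\<lambda>x. \<phi> x - f x) < e"
proof -
  have [measurable]: "f \<in> borel_measurable borel" using f by (rule L2_measurable)
  define F where "F n x = (if norm (f x) \<le> real n \<and> norm x \<le> real n then f x else 0)" for n :: nat and x
  have [measurable]: "F n \<in> borel_measurable borel" for n
    unfolding F_def by measurable
  have F_L2: "F n \<in> L2" for n
    by (rule L2_bounded_by[where C = 1 and g = f]) (auto simp: f F_def)
  have "(\<lambda>n. l2_norm (\<lambda>x. F n x - f x)) \<longlonglongrightarrow> 0"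
  proof (rule tendsto_l2_norm_dominated[where D = "\<lambda>x. norm (f x)"])
    show "AE x in lborel. (\<lambda>n. F n x) \<longlonglongrightarrow> f x"
    proof (rule AE_I2, rule tendsto_eventually)
      fix x
      obtain n0 :: nat where n0: "max (norm (f x)) (norm x) \<le> real n0" using real_arch_simple by blast
      show "\<forall>\<^sub>F n in sequentially. F n x = f x"
        using eventually_ge_at_top[of n0] by eventually_elim (use n0 in \<open>auto simp: F_def\<close>)
    qed
  qed (auto simp: F_def L2_square_integrable[OF f])
  then have "\<forall>\<^sub>F n in sequentially. l2_norm (\<lambda>x. F n x - f x) < e / 2"
    by (rule order_tendstoD) (use e in simp)
  then obtain n where n: "l2_norm (\<lambda>x. F n x - f x) < e / 2"
    by (auto simp: eventually_sequentially)
  \<comment> \<open>A continuous envelope of the truncation: for norm x <= n the two exponentials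
    multiply to at least 1. Using n + 1 and not n keeps \<open>W\<close> positive for n = 0, as the
    division below requires.\<close>
  define W where "W x = (real n + 1) * exp (real n * real n) * exp (- (x \<bullet> x))" for x :: 'a
  have W_pos: "W x > 0" for x by (simp add: W_def)
  have [measurable]: "W \<in> borel_measurable borel" unfolding W_def by measurable
  have F_le: "norm (F n x) \<le> W x" for x
  proof (cases "norm (f x) \<le> real n \<and> norm x \<le> real n")
    case True
    have "x \<bullet> x \<le> real n * real n"
      using True by (simp add: dot_square_norm power2_eq_square mult_mono)
    then have "1 \<le> exp (real n * real n) * exp (- (x \<bullet> x))"
      by (simp add: exp_add[symmetric])
    then have "(real n + 1) * 1 \<le> (real n + 1) * (exp (real n * real n) * exp (- (x \<bullet> x)))"
      by (intro mult_left_mono) auto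
    then have "real n + 1 \<le> W x" by (simp add: W_def mult.assoc)
    with True show ?thesis by (simp add: F_def)
  qed (use W_pos[of x] in \<open>auto simp: F_def\<close>)
  have "F n \<in> borel_measurable lebesgue"
    by (rule measurable_completion) simp
  then have "F n measurable_on UNIV"
    by (rule lebesgue_measurable_imp_measurable_on) simp
  then obtain N g where N: "negligible N" and g: "\<And>k. continuous_on UNIV (g k)"
    and lim: "\<And>x. x \<notin> N \<Longrightarrow> (\<lambda>k. g k x) \<longlonglongrightarrow> F n x"
    unfolding measurable_on_def by auto
  \<comment> \<open>Radial clipping of \<open>g k\<close> to height \<open>W\<close>. It is
    continuous and leaves the limit \<open>F n\<close> unchanged because norm (F n x) <= W
    x.\<close>
  define h where "h k x = (W x / max (W x) (norm (g k x))) *\<^sub>R g k x" for k :: nat and x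
  have maxpos: "max (W x) (norm (g k x)) > 0" for k x
    using W_pos[of x] by (simp add: less_max_iff_disj)
  have h_cont: "continuous_on UNIV (h k)" for k
    unfolding h_def
  proof (intro continuous_intros g)
    show "continuous_on UNIV W" unfolding W_def by (intro continuous_intros)
    then show "continuous_on UNIV W" .
    show "\<forall>x\<in>UNIV. max (W x) (norm (g k x)) \<noteq> 0"
      using maxpos by (metis less_irrefl)
  qed
  have h_le: "norm (h k x) \<le> W x" for k x
  proof -
    have "norm (h k x) = W x * (norm (g k x) / max (W x) (norm (g k x)))"
      using W_pos[of x] maxpos[of x k] by (simp add: h_def abs_of_pos)
    also have "\<dots> \<le> W x * 1"
      using W_pos[of x] maxpos[of x k] by (intro mult_left_mono) (auto simp: divide_le_eq)
    finally show ?thesis by simp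
  qed
  have [measurable]: "h k \<in> borel_measurable borel" for k
    using h_cont by (rule borel_measurable_continuous_onI)
  have W_int: "integrable lborel (\<lambda>x. (c * W x)\<^sup>2)" for c
  proof -
    have "(c * W x)\<^sup>2 = (c * ((real n + 1) * exp (real n * real n)))\<^sup>2 * exp (- 2 * (x \<bullet> x))" for x
      by (simp add: W_def power_mult_distrib exp_double[symmetric])
    then show ?thesis using gauss_integral(1)[of 2, where 'a='a] by simp
  qed
  have h_L2: "h k \<in> L2" for k
  proof -
    have "(\<lambda>x. complex_of_real (W x)) \<in> L2"
      using W_int[of 1] by (simp add: L2_def)
    then show ?thesis
      by (rule L2_bounded_by[where C = 1]) (use h_le W_pos in \<open>auto simp: abs_of_pos\<close>)
  qed
  have "(\<lambda>k. l2_norm (\<lambda>x. h k x - F n x)) \<longlonglongrightarrow> 0"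
  proof (rule tendsto_l2_norm_dominated[where D = "\<lambda>x. 2 * W x"])
    have "AE x in lebesgue. x \<notin> N"
      using N by (intro AE_not_in) (simp add: negligible_iff_null_sets)
    then have "AE x in lebesgue. (\<lambda>k. h k x) \<longlonglongrightarrow> F n x"
    proof eventually_elim
      case (elim x)
      have "(\<lambda>k. h k x) \<longlonglongrightarrow> (W x / max (W x) (norm (F n x))) *\<^sub>R F n x"
        unfolding h_def using W_pos[of x] by (intro tendsto_intros lim elim) (auto simp: max_def)
      then show ?case using F_le[of x] W_pos[of x] by (simp add: max_def)
    qed
    then show "AE x in lborel. (\<lambda>k. h k x) \<longlonglongrightarrow> F n x"
      by (simp add: AE_completion_iff)
    show "AE x in lborel. norm (h k x - F n x) \<le> 2 * W x" for k
      using norm_triangle_ineq4[of "h k x" "F n x" for x] h_le[of k] F_le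
      by (intro AE_I2) (smt (verit))
  qed (use W_int[of 1] W_int[of 2] in auto)
  then have "\<forall>\<^sub>F k in sequentially. l2_norm (\<lambda>x. h k x - F n x) < e / 2"
    by (rule order_tendstoD) (use e in simp)
  then obtain k where k: "l2_norm (\<lambda>x. h k x - F n x) < e / 2"
    by (auto simp: eventually_sequentially)
  have "l2_norm (\<lambda>x. h k x - f x) \<le> l2_norm (\<lambda>x. h k x - F n x) + l2_norm (\<lambda>x. F n x - f x)"
    using l2_norm_triangle[OF L2_diff[OF h_L2[of k] F_L2[of n]] L2_diff[OF F_L2[of n] f]] by simp
  with n k have "l2_norm (\<lambda>x. h k x - f x) < e" by simp
  moreover have "norm (h k x) \<le> ((real n + 1) * exp (real n * real n)) * exp (- (x \<bullet> x))" for x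
    using h_le[of k x] by (simp add: W_def)
  ultimately show thesis using that[OF h_cont _ h_L2] by blast
qed

section \<open>Fubini's theorem and Young's inequality\<close>

lemma fubini:
  fixes f :: "'x \<Rightarrow> 'y \<Rightarrow> 'c::{banach, second_countable_topology}"
  assumes "sigma_finite_measure M1" "sigma_finite_measure M2"
    and [measurable]: "case_prod f \<in> borel_measurable (M1 \<Otimes>\<^sub>M M2)"
    and fin: "(\<integral>\<^sup>+x. (\<integral>\<^sup>+y. ennreal (norm (f x y)) \<partial>M2) \<partial>M1) < \<infinity>"
  shows fubini_AE_fst: "AE x in M1. integrable M2 (\<lambda>y. f x y)"
    and fubini_integrable_fst: "integrable M1 (\<lambda>x. LINT y|M2. f x y)"
    and fubini_AE_snd: "AE y in M2. integrable M1 (\<lambda>x. f x y)"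
    and fubini_integrable_snd: "integrable M2 (\<lambda>y. LINT x|M1. f x y)"
    and fubini_eq: "(LINT x|M1. (LINT y|M2. f x y)) = (LINT y|M2. (LINT x|M1. f x y))"
proof -
  interpret pair_sigma_finite M1 M2
    using assms(1,2) by (simp add: pair_sigma_finite_def)
  have "(\<integral>\<^sup>+z. ennreal (norm (case_prod f z)) \<partial>(M1 \<Otimes>\<^sub>M M2)) < \<infinity>"
    using fin by (subst M2.nn_integral_fst[symmetric]) auto
  then have int: "integrable (M1 \<Otimes>\<^sub>M M2) (case_prod f)"
    by (subst integrable_iff_bounded) auto
  show "AE x in M1. integrable M2 (\<lambda>y. f x y)" by (rule AE_integrable_fst[OF int])
  show "integrable M1 (\<lambda>x. LINT y|M2. f x y)" by (rule integrable_fst[OF int])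
  show "AE y in M2. integrable M1 (\<lambda>x. f x y)" by (rule AE_integrable_snd[OF int])
  show "integrable M2 (\<lambda>y. LINT x|M1. f x y)" by (rule integrable_snd[OF int])
  show "(LINT x|M1. (LINT y|M2. f x y)) = (LINT y|M2. (LINT x|M1. f x y))"
    by (rule Fubini_integral[symmetric, OF int])
qed

lemma distr_lborel_translate: "distr lborel borel (\<lambda>x. y + x) = (lborel :: 'a::euclidean_space measure)"
  by (subst lborel_affine[of 1 y]) (auto simp: density_1)

lemma distr_lborel_reflect: "distr lborel borel (\<lambda>x. y - x) = (lborel :: 'a::euclidean_space measure)"
  by (subst lborel_affine[of "-1" y]) (auto simp: density_1)

lemma nn_integral_reflect:
  fixes y :: "'a::euclidean_space"
  assumes [measurable]: "f \<in> borel_measurable borel"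
  shows "(\<integral>\<^sup>+x. f (y - x) \<partial>lborel) = (\<integral>\<^sup>+x. f x \<partial>lborel)"
  by (subst distr_lborel_reflect[of y, symmetric], subst nn_integral_distr) auto

lemma nn_integral_translate:
  fixes y :: "'a::euclidean_space"
  assumes [measurable]: "f \<in> borel_measurable borel"
  shows "(\<integral>\<^sup>+x. f (x - y) \<partial>lborel) = (\<integral>\<^sup>+x. f x \<partial>lborel)"
  by (subst distr_lborel_translate[of "y", symmetric], subst nn_integral_distr) (auto simp: algebra_simps)

lemma integral_reflect:
  fixes y :: "'a::euclidean_space" and f :: "'a \<Rightarrow> 'b::{banach, second_countable_topology}"
  assumes [measurable]: "f \<in> borel_measurable borel"
  shows "(LINT x|lborel. f (y - x)) = (LINT x|lborel. f x)"
  by (subst (2) distr_lborel_reflect[of y, symmetric], subst integral_distr) auto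

lemma integral_translate:
  fixes y :: "'a::euclidean_space" and f :: "'a \<Rightarrow> 'b::{banach, second_countable_topology}"
  assumes [measurable]: "f \<in> borel_measurable borel"
  shows "(LINT x|lborel. f (y + x)) = (LINT x|lborel. f x)"
  by (subst (2) distr_lborel_translate[of y, symmetric], subst integral_distr) auto

lemma integrable_reflect:
  fixes y :: "'a::euclidean_space" and f :: "'a \<Rightarrow> 'b::{banach, second_countable_topology}"
  assumes "integrable lborel f"
  shows "integrable lborel (\<lambda>x. f (y - x))"
proof -
  have [measurable]: "f \<in> borel_measurable borel" using assms by auto
  have "integrable (distr lborel borel (\<lambda>x. y - x)) f" by (simp add: distr_lborel_reflect assms)
  then show ?thesis by (subst (asm) integrable_distr_eq) auto
qed

lemma integrable_translate:
  fixes y :: "'a::euclidean_space" and f :: "'a \<Rightarrow> 'b::{banach, second_countable_topology}"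
  assumes "integrable lborel f"
  shows "integrable lborel (\<lambda>x. f (y + x))"
proof -
  have [measurable]: "f \<in> borel_measurable borel" using assms by auto
  have "integrable (distr lborel borel (\<lambda>x. y + x)) f" by (simp add: distr_lborel_translate assms)
  then show ?thesis by (subst (asm) integrable_distr_eq) auto
qed

lemma nn_weighted_cauchy_schwarz:
  assumes [measurable]: "w \<in> borel_measurable M" "f \<in> borel_measurable M"
  shows "(\<integral>\<^sup>+z. w z * f z \<partial>M)\<^sup>2 \<le> (\<integral>\<^sup>+z. w z \<partial>M) * (\<integral>\<^sup>+z. w z * (f z)\<^sup>2 \<partial>M)"
proof -
  have "(\<integral>\<^sup>+z. 1 * f z \<partial>density M w)\<^sup>2 \<le> (\<integral>\<^sup>+z. 1\<^sup>2 \<partial>density M w) * (\<integral>\<^sup>+z. (f z)\<^sup>2 \<partial>density M w)"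
    by (rule Cauchy_Schwarz_nn_integral) auto
  then show ?thesis by (simp add: nn_integral_density emeasure_density)
qed

text \<open>Young's inequality for L1 * L2: Cauchy-Schwarz in \<open>z\<close> with weight N (x -
  z), then Tonelli and translation invariance.\<close>

lemma nn_young:
  fixes N F :: "'a::euclidean_space \<Rightarrow> ennreal"
  assumes [measurable]: "N \<in> borel_measurable borel" "F \<in> borel_measurable borel"
  shows "(\<integral>\<^sup>+x. (\<integral>\<^sup>+z. N (x - z) * F z \<partial>lborel)\<^sup>2 \<partial>lborel) \<le> (\<integral>\<^sup>+x. N x \<partial>lborel)\<^sup>2 * (\<integral>\<^sup>+x. (F x)\<^sup>2 \<partial>lborel)"
proof -
  define I where "I = (\<integral>\<^sup>+x. N x \<partial>lborel)"
  have "(\<integral>\<^sup>+x. (\<integral>\<^sup>+z. N (x - z) * F z \<partial>lborel)\<^sup>2 \<partial>lborel)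
      \<le> (\<integral>\<^sup>+x. I * (\<integral>\<^sup>+z. N (x - z) * (F z)\<^sup>2 \<partial>lborel) \<partial>lborel)"
  proof (rule nn_integral_mono)
    fix x :: 'a
    have "(\<integral>\<^sup>+z. N (x - z) \<partial>lborel) = I"
      unfolding I_def by (rule nn_integral_reflect) simp
    then show "(\<integral>\<^sup>+z. N (x - z) * F z \<partial>lborel)\<^sup>2 \<le> I * (\<integral>\<^sup>+z. N (x - z) * (F z)\<^sup>2 \<partial>lborel)"
      using nn_weighted_cauchy_schwarz[of "\<lambda>z. N (x - z)" lborel F] by simp
  qed
  also have "\<dots> = I * (\<integral>\<^sup>+x. (\<integral>\<^sup>+z. N (x - z) * (F z)\<^sup>2 \<partial>lborel) \<partial>lborel)"
    by (rule nn_integral_cmult) measurable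
  also have "(\<integral>\<^sup>+x. (\<integral>\<^sup>+z. N (x - z) * (F z)\<^sup>2 \<partial>lborel) \<partial>lborel)
      = (\<integral>\<^sup>+z. (\<integral>\<^sup>+x. N (x - z) * (F z)\<^sup>2 \<partial>lborel) \<partial>lborel)"
    by (rule lborel_pair.Fubini'[symmetric]) measurable
  also have "\<dots> = (\<integral>\<^sup>+z. I * (F z)\<^sup>2 \<partial>lborel)"
  proof (rule nn_integral_cong)
    fix z :: 'a
    have "(\<integral>\<^sup>+x. N (x - z) * (F z)\<^sup>2 \<partial>lborel) = (\<integral>\<^sup>+x. N (x - z) \<partial>lborel) * (F z)\<^sup>2"
      by (rule nn_integral_multc) measurable
    then show "(\<integral>\<^sup>+x. N (x - z) * (F z)\<^sup>2 \<partial>lborel) = I * (F z)\<^sup>2"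
      by (simp add: I_def nn_integral_translate)
  qed
  also have "\<dots> = I * (\<integral>\<^sup>+z. (F z)\<^sup>2 \<partial>lborel)"
    by (rule nn_integral_cmult) measurable
  finally show ?thesis by (simp add: I_def power2_eq_square mult.assoc)
qed

section \<open>Convolution\<close>

definition conv :: "('a::euclidean_space \<Rightarrow> real) \<Rightarrow> ('a \<Rightarrow> complex) \<Rightarrow> 'a \<Rightarrow> complex" where
  "conv k u y = (LINT x|lborel. k (y - x) *\<^sub>R u x)"

lemma borel_measurable_conv [measurable]:
  assumes [measurable]: "k \<in> borel_measurable borel" "u \<in> borel_measurable borel"
  shows "conv k u \<in> borel_measurable borel"
  unfolding conv_def by measurable

text \<open>Kernels are real-valued while \<open>L2\<close> consists of complex functions; this
  predicate transfers the theory of \<open>L2\<close> to kernels.\<close>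

definition real_L2 :: "('a::euclidean_space \<Rightarrow> real) \<Rightarrow> bool" where
  "real_L2 k \<longleftrightarrow> (\<lambda>x. complex_of_real (k x)) \<in> L2"

lemma real_L2_iff: "real_L2 k \<longleftrightarrow> k \<in> borel_measurable borel \<and> integrable lborel (\<lambda>x. (k x)\<^sup>2)"
proof -
  have "(\<lambda>x. complex_of_real (k x)) \<in> borel_measurable borel \<longleftrightarrow> k \<in> borel_measurable borel"
  proof
    assume "(\<lambda>x. complex_of_real (k x)) \<in> borel_measurable borel"
    from measurable_compose[OF this borel_measurable_Re] show "k \<in> borel_measurable borel" by simp
  qed (rule measurable_compose[OF _ borel_measurable_of_real])
  then show ?thesis by (simp add: real_L2_def L2_def)
qed

lemma real_L2_measurable: "real_L2 k \<Longrightarrow> k \<in> borel_measurable borel"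
  by (simp add: real_L2_iff)

lemma L2_reflect:
  assumes "f \<in> L2" shows "(\<lambda>x. f (y - x)) \<in> L2" "l2_norm (\<lambda>x. f (y - x)) = l2_norm f"
proof -
  have [measurable]: "f \<in> borel_measurable borel" using assms by (rule L2_measurable)
  show "(\<lambda>x. f (y - x)) \<in> L2"
    using integrable_reflect[OF L2_square_integrable[OF assms], of y] by (simp add: L2_def)
  show "l2_norm (\<lambda>x. f (y - x)) = l2_norm f"
    using integral_reflect[of "\<lambda>x. (norm (f x))\<^sup>2" y] by (simp add: l2_norm_def)
qed

abbreviation (input) cpx :: "('a \<Rightarrow> real) \<Rightarrow> 'a \<Rightarrow> complex" where
  "cpx k \<equiv> (\<lambda>x. complex_of_real (k x))"

lemma real_L2_reflect: "real_L2 k \<Longrightarrow> (\<lambda>x. complex_of_real (k (y - x))) \<in> L2"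
  using L2_reflect(1)[of "cpx k" y] by (simp add: real_L2_def)

lemma conv_integrable:
  assumes "real_L2 k" "u \<in> L2"
  shows "integrable lborel (\<lambda>x. k (y - x) *\<^sub>R u x)"
  using L2_mult_integrable[OF real_L2_reflect[OF assms(1), of y] assms(2)]
  by (simp add: scaleR_conv_of_real)

lemma conv_bound:
  assumes "real_L2 k" "u \<in> L2"
  shows "norm (conv k u y) \<le> l2_norm (cpx k) * l2_norm u"
  using cauchy_schwarz_L2[OF real_L2_reflect[OF assms(1), of y] assms(2)]
    L2_reflect(2)[of "cpx k" y] assms(1)
  by (simp add: conv_def scaleR_conv_of_real real_L2_def)

lemma conv_diff_right:
  "\<lbrakk>real_L2 k; u \<in> L2; v \<in> L2\<rbrakk> \<Longrightarrow> conv k (\<lambda>x. u x - v x) y = conv k u y - conv k v y"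
  unfolding conv_def scaleR_diff_right
  by (intro Bochner_Integration.integral_diff conv_integrable)

lemma conv_sum_right:
  "\<lbrakk>real_L2 k; \<And>i. i \<in> I \<Longrightarrow> u i \<in> L2\<rbrakk> \<Longrightarrow> conv k (\<lambda>x. \<Sum>i\<in>I. u i x) y = (\<Sum>i\<in>I. conv k (u i) y)"
  unfolding conv_def scaleR_sum_right
  by (intro Bochner_Integration.integral_sum conv_integrable)

lemma conv_diff_left:
  "\<lbrakk>real_L2 k; real_L2 k'; u \<in> L2\<rbrakk> \<Longrightarrow> conv (\<lambda>x. k x - k' x) u y = conv k u y - conv k' u y"
  unfolding conv_def scaleR_diff_left
  by (intro Bochner_Integration.integral_diff conv_integrable)

lemma conv_sum_left:
  "\<lbrakk>\<And>i. i \<in> I \<Longrightarrow> real_L2 (k i); u \<in> L2\<rbrakk> \<Longrightarrow> conv (\<lambda>x. \<Sum>i\<in>I. k i x) u y = (\<Sum>i\<in>I. conv (k i) u y)"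
  unfolding conv_def scaleR_sum_left
  by (intro Bochner_Integration.integral_sum conv_integrable)

lemma conv_cong_AE:
  assumes [measurable]: "k \<in> borel_measurable borel" "u \<in> borel_measurable borel" "v \<in> borel_measurable borel"
    and "AE x in lborel. u x = v x"
  shows "conv k u y = conv k v y"
  unfolding conv_def by (rule integral_cong_AE) (use assms(4) in auto)

lemma conv_L2:
  assumes k: "integrable lborel k" and u: "u \<in> L2"
  shows "conv k u \<in> L2" and "l2_norm (conv k u) \<le> (LINT x|lborel. \<bar>k x\<bar>) * l2_norm u"
proof -
  have [measurable]: "k \<in> borel_measurable borel" "u \<in> borel_measurable borel"
    using k u by (auto simp: L2_measurable)
  have "(\<integral>\<^sup>+y. ennreal ((norm (conv k u y))\<^sup>2) \<partial>lborel)
      \<le> (\<integral>\<^sup>+y. (\<integral>\<^sup>+x. ennreal \<bar>k (y - x)\<bar> * ennreal (norm (u x)) \<partial>lborel)\<^sup>2 \<partial>lborel)"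
  proof (rule nn_integral_mono)
    fix y
    \<comment> \<open>Where the convolution integral does not exist, \<open>conv\<close> is 0 by
      default and the estimate is trivial.\<close>
    have "ennreal (norm (conv k u y)) \<le> (\<integral>\<^sup>+x. ennreal (norm (k (y - x) *\<^sub>R u x)) \<partial>lborel)"
    proof (cases "integrable lborel (\<lambda>x. k (y - x) *\<^sub>R u x)")
      case True then show ?thesis unfolding conv_def by (rule integral_norm_bound_ennreal)
    qed (simp add: conv_def not_integrable_integral_eq)
    also have "\<dots> = (\<integral>\<^sup>+x. ennreal \<bar>k (y - x)\<bar> * ennreal (norm (u x)) \<partial>lborel)"
      by (simp add: ennreal_mult)
    finally have "(ennreal (norm (conv k u y)))\<^sup>2 \<le> (\<integral>\<^sup>+x. ennreal \<bar>k (y - x)\<bar> * ennreal (norm (u x)) \<partial>lborel)\<^sup>2"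
      by (rule power_mono) simp
    then show "ennreal ((norm (conv k u y))\<^sup>2) \<le> (\<integral>\<^sup>+x. ennreal \<bar>k (y - x)\<bar> * ennreal (norm (u x)) \<partial>lborel)\<^sup>2"
      by (simp add: ennreal_power)
  qed
  also have "\<dots> \<le> (\<integral>\<^sup>+x. ennreal \<bar>k x\<bar> \<partial>lborel)\<^sup>2 * (\<integral>\<^sup>+x. (ennreal (norm (u x)))\<^sup>2 \<partial>lborel)"
    by (rule nn_young) auto
  also have "(\<integral>\<^sup>+x. ennreal \<bar>k x\<bar> \<partial>lborel) = ennreal (LINT x|lborel. \<bar>k x\<bar>)"
    using k by (intro nn_integral_eq_integral) auto
  also have "(\<integral>\<^sup>+x. (ennreal (norm (u x)))\<^sup>2 \<partial>lborel) = ennreal ((l2_norm u)\<^sup>2)"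
    using nn_l2_norm[OF u] by (simp add: ennreal_power)
  also have "(ennreal (LINT x|lborel. \<bar>k x\<bar>))\<^sup>2 * ennreal ((l2_norm u)\<^sup>2) = ennreal (((LINT x|lborel. \<bar>k x\<bar>) * l2_norm u)\<^sup>2)"
    by (simp add: ennreal_power ennreal_mult[symmetric] power_mult_distrib)
  finally have le: "(\<integral>\<^sup>+y. ennreal ((norm (conv k u y))\<^sup>2) \<partial>lborel) \<le> ennreal (((LINT x|lborel. \<bar>k x\<bar>) * l2_norm u)\<^sup>2)" .
  also have "\<dots> < \<infinity>" by simp
  finally show L2: "conv k u \<in> L2" by (simp add: L2_iff)
  have "(l2_norm (conv k u))\<^sup>2 \<le> ((LINT x|lborel. \<bar>k x\<bar>) * l2_norm u)\<^sup>2"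
    using le unfolding nn_l2_norm[OF L2] by simp
  then show "l2_norm (conv k u) \<le> (LINT x|lborel. \<bar>k x\<bar>) * l2_norm u"
    by (rule power2_le_imp_le) (simp add: integral_nonneg)
qed

lemma continuous_conv_gaussian:
  fixes \<phi> :: "'a::euclidean_space \<Rightarrow> complex"
  assumes "continuous_on UNIV \<phi>" "\<And>x. norm (\<phi> x) \<le> C * exp (- (x \<bullet> x))" "u \<in> L2"
  shows "continuous_on UNIV (\<lambda>y. LINT x|lborel. \<phi> (y - x) * u x)"
proof (rule continuous_on_sequentiallyI)
  fix s and y :: 'a assume s: "s \<longlonglongrightarrow> y"
  have [measurable]: "\<phi> \<in> borel_measurable borel" "u \<in> borel_measurable borel"
    using assms by (auto simp: L2_measurable intro: borel_measurable_continuous_onI)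
  have C: "C \<ge> 0" using assms(2)[of 0] norm_ge_zero[of "\<phi> 0"] by (simp add: order_trans[OF norm_ge_zero])
  \<comment> \<open>A wider Gaussian centred at the limit point. For norm (z - y) <= 1, the
    inequality norm (y - x)^2 <= 2 norm (z - y)^2 + 2 norm (z - x)^2 costs half of the rate and a
    factor \<open>exp 1\<close>, and makes the bound uniform in \<open>z\<close>.\<close>
  define D where "D x = C * exp 1 * exp (- (1 / 2) * ((y - x) \<bullet> (y - x)))" for x
  have D_L2: "cpx D \<in> L2"
  proof -
    have "(D x)\<^sup>2 = (C * exp 1)\<^sup>2 * exp (- 1 * ((y - x) \<bullet> (y - x)))" for x
      by (simp add: D_def power_mult_distrib exp_double[symmetric])
    moreover have "integrable lborel (\<lambda>x. exp (- 1 * ((y - x) \<bullet> (y - x))))"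
      using integrable_reflect[OF gauss_integral(1)[of 1], of y] by simp
    ultimately have "integrable lborel (\<lambda>x. (D x)\<^sup>2)" by simp
    moreover have "D \<in> borel_measurable borel" unfolding D_def by measurable
    ultimately show ?thesis by (simp add: L2_def)
  qed
  have bound: "norm (\<phi> (z - x)) \<le> D x" if "norm (z - y) \<le> 1" for z x
  proof -
    have "(norm (y - x))\<^sup>2 \<le> (norm (z - y) + norm (z - x))\<^sup>2"
      using norm_triangle_ineq4[of "z - x" "z - y"] by (intro power_mono) (auto simp: algebra_simps)
    also have "\<dots> \<le> 2 * (norm (z - y))\<^sup>2 + 2 * (norm (z - x))\<^sup>2"
      using sum_squares_bound[of "norm (z - y)" "norm (z - x)"] by (simp add: power2_sum)
    also have "\<dots> \<le> 2 + 2 * (norm (z - x))\<^sup>2"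
      using that by (simp add: power_le_one)
    finally have "- ((z - x) \<bullet> (z - x)) \<le> 1 + - (1 / 2) * ((y - x) \<bullet> (y - x))"
      by (simp add: dot_square_norm)
    then have "exp (- ((z - x) \<bullet> (z - x))) \<le> exp 1 * exp (- (1 / 2) * ((y - x) \<bullet> (y - x)))"
      by (simp add: exp_add[symmetric])
    then have "C * exp (- ((z - x) \<bullet> (z - x))) \<le> D x"
      using C unfolding D_def mult.assoc by (rule mult_left_mono)
    then show ?thesis using assms(2)[of "z - x"] by simp
  qed
  obtain n0 where n0: "\<And>n. n \<ge> n0 \<Longrightarrow> norm (s n - y) \<le> 1"
    using LIMSEQ_D[OF s, of 1] by (auto intro: less_imp_le)
  have "(\<lambda>n. LINT x|lborel. \<phi> (s (n + n0) - x) * u x) \<longlonglongrightarrow> (LINT x|lborel. \<phi> (y - x) * u x)"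
  proof (rule integral_dominated_convergence[where w = "\<lambda>x. norm (complex_of_real (D x) * u x)"])
    show "integrable lborel (\<lambda>x. norm (complex_of_real (D x) * u x))"
      by (intro integrable_norm L2_mult_integrable D_L2 assms)
    have "(\<lambda>n. s (n + n0)) \<longlonglongrightarrow> y" by (rule LIMSEQ_ignore_initial_segment[OF s])
    then show "AE x in lborel. (\<lambda>n. \<phi> (s (n + n0) - x) * u x) \<longlonglongrightarrow> \<phi> (y - x) * u x"
      using assms(1)
      by (intro AE_I2 tendsto_intros continuous_on_tendsto_compose[of UNIV \<phi>]) auto
    show "AE x in lborel. norm (\<phi> (s (n + n0) - x) * u x) \<le> norm (complex_of_real (D x) * u x)" for n
      using bound[OF n0[of "n + n0"]] by (intro AE_I2) (auto simp: norm_mult intro!: mult_right_mono abs_ge_self order_trans[OF _ abs_ge_self])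
  qed auto
  then show "(\<lambda>n. LINT x|lborel. \<phi> (s n - x) * u x) \<longlonglongrightarrow> (LINT x|lborel. \<phi> (y - x) * u x)"
    by (rule LIMSEQ_offset)
qed

text \<open>By Cauchy-Schwarz the convolution depends on the kernel uniformly in the evaluation
  point. Approximating \<open>k\<close> in \<open>L2\<close> by continuous functions of Gaussian
  decay exhibits the convolution as a uniform limit of continuous functions.\<close>

lemma continuous_conv:
  fixes k :: "'a::euclidean_space \<Rightarrow> real"
  assumes k: "real_L2 k" and u: "u \<in> L2"
  shows "continuous_on UNIV (conv k u)"
proof -
  have kL2: "cpx k \<in> L2" using k by (simp add: real_L2_def)
  have "\<exists>\<phi> C. continuous_on UNIV \<phi> \<and> (\<forall>x. norm (\<phi> x) \<le> C * exp (- (x \<bullet> x))) \<and> \<phi> \<in> L2 \<and>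
      l2_norm (\<lambda>x. \<phi> x - cpx k x) < 1 / Suc n" for n
    by (rule L2_dense_continuous[OF kL2, of "1 / Suc n"]) auto
  then obtain \<phi> C where \<phi>: "\<And>n. continuous_on UNIV (\<phi> n)" "\<And>n x. norm (\<phi> n x) \<le> C n * exp (- (x \<bullet> x))"
    "\<And>n. \<phi> n \<in> L2" "\<And>n::nat. l2_norm (\<lambda>x. \<phi> n x - cpx k x) < 1 / Suc n"
    by metis
  have uc: "uniform_limit UNIV (\<lambda>n y. LINT x|lborel. \<phi> n (y - x) * u x) (conv k u) sequentially"
  proof (rule uniform_limitI)
    fix e :: real assume e: "e > 0"
    have "(\<lambda>n. inverse (real (Suc n)) * l2_norm u) \<longlonglongrightarrow> 0 * l2_norm u"
      by (intro tendsto_intros LIMSEQ_inverse_real_of_nat)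
    then have "\<forall>\<^sub>F n in sequentially. inverse (real (Suc n)) * l2_norm u < e"
      by (rule order_tendstoD) (use e in simp)
    then show "\<forall>\<^sub>F n in sequentially. \<forall>y\<in>UNIV. dist (LINT x|lborel. \<phi> n (y - x) * u x) (conv k u y) < e"
    proof eventually_elim
      case (elim n)
      show ?case
      proof
        fix y
        have "(LINT x|lborel. \<phi> n (y - x) * u x) - conv k u y = (LINT x|lborel. (\<phi> n (y - x) - cpx k (y - x)) * u x)"
          using L2_mult_integrable[OF L2_reflect(1)[OF \<phi>(3)[of n], of y] u] conv_integrable[OF k u, of y]
          by (simp add: conv_def scaleR_conv_of_real left_diff_distrib)
        also have "norm \<dots> \<le> l2_norm (\<lambda>x. \<phi> n (y - x) - cpx k (y - x)) * l2_norm u"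
          by (rule cauchy_schwarz_L2) (intro L2_diff L2_reflect(1)[OF \<phi>(3)] L2_reflect(1)[OF kL2] u)+
        also have "l2_norm (\<lambda>x. \<phi> n (y - x) - cpx k (y - x)) = l2_norm (\<lambda>x. \<phi> n x - cpx k x)"
          using L2_reflect(2)[OF L2_diff[OF \<phi>(3)[of n] kL2], of y] by simp
        also have "\<dots> * l2_norm u \<le> inverse (real (Suc n)) * l2_norm u"
          using \<phi>(4)[of n] by (intro mult_right_mono) (auto simp: field_simps)
        also note elim
        finally show "dist (LINT x|lborel. \<phi> n (y - x) * u x) (conv k u y) < e"
          by (simp add: dist_norm)
      qed
    qed
  qed
  show ?thesis
    by (rule uniform_limit_theorem[OF _ uc]) (auto intro!: always_eventually continuous_conv_gaussian \<phi> u)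
qed

section \<open>Polynomials times Gaussians\<close>

definition pd :: "'a::euclidean_space \<Rightarrow> ('a \<Rightarrow> real) \<Rightarrow> 'a \<Rightarrow> real" where
  "pd i f x = frechet_derivative f (at x) i"

text \<open>A concrete stand-in for the Schwartz space: it contains the Gaussians and is closed
  under partial derivatives, and smoothness, Gaussian bounds and symmetry of second derivatives
  follow by induction on the generation.\<close>

inductive sch :: "('a::euclidean_space \<Rightarrow> real) \<Rightarrow> bool" where
  sch_gauss: "c > 0 \<Longrightarrow> sch (\<lambda>x. exp (- (c * (x \<bullet> x))))"
| sch_coord: "sch f \<Longrightarrow> i \<in> Basis \<Longrightarrow> sch (\<lambda>x. (x \<bullet> i) * f x)"
| sch_scale: "sch f \<Longrightarrow> sch (\<lambda>x. a * f x)"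
| sch_add: "sch f \<Longrightarrow> sch g \<Longrightarrow> sch (\<lambda>x. f x + g x)"

lemma pd_eqI: "(f has_derivative f') (at x) \<Longrightarrow> pd i f x = f' i"
  unfolding pd_def by (metis frechet_derivative_at)

lemma pd_add:
  assumes "\<And>x. f differentiable (at x)" "\<And>x. g differentiable (at x)"
  shows "pd i (\<lambda>x. f x + g x) = (\<lambda>x. pd i f x + pd i g x)"
  unfolding pd_def
  by (intro ext pd_eqI[unfolded pd_def] has_derivative_add)
    (use assms in \<open>auto simp: frechet_derivative_works[symmetric]\<close>)

lemma pd_mult:
  assumes "\<And>x. f differentiable (at x)" "\<And>x. g differentiable (at x)"
  shows "pd i (\<lambda>x. f x * g x) = (\<lambda>x. f x * pd i g x + pd i f x * g x)"
  unfolding pd_def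
  by (intro ext pd_eqI[unfolded pd_def] has_derivative_mult)
    (use assms in \<open>auto simp: frechet_derivative_works[symmetric]\<close>)

lemma pd_scale:
  assumes "\<And>x. f differentiable (at x)"
  shows "pd i (\<lambda>x. c * f x) = (\<lambda>x. c * pd i f x)"
  unfolding pd_def
  by (intro ext pd_eqI[unfolded pd_def] has_derivative_mult_right)
    (use assms in \<open>auto simp: frechet_derivative_works[symmetric]\<close>)

lemma pd_coord: "pd i (\<lambda>x. x \<bullet> j) = (\<lambda>x. i \<bullet> j)"
  by (intro ext pd_eqI) (auto intro!: derivative_eq_intros)

lemma pd_const [simp]: "pd i (\<lambda>x. c) = (\<lambda>x. 0)"
  by (intro ext pd_eqI) (rule has_derivative_const)

lemma coord_differentiable [simp]: "(\<lambda>x. x \<bullet> j) differentiable (at x)"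
  by (rule differentiableI) (auto intro!: derivative_eq_intros)

lemma gauss_has_derivative:
  "((\<lambda>x::'a::euclidean_space. exp (- (c * (x \<bullet> x)))) has_derivative
     (\<lambda>h. - (2 * c) * ((x \<bullet> h) * exp (- (c * (x \<bullet> x)))))) (at x)"
  by (auto intro!: derivative_eq_intros simp: inner_commute algebra_simps)

lemma pd_gauss: "pd i (\<lambda>x. exp (- (c * (x \<bullet> x)))) = (\<lambda>x. - (2 * c) * ((x \<bullet> i) * exp (- (c * (x \<bullet> x)))))"
  by (intro ext) (simp add: pd_eqI[OF gauss_has_derivative])

lemma gauss_differentiable [simp]: "(\<lambda>x::'a::euclidean_space. exp (- (c * (x \<bullet> x)))) differentiable (at x)"
  by (rule differentiableI) (rule gauss_has_derivative)

lemma sch_differentiable: "sch f \<Longrightarrow> f differentiable (at x)"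
  by (induction f rule: sch.induct) (auto simp del: mult_minus_left)

lemma sch_pd: "sch f \<Longrightarrow> i \<in> Basis \<Longrightarrow> sch (pd i f)"
proof (induction f rule: sch.induct)
  case (sch_gauss c)
  then show ?case unfolding pd_gauss by (intro sch.intros)
next
  case (sch_coord f j)
  then show ?case by (subst pd_mult) (auto simp: pd_coord sch_differentiable intro!: sch.intros)
next
  case (sch_scale f a)
  then show ?case by (subst pd_scale) (auto simp: sch_differentiable intro!: sch.intros)
next
  case (sch_add f g)
  then show ?case by (subst pd_add) (auto simp: sch_differentiable intro!: sch.intros)
qed

lemma sch_pd_commute: "sch f \<Longrightarrow> i \<in> Basis \<Longrightarrow> j \<in> Basis \<Longrightarrow> pd i (pd j f) = pd j (pd i f)"
proof (induction f rule: sch.induct)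
  case (sch_gauss c)
  define g where "g = (\<lambda>x::'a. exp (- (c * (x \<bullet> x))))"
  have g: "g differentiable (at x)" for x
    unfolding g_def by (rule gauss_differentiable)
  have pdg: "pd k g = (\<lambda>x. - (2 * c) * ((x \<bullet> k) * g x))" for k
    unfolding g_def by (rule pd_gauss)
  have "pd k (pd l g) = (\<lambda>x. - (2 * c) * ((x \<bullet> l) * (- (2 * c) * ((x \<bullet> k) * g x)) + (k \<bullet> l) * g x))" for k l
  proof -
    have "pd k (pd l g) = (\<lambda>x. - (2 * c) * pd k (\<lambda>x. (x \<bullet> l) * g x) x)"
      unfolding pdg[of l] by (rule pd_scale) (use g in auto)
    also have "pd k (\<lambda>x. (x \<bullet> l) * g x) = (\<lambda>x. (x \<bullet> l) * pd k g x + (k \<bullet> l) * g x)"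
      by (subst pd_mult) (use g in \<open>auto simp: pd_coord\<close>)
    finally show ?thesis by (simp only: pdg)
  qed
  then show ?case
    unfolding g_def[symmetric] by (simp add: inner_commute algebra_simps)
next
  case (sch_coord f k)
  have d: "f differentiable (at x)" "pd i f differentiable (at x)" "pd j f differentiable (at x)" for x
    using sch_coord by (auto intro!: sch_differentiable sch_pd)
  have "(\<lambda>x. (x \<bullet> k) * pd j f x) differentiable (at x)" "(\<lambda>x. (j \<bullet> k) * f x) differentiable (at x)"
    "(\<lambda>x. (x \<bullet> k) * pd i f x) differentiable (at x)" "(\<lambda>x. (i \<bullet> k) * f x) differentiable (at x)" for x
    using d by auto
  with d sch_coord show ?case
    by (simp add: pd_mult pd_add pd_scale pd_coord algebra_simps)
next
  case (sch_scale f a)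
  then show ?case by (simp add: pd_scale sch_differentiable sch_pd)
next
  case (sch_add f g)
  then show ?case by (simp add: pd_add sch_differentiable sch_pd)
qed

lemma sch_bound: "sch f \<Longrightarrow> \<exists>C c. 0 < c \<and> (\<forall>x. \<bar>f x\<bar> \<le> C * exp (- (c * (x \<bullet> x))))"
proof (induction f rule: sch.induct)
  case (sch_gauss c)
  then show ?case by (intro exI[of _ 1] exI[of _ c]) auto
next
  case (sch_coord f i)
  then obtain C c where c: "0 < c" "\<And>x. \<bar>f x\<bar> \<le> C * exp (- (c * (x \<bullet> x)))" by blast
  have C: "C \<ge> 0" using c(2)[of 0] by (simp add: order_trans[OF abs_ge_zero])
  \<comment> \<open>Half of the decay rate absorbs the coordinate, by abs (x . i) <= 1 + q <= (1 + 2
    / c) * exp ((c / 2) * q) for q = x . x.\<close>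
  have "\<bar>(x \<bullet> i) * f x\<bar> \<le> (C * (1 + 2 / c)) * exp (- ((c / 2) * (x \<bullet> x)))" for x
  proof -
    define q where "q = x \<bullet> x"
    have q: "q \<ge> 0" by (simp add: q_def)
    have "\<bar>x \<bullet> i\<bar> \<le> norm x" using \<open>i \<in> Basis\<close> by (rule Basis_le_norm)
    also have "\<dots> \<le> 1 + (norm x)\<^sup>2"
    proof -
      have "0 \<le> (norm x - 1 / 2)\<^sup>2" by simp
      also have "\<dots> = (norm x)\<^sup>2 - norm x + 1 / 4" by (simp add: power2_eq_square algebra_simps)
      finally show ?thesis by simp
    qed
    also have "\<dots> = 1 + q" by (simp add: q_def dot_square_norm)
    also have "\<dots> \<le> (1 + 2 / c) * (1 + (c / 2) * q)"
    proof -
      have "(1 + 2 / c) * (1 + (c / 2) * q) = 1 + q + (c / 2) * q + 2 / c"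
        using c by (simp add: field_simps)
      then show ?thesis using c q by simp
    qed
    also have "\<dots> \<le> (1 + 2 / c) * exp ((c / 2) * q)"
      using c by (intro mult_left_mono exp_ge_add_one_self) auto
    finally have "\<bar>x \<bullet> i\<bar> \<le> (1 + 2 / c) * exp ((c / 2) * q)" .
    then have "\<bar>x \<bullet> i\<bar> * \<bar>f x\<bar> \<le> ((1 + 2 / c) * exp ((c / 2) * q)) * (C * exp (- (c * q)))"
      using c(1) c(2)[of x] by (intro mult_mono) (auto simp: q_def)
    also have "\<dots> = (C * (1 + 2 / c)) * (exp ((c / 2) * q) * exp (- (c * q)))" by simp
    also have "exp ((c / 2) * q) * exp (- (c * q)) = exp (- ((c / 2) * q))"
      by (simp add: exp_add[symmetric] field_simps)
    finally show ?thesis by (simp add: abs_mult q_def)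
  qed
  then show ?case using c(1) by (intro exI[of _ "C * (1 + 2 / c)"] exI[of _ "c / 2"]) auto
next
  case (sch_scale f a)
  then obtain C c where c: "0 < c" "\<And>x. \<bar>f x\<bar> \<le> C * exp (- (c * (x \<bullet> x)))" by blast
  then have "\<bar>a * f x\<bar> \<le> (\<bar>a\<bar> * C) * exp (- (c * (x \<bullet> x)))" for x
    unfolding abs_mult mult.assoc by (intro mult_left_mono) auto
  then show ?case using c(1) by blast
next
  case (sch_add f g)
  then obtain C c C' c' where c: "0 < c" "\<And>x. \<bar>f x\<bar> \<le> C * exp (- (c * (x \<bullet> x)))"
    "0 < c'" "\<And>x. \<bar>g x\<bar> \<le> C' * exp (- (c' * (x \<bullet> x)))" by blast
  have C: "C \<ge> 0" "C' \<ge> 0"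
    using c(2)[of 0] c(4)[of 0] by (auto simp: order_trans[OF abs_ge_zero])
  have "\<bar>f x + g x\<bar> \<le> (C + C') * exp (- (min c c' * (x \<bullet> x)))" for x
  proof -
    have "C * exp (- (c * (x \<bullet> x))) \<le> C * exp (- (min c c' * (x \<bullet> x)))"
      "C' * exp (- (c' * (x \<bullet> x))) \<le> C' * exp (- (min c c' * (x \<bullet> x)))"
      using C by (auto intro!: mult_left_mono mult_right_mono)
    then show ?thesis using c(2)[of x] c(4)[of x] by (simp add: distrib_right)
  qed
  then show ?case using c by (intro exI[of _ "C + C'"] exI[of _ "min c c'"]) auto
qed

lemma sch_continuous: "sch f \<Longrightarrow> continuous_on UNIV f"
  by (simp add: continuous_at_imp_continuous_on differentiable_imp_continuous_within sch_differentiable)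

lemma sch_measurable: "sch f \<Longrightarrow> f \<in> borel_measurable borel"
  by (intro borel_measurable_continuous_onI sch_continuous)

lemma sch_integrable:
  assumes "sch f" shows "integrable lborel f"
proof -
  obtain C c where c: "0 < c" "\<And>x. \<bar>f x\<bar> \<le> C * exp (- (c * (x \<bullet> x)))"
    using sch_bound[OF assms] by blast
  have "integrable lborel (\<lambda>x. C * exp (- (c * (x \<bullet> x))))"
    by (intro integrable_mult_right gauss_integral c)
  then show ?thesis
    by (rule Bochner_Integration.integrable_bound)
      (use c(2) sch_measurable[OF assms] in \<open>auto intro: order_trans[OF _ abs_ge_self]\<close>)
qed

lemma sch_bounded:
  assumes "sch f" obtains B where "\<And>x. \<bar>f x\<bar> \<le> B"
proof -
  obtain C c where c: "0 < c" "\<And>x. \<bar>f x\<bar> \<le> C * exp (- (c * (x \<bullet> x)))"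
    using sch_bound[OF assms] by blast
  have "C \<ge> 0" using c(2)[of 0] by (simp add: order_trans[OF abs_ge_zero])
  then have "C * exp (- (c * (x \<bullet> x))) \<le> C * 1" for x
    using c(1) by (intro mult_left_mono) auto
  then show ?thesis using that[of C] c(2) order_trans by fastforce
qed

lemma real_L2I:
  assumes "integrable lborel f" "\<And>x. \<bar>f x\<bar> \<le> B"
  shows "real_L2 f"
proof -
  have "integrable lborel (\<lambda>x. B * \<bar>f x\<bar>)" using assms(1) by simp
  then have "integrable lborel (\<lambda>x. (f x)\<^sup>2)"
  proof (rule Bochner_Integration.integrable_bound)
    show "AE x in lborel. norm ((f x)\<^sup>2) \<le> norm (B * \<bar>f x\<bar>)"
    proof (rule AE_I2)
      fix x
      have "\<bar>f x\<bar> * \<bar>f x\<bar> \<le> B * \<bar>f x\<bar>" using assms(2)[of x] by (intro mult_right_mono) auto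
      then show "norm ((f x)\<^sup>2) \<le> norm (B * \<bar>f x\<bar>)"
        by (simp add: power2_eq_square abs_mult[symmetric])
    qed
  qed (use assms(1) in auto)
  then show ?thesis using assms(1) by (auto simp: real_L2_iff)
qed

lemma sch_real_L2: "sch f \<Longrightarrow> real_L2 f"
  by (metis sch_bounded sch_integrable real_L2I)

section \<open>The heat kernel\<close>

text \<open>Set to 0 at nonpositive times, so that a time integral over the whole line is one over
  the positive half-line.\<close>

definition heat :: "real \<Rightarrow> 'a::euclidean_space \<Rightarrow> real" where
  "heat t x = (if 0 < t then (4 * pi * t) powr (- (real DIM('a) / 2)) * exp (- (1 / (4 * t)) * (x \<bullet> x)) else 0)"

text \<open>For positive times both the time derivative and the spatial Laplacian of the heat
  kernel.\<close>

definition heat' :: "real \<Rightarrow> 'a::euclidean_space \<Rightarrow> real" where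
  "heat' t x = (x \<bullet> x / (4 * t\<^sup>2) - real DIM('a) / (2 * t)) * heat t x"

lemma borel_measurable_heat [measurable (raw)]:
  assumes [measurable]: "f \<in> borel_measurable M" "g \<in> borel_measurable M"
  shows "(\<lambda>x. heat (f x) (g x :: 'a::euclidean_space)) \<in> borel_measurable M"
  unfolding heat_def by measurable

lemma borel_measurable_heat' [measurable (raw)]:
  assumes [measurable]: "f \<in> borel_measurable M" "g \<in> borel_measurable M"
  shows "(\<lambda>x. heat' (f x) (g x :: 'a::euclidean_space)) \<in> borel_measurable M"
  unfolding heat'_def by measurable

lemma heat_nonneg [simp]: "0 \<le> heat t x"
  by (simp add: heat_def)

lemma heat_minus [simp]: "heat t (- x) = heat t x"
  by (simp add: heat_def)

lemma heat_commute: "heat t (x - y) = heat t (y - x)"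
  by (metis heat_minus minus_diff_eq)

lemma heat'_minus [simp]: "heat' t (- x) = heat' t x"
  by (simp add: heat'_def)

lemma heat_le:
  fixes x :: "'a::euclidean_space"
  shows "heat t x \<le> heat t (0::'a)"
  by (auto simp: heat_def intro!: mult_left_le)

lemma heat_eq_gauss:
  "t > 0 \<Longrightarrow> heat t = (\<lambda>x::'a::euclidean_space. (4 * pi * t) powr (- (real DIM('a) / 2)) * exp (- ((1 / (4 * t)) * (x \<bullet> x))))"
  by (simp add: heat_def fun_eq_iff)

lemma sch_heat: "t > 0 \<Longrightarrow> sch (heat t)"
  unfolding heat_eq_gauss by (intro sch_scale sch_gauss) simp

lemma pd_heat: "t > 0 \<Longrightarrow> pd i (heat t) = (\<lambda>x. - (1 / (2 * t)) * ((x \<bullet> i) * heat t x))"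
  unfolding heat_eq_gauss pd_scale[OF gauss_differentiable] pd_gauss by (simp add: fun_eq_iff field_simps)

lemma heat'_eq_laplacian:
  assumes t: "t > 0"
  shows "heat' t = (\<lambda>x. \<Sum>i\<in>Basis. pd i (pd i (heat t)) x)"
proof
  fix x :: 'a
  have d: "heat t differentiable (at x)" for x :: 'a
    by (intro sch_differentiable sch_heat t)
  have "pd i (pd i (heat t)) x = (x \<bullet> i)\<^sup>2 / (4 * t\<^sup>2) * heat t x - 1 / (2 * t) * heat t x" if "i \<in> Basis" for i
  proof -
    have "pd i (pd i (heat t)) = (\<lambda>x. - (1 / (2 * t)) * ((x \<bullet> i) * pd i (heat t) x + (i \<bullet> i) * heat t x))"
      unfolding pd_heat[OF t, of i] using d by (subst pd_scale) (auto simp: pd_mult pd_coord pd_heat[OF t])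
    then show ?thesis
      using that t by (simp add: pd_heat[OF t] inner_Basis field_simps power2_eq_square)
  qed
  then have "(\<Sum>i\<in>Basis. pd i (pd i (heat t)) x)
      = (\<Sum>i\<in>Basis. (x \<bullet> i) * (x \<bullet> i)) / (4 * t\<^sup>2) * heat t x - real DIM('a) / (2 * t) * heat t x"
    by (simp add: sum_subtractf sum_divide_distrib sum_distrib_right power2_eq_square)
  then show "heat' t x = (\<Sum>i\<in>Basis. pd i (pd i (heat t)) x)"
    by (simp add: heat'_def euclidean_inner[symmetric] algebra_simps)
qed

lemma sch_sum:
  assumes "finite I" "I \<noteq> {}" "\<And>i. i \<in> I \<Longrightarrow> sch (f i)"
  shows "sch (\<lambda>x. \<Sum>i\<in>I. f i x)"
  using assms by (induction I rule: finite_ne_induct) (auto intro: sch_add)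

lemma sch_heat': "t > 0 \<Longrightarrow> sch (heat' t)"
  unfolding heat'_eq_laplacian by (rule sch_sum) (auto intro!: sch_pd sch_heat)

text \<open>Together with \<open>heat'_eq_laplacian\<close> this is the heat equation, which trades
  spatial Laplacians for time derivatives.\<close>

lemma heat_has_real_derivative:
  assumes t: "t > 0"
  shows "((\<lambda>t. heat t (x::'a::euclidean_space)) has_real_derivative heat' t x) (at t)"
proof -
  define p where "p = real DIM('a) / 2"
  have dim: "real DIM('a) = 2 * p" by (simp add: p_def)
  define E where "E = (\<lambda>t. exp (- (1 / (4 * t)) * (x \<bullet> x)))"
  define Q where "Q = (\<lambda>t. (4 * pi * t) powr (- p))"
  have E': "(E has_real_derivative (x \<bullet> x / (4 * t\<^sup>2)) * E t) (at t)"
    unfolding E_def using t by (auto intro!: derivative_eq_intros simp: power2_eq_square)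
  have "(Q has_real_derivative - p * (4 * pi * t) powr (- p - 1) * (4 * pi)) (at t)"
    unfolding Q_def using t by (auto intro!: derivative_eq_intros)
  moreover have "(4 * pi * t) powr (- p - 1) = Q t / (4 * pi * t)"
    using t by (simp add: powr_diff Q_def)
  ultimately have "(Q has_real_derivative - p * (Q t / (4 * pi * t)) * (4 * pi)) (at t)"
    by (simp only:)
  then have Q': "(Q has_real_derivative - p / t * Q t) (at t)"
    by (rule DERIV_cong) (use t in simp)
  have "((\<lambda>t. Q t * E t) has_real_derivative heat' t x) (at t)"
    by (rule DERIV_cong[OF DERIV_mult[OF Q' E']])
      (use t in \<open>simp add: heat'_def heat_def dim Q_def E_def algebra_simps\<close>)
  then have "((\<lambda>t. (4 * pi * t) powr (- p) * exp (- (1 / (4 * t)) * (x \<bullet> x))) has_real_derivative heat' t x) (at t)"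
    by (simp only: Q_def E_def)
  then show ?thesis
    by (rule DERIV_cong_ev[THEN iffD1, rotated 3])
      (use t in \<open>auto simp: heat_def p_def intro: eventually_mono[OF eventually_nhds_in_open[of "{0<..}"]]\<close>)
qed

lemma heat_integral:
  assumes t: "t > 0"
  shows "integrable lborel (heat t :: 'a::euclidean_space \<Rightarrow> real)" "(LINT x|lborel. heat t (x::'a)) = 1"
proof -
  show "integrable lborel (heat t :: 'a \<Rightarrow> real)" by (intro sch_integrable sch_heat t)
  have "(LINT x|lborel. heat t (x::'a)) = (4 * pi * t) powr (- (real DIM('a) / 2)) * (pi / (1 / (4 * t))) powr (real DIM('a) / 2)"
    using t gauss_integral(2)[of "1 / (4 * t)", where 'a='a] by (simp add: heat_def)
  also have "\<dots> = 1"
    using t by (simp add: powr_minus field_simps)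
  finally show "(LINT x|lborel. heat t (x::'a)) = 1" .
qed

text \<open>Completing the square in \<open>z\<close>. The second factor is a heat kernel in
  \<open>z\<close> of total mass 1, so integrating it out yields the semigroup law.\<close>

lemma heat_mult:
  fixes x y z :: "'a::euclidean_space"
  assumes s: "s > 0" and t: "t > 0"
  shows "heat s (x - z) * heat t (z - y)
    = heat (s + t) (x - y) * heat (s * t / (s + t)) (z - (1 / (s + t)) *\<^sub>R (t *\<^sub>R x + s *\<^sub>R y))"
proof -
  define D where "D = x - y"
  define w where "w = z - (1 / (s + t)) *\<^sub>R (t *\<^sub>R x + s *\<^sub>R y)"
  define p where "p = real DIM('a) / 2"
  have st: "s + t > 0" using s t by simp
  have eq: "(t / (s + t)) *\<^sub>R v + (s / (s + t)) *\<^sub>R v = v" for v :: 'a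
    using st by (simp add: scaleR_add_left[symmetric] add_divide_distrib[symmetric] add.commute)
  have e1: "x - z = (s / (s + t)) *\<^sub>R D - w" and e2: "z - y = (t / (s + t)) *\<^sub>R D + w"
    using eq[of x] eq[of y] by (simp_all add: D_def w_def algebra_simps)
  have "(1 / (4 * s)) * ((x - z) \<bullet> (x - z)) + (1 / (4 * t)) * ((z - y) \<bullet> (z - y))
      = (1 / (4 * (s + t))) * (D \<bullet> D) + (1 / (4 * (s * t / (s + t)))) * (w \<bullet> w)"
  proof -
    \<comment> \<open>After naming the scalars, the mixed terms cancel because S p and T q both
      equal r, and the remaining coefficient of \<open>a\<close> is r (p + q) = r.\<close>
    define a b c where "a = D \<bullet> D" and "b = D \<bullet> w" and "c = w \<bullet> w"
    define p q S T r where "p = s / (s + t)" and "q = t / (s + t)" and "S = 1 / (4 * s)"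
      and "T = 1 / (4 * t)" and "r = 1 / (4 * (s + t))"
    have X: "(x - z) \<bullet> (x - z) = p * p * a - 2 * p * b + c"
      unfolding e1 a_def b_def c_def p_def[symmetric] by (simp add: inner_simps inner_commute algebra_simps)
    have Y: "(z - y) \<bullet> (z - y) = q * q * a + 2 * q * b + c"
      unfolding e2 a_def b_def c_def q_def[symmetric] by (simp add: inner_simps inner_commute algebra_simps)
    have Sp: "S * p = r" and Tq: "T * q = r"
      using s t by (auto simp: S_def T_def p_def q_def r_def)
    have pq: "p + q = 1"
      using st by (simp add: p_def q_def add_divide_distrib[symmetric])
    have ST: "S + T = 1 / (4 * (s * t / (s + t)))"
      using s t st by (simp add: S_def T_def field_simps)
    have "S * (p * p * a - 2 * p * b + c) + T * (q * q * a + 2 * q * b + c)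
        = ((S * p) * p + (T * q) * q) * a + 2 * (T * q - S * p) * b + (S + T) * c"
      by algebra
    also have "\<dots> = r * (p + q) * a + (S + T) * c"
      unfolding Sp Tq by (simp add: distrib_left)
    finally show ?thesis
      unfolding X Y S_def[symmetric] T_def[symmetric] r_def[symmetric] a_def[symmetric] c_def[symmetric] ST[symmetric]
      by (simp add: pq)
  qed
  then have "exp (- ((1 / (4 * s)) * ((x - z) \<bullet> (x - z)) + (1 / (4 * t)) * ((z - y) \<bullet> (z - y))))
      = exp (- ((1 / (4 * (s + t))) * (D \<bullet> D) + (1 / (4 * (s * t / (s + t)))) * (w \<bullet> w)))"
    by (rule arg_cong)
  then have e: "exp (- (1 / (4 * s)) * ((x - z) \<bullet> (x - z))) * exp (- (1 / (4 * t)) * ((z - y) \<bullet> (z - y)))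
      = exp (- (1 / (4 * (s + t))) * (D \<bullet> D)) * exp (- (1 / (4 * (s * t / (s + t)))) * (w \<bullet> w))"
    unfolding minus_add_distrib exp_add mult_minus_left .
  have c: "(4 * pi * s) powr (- p) * (4 * pi * t) powr (- p)
      = (4 * pi * (s + t)) powr (- p) * (4 * pi * (s * t / (s + t))) powr (- p)"
  proof -
    have "(4 * pi * s) * (4 * pi * t) = (4 * pi * (s + t)) * (4 * pi * (s * t / (s + t)))"
      using st by (simp add: field_simps)
    then show ?thesis
      by (simp only: powr_mult[symmetric])
  qed
  have h: "heat s (x - z) = (4 * pi * s) powr (- p) * exp (- (1 / (4 * s)) * ((x - z) \<bullet> (x - z)))"
    "heat t (z - y) = (4 * pi * t) powr (- p) * exp (- (1 / (4 * t)) * ((z - y) \<bullet> (z - y)))"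
    "heat (s + t) D = (4 * pi * (s + t)) powr (- p) * exp (- (1 / (4 * (s + t))) * (D \<bullet> D))"
    "heat (s * t / (s + t)) w = (4 * pi * (s * t / (s + t))) powr (- p) * exp (- (1 / (4 * (s * t / (s + t)))) * (w \<bullet> w))"
    using s t st unfolding heat_def p_def by auto
  have "(g * e) * (g' * e') = (h * f) * (h' * f')" if "e * e' = f * f'" "g * g' = h * h'"
    for e e' f f' g g' h h' :: real
    using that by algebra
  from this[OF e c] show ?thesis
    unfolding D_def[symmetric] w_def[symmetric] h .
qed

lemma integrable_heat_translate:
  assumes "t > 0"
  shows "integrable lborel (\<lambda>z::'a::euclidean_space. heat t (z - w))"
  using integrable_translate[OF heat_integral(1)[OF assms], of "- w"] by simp

lemma integrable_heat_mult:
  fixes x y :: "'a::euclidean_space"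
  assumes "s > 0" "t > 0"
  shows "integrable lborel (\<lambda>z. heat s (x - z) * heat t (z - y))"
  unfolding heat_mult[OF assms]
  by (intro integrable_mult_right integrable_heat_translate) (use assms in simp)

lemma heat_semigroup:
  fixes x y :: "'a::euclidean_space"
  assumes s: "s > 0" and t: "t > 0"
  shows "(LINT z|lborel. heat s (x - z) * heat t (z - y)) = heat (s + t) (x - y)"
proof -
  have r: "s * t / (s + t) > 0" using s t by simp
  define w where "w = (1 / (s + t)) *\<^sub>R (t *\<^sub>R x + s *\<^sub>R y)"
  have "(LINT z|lborel. heat (s * t / (s + t)) (z - w)) = 1"
    using integral_translate[of "heat (s * t / (s + t))" "- w"] heat_integral(2)[OF r, where 'a='a]
    by simp
  then show ?thesis
    unfolding heat_mult[OF s t] w_def[symmetric] by simp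
qed

lemma l2_norm_heat:
  assumes t: "t > 0"
  shows "(l2_norm (cpx (heat t :: 'a::euclidean_space \<Rightarrow> real)))\<^sup>2 = heat (2 * t) (0::'a)"
proof -
  have eq: "(norm (complex_of_real (heat t z)))\<^sup>2 = heat t (0 - z) * heat t (z - 0)" for z :: 'a
    by (simp add: power2_eq_square)
  show ?thesis
    unfolding l2_norm_square eq heat_semigroup[OF t t, of "0::'a" 0] by (simp only: mult_2 diff_0_right)
qed

lemma conv_heat_heat:
  assumes "s > 0" "t > 0"
  shows "conv (heat s) (\<lambda>x. complex_of_real (heat t (x - z))) y = complex_of_real (heat (s + t) (y - z))"
  unfolding conv_def using heat_semigroup[OF assms, of y z]
  by (simp add: scaleR_conv_of_real of_real_mult[symmetric] del: of_real_mult)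

lemma conv_heat_contraction:
  assumes "t > 0" "u \<in> L2"
  shows "conv (heat t) u \<in> L2" "l2_norm (conv (heat t) u) \<le> l2_norm u"
  using conv_L2[OF heat_integral(1)[OF assms(1)] assms(2)] heat_integral(2)[OF assms(1), where 'a='a]
  by simp_all

text \<open>The rescaling by sqrt s moves the time dependence into the argument of \<phi>, so that
  dominated convergence applies with the fixed Gaussian \<open>heat 1\<close>.\<close>

lemma conv_heat_rescale:
  fixes \<phi> :: "'a::euclidean_space \<Rightarrow> complex"
  assumes s: "s > 0" and [measurable]: "\<phi> \<in> borel_measurable borel"
  shows "conv (heat s) \<phi> y = (LINT z|lborel. heat 1 z *\<^sub>R \<phi> (y - sqrt s *\<^sub>R z))"
proof -
  have "conv (heat s) \<phi> y = (LINT x|lborel. heat s (y - (y - x)) *\<^sub>R \<phi> (y - x))"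
    unfolding conv_def by (rule integral_reflect[symmetric]) measurable
  also have "\<dots> = (LINT x|lborel. heat s x *\<^sub>R \<phi> (y - x))" by simp
  also have "\<dots> = (LINT z|lborel. (sqrt s ^ DIM('a)) *\<^sub>R heat s (sqrt s *\<^sub>R z) *\<^sub>R \<phi> (y - sqrt s *\<^sub>R z))"
    by (subst lborel_affine[of "sqrt s" 0])
      (use s in \<open>simp_all add: integral_density integral_distr\<close>)
  also have "\<dots> = (LINT z|lborel. heat 1 z *\<^sub>R \<phi> (y - sqrt s *\<^sub>R z))"
  proof (rule Bochner_Integration.integral_cong[OF refl])
    fix z :: 'a
    have p: "sqrt s ^ DIM('a) * (4 * pi * s) powr (- (real DIM('a) / 2)) = (4 * pi) powr (- (real DIM('a) / 2))"
    proof -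
      have "sqrt s ^ DIM('a) = s powr (real DIM('a) / 2)"
        using s by (simp add: powr_half_sqrt[symmetric] powr_powr powr_realpow[symmetric])
      moreover have "(4 * pi * s) powr (- (real DIM('a) / 2)) = (4 * pi) powr (- (real DIM('a) / 2)) * s powr (- (real DIM('a) / 2))"
        by (rule powr_mult)
      ultimately show ?thesis using s by (simp add: powr_minus)
    qed
    have "sqrt s ^ DIM('a) * heat s (sqrt s *\<^sub>R z) = heat 1 z"
      using s p by (simp add: heat_def mult.assoc[symmetric])
    then show "(sqrt s ^ DIM('a)) *\<^sub>R heat s (sqrt s *\<^sub>R z) *\<^sub>R \<phi> (y - sqrt s *\<^sub>R z) = heat 1 z *\<^sub>R \<phi> (y - sqrt s *\<^sub>R z)"
      by (simp only: scaleR_scaleR)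
  qed
  finally show ?thesis .
qed

lemma conv_heat_tendsto_bounded:
  fixes \<phi> :: "'a::euclidean_space \<Rightarrow> complex"
  assumes \<phi>: "continuous_on UNIV \<phi>" "\<And>x. norm (\<phi> x) \<le> B"
    and s: "\<And>n. s n > 0" "s \<longlonglongrightarrow> 0"
  shows "(\<lambda>n. conv (heat (s n)) \<phi> y) \<longlonglongrightarrow> \<phi> y"
proof -
  have [measurable]: "\<phi> \<in> borel_measurable borel" using \<phi>(1) by (rule borel_measurable_continuous_onI)
  have "(\<lambda>n. LINT z|lborel. heat 1 z *\<^sub>R \<phi> (y - sqrt (s n) *\<^sub>R z)) \<longlonglongrightarrow> (LINT z|lborel. heat 1 (z::'a) *\<^sub>R \<phi> y)"
  proof (rule integral_dominated_convergence[where w = "\<lambda>z. B * heat 1 z"])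
    show "integrable lborel (\<lambda>z::'a. B * heat 1 z)" by (intro integrable_mult_right heat_integral) simp
    show "AE z in lborel. (\<lambda>n. heat 1 z *\<^sub>R \<phi> (y - sqrt (s n) *\<^sub>R z)) \<longlonglongrightarrow> heat 1 z *\<^sub>R \<phi> y"
    proof (rule AE_I2)
      fix z
      have "(\<lambda>n. y - sqrt (s n) *\<^sub>R z) \<longlonglongrightarrow> y - sqrt 0 *\<^sub>R z"
        by (intro tendsto_intros s)
      then have "(\<lambda>n. \<phi> (y - sqrt (s n) *\<^sub>R z)) \<longlonglongrightarrow> \<phi> y"
        using continuous_on_tendsto_compose[OF \<phi>(1), of "\<lambda>n. y - sqrt (s n) *\<^sub>R z" y] by simp
      then show "(\<lambda>n. heat 1 z *\<^sub>R \<phi> (y - sqrt (s n) *\<^sub>R z)) \<longlonglongrightarrow> heat 1 z *\<^sub>R \<phi> y"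
        by (intro tendsto_intros)
    qed
    show "AE z in lborel. norm (heat 1 z *\<^sub>R \<phi> (y - sqrt (s n) *\<^sub>R z)) \<le> B * heat 1 z" for n
      using \<phi>(2) by (intro AE_I2) (simp add: mult.commute[of B] mult_left_mono)
  qed auto
  also have "(LINT z|lborel. heat 1 (z::'a) *\<^sub>R \<phi> y) = \<phi> y"
    using heat_integral[of 1, where 'a='a] by (simp add: integral_scaleR_left)
  finally show ?thesis using s(1) by (simp add: conv_heat_rescale)
qed

lemma conv_heat_tendsto_gaussian:
  fixes \<phi> :: "'a::euclidean_space \<Rightarrow> complex"
  assumes \<phi>: "continuous_on UNIV \<phi>" "\<And>x. norm (\<phi> x) \<le> C * exp (- (x \<bullet> x))"
    and s: "\<And>n. s n > 0" "s \<longlonglongrightarrow> 0"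
  shows "(\<lambda>n. l2_norm (\<lambda>x. conv (heat (s n)) \<phi> x - \<phi> x)) \<longlonglongrightarrow> 0"
proof -
  have [measurable]: "\<phi> \<in> borel_measurable borel" using \<phi>(1) by (rule borel_measurable_continuous_onI)
  have C: "C \<ge> 0" using \<phi>(2)[of 0] norm_ge_zero[of "\<phi> 0"] by (simp add: order_trans[OF norm_ge_zero])
  define K where "K = (4 * pi * (1 / 4)) powr (- (real DIM('a) / 2))"
  have K: "K > 0" by (simp add: K_def)
  have gauss: "exp (- (x \<bullet> x)) = heat (1/4) x / K" for x :: 'a
    using K by (simp add: heat_def K_def)
  \<comment> \<open>The majorant exp (- (x . x)) is a multiple of \<open>heat (1/4)\<close>, so by
    the semigroup law the smoothed function is bounded by a multiple of
    \<open>heat (r + 1/4)\<close>. The restriction on \<open>r\<close> keeps r + 1/4 <= 1, hence the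
    decay rate at least 1/4.\<close>
  have bnd: "norm (conv (heat r) \<phi> x) \<le> C * exp (- (1 / 4) * (x \<bullet> x))" if r: "0 < r" "r \<le> 3 / 4" for r x
  proof -
    have int: "integrable lborel (\<lambda>z. heat r (x - z) * heat (1/4) z)"
      using integrable_heat_mult[OF r(1), of "1/4" x 0] by simp
    have "norm (conv (heat r) \<phi> x) \<le> (LINT z|lborel. C / K * (heat r (x - z) * heat (1/4) z))"
      unfolding conv_def
    proof (rule Bochner_Integration.integral_norm_bound_integral)
      show "integrable lborel (\<lambda>z. C / K * (heat r (x - z) * heat (1/4) z))"
        by (intro integrable_mult_right int)
      show le: "norm (heat r (x - z) *\<^sub>R \<phi> z) \<le> C / K * (heat r (x - z) * heat (1/4) z)" for z
        using mult_left_mono[OF \<phi>(2)[of z], of "heat r (x - z)"] by (simp add: gauss mult_ac)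
      show "integrable lborel (\<lambda>z. heat r (x - z) *\<^sub>R \<phi> z)"
        by (rule Bochner_Integration.integrable_bound[OF integrable_mult_right[OF int, of "C / K"]])
          (measurable, intro AE_I2 order_trans[OF le], unfold real_norm_def, rule abs_ge_self)
    qed
    also have "\<dots> = C / K * heat (r + 1/4) x"
      using heat_semigroup[OF r(1), of "1/4" x 0] by simp
    also have "\<dots> \<le> C / K * (K * exp (- (1 / 4) * (x \<bullet> x)))"
    proof (intro mult_left_mono)
      have "1 / 4 \<le> 1 / (4 * (r + 1 / 4))" using r by (simp add: field_simps)
      then have "1 / 4 * (x \<bullet> x) \<le> 1 / (4 * (r + 1 / 4)) * (x \<bullet> x)" by (rule mult_right_mono) simp
      then have e: "exp (- (1 / (4 * (r + 1 / 4))) * (x \<bullet> x)) \<le> exp (- (1 / 4) * (x \<bullet> x))" by simp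
      have "(4 * pi * (r + 1 / 4)) powr (- (real DIM('a) / 2)) \<le> K"
        unfolding K_def using r by (intro powr_mono2') auto
      then have "(4 * pi * (r + 1 / 4)) powr (- (real DIM('a) / 2)) * exp (- (1 / (4 * (r + 1 / 4))) * (x \<bullet> x)) \<le> K * exp (- (1 / 4) * (x \<bullet> x))"
        using e by (intro mult_mono) (use K in auto)
      then show "heat (r + 1/4) x \<le> K * exp (- (1 / 4) * (x \<bullet> x))"
        using r by (simp add: heat_def)
    qed (use C K in auto)
    finally show ?thesis using K by simp
  qed
  have phibnd: "norm (\<phi> x) \<le> C * exp (- (1 / 4) * (x \<bullet> x))" for x
    by (rule order_trans[OF \<phi>(2)]) (use C in \<open>auto intro!: mult_left_mono\<close>)
  obtain n0 where n0: "\<And>n. n \<ge> n0 \<Longrightarrow> s n \<le> 3 / 4"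
  proof -
    have "\<forall>\<^sub>F n in sequentially. s n < 3 / 4" by (rule order_tendstoD(2)[OF s(2)]) simp
    then show ?thesis using that by (auto simp: eventually_sequentially intro: less_imp_le)
  qed
  have "(\<lambda>n. l2_norm (\<lambda>x. conv (heat (s (n + n0))) \<phi> x - \<phi> x)) \<longlonglongrightarrow> 0"
  proof (rule tendsto_l2_norm_dominated[where D = "\<lambda>x. 2 * C * exp (- (1 / 4) * (x \<bullet> x))"])
    have B: "norm (\<phi> x) \<le> C" for x
      using \<phi>(2)[of x] C by (auto elim!: order_trans intro!: mult_left_le)
    show "AE x in lborel. (\<lambda>n. conv (heat (s (n + n0))) \<phi> x) \<longlonglongrightarrow> \<phi> x"
      by (intro AE_I2 LIMSEQ_ignore_initial_segment conv_heat_tendsto_bounded[OF \<phi>(1) B s])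
    show "AE x in lborel. norm (conv (heat (s (n + n0))) \<phi> x - \<phi> x) \<le> 2 * C * exp (- (1 / 4) * (x \<bullet> x))" for n
    proof (rule AE_I2)
      fix x
      show "norm (conv (heat (s (n + n0))) \<phi> x - \<phi> x) \<le> 2 * C * exp (- (1 / 4) * (x \<bullet> x))"
        using norm_triangle_ineq4[of "conv (heat (s (n + n0))) \<phi> x" "\<phi> x"] bnd[OF s(1) n0[of "n + n0"], of x] phibnd[of x]
        by simp
    qed
    have "(2 * C * exp (- (1 / 4) * (x \<bullet> x)))\<^sup>2 = (2 * C)\<^sup>2 * exp (- (1 / 2) * (x \<bullet> x))" for x :: 'a
      by (simp add: power_mult_distrib exp_double[symmetric])
    then show "integrable lborel (\<lambda>x::'a. (2 * C * exp (- (1 / 4) * (x \<bullet> x)))\<^sup>2)"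
      using gauss_integral(1)[of "1 / 2", where 'a='a] by simp
  qed auto
  then show ?thesis by (rule LIMSEQ_offset)
qed

lemma conv_heat_tendsto:
  fixes u :: "'a::euclidean_space \<Rightarrow> complex"
  assumes u: "u \<in> L2" and s: "\<And>n. s n > 0" "s \<longlonglongrightarrow> 0"
  shows "(\<lambda>n. l2_norm (\<lambda>x. conv (heat (s n)) u x - u x)) \<longlonglongrightarrow> 0"
proof (rule LIMSEQ_I)
  fix e :: real assume e: "e > 0"
  obtain \<phi> C where \<phi>: "continuous_on UNIV \<phi>" "\<And>x. norm (\<phi> x) \<le> C * exp (- (x \<bullet> x))"
    "\<phi> \<in> L2" "l2_norm (\<lambda>x. \<phi> x - u x) < e / 3"
    using L2_dense_continuous[OF u, of "e / 3"] e by auto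
  obtain n0 where n0: "\<And>n. n \<ge> n0 \<Longrightarrow> l2_norm (\<lambda>x. conv (heat (s n)) \<phi> x - \<phi> x) < e / 3"
    using LIMSEQ_D[OF conv_heat_tendsto_gaussian[OF \<phi>(1,2) s], of "e / 3"] e by auto
  have "l2_norm (\<lambda>x. conv (heat (s n)) u x - u x) < e" if "n \<ge> n0" for n
  proof -
    let ?P = "conv (heat (s n))"
    have rl: "real_L2 (heat (s n) :: 'a \<Rightarrow> real)" by (intro sch_real_L2 sch_heat s)
    have d: "(\<lambda>x. u x - \<phi> x) \<in> L2" by (intro L2_diff u \<phi>)
    have "(\<lambda>x. ?P u x - u x) = (\<lambda>x. ?P (\<lambda>x. u x - \<phi> x) x + ((?P \<phi> x - \<phi> x) + (\<phi> x - u x)))"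
      by (simp add: conv_diff_right[OF rl u \<phi>(3)])
    then have 0: "l2_norm (\<lambda>x. ?P u x - u x) = l2_norm (\<lambda>x. ?P (\<lambda>x. u x - \<phi> x) x + ((?P \<phi> x - \<phi> x) + (\<phi> x - u x)))"
      by (rule arg_cong)
    have m: "(\<lambda>x. ?P \<phi> x - \<phi> x) \<in> L2" "(\<lambda>x. \<phi> x - u x) \<in> L2"
      by (intro L2_diff conv_heat_contraction s \<phi> u)+
    note 1 = l2_norm_triangle[OF conv_heat_contraction(1)[OF s(1)[of n] d] L2_add[OF m]]
    note 2 = l2_norm_triangle[OF m]
    note 3 = conv_heat_contraction(2)[OF s(1)[of n] d]
    note 4 = l2_norm_minus_commute[of u \<phi>]
    show ?thesis using 0 1 2 3 4 n0[OF that] \<phi>(4) by linarith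
  qed
  then show "\<exists>no. \<forall>n\<ge>no. norm (l2_norm (\<lambda>x. conv (heat (s n)) u x - u x) - 0) < e"
    by auto
qed

text \<open>Injectivity of the heat flow. Identities that are known only after convolution with heat
  kernels become identities almost everywhere in this way.\<close>

lemma conv_heat_eq_0:
  fixes u :: "'a::euclidean_space \<Rightarrow> complex"
  assumes u: "u \<in> L2" and "\<And>t y. t > 0 \<Longrightarrow> conv (heat t) u y = 0"
  shows "AE x in lborel. u x = 0"
proof -
  have "(\<lambda>n. l2_norm (\<lambda>x. conv (heat (inverse (real (Suc n)))) u x - u x)) \<longlonglongrightarrow> 0"
    by (rule conv_heat_tendsto[OF u _ LIMSEQ_inverse_real_of_nat]) simp
  then have "l2_norm u = 0"
    by (simp add: assms(2) LIMSEQ_const_iff)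
  then show ?thesis using l2_norm_eq_0_iff[OF u] by simp
qed

lemma heat'_bound:
  fixes x :: "'a::euclidean_space"
  assumes "0 < a" "a \<le> r" "r \<le> b"
  shows "\<bar>heat' r x\<bar> \<le> (x \<bullet> x / (4 * a\<^sup>2) + real DIM('a) / (2 * a)) * ((4 * pi * a) powr (- (real DIM('a) / 2)) * exp (- ((1 / (4 * b)) * (x \<bullet> x))))"
  unfolding heat'_def abs_mult
proof (rule mult_mono)
  have "\<bar>x \<bullet> x / (4 * r\<^sup>2) - real DIM('a) / (2 * r)\<bar> \<le> x \<bullet> x / (4 * r\<^sup>2) + real DIM('a) / (2 * r)"
    using assms by (intro abs_leI) auto
  also have "\<dots> \<le> x \<bullet> x / (4 * a\<^sup>2) + real DIM('a) / (2 * a)"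
    using assms by (intro add_mono divide_left_mono mult_left_mono power_mono) auto
  finally show "\<bar>x \<bullet> x / (4 * r\<^sup>2) - real DIM('a) / (2 * r)\<bar> \<le> x \<bullet> x / (4 * a\<^sup>2) + real DIM('a) / (2 * a)" .
  have "exp (- (1 / (4 * r)) * (x \<bullet> x)) \<le> exp (- ((1 / (4 * b)) * (x \<bullet> x)))"
  proof -
    have "1 / (4 * b) \<le> 1 / (4 * r)" using assms by (intro divide_left_mono) auto
    then have "1 / (4 * b) * (x \<bullet> x) \<le> 1 / (4 * r) * (x \<bullet> x)" by (rule mult_right_mono) simp
    then show ?thesis by simp
  qed
  then have "(4 * pi * r) powr (- (real DIM('a) / 2)) * exp (- (1 / (4 * r)) * (x \<bullet> x)) \<le> (4 * pi * a) powr (- (real DIM('a) / 2)) * exp (- ((1 / (4 * b)) * (x \<bullet> x)))"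
    using assms by (intro mult_mono powr_mono2') auto
  then show "\<bar>heat r x\<bar> \<le> (4 * pi * a) powr (- (real DIM('a) / 2)) * exp (- ((1 / (4 * b)) * (x \<bullet> x)))"
    using assms by (simp add: heat_def)
  show "0 \<le> x \<bullet> x / (4 * a\<^sup>2) + real DIM('a) / (2 * a)" using assms by auto
qed simp

lemma sch_heat'_majorant:
  assumes "0 < b"
  shows "sch (\<lambda>x::'a::euclidean_space. (x \<bullet> x / p + q) * (w * exp (- ((1 / (4 * b)) * (x \<bullet> x)))))"
proof -
  have "(\<lambda>x::'a. (x \<bullet> x / p + q) * (w * exp (- ((1 / (4 * b)) * (x \<bullet> x)))))
      = (\<lambda>x. (w / p) * (\<Sum>i\<in>Basis. (x \<bullet> i) * ((x \<bullet> i) * exp (- ((1 / (4 * b)) * (x \<bullet> x))))) + (q * w) * exp (- ((1 / (4 * b)) * (x \<bullet> x))))"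
  proof
    fix x :: 'a
    define e where "e = exp (- ((1 / (4 * b)) * (x \<bullet> x)))"
    have "(\<Sum>i\<in>Basis. (x \<bullet> i) * ((x \<bullet> i) * e)) = (x \<bullet> x) * e"
      by (simp add: euclidean_inner[of x x] sum_distrib_right mult.assoc)
    then show "(x \<bullet> x / p + q) * (w * exp (- ((1 / (4 * b)) * (x \<bullet> x))))
      = (w / p) * (\<Sum>i\<in>Basis. (x \<bullet> i) * ((x \<bullet> i) * exp (- ((1 / (4 * b)) * (x \<bullet> x))))) + (q * w) * exp (- ((1 / (4 * b)) * (x \<bullet> x)))"
      unfolding e_def[symmetric] by (simp add: algebra_simps)
  qed
  then show ?thesis
    by (simp only:) (intro sch_add sch_scale sch_sum sch_coord sch_gauss; use assms in simp)
qed

text \<open>Differentiation under the integral sign: by the mean value theorem on {t/2..2t} the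
  difference quotients are dominated by the square-integrable kernel \<open>D\<close>, which is the
  bound of \<open>heat'_bound\<close> for a = t/2 and b = 2t.\<close>

lemma conv_heat_has_vector_derivative:
  fixes f :: "'a::euclidean_space \<Rightarrow> complex"
  assumes f: "f \<in> L2" and t: "t > 0"
  shows "((\<lambda>t. conv (heat t) f y) has_vector_derivative conv (heat' t) f y) (at t)"
proof -
  have [measurable]: "f \<in> borel_measurable borel" using f by (rule L2_measurable)
  define D where "D x = (x \<bullet> x / (4 * (t/2)\<^sup>2) + real DIM('a) / (2 * (t/2))) * ((4 * pi * (t/2)) powr (- (real DIM('a) / 2)) * exp (- ((1 / (4 * (2 * t))) * (x \<bullet> x))))" for x :: 'a
  have D: "real_L2 D"
    unfolding D_def using t by (intro sch_real_L2 sch_heat'_majorant) auto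
  have D_nonneg: "D x \<ge> 0" for x using t by (simp add: D_def)
  have heat'_D: "\<bar>heat' r x\<bar> \<le> D x" if "t / 2 \<le> r" "r \<le> 2 * t" for r x
    unfolding D_def using that t by (intro heat'_bound) auto
  have lim: "(\<lambda>n. (conv (heat (t + h n)) f y - conv (heat t) f y) /\<^sub>R h n) \<longlonglongrightarrow> conv (heat' t) f y"
    if h: "\<And>n. h n \<noteq> 0" "\<And>n. \<bar>h n\<bar> \<le> t / 2" "h \<longlonglongrightarrow> 0" for h :: "nat \<Rightarrow> real"
  proof -
    have pos: "t + h n > 0" for n using h(2)[of n] t by linarith
    have eq: "(conv (heat (t + h n)) f y - conv (heat t) f y) /\<^sub>R h n
        = (LINT x|lborel. ((heat (t + h n) (y - x) - heat t (y - x)) / h n) *\<^sub>R f x)" for n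
    proof -
      have "conv (heat (t + h n)) f y - conv (heat t) f y = conv (\<lambda>x. heat (t + h n) x - heat t x) f y"
        by (rule conv_diff_left[symmetric]) (intro sch_real_L2 sch_heat pos t f)+
      then show ?thesis
        unfolding conv_def by (simp add: divide_inverse_commute scaleR_scaleR[symmetric] del: scaleR_scaleR)
    qed
    show ?thesis
      unfolding eq
      unfolding conv_def
    proof (rule integral_dominated_convergence[where w = "\<lambda>x. norm (D (y - x) *\<^sub>R f x)"])
      show "integrable lborel (\<lambda>x. norm (D (y - x) *\<^sub>R f x))"
        by (intro integrable_norm conv_integrable D f)
      show "AE x in lborel. (\<lambda>n. ((heat (t + h n) (y - x) - heat t (y - x)) / h n) *\<^sub>R f x) \<longlonglongrightarrow> heat' t (y - x) *\<^sub>R f x"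
      proof (rule AE_I2, intro tendsto_intros)
        fix x
        have "(\<lambda>k. (heat (t + k) (y - x) - heat t (y - x)) / k) \<midarrow>0\<rightarrow> heat' t (y - x)"
          using heat_has_real_derivative[OF t, of "y - x"] by (simp add: DERIV_def)
        then show "(\<lambda>n. (heat (t + h n) (y - x) - heat t (y - x)) / h n) \<longlonglongrightarrow> heat' t (y - x)"
          using h by (auto simp: tendsto_at_iff_sequentially o_def)
      qed
      show "AE x in lborel. norm (((heat (t + h n) (y - x) - heat t (y - x)) / h n) *\<^sub>R f x) \<le> norm (D (y - x) *\<^sub>R f x)" for n
      proof (rule AE_I2)
        fix x
        have "\<bar>heat (t + h n) (y - x) - heat t (y - x)\<bar> \<le> D (y - x) * \<bar>(t + h n) - t\<bar>"
        proof (rule field_differentiable_bound[where S = "{t / 2..2 * t}" and f = "\<lambda>r. heat r (y - x)" and f' = "\<lambda>r. heat' r (y - x)", simplified real_norm_def])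
          show "((\<lambda>r. heat r (y - x)) has_real_derivative heat' r (y - x)) (at r within {t / 2..2 * t})" if "r \<in> {t / 2..2 * t}" for r
            by (rule has_field_derivative_at_within, rule heat_has_real_derivative) (use that t in auto)
        qed (use heat'_D h(2)[of n] t in \<open>auto simp: abs_le_iff\<close>)
        then have "\<bar>(heat (t + h n) (y - x) - heat t (y - x)) / h n\<bar> \<le> D (y - x)"
          using h(1)[of n] by (simp add: divide_le_eq)
        then have "\<bar>(heat (t + h n) (y - x) - heat t (y - x)) / h n\<bar> * norm (f x) \<le> \<bar>D (y - x)\<bar> * norm (f x)"
          using D_nonneg by (intro mult_right_mono) auto
        then show "norm (((heat (t + h n) (y - x) - heat t (y - x)) / h n) *\<^sub>R f x) \<le> norm (D (y - x) *\<^sub>R f x)"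
          by simp
      qed
      show "(\<lambda>x. heat' t (y - x) *\<^sub>R f x) \<in> borel_measurable lborel" by simp
    qed simp
  qed
  show ?thesis
    unfolding has_vector_derivative_def has_derivative_at
  proof (intro conjI)
    show "bounded_linear (\<lambda>x. x *\<^sub>R conv (heat' t) f y)" by (rule bounded_linear_scaleR_left)
    show "(\<lambda>h. norm (conv (heat (t + h)) f y - conv (heat t) f y - h *\<^sub>R conv (heat' t) f y) / norm h) \<midarrow>0\<rightarrow> 0"
    proof (rule sequentially_imp_eventually_within[where s = UNIV and P = "\<lambda>_. True", THEN _] | unfold tendsto_at_iff_sequentially)
      show "\<forall>X. (\<forall>i. X i \<in> UNIV - {0}) \<longrightarrow> X \<longlonglongrightarrow> 0 \<longrightarrow>
        ((\<lambda>h. norm (conv (heat (t + h)) f y - conv (heat t) f y - h *\<^sub>R conv (heat' t) f y) / norm h) \<circ> X) \<longlonglongrightarrow> 0"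
      proof (intro allI impI)
        fix X :: "nat \<Rightarrow> real" assume X: "\<forall>i. X i \<in> UNIV - {0}" "X \<longlonglongrightarrow> 0"
        obtain n0 where n0: "\<And>n. n \<ge> n0 \<Longrightarrow> \<bar>X n\<bar> \<le> t / 2"
          using LIMSEQ_D[OF X(2), of "t / 2"] t by (auto intro: less_imp_le)
        have "(\<lambda>n. (conv (heat (t + X (n + n0))) f y - conv (heat t) f y) /\<^sub>R X (n + n0)) \<longlonglongrightarrow> conv (heat' t) f y"
          by (rule lim) (use X n0 in \<open>auto intro: LIMSEQ_ignore_initial_segment\<close>)
        then have "(\<lambda>n. norm ((conv (heat (t + X (n + n0))) f y - conv (heat t) f y) /\<^sub>R X (n + n0) - conv (heat' t) f y)) \<longlonglongrightarrow> 0"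
          by (intro tendsto_norm_zero LIM_zero)
        moreover have "norm ((conv (heat (t + X n)) f y - conv (heat t) f y) /\<^sub>R X n - conv (heat' t) f y)
            = norm (conv (heat (t + X n)) f y - conv (heat t) f y - X n *\<^sub>R conv (heat' t) f y) / norm (X n)" for n
        proof -
          have "(conv (heat (t + X n)) f y - conv (heat t) f y) /\<^sub>R X n - conv (heat' t) f y
              = (conv (heat (t + X n)) f y - conv (heat t) f y - X n *\<^sub>R conv (heat' t) f y) /\<^sub>R X n"
            using X(1) by (simp add: scaleR_diff_right)
          then show ?thesis by (simp add: divide_inverse_commute)
        qed
        ultimately have "(\<lambda>n. norm (conv (heat (t + X (n + n0))) f y - conv (heat t) f y - X (n + n0) *\<^sub>R conv (heat' t) f y) / norm (X (n + n0))) \<longlonglongrightarrow> 0"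
          by simp
        then show "((\<lambda>h. norm (conv (heat (t + h)) f y - conv (heat t) f y - h *\<^sub>R conv (heat' t) f y) / norm h) \<circ> X) \<longlonglongrightarrow> 0"
          unfolding o_def by (rule LIMSEQ_offset)
      qed
    qed
  qed
qed

section \<open>Test functions\<close>

lemma Ck_Suc_pd: "Ck (Suc k) \<phi> \<longleftrightarrow> (\<forall>x. \<phi> differentiable (at x)) \<and> (\<forall>i\<in>Basis. Ck k (pd i \<phi>))"
  by (simp add: pd_def[abs_def])

declare Ck.simps(2) [simp del]

lemma Ck_SucD: "Ck (Suc k) \<phi> \<Longrightarrow> Ck k \<phi>"
proof (induction k arbitrary: \<phi>)
  case 0
  then show ?case
    by (simp add: Ck_Suc_pd continuous_at_imp_continuous_on differentiable_imp_continuous_within)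
next
  case (Suc k)
  then show ?case by (auto simp: Ck_Suc_pd)
qed

lemma Ck_const: "Ck k (\<lambda>x. c)"
  by (induction k arbitrary: c) (auto simp: Ck_Suc_pd)

lemma Ck_add: "Ck k f \<Longrightarrow> Ck k g \<Longrightarrow> Ck k (\<lambda>x. f x + g x)"
  by (induction k arbitrary: f g) (auto simp: Ck_Suc_pd pd_add intro: continuous_intros)

lemma Ck_mult: "Ck k f \<Longrightarrow> Ck k g \<Longrightarrow> Ck k (\<lambda>x. f x * g x)"
proof (induction k arbitrary: f g)
  case 0
  then show ?case by (auto intro: continuous_intros)
next
  case (Suc k)
  then have "Ck k f" "Ck k g" by (auto dest: Ck_SucD)
  with Suc show ?case by (auto simp: Ck_Suc_pd pd_mult intro!: Ck_add)
qed

lemma Ck_coord: "Ck k (\<lambda>x. x \<bullet> i)"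
  by (cases k) (auto simp: Ck_Suc_pd pd_coord Ck_const intro: continuous_intros)

lemma Ck_sum: "(\<And>i. i \<in> I \<Longrightarrow> Ck k (f i)) \<Longrightarrow> Ck k (\<lambda>x. \<Sum>i\<in>I. f i x)"
  by (induction I rule: infinite_finite_induct) (auto intro: Ck_add Ck_const)

lemma Ck_sch: "sch f \<Longrightarrow> Ck k f"
  by (induction k arbitrary: f) (auto simp: Ck_Suc_pd sch_continuous sch_differentiable sch_pd)

lemma pd_reflect:
  assumes "\<And>x. f differentiable (at x)"
  shows "pd i (\<lambda>x. f (y - x)) = (\<lambda>x. - pd i f (y - x))"
proof
  fix x
  have "(f has_derivative frechet_derivative f (at (y - x))) (at (y - x))"
    using assms by (simp add: frechet_derivative_works[symmetric])
  then have "((\<lambda>x. f (y - x)) has_derivative (\<lambda>h. frechet_derivative f (at (y - x)) (- h))) (at x)"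
    by (rule has_derivative_compose[rotated]) (auto intro!: derivative_eq_intros)
  then have "pd i (\<lambda>x. f (y - x)) x = frechet_derivative f (at (y - x)) (- i)" by (rule pd_eqI)
  also have "\<dots> = - frechet_derivative f (at (y - x)) i"
    using assms by (intro linear_neg linear_frechet_derivative)
  finally show "pd i (\<lambda>x. f (y - x)) x = - pd i f (y - x)" by (simp add: pd_def)
qed

lemma differentiable_reflect:
  fixes f :: "'a::euclidean_space \<Rightarrow> real"
  assumes "\<And>x. f differentiable (at x)" shows "(\<lambda>x. f (y - x)) differentiable (at x)"
  by (rule differentiable_compose[of f "\<lambda>x. y - x"]) (auto intro: assms derivative_intros)

lemma Ck_reflect: "Ck k f \<Longrightarrow> Ck k (\<lambda>x. f (y - x))"
proof (induction k arbitrary: f)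
  case 0
  then show ?case by (auto intro!: continuous_intros intro: continuous_on_compose2)
next
  case (Suc k)
  then have "Ck k (\<lambda>x. (-1) * pd i f (y - x))" if "i \<in> Basis" for i
    using that by (intro Ck_mult Ck_const) (auto simp: Ck_Suc_pd)
  with Suc.prems show ?case by (auto simp: Ck_Suc_pd pd_reflect differentiable_reflect)
qed

section \<open>A smooth compactly supported cutoff\<close>

text \<open>For n = 0 the classical flat function exp (- 1/t). The powers of 1/t are included
  because differentiation maps the family into its span, so smoothness of all orders is a single
  induction.\<close>

definition flat_exp :: "nat \<Rightarrow> real \<Rightarrow> real" where
  "flat_exp n t = (if 0 < t then (1 / t) ^ n * exp (- (1 / t)) else 0)"

lemma flat_exp_nonneg: "0 \<le> flat_exp n t"
  by (simp add: flat_exp_def)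

lemma flat_exp_tendsto_0: "((\<lambda>t. flat_exp n t) \<longlongrightarrow> 0) (at 0)"
proof (rule filterlim_split_at)
  show "((\<lambda>t. flat_exp n t) \<longlongrightarrow> 0) (at_left 0)"
    by (rule tendsto_eventually) (auto simp: eventually_at_filter flat_exp_def)
  have "((\<lambda>t. inverse t ^ n / exp (inverse t)) \<longlongrightarrow> 0) (at_right (0::real))"
    by (rule filterlim_compose[OF tendsto_power_div_exp_0 filterlim_inverse_at_top_right])
  then show "((\<lambda>t. flat_exp n t) \<longlongrightarrow> 0) (at_right 0)"
    by (rule Lim_transform_eventually) (auto simp: eventually_at_filter flat_exp_def exp_minus divide_inverse)
qed

lemma flat_exp_has_real_derivative:
  "(flat_exp n has_real_derivative flat_exp (n + 2) t - real n * flat_exp (n + 1) t) (at t)"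
proof -
  consider "t > 0" | "t < 0" | "t = 0" by linarith
  then show ?thesis
  proof cases
    case 1
    have i: "((\<lambda>t. 1 / t) has_real_derivative - ((1 / t)\<^sup>2)) (at t)"
      using 1 by (auto intro!: derivative_eq_intros simp: power2_eq_square)
    have e: "((\<lambda>t. exp (- (1 / t))) has_real_derivative (1 / t)\<^sup>2 * exp (- (1 / t))) (at t)"
      using 1 by (auto intro!: derivative_eq_intros simp: power2_eq_square)
    have "((\<lambda>t. (1 / t) ^ n * exp (- (1 / t))) has_real_derivative flat_exp (n + 2) t - real n * flat_exp (n + 1) t) (at t)"
    proof (rule DERIV_cong[OF DERIV_mult[OF DERIV_power[OF i, of n] e]])
      show "real n * (- ((1 / t)\<^sup>2) * (1 / t) ^ (n - Suc 0)) * exp (- (1 / t)) + (1 / t)\<^sup>2 * exp (- (1 / t)) * (1 / t) ^ n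
        = flat_exp (n + 2) t - real n * flat_exp (n + 1) t"
        using 1 by (cases n) (auto simp: flat_exp_def power2_eq_square algebra_simps)
    qed
    then show ?thesis
      by (rule DERIV_cong_ev[THEN iffD1, rotated 3])
        (use 1 in \<open>auto simp: flat_exp_def intro: eventually_mono[OF eventually_nhds_in_open[of "{0<..}"]]\<close>)
  next
    case 2
    have "((\<lambda>t. 0) has_real_derivative flat_exp (n + 2) t - real n * flat_exp (n + 1) t) (at t)"
      using 2 by (simp add: flat_exp_def)
    then show ?thesis
      by (rule DERIV_cong_ev[THEN iffD1, rotated 3])
        (use 2 in \<open>auto simp: flat_exp_def intro: eventually_mono[OF eventually_nhds_in_open[of "{..<0}"]]\<close>)
  next
    case 3
    \<comment> \<open>At the junction point the difference quotient is
      \<open>flat_exp (Suc n)\<close> itself.\<close>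
    have "((\<lambda>h. (flat_exp n h - flat_exp n 0) / h) \<longlongrightarrow> 0) (at 0)"
      by (rule Lim_transform_eventually[OF flat_exp_tendsto_0[of "Suc n"]])
        (auto simp: eventually_at_filter flat_exp_def divide_simps)
    with 3 show ?thesis by (simp add: DERIV_def flat_exp_def)
  qed
qed

lemma pd_flat_exp:
  assumes "\<And>x. g differentiable (at x)"
  shows "(\<lambda>x. flat_exp n (g x)) differentiable (at x)"
    and "pd i (\<lambda>x. flat_exp n (g x)) = (\<lambda>x. (flat_exp (n + 2) (g x) + (- real n) * flat_exp (n + 1) (g x)) * pd i g x)"
proof -
  have d: "((\<lambda>x. flat_exp n (g x)) has_derivative
      (\<lambda>h. (flat_exp (n + 2) (g x) - real n * flat_exp (n + 1) (g x)) * frechet_derivative g (at x) h)) (at x)" for x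
  proof -
    have "(g has_derivative frechet_derivative g (at x)) (at x)"
      using assms by (simp add: frechet_derivative_works[symmetric])
    moreover have "(flat_exp n has_derivative (\<lambda>h. (flat_exp (n + 2) (g x) - real n * flat_exp (n + 1) (g x)) * h)) (at (g x))"
      using flat_exp_has_real_derivative[of n "g x"] by (simp add: has_field_derivative_def)
    ultimately show ?thesis by (rule has_derivative_compose)
  qed
  show "(\<lambda>x. flat_exp n (g x)) differentiable (at x)" using d by (rule differentiableI)
  show "pd i (\<lambda>x. flat_exp n (g x)) = (\<lambda>x. (flat_exp (n + 2) (g x) + (- real n) * flat_exp (n + 1) (g x)) * pd i g x)"
    by (intro ext) (simp add: pd_eqI[OF d] pd_def)
qed

lemma Ck_flat_exp: "(\<And>k. Ck k g) \<Longrightarrow> Ck k (\<lambda>x. flat_exp n (g x))"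
proof (induction k arbitrary: n)
  case 0
  have g: "g differentiable (at x)" for x using 0[of "Suc 0"] by (simp add: Ck_Suc_pd)
  then show ?case
    by (simp add: continuous_at_imp_continuous_on differentiable_imp_continuous_within pd_flat_exp)
next
  case (Suc k)
  have g: "g differentiable (at x)" "i \<in> Basis \<Longrightarrow> Ck k (pd i g)" for x i
    using Suc.prems[of "Suc k"] by (auto simp: Ck_Suc_pd)
  show ?case
    unfolding Ck_Suc_pd pd_flat_exp(2)[OF g(1)]
    by (intro conjI allI ballI pd_flat_exp(1) Ck_mult Ck_add Ck_const g Suc.IH Suc.prems)
qed

text \<open>The factor \<open>exp 1\<close> normalises the value at the origin to 1, and
  \<open>Suc n\<close> avoids radius 0.\<close>

definition cutoff :: "nat \<Rightarrow> 'a::euclidean_space \<Rightarrow> real" where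
  "cutoff n x = exp 1 * flat_exp 0 (1 - (x \<bullet> x) / (real (Suc n))\<^sup>2)"

lemma Ck_cutoff_arg: "Ck k (\<lambda>x::'a::euclidean_space. 1 - (x \<bullet> x) / r)"
proof -
  have "(\<lambda>x::'a. 1 - (x \<bullet> x) / r) = (\<lambda>x. 1 + (- (1 / r)) * (\<Sum>i\<in>Basis. (x \<bullet> i) * (x \<bullet> i)))"
    by (rule ext) (simp add: euclidean_inner[symmetric])
  then show ?thesis
    by (simp only:) (intro Ck_add Ck_mult Ck_const Ck_sum Ck_coord)
qed

lemma Ck_cutoff: "Ck k (cutoff n)"
  unfolding cutoff_def by (intro Ck_mult Ck_const Ck_flat_exp Ck_cutoff_arg)

lemma cutoff_nonneg: "0 \<le> cutoff n x"
  by (simp add: cutoff_def flat_exp_nonneg)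

lemma cutoff_le_1: "cutoff n x \<le> 1"
proof (cases "0 < 1 - (x \<bullet> x) / (real (Suc n))\<^sup>2")
  case True
  define t where "t = 1 - (x \<bullet> x) / (real (Suc n))\<^sup>2"
  have t: "t \<le> 1" "t > 0" using True by (simp_all add: t_def)
  then have "exp 1 * exp (- (1 / t)) \<le> 1"
    by (simp add: exp_add[symmetric])
  then show ?thesis using True by (simp add: cutoff_def flat_exp_def t_def)
qed (simp add: cutoff_def flat_exp_def)

lemma cutoff_tendsto: "(\<lambda>n. cutoff n x) \<longlonglongrightarrow> 1"
proof -
  have a: "(\<lambda>n. 1 - (x \<bullet> x) * (inverse (real (Suc n)))\<^sup>2) \<longlonglongrightarrow> 1 - (x \<bullet> x) * 0\<^sup>2"
    by (intro tendsto_intros LIMSEQ_inverse_real_of_nat)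
  have "isCont (flat_exp 0) 1" using flat_exp_has_real_derivative by (rule DERIV_isCont)
  then have "(\<lambda>n. flat_exp 0 (1 - (x \<bullet> x) * (inverse (real (Suc n)))\<^sup>2)) \<longlonglongrightarrow> flat_exp 0 1"
    using a by (intro isCont_tendsto_compose[of 1 "flat_exp 0"]) auto
  then have "(\<lambda>n. exp 1 * flat_exp 0 (1 - (x \<bullet> x) * (inverse (real (Suc n)))\<^sup>2)) \<longlonglongrightarrow> exp 1 * flat_exp 0 1"
    by (intro tendsto_intros)
  moreover have "exp 1 * flat_exp 0 1 = (1::real)" by (simp add: flat_exp_def exp_minus)
  ultimately show ?thesis by (simp add: cutoff_def divide_inverse power_inverse)
qed

lemma flat_exp_2_le: "flat_exp 2 t \<le> 2"
proof (cases "t > 0")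
  case True
  define u where "u = 1 / t"
  have u: "u > 0" using True by (simp add: u_def)
  have "u\<^sup>2 \<le> 2 * exp u" using exp_lower_Taylor_quadratic[of u] u by simp
  then have "u\<^sup>2 * exp (- u) \<le> 2" by (simp add: exp_minus field_simps)
  then show ?thesis using True by (simp add: flat_exp_def u_def)
qed (simp add: flat_exp_def)

text \<open>Inside the ball the constant is \<open>exp 1\<close> times the bound 2 for
  \<open>flat_exp 2\<close> times the bound 2 / r for the inner derivative, with r = n + 1; outside
  the ball the derivative vanishes. The decay in \<open>n\<close> removes the commutator term when a
  cutoff is taken to the limit.\<close>

lemma pd_cutoff_le:
  fixes x :: "'a::euclidean_space"
  assumes i: "i \<in> Basis"
  shows "\<bar>pd i (cutoff n) x\<bar> \<le> 4 * exp 1 / real (Suc n)"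
proof -
  define r where "r = real (Suc n)"
  have r: "r \<ge> 1" by (simp add: r_def)
  define g where "g = (\<lambda>x::'a. 1 - (x \<bullet> x) / r\<^sup>2)"
  have gd: "g differentiable (at x)" for x
    unfolding g_def using Ck_cutoff_arg[of "Suc 0" "r\<^sup>2", where 'a='a] by (simp add: Ck_Suc_pd)
  have pdg: "pd i g x = - 2 * (x \<bullet> i) / r\<^sup>2" for x
  proof -
    have "(g has_derivative (\<lambda>h. - 2 * (x \<bullet> h) / r\<^sup>2)) (at x)"
      unfolding g_def using r by (auto intro!: derivative_eq_intros simp: inner_commute field_simps)
    then show ?thesis by (rule pd_eqI)
  qed
  have c: "cutoff n = (\<lambda>x::'a. exp 1 * flat_exp 0 (g x))"
    by (simp add: cutoff_def g_def r_def fun_eq_iff)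
  have "pd i (cutoff n) x = exp 1 * (flat_exp 2 (g x) * (- 2 * (x \<bullet> i) / r\<^sup>2))"
    unfolding c pd_scale[OF pd_flat_exp(1)[OF gd]] pd_flat_exp(2)[OF gd] pdg by (simp add: numeral_2_eq_2)
  then have eq: "\<bar>pd i (cutoff n) x\<bar> = exp 1 * (flat_exp 2 (g x) * (2 * \<bar>x \<bullet> i\<bar> / r\<^sup>2))"
    by (simp add: abs_mult flat_exp_nonneg)
  show ?thesis
  proof (cases "norm x < r")
    case True
    have "\<bar>x \<bullet> i\<bar> \<le> r" using Basis_le_norm[OF i, of x] True by linarith
    then have "2 * \<bar>x \<bullet> i\<bar> / r\<^sup>2 \<le> 2 * r / r\<^sup>2" by (intro divide_right_mono) auto
    also have "\<dots> = 2 / r" using r by (simp add: power2_eq_square)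
    finally have "flat_exp 2 (g x) * (2 * \<bar>x \<bullet> i\<bar> / r\<^sup>2) \<le> 2 * (2 / r)"
      by (intro mult_mono flat_exp_2_le) auto
    then have "\<bar>pd i (cutoff n) x\<bar> \<le> exp 1 * (2 * (2 / r))"
      unfolding eq by (intro mult_left_mono) auto
    then show ?thesis by (simp add: r_def field_simps)
  next
    case False
    then have "r\<^sup>2 \<le> x \<bullet> x" using r by (simp add: dot_square_norm power_mono)
    then have "g x \<le> 0" using r by (simp add: g_def field_simps)
    then have "flat_exp 2 (g x) = 0" by (simp add: flat_exp_def)
    then show ?thesis unfolding eq by simp
  qed
qed

lemma cutoff_support: "cutoff n x \<noteq> 0 \<Longrightarrow> x \<in> cball 0 (real (Suc n))"
proof -
  assume "cutoff n x \<noteq> 0"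
  then have "0 < 1 - (x \<bullet> x) / (real (Suc n))\<^sup>2"
    by (auto simp: cutoff_def flat_exp_def split: if_splits)
  then have "(norm x)\<^sup>2 < (real (Suc n))\<^sup>2" by (simp add: dot_square_norm field_simps)
  then have "norm x < real (Suc n)" by (rule power2_less_imp_less) simp
  then show ?thesis by (simp add: dist_norm)
qed

lemma test_fun_cutoff_mult:
  assumes "\<And>k. Ck k f"
  shows "test_fun (\<lambda>x. cutoff n x * f x)"
proof -
  have "closure {x. cutoff n x * f x \<noteq> 0} \<subseteq> cball 0 (real (Suc n))"
    by (rule closure_minimal) (use cutoff_support in auto)
  then have "compact (closure {x. cutoff n x * f x \<noteq> 0})"
    by (auto simp: compact_eq_bounded_closed intro: bounded_subset[OF bounded_cball])
  then show ?thesis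
    unfolding test_fun_def using assms by (auto intro!: Ck_mult Ck_cutoff)
qed

lemma test_fun_differentiable: "test_fun \<phi> \<Longrightarrow> \<phi> differentiable (at x)"
  unfolding test_fun_def using Ck_Suc_pd[of 0 \<phi>] by blast

lemma test_fun_continuous: "test_fun \<phi> \<Longrightarrow> continuous_on UNIV \<phi>"
  unfolding test_fun_def using Ck.simps(1) by blast

lemma test_fun_pd:
  assumes "test_fun \<phi>" "i \<in> Basis" shows "test_fun (pd i \<phi>)"
proof -
  have "Ck k (pd i \<phi>)" for k
    using assms Ck_Suc_pd[of k \<phi>] by (auto simp: test_fun_def)
  moreover have "{x. pd i \<phi> x \<noteq> 0} \<subseteq> closure {x. \<phi> x \<noteq> 0}"
  proof (rule ccontr)
    assume "\<not> ?thesis"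
    then obtain x where x: "pd i \<phi> x \<noteq> 0" "x \<in> - closure {x. \<phi> x \<noteq> 0}" by blast
    have "(\<phi> has_derivative (\<lambda>h. 0)) (at x)"
      by (rule has_derivative_transform_within_open[of "\<lambda>x. 0" _ _ UNIV "- closure {x. \<phi> x \<noteq> 0}"])
        (use x(2) closure_subset[of "{x. \<phi> x \<noteq> 0}"] in \<open>auto intro: has_derivative_const\<close>)
    then have "pd i \<phi> x = 0" by (rule pd_eqI)
    with x show False by simp
  qed
  then have "closure {x. pd i \<phi> x \<noteq> 0} \<subseteq> closure {x. \<phi> x \<noteq> 0}"
    by (rule closure_minimal) simp
  then have "compact (closure {x. pd i \<phi> x \<noteq> 0})"
    using assms by (auto simp: test_fun_def compact_eq_bounded_closed dest: bounded_subset)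
  ultimately show ?thesis by (simp add: test_fun_def)
qed

lemma test_fun_integrable:
  assumes "test_fun \<phi>" shows "integrable lborel \<phi>"
proof -
  let ?S = "closure {x. \<phi> x \<noteq> 0}"
  have "integrable lborel (\<lambda>x. indicator ?S x *\<^sub>R \<phi> x)"
    by (rule borel_integrable_compact)
      (use assms test_fun_continuous[OF assms] in \<open>auto simp: test_fun_def intro: continuous_on_subset\<close>)
  also have "(\<lambda>x. indicator ?S x *\<^sub>R \<phi> x) = \<phi>"
    using closure_subset[of "{x. \<phi> x \<noteq> 0}"] by (auto simp: fun_eq_iff indicator_def)
  finally show ?thesis .
qed

lemma test_fun_bounded:
  assumes "test_fun \<phi>" obtains B where "\<And>x. \<bar>\<phi> x\<bar> \<le> B"
proof -
  let ?S = "closure {x. \<phi> x \<noteq> 0}"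
  have "compact (\<phi> ` ?S)"
    by (rule compact_continuous_image)
      (use assms test_fun_continuous[OF assms] in \<open>auto simp: test_fun_def intro: continuous_on_subset\<close>)
  then obtain B where B: "B > 0" "\<And>x. x \<in> ?S \<Longrightarrow> \<bar>\<phi> x\<bar> \<le> B"
    using compact_imp_bounded bounded_pos by (metis imageI real_norm_def)
  have "\<bar>\<phi> x\<bar> \<le> B" for x
    using B closure_subset[of "{x. \<phi> x \<noteq> 0}"] by (cases "\<phi> x = 0") auto
  then show ?thesis by (rule that)
qed

lemma test_fun_real_L2: "test_fun \<phi> \<Longrightarrow> real_L2 \<phi>"
  by (metis test_fun_bounded test_fun_integrable real_L2I)

section \<open>Weak derivatives\<close>

lemma L2_pairing_integrable:
  assumes "real_L2 k" "u \<in> L2" shows "integrable lborel (\<lambda>x. k x *\<^sub>R u x)"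
  using L2_mult_integrable[of "cpx k" u] assms by (simp add: real_L2_def scaleR_conv_of_real)

text \<open>The definition tests only with compactly supported functions, whereas heat kernels have
  none of that. Test with \<open>cutoff n\<close> times \<open>f\<close> and let \<open>n\<close>
  grow: the term containing the derivative of the cutoff tends to 0, and dominated convergence
  handles the rest.\<close>

lemma weak_deriv_smooth:
  assumes w: "has_weak_deriv i u g" and i: "i \<in> Basis" and u: "u \<in> L2" and g: "g \<in> L2"
    and f: "\<And>k. Ck k f" and fL2: "real_L2 f" "real_L2 (pd i f)"
  shows "(LINT x|lborel. pd i f x *\<^sub>R u x) = - (LINT x|lborel. f x *\<^sub>R g x)"
proof -
  have [measurable]: "u \<in> borel_measurable borel" "g \<in> borel_measurable borel"
    "f \<in> borel_measurable borel" "pd i f \<in> borel_measurable borel"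
    using u g fL2 by (auto simp: L2_measurable real_L2_measurable)
  have c_cont: "continuous_on UNIV (cutoff n :: 'a \<Rightarrow> real)" for n
    using Ck_cutoff[of 0 n, where 'a='a] by simp
  have pc_cont: "continuous_on UNIV (pd i (cutoff n :: 'a \<Rightarrow> real))" for n
    using Ck_cutoff[of "Suc 0" n, where 'a='a] i by (simp add: Ck_Suc_pd)
  have [measurable]: "(cutoff n :: 'a \<Rightarrow> real) \<in> borel_measurable borel" "pd i (cutoff n) \<in> borel_measurable borel" for n
    using c_cont pc_cont by (auto intro: borel_measurable_continuous_onI)
  have d: "cutoff n differentiable (at x)" "f differentiable (at x)" for n and x :: 'a
    using Ck_cutoff[of "Suc 0" n, where 'a='a] f[of "Suc 0"] by (auto simp: Ck_Suc_pd)
  have eq: "(LINT x|lborel. (cutoff n x * pd i f x + pd i (cutoff n) x * f x) *\<^sub>R u x)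
      = - (LINT x|lborel. (cutoff n x * f x) *\<^sub>R g x)" for n
  proof -
    have "(LINT x|lborel. pd i (\<lambda>x. cutoff n x * f x) x *\<^sub>R u x) = - (LINT x|lborel. (cutoff n x * f x) *\<^sub>R g x)"
      using w test_fun_cutoff_mult[OF f, of n] unfolding has_weak_deriv_def pd_def by blast
    then show ?thesis unfolding pd_mult[OF d(1)[of n] d(2), of i] .
  qed
  have "(\<lambda>n. LINT x|lborel. (cutoff n x * pd i f x + pd i (cutoff n) x * f x) *\<^sub>R u x)
      \<longlonglongrightarrow> (LINT x|lborel. pd i f x *\<^sub>R u x)"
  proof (rule integral_dominated_convergence[where w = "\<lambda>x. norm (pd i f x *\<^sub>R u x) + (4 * exp 1) * norm (f x *\<^sub>R u x)"])
    show "integrable lborel (\<lambda>x. norm (pd i f x *\<^sub>R u x) + (4 * exp 1) * norm (f x *\<^sub>R u x))"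
      by (intro Bochner_Integration.integrable_add integrable_mult_right integrable_norm L2_pairing_integrable fL2 u)
    show "AE x in lborel. (\<lambda>n. (cutoff n x * pd i f x + pd i (cutoff n) x * f x) *\<^sub>R u x) \<longlonglongrightarrow> pd i f x *\<^sub>R u x"
    proof (rule AE_I2)
      fix x :: 'a
      have "(\<lambda>n. pd i (cutoff n) x) \<longlonglongrightarrow> 0"
      proof (rule Lim_null_comparison)
        show "\<forall>\<^sub>F n in sequentially. norm (pd i (cutoff n) x) \<le> 4 * exp 1 * inverse (real (Suc n))"
          using pd_cutoff_le[OF i] by (auto simp: divide_inverse)
        show "(\<lambda>n. 4 * exp 1 * inverse (real (Suc n))) \<longlonglongrightarrow> 0"
          using tendsto_mult_right_zero[OF LIMSEQ_inverse_real_of_nat] by simp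
      qed
      then have "(\<lambda>n. (cutoff n x * pd i f x + pd i (cutoff n) x * f x) *\<^sub>R u x) \<longlonglongrightarrow> (1 * pd i f x + 0 * f x) *\<^sub>R u x"
        by (intro tendsto_intros cutoff_tendsto)
      then show "(\<lambda>n. (cutoff n x * pd i f x + pd i (cutoff n) x * f x) *\<^sub>R u x) \<longlonglongrightarrow> pd i f x *\<^sub>R u x" by simp
    qed
    show "AE x in lborel. norm ((cutoff n x * pd i f x + pd i (cutoff n) x * f x) *\<^sub>R u x)
        \<le> norm (pd i f x *\<^sub>R u x) + (4 * exp 1) * norm (f x *\<^sub>R u x)" for n
    proof (rule AE_I2)
      fix x :: 'a
      have "4 * exp 1 / real (Suc n) \<le> 4 * exp 1" by (simp add: field_simps)
      then have "\<bar>pd i (cutoff n) x\<bar> \<le> 4 * exp 1" using pd_cutoff_le[OF i, of n x] by linarith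
      then have "\<bar>cutoff n x * pd i f x\<bar> + \<bar>pd i (cutoff n) x * f x\<bar> \<le> 1 * \<bar>pd i f x\<bar> + (4 * exp 1) * \<bar>f x\<bar>"
        unfolding abs_mult using cutoff_nonneg[of n x] cutoff_le_1[of n x] by (intro add_mono mult_right_mono) auto
      then have "\<bar>cutoff n x * pd i f x + pd i (cutoff n) x * f x\<bar> \<le> \<bar>pd i f x\<bar> + (4 * exp 1) * \<bar>f x\<bar>"
        by linarith
      then have "\<bar>cutoff n x * pd i f x + pd i (cutoff n) x * f x\<bar> * norm (u x) \<le> (\<bar>pd i f x\<bar> + (4 * exp 1) * \<bar>f x\<bar>) * norm (u x)"
        by (rule mult_right_mono) simp
      then show "norm ((cutoff n x * pd i f x + pd i (cutoff n) x * f x) *\<^sub>R u x)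
          \<le> norm (pd i f x *\<^sub>R u x) + (4 * exp 1) * norm (f x *\<^sub>R u x)"
        by (simp add: distrib_right mult.assoc)
    qed
  qed auto
  moreover have "(\<lambda>n. - (LINT x|lborel. (cutoff n x * f x) *\<^sub>R g x)) \<longlonglongrightarrow> - (LINT x|lborel. f x *\<^sub>R g x)"
  proof (rule tendsto_minus, rule integral_dominated_convergence[where w = "\<lambda>x. norm (f x *\<^sub>R g x)"])
    show "integrable lborel (\<lambda>x. norm (f x *\<^sub>R g x))"
      by (intro integrable_norm L2_pairing_integrable fL2 g)
    show "AE x in lborel. (\<lambda>n. (cutoff n x * f x) *\<^sub>R g x) \<longlonglongrightarrow> f x *\<^sub>R g x"
    proof (rule AE_I2)
      fix x :: 'a
      have "(\<lambda>n. (cutoff n x * f x) *\<^sub>R g x) \<longlonglongrightarrow> (1 * f x) *\<^sub>R g x"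
        by (intro tendsto_intros cutoff_tendsto)
      then show "(\<lambda>n. (cutoff n x * f x) *\<^sub>R g x) \<longlonglongrightarrow> f x *\<^sub>R g x" by simp
    qed
    show "AE x in lborel. norm ((cutoff n x * f x) *\<^sub>R g x) \<le> norm (f x *\<^sub>R g x)" for n
    proof (rule AE_I2)
      fix x :: 'a
      have "\<bar>cutoff n x\<bar> \<le> 1" using cutoff_nonneg[of n x] cutoff_le_1[of n x] by simp
      then show "norm ((cutoff n x * f x) *\<^sub>R g x) \<le> norm (f x *\<^sub>R g x)"
        by (auto simp: abs_mult intro!: mult_right_mono mult_left_le_one_le)
    qed
  qed auto
  ultimately show ?thesis
    unfolding eq using LIMSEQ_unique by blast
qed

lemma real_L2_reflect': "real_L2 k \<Longrightarrow> real_L2 (\<lambda>x. k (y - x))"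
  using real_L2_reflect[of k y] by (simp add: real_L2_def)

text \<open>The test function x \<mapsto> k (y - x) has derivative - pd i k (y - x); this sign
  cancels the one in the definition of the weak derivative.\<close>

lemma conv_weak_deriv:
  assumes w: "has_weak_deriv i u g" and i: "i \<in> Basis" and u: "u \<in> L2" and g: "g \<in> L2"
    and k: "sch k"
  shows "conv (pd i k) u y = conv k g y"
proof -
  have eq: "pd i (\<lambda>x. k (y - x)) = (\<lambda>x. - pd i k (y - x))"
    by (rule pd_reflect) (rule sch_differentiable[OF k])
  have "(LINT x|lborel. pd i (\<lambda>x. k (y - x)) x *\<^sub>R u x) = - (LINT x|lborel. k (y - x) *\<^sub>R g x)"
  proof (rule weak_deriv_smooth[OF w i u g])
    show "Ck n (\<lambda>x. k (y - x))" for n by (intro Ck_reflect Ck_sch k)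
    show "real_L2 (\<lambda>x. k (y - x))" by (intro real_L2_reflect' sch_real_L2 k)
    have "real_L2 (\<lambda>x. pd i k (y - x))" by (intro real_L2_reflect' sch_real_L2 sch_pd k i)
    then show "real_L2 (pd i (\<lambda>x. k (y - x)))" unfolding eq by (simp add: real_L2_iff)
  qed
  then show ?thesis by (simp add: eq conv_def)
qed

text \<open>Two weak derivatives have the same convolutions with all heat kernels.\<close>

lemma weak_deriv_unique:
  assumes "has_weak_deriv i u g" "has_weak_deriv i u g'" "i \<in> Basis" "u \<in> L2" "g \<in> L2" "g' \<in> L2"
  shows "AE x in lborel. g x = g' x"
proof -
  have "AE x in lborel. g x - g' x = 0"
  proof (rule conv_heat_eq_0)
    show "(\<lambda>x. g x - g' x) \<in> L2" by (intro L2_diff assms)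
    fix t :: real and y :: 'a assume t: "t > 0"
    have "conv (heat t) g y = conv (heat t) g' y"
      using conv_weak_deriv[OF assms(1,3,4,5) sch_heat[OF t], of y]
        conv_weak_deriv[OF assms(2,3,4,6) sch_heat[OF t], of y] by simp
    then show "conv (heat t) (\<lambda>x. g x - g' x) y = 0"
      by (simp add: conv_diff_right sch_real_L2 sch_heat t assms)
  qed
  then show ?thesis by simp
qed

lemma weak_deriv_works:
  assumes "g \<in> L2" "has_weak_deriv i f g"
  shows "weak_deriv i f \<in> L2" "has_weak_deriv i f (weak_deriv i f)"
  using someI[of "\<lambda>g. g \<in> L2 \<and> has_weak_deriv i f g" g] assms by (auto simp: weak_deriv_def)

lemma weak_deriv_eq_AE:
  assumes "g \<in> L2" "has_weak_deriv i f g" "i \<in> Basis" "f \<in> L2"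
  shows "AE x in lborel. weak_deriv i f x = g x"
  using weak_deriv_unique weak_deriv_works assms by blast

lemma has_weak_deriv_cong_AE:
  assumes "has_weak_deriv i f g" "i \<in> Basis" "f \<in> L2" "f' \<in> L2" "g \<in> L2" "g' \<in> L2"
    "AE x in lborel. f' x = f x" "AE x in lborel. g' x = g x"
  shows "has_weak_deriv i f' g'"
  unfolding has_weak_deriv_def
proof (intro allI impI)
  fix \<phi> :: "'a \<Rightarrow> real" assume \<phi>: "test_fun \<phi>"
  have [measurable]: "f \<in> borel_measurable borel" "f' \<in> borel_measurable borel"
    "g \<in> borel_measurable borel" "g' \<in> borel_measurable borel"
    "\<phi> \<in> borel_measurable borel" "pd i \<phi> \<in> borel_measurable borel"
    using assms \<phi> test_fun_pd[OF \<phi> assms(2)] by (auto simp: L2_measurable intro: borel_measurable_continuous_onI test_fun_continuous)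
  have "(LINT x|lborel. pd i \<phi> x *\<^sub>R f' x) = (LINT x|lborel. pd i \<phi> x *\<^sub>R f x)"
    by (rule integral_cong_AE) (use assms(7) in auto)
  moreover have "(LINT x|lborel. \<phi> x *\<^sub>R g' x) = (LINT x|lborel. \<phi> x *\<^sub>R g x)"
    by (rule integral_cong_AE) (use assms(8) in auto)
  moreover have "(LINT x|lborel. pd i \<phi> x *\<^sub>R f x) = - (LINT x|lborel. \<phi> x *\<^sub>R g x)"
    using assms(1) \<phi> by (simp add: has_weak_deriv_def pd_def)
  ultimately show "(LINT x|lborel. frechet_derivative \<phi> (at x) i *\<^sub>R f' x) = - (LINT x|lborel. \<phi> x *\<^sub>R g' x)"
    by (simp add: pd_def)
qed

lemma has_weak_deriv_cnj:
  assumes "has_weak_deriv i f g" shows "has_weak_deriv i (\<lambda>x. cnj (f x)) (\<lambda>x. cnj (g x))"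
proof -
  have *: "(LINT x|lborel. k x *\<^sub>R cnj (v x)) = cnj (LINT x|lborel. k x *\<^sub>R v x)" for k and v :: "'a \<Rightarrow> complex"
    by (subst Bochner_Integration.integral_cnj[symmetric]) simp
  show ?thesis
    using assms unfolding has_weak_deriv_def * by (metis complex_cnj_minus)
qed

text \<open>Closedness of weak differentiation as an operator in \<open>L2\<close>; it transfers
  derivatives from heat-smoothed functions to their limits.\<close>

lemma has_weak_deriv_limit:
  assumes w: "\<And>n. has_weak_deriv i (f n) (g n)" and i: "i \<in> Basis"
    and L2: "\<And>n. f n \<in> L2" "\<And>n. g n \<in> L2" "F \<in> L2" "G \<in> L2"
    and lim: "(\<lambda>n. l2_norm (\<lambda>x. f n x - F x)) \<longlonglongrightarrow> 0" "(\<lambda>n. l2_norm (\<lambda>x. g n x - G x)) \<longlonglongrightarrow> 0"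
  shows "has_weak_deriv i F G"
  unfolding has_weak_deriv_def
proof (intro allI impI)
  fix \<phi> :: "'a \<Rightarrow> real" assume \<phi>: "test_fun \<phi>"
  have r: "cpx \<phi> \<in> L2" "cpx (pd i \<phi>) \<in> L2"
    using test_fun_real_L2[OF \<phi>] test_fun_real_L2[OF test_fun_pd[OF \<phi> i]] by (auto simp: real_L2_def)
  have 1: "(\<lambda>n. LINT x|lborel. f n x * cpx (pd i \<phi>) x) \<longlonglongrightarrow> (LINT x|lborel. F x * cpx (pd i \<phi>) x)"
    by (rule tendsto_l2_pairing[OF L2(3) r(2) L2(1) lim(1)])
  have 2: "(\<lambda>n. - (LINT x|lborel. g n x * cpx \<phi> x)) \<longlonglongrightarrow> - (LINT x|lborel. G x * cpx \<phi> x)"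
    by (intro tendsto_minus tendsto_l2_pairing[OF L2(4) r(1) L2(2) lim(2)])
  have 3: "(LINT x|lborel. f n x * cpx (pd i \<phi>) x) = - (LINT x|lborel. g n x * cpx \<phi> x)" for n
    using w[of n] \<phi> by (simp add: has_weak_deriv_def pd_def scaleR_conv_of_real mult.commute)
  have "(LINT x|lborel. F x * cpx (pd i \<phi>) x) = - (LINT x|lborel. G x * cpx \<phi> x)"
    using 1 2 unfolding 3 by (rule LIMSEQ_unique)
  then show "(LINT x|lborel. frechet_derivative \<phi> (at x) i *\<^sub>R F x) = - (LINT x|lborel. \<phi> x *\<^sub>R G x)"
    by (simp add: pd_def scaleR_conv_of_real mult.commute)
qed

section \<open>Integration by parts\<close>

text \<open>Translation invariance of Lebesgue measure makes the integral of a directional derivative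
  vanish, without any boundary terms.\<close>

lemma integral_pd_eq_0:
  fixes f :: "'a::euclidean_space \<Rightarrow> real"
  assumes d: "\<And>x. f differentiable (at x)" and c: "continuous_on UNIV (pd i f)"
    and f: "integrable lborel f" and pf: "integrable lborel (pd i f)"
  shows "(LINT x|lborel. pd i f x) = 0"
proof -
  have [measurable]: "f \<in> borel_measurable borel" "pd i f \<in> borel_measurable borel" using f pf by auto
  have vd: "((\<lambda>r. f (x + r *\<^sub>R i)) has_vector_derivative pd i f (x + r *\<^sub>R i)) (at r within S)" for x r S
  proof -
    have 1: "(f has_derivative frechet_derivative f (at (x + r *\<^sub>R i))) (at (x + r *\<^sub>R i))"
      using d by (simp add: frechet_derivative_works[symmetric])
    have "((\<lambda>r. x + r *\<^sub>R i) has_derivative (\<lambda>h. h *\<^sub>R i)) (at r within S)"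
      by (auto intro!: derivative_eq_intros)
    from has_derivative_compose[OF this 1]
    have "((\<lambda>r. f (x + r *\<^sub>R i)) has_derivative (\<lambda>h. frechet_derivative f (at (x + r *\<^sub>R i)) (h *\<^sub>R i))) (at r within S)" .
    moreover have "frechet_derivative f (at (x + r *\<^sub>R i)) (h *\<^sub>R i) = h *\<^sub>R pd i f (x + r *\<^sub>R i)" for h
      using linear_frechet_derivative[OF d] by (simp add: pd_def linear_scale)
    ultimately show ?thesis by (simp add: has_vector_derivative_def)
  qed
  have cont: "continuous_on {0..1} (\<lambda>r. pd i f (x + r *\<^sub>R i))" for x
    by (rule continuous_on_compose2[OF c]) (auto intro!: continuous_intros)
  \<comment> \<open>Averaging the derivative over the unit segment in direction \<open>i\<close>
    gives a difference of two translates, whose integrals agree; exchanging the integrals turns the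
    average back into the integral of the derivative.\<close>
  have ftc: "(LINT r|lborel. indicator {0..1} r *\<^sub>R pd i f (x + r *\<^sub>R i)) = f (i + x) - f x" for x
    using integral_FTC_atLeastAtMost[OF _ vd cont] by (simp add: add.commute)
  have "(LINT x|lborel. (LINT r|lborel. indicator {0..1} r *\<^sub>R pd i f (x + r *\<^sub>R i)))
      = (LINT r|lborel. (LINT x|lborel. indicator {0..1} r *\<^sub>R pd i f (x + r *\<^sub>R i)))"
  proof (rule fubini_eq[symmetric])
    have "(\<integral>\<^sup>+r. (\<integral>\<^sup>+x. ennreal (norm (indicator {0..1} r *\<^sub>R pd i f (x + r *\<^sub>R i))) \<partial>lborel) \<partial>lborel)
        = (\<integral>\<^sup>+r. indicator {0..1::real} r * (\<integral>\<^sup>+x. ennreal \<bar>pd i f x\<bar> \<partial>lborel) \<partial>lborel)"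
    proof (rule nn_integral_cong)
      fix r :: real
      have "(\<integral>\<^sup>+x. ennreal \<bar>pd i f (x - (- (r *\<^sub>R i)))\<bar> \<partial>lborel) = (\<integral>\<^sup>+x. ennreal \<bar>pd i f x\<bar> \<partial>lborel)"
        by (rule nn_integral_translate) simp
      then show "(\<integral>\<^sup>+x. ennreal (norm (indicator {0..1} r *\<^sub>R pd i f (x + r *\<^sub>R i))) \<partial>lborel)
          = indicator {0..1} r * (\<integral>\<^sup>+x. ennreal \<bar>pd i f x\<bar> \<partial>lborel)"
        by (simp split: split_indicator)
    qed
    also have "\<dots> = (\<integral>\<^sup>+x. ennreal \<bar>pd i f x\<bar> \<partial>lborel)"
      by (simp add: nn_integral_multc)
    also have "\<dots> < \<infinity>" using pf by (simp add: integrable_iff_bounded)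
    finally show "(\<integral>\<^sup>+r. (\<integral>\<^sup>+x. ennreal (norm (indicator {0..1} r *\<^sub>R pd i f (x + r *\<^sub>R i))) \<partial>lborel) \<partial>lborel) < \<infinity>" .
  qed (auto intro: lborel.sigma_finite_measure_axioms)
  also have "\<dots> = (LINT r|lborel. indicator {0..1::real} r *\<^sub>R (LINT x|lborel. pd i f x))"
  proof (rule Bochner_Integration.integral_cong[OF refl])
    fix r :: real
    have "(LINT x|lborel. pd i f (x + r *\<^sub>R i)) = (LINT x|lborel. pd i f x)"
      using integral_translate[of "pd i f" "r *\<^sub>R i"] by (simp add: add.commute)
    then show "(LINT x|lborel. indicator {0..1} r *\<^sub>R pd i f (x + r *\<^sub>R i)) = indicator {0..1} r *\<^sub>R (LINT x|lborel. pd i f x)"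
      by simp
  qed
  also have "\<dots> = (LINT x|lborel. pd i f x)" by simp
  finally have "(LINT x|lborel. pd i f x) = (LINT x|lborel. f (i + x) - f x)"
    unfolding ftc by (rule sym)
  also have "\<dots> = 0"
    using f integrable_translate[OF f, of i] by (simp add: integral_translate)
  finally show ?thesis .
qed

lemma translate_has_derivative:
  fixes f :: "'a::euclidean_space \<Rightarrow> real"
  assumes "\<And>x. f differentiable (at x)"
  shows "((\<lambda>x. f (x - z)) has_derivative frechet_derivative f (at (x - z))) (at x)"
proof -
  have "(f has_derivative frechet_derivative f (at (x - z))) (at (x - z))"
    using assms by (simp add: frechet_derivative_works[symmetric])
  then show ?thesis
    by (rule has_derivative_compose[rotated]) (auto intro!: derivative_eq_intros)
qed

lemma pd_translate:
  fixes f :: "'a::euclidean_space \<Rightarrow> real"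
  assumes "\<And>x. f differentiable (at x)"
  shows "pd i (\<lambda>x. f (x - z)) = (\<lambda>x. pd i f (x - z))"
proof
  fix x
  show "pd i (\<lambda>x. f (x - z)) x = pd i f (x - z)"
    using pd_eqI[OF translate_has_derivative[OF assms, of z x], of i] by (simp add: pd_def)
qed

lemma integrable_mult_bounded:
  fixes f g :: "'a::euclidean_space \<Rightarrow> real"
  assumes "integrable lborel f" "g \<in> borel_measurable borel" "\<And>x. \<bar>g x\<bar> \<le> B"
  shows "integrable lborel (\<lambda>x. f x * g x)"
proof (rule Bochner_Integration.integrable_bound[OF integrable_mult_right[OF integrable_abs[OF assms(1)], of B]])
  show "AE x in lborel. norm (f x * g x) \<le> norm (B * \<bar>f x\<bar>)"
  proof (rule AE_I2)
    fix x
    have "\<bar>g x\<bar> \<le> \<bar>B\<bar>" using assms(3)[of x] by linarith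
    then show "norm (f x * g x) \<le> norm (B * \<bar>f x\<bar>)"
      using mult_left_mono[of "\<bar>g x\<bar>" "\<bar>B\<bar>" "\<bar>f x\<bar>"] by (simp add: abs_mult mult.commute)
  qed
qed (use assms in auto)

lemma test_fun_integral_by_parts:
  assumes \<phi>: "test_fun \<phi>" and k: "sch k" and i: "i \<in> Basis"
  shows "(LINT x|lborel. pd i \<phi> x * k (x - z)) = - (LINT x|lborel. \<phi> x * pd i k (x - z))"
proof -
  have pk: "sch (pd i k)" and p\<phi>: "test_fun (pd i \<phi>)" using \<phi> k i by (auto intro: sch_pd test_fun_pd)
  have dk: "(\<lambda>x. k (x - z)) differentiable (at x)" for x
    by (rule differentiableI) (rule translate_has_derivative[OF sch_differentiable[OF k]])
  have ck: "continuous_on UNIV (\<lambda>x. k (x - z))"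
    by (rule continuous_on_compose2[OF sch_continuous[OF k]]) (auto intro: continuous_intros)
  have cpk: "continuous_on UNIV (\<lambda>x. pd i k (x - z))"
    by (rule continuous_on_compose2[OF sch_continuous[OF pk]]) (auto intro: continuous_intros)
  obtain B where B: "\<And>x. \<bar>k x\<bar> \<le> B" using sch_bounded[OF k] by blast
  obtain B' where B': "\<And>x. \<bar>pd i k x\<bar> \<le> B'" using sch_bounded[OF pk] by blast
  have i1: "integrable lborel (\<lambda>x. \<phi> x * k (x - z))"
    by (rule integrable_mult_bounded[OF test_fun_integrable[OF \<phi>]]) (use ck B in \<open>auto intro: borel_measurable_continuous_onI\<close>)
  have i2: "integrable lborel (\<lambda>x. \<phi> x * pd i k (x - z))"
    by (rule integrable_mult_bounded[OF test_fun_integrable[OF \<phi>]]) (use cpk B' in \<open>auto intro: borel_measurable_continuous_onI\<close>)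
  have i3: "integrable lborel (\<lambda>x. pd i \<phi> x * k (x - z))"
    by (rule integrable_mult_bounded[OF test_fun_integrable[OF p\<phi>]]) (use ck B in \<open>auto intro: borel_measurable_continuous_onI\<close>)
  have eq: "pd i (\<lambda>x. \<phi> x * k (x - z)) = (\<lambda>x. \<phi> x * pd i k (x - z) + pd i \<phi> x * k (x - z))"
    using pd_mult[OF test_fun_differentiable[OF \<phi>] dk] pd_translate[OF sch_differentiable[OF k]] by simp
  have "(LINT x|lborel. pd i (\<lambda>x. \<phi> x * k (x - z)) x) = 0"
  proof (rule integral_pd_eq_0)
    show "(\<lambda>x. \<phi> x * k (x - z)) differentiable (at x)" for x
      by (intro derivative_intros test_fun_differentiable \<phi> dk)
    show "continuous_on UNIV (pd i (\<lambda>x. \<phi> x * k (x - z)))"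
      unfolding eq by (intro continuous_intros test_fun_continuous \<phi> p\<phi> ck cpk)
    show "integrable lborel (pd i (\<lambda>x. \<phi> x * k (x - z)))"
      unfolding eq by (intro Bochner_Integration.integrable_add i2 i3)
  qed (rule i1)
  then show ?thesis unfolding eq using i2 i3 by simp
qed

lemma nn_conv_bound:
  assumes "real_L2 k" "v \<in> L2"
  shows "(\<integral>\<^sup>+z. ennreal (norm (k (x - z) *\<^sub>R v z)) \<partial>lborel) \<le> ennreal (l2_norm (cpx k) * l2_norm v)"
  using nn_cauchy_schwarz_L2[OF real_L2_reflect[OF assms(1), of x] assms(2)]
    L2_reflect(2)[of "cpx k" x] assms(1)
  by (simp add: real_L2_def)

lemma integral_conv:
  assumes \<psi>: "integrable lborel \<psi>" and k: "real_L2 k" "\<And>x. \<bar>k x\<bar> \<le> B" and v: "v \<in> L2"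
  shows "(LINT x|lborel. \<psi> x *\<^sub>R conv k v x) = (LINT z|lborel. (LINT x|lborel. \<psi> x * k (x - z)) *\<^sub>R v z)"
proof -
  have [measurable]: "\<psi> \<in> borel_measurable borel" "k \<in> borel_measurable borel" "v \<in> borel_measurable borel"
    using assms by (auto simp: real_L2_measurable L2_measurable)
  have "(\<integral>\<^sup>+x. (\<integral>\<^sup>+z. ennreal (norm ((\<psi> x * k (x - z)) *\<^sub>R v z)) \<partial>lborel) \<partial>lborel)
      = (\<integral>\<^sup>+x. ennreal \<bar>\<psi> x\<bar> * (\<integral>\<^sup>+z. ennreal (norm (k (x - z) *\<^sub>R v z)) \<partial>lborel) \<partial>lborel)"
    by (simp add: nn_integral_cmult[symmetric] ennreal_mult[symmetric] abs_mult mult.assoc)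
  also have "\<dots> \<le> (\<integral>\<^sup>+x. ennreal \<bar>\<psi> x\<bar> * ennreal (l2_norm (cpx k) * l2_norm v) \<partial>lborel)"
    by (intro nn_integral_mono mult_left_mono nn_conv_bound k v) simp
  also have "\<dots> = (\<integral>\<^sup>+x. ennreal \<bar>\<psi> x\<bar> \<partial>lborel) * ennreal (l2_norm (cpx k) * l2_norm v)"
    by (rule nn_integral_multc) simp
  also have "\<dots> < \<infinity>"
    using \<psi> by (auto simp: integrable_iff_bounded ennreal_mult_less_top)
  finally have fin: "(\<integral>\<^sup>+x. (\<integral>\<^sup>+z. ennreal (norm ((\<psi> x * k (x - z)) *\<^sub>R v z)) \<partial>lborel) \<partial>lborel) < \<infinity>" .
  have F: "(LINT x|lborel. (LINT z|lborel. (\<psi> x * k (x - z)) *\<^sub>R v z)) = (LINT z|lborel. (LINT x|lborel. (\<psi> x * k (x - z)) *\<^sub>R v z))"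
    by (rule fubini_eq[OF _ _ _ fin]) (auto intro: lborel.sigma_finite_measure_axioms)
  moreover have "(LINT x|lborel. (\<psi> x * k (x - z)) *\<^sub>R v z) = (LINT x|lborel. \<psi> x * k (x - z)) *\<^sub>R v z" for z
    by (intro integral_scaleR_left integrable_mult_bounded[OF \<psi>, of _ B]) (use k in auto)
  moreover have "(LINT z|lborel. (\<psi> x * k (x - z)) *\<^sub>R v z) = \<psi> x *\<^sub>R conv k v x" for x
    unfolding conv_def scaleR_scaleR[symmetric] by (rule integral_scaleR_right)
  ultimately show ?thesis by simp
qed

lemma conv_has_weak_deriv:
  assumes k: "sch k" and v: "v \<in> L2" and i: "i \<in> Basis"
  shows "has_weak_deriv i (conv k v) (conv (pd i k) v)"
  unfolding has_weak_deriv_def pd_def[symmetric]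
proof (intro allI impI)
  fix \<phi> :: "'a \<Rightarrow> real" assume \<phi>: "test_fun \<phi>"
  obtain B where B: "\<And>x. \<bar>k x\<bar> \<le> B" using sch_bounded[OF k] by blast
  obtain B' where B': "\<And>x. \<bar>pd i k x\<bar> \<le> B'" using sch_bounded[OF sch_pd[OF k i]] by blast
  have "(LINT x|lborel. pd i \<phi> x *\<^sub>R conv k v x) = (LINT z|lborel. (LINT x|lborel. pd i \<phi> x * k (x - z)) *\<^sub>R v z)"
    by (rule integral_conv[OF test_fun_integrable[OF test_fun_pd[OF \<phi> i]] sch_real_L2[OF k] B v])
  also have "\<dots> = - (LINT z|lborel. (LINT x|lborel. \<phi> x * pd i k (x - z)) *\<^sub>R v z)"
    by (simp add: test_fun_integral_by_parts[OF \<phi> k i])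
  also have "\<dots> = - (LINT x|lborel. \<phi> x *\<^sub>R conv (pd i k) v x)"
    by (subst integral_conv[OF test_fun_integrable[OF \<phi>] sch_real_L2[OF sch_pd[OF k i]] B' v]) simp
  finally show "(LINT x|lborel. pd i \<phi> x *\<^sub>R conv k v x) = - (LINT x|lborel. \<phi> x *\<^sub>R conv (pd i k) v x)" .
qed

lemma nn_cauchy_schwarz_finite:
  assumes [measurable]: "f \<in> borel_measurable M" "g \<in> borel_measurable M"
    and "(\<integral>\<^sup>+x. (f x)\<^sup>2 \<partial>M) < \<infinity>" "(\<integral>\<^sup>+x. (g x)\<^sup>2 \<partial>M) < \<infinity>"
  shows "(\<integral>\<^sup>+x. f x * g x \<partial>M) < \<infinity>"
proof -
  have "(\<integral>\<^sup>+x. f x * g x \<partial>M)\<^sup>2 \<le> (\<integral>\<^sup>+x. (f x)\<^sup>2 \<partial>M) * (\<integral>\<^sup>+x. (g x)\<^sup>2 \<partial>M)"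
    by (rule Cauchy_Schwarz_nn_integral) auto
  also have "\<dots> < \<infinity>" using assms by (simp add: ennreal_mult_less_top)
  finally show ?thesis
    by (cases "(\<integral>\<^sup>+x. f x * g x \<partial>M) = \<top>") (auto simp: power2_eq_square ennreal_mult_top less_top)
qed

lemma L2_nn_finite: "u \<in> L2 \<Longrightarrow> (\<integral>\<^sup>+x. (ennreal (norm (u x)))\<^sup>2 \<partial>lborel) < \<infinity>"
  by (simp add: L2_iff ennreal_power)

lemma conv_transpose:
  assumes k: "integrable lborel k" and u: "u \<in> L2" and h: "h \<in> L2"
  shows "(LINT x|lborel. u x * conv k h x) = (LINT y|lborel. conv (\<lambda>z. k (- z)) u y * h y)"
proof -
  have [measurable]: "u \<in> borel_measurable borel" "k \<in> borel_measurable borel" "h \<in> borel_measurable borel"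
    using assms by (auto simp: L2_measurable)
  have fin: "(\<integral>\<^sup>+x. (\<integral>\<^sup>+y. ennreal (norm (u x * (k (x - y) *\<^sub>R h y))) \<partial>lborel) \<partial>lborel) < \<infinity>"
  proof -
    have "(\<integral>\<^sup>+x. (\<integral>\<^sup>+y. ennreal (norm (u x * (k (x - y) *\<^sub>R h y))) \<partial>lborel) \<partial>lborel)
        = (\<integral>\<^sup>+x. ennreal (norm (u x)) * (\<integral>\<^sup>+y. ennreal \<bar>k (x - y)\<bar> * ennreal (norm (h y)) \<partial>lborel) \<partial>lborel)"
      by (simp add: nn_integral_cmult[symmetric] ennreal_mult[symmetric] norm_mult mult_ac)
    also have "\<dots> < \<infinity>"
    proof (rule nn_cauchy_schwarz_finite)
      have "(\<integral>\<^sup>+x. (\<integral>\<^sup>+y. ennreal \<bar>k (x - y)\<bar> * ennreal (norm (h y)) \<partial>lborel)\<^sup>2 \<partial>lborel)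
          \<le> (\<integral>\<^sup>+x. ennreal \<bar>k x\<bar> \<partial>lborel)\<^sup>2 * (\<integral>\<^sup>+x. (ennreal (norm (h x)))\<^sup>2 \<partial>lborel)"
        by (rule nn_young) auto
      also have "\<dots> < \<infinity>"
        using k L2_nn_finite[OF h] by (auto simp: integrable_iff_bounded ennreal_mult_less_top power2_eq_square)
      finally show "(\<integral>\<^sup>+x. (\<integral>\<^sup>+y. ennreal \<bar>k (x - y)\<bar> * ennreal (norm (h y)) \<partial>lborel)\<^sup>2 \<partial>lborel) < \<infinity>" .
    qed (use L2_nn_finite[OF u] in auto)
    finally show ?thesis .
  qed
  have "(LINT x|lborel. (LINT y|lborel. u x * (k (x - y) *\<^sub>R h y))) = (LINT y|lborel. (LINT x|lborel. u x * (k (x - y) *\<^sub>R h y)))"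
    by (rule fubini_eq[OF _ _ _ fin]) (auto intro: lborel.sigma_finite_measure_axioms)
  also have "(LINT x|lborel. (LINT y|lborel. u x * (k (x - y) *\<^sub>R h y))) = (LINT x|lborel. u x * conv k h x)"
    by (simp add: conv_def del: mult_scaleR_right)
  also have "(LINT y|lborel. (LINT x|lborel. u x * (k (x - y) *\<^sub>R h y))) = (LINT y|lborel. conv (\<lambda>z. k (- z)) u y * h y)"
  proof -
    have "(LINT x|lborel. u x * (k (x - y) *\<^sub>R h y)) = (LINT x|lborel. (k (x - y) *\<^sub>R u x) * h y)" for y
      by simp
    then show ?thesis by (simp add: conv_def del: mult_scaleR_right mult_scaleR_left)
  qed
  finally show ?thesis .
qed

lemma pd_heat_odd: "t > 0 \<Longrightarrow> pd i (heat t) (- x) = - pd i (heat t) x"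
  by (simp add: pd_heat)

text \<open>Neither factor is a test function, so \<open>u'\<close> is first smoothed by the heat
  flow. The derivative then sits on the kernel and can be passed to the other factor by
  transposition; oddness of the differentiated heat kernel supplies the minus sign, and the
  smoothing is removed in the limit.\<close>

lemma weak_integral_by_parts:
  assumes "has_weak_deriv i u u'" "has_weak_deriv i h h'" and i: "i \<in> Basis"
    and L2: "u \<in> L2" "u' \<in> L2" "h \<in> L2" "h' \<in> L2"
  shows "(LINT x|lborel. u' x * h x) = - (LINT x|lborel. u x * h' x)"
proof -
  define s where "s n = inverse (real (Suc n))" for n
  have "s n > 0" for n by (simp add: s_def)
  moreover have "s \<longlonglongrightarrow> 0" unfolding s_def[abs_def] by (rule LIMSEQ_inverse_real_of_nat)
  ultimately have s: "\<And>n. s n > 0" "s \<longlonglongrightarrow> 0" by auto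
  have eq: "(LINT x|lborel. conv (heat (s n)) u' x * h x) = - (LINT x|lborel. conv (heat (s n)) h' x * u x)" for n
  proof -
    have int: "integrable lborel (pd i (heat (s n)) :: 'a \<Rightarrow> real)"
      by (intro sch_integrable sch_pd sch_heat s i)
    have "(LINT x|lborel. conv (heat (s n)) h' x * u x) = (LINT x|lborel. u x * conv (pd i (heat (s n))) h x)"
      using conv_weak_deriv[OF assms(2) i L2(3,4) sch_heat[OF s(1)[of n]]] by (simp add: mult.commute)
    also have "\<dots> = (LINT y|lborel. conv (\<lambda>z. pd i (heat (s n)) (- z)) u y * h y)"
      by (rule conv_transpose[OF int L2(1,3)])
    also have "\<dots> = (LINT y|lborel. - (conv (heat (s n)) u' y) * h y)"
      using conv_weak_deriv[OF assms(1) i L2(1,2) sch_heat[OF s(1)[of n]]]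
      by (simp add: pd_heat_odd[OF s(1)] conv_def)
    finally show ?thesis by simp
  qed
  have 1: "(\<lambda>n. LINT x|lborel. conv (heat (s n)) u' x * h x) \<longlonglongrightarrow> (LINT x|lborel. u' x * h x)"
    by (intro tendsto_l2_pairing conv_heat_contraction conv_heat_tendsto s L2)
  have 2: "(\<lambda>n. - (LINT x|lborel. conv (heat (s n)) h' x * u x)) \<longlonglongrightarrow> - (LINT x|lborel. h' x * u x)"
    by (intro tendsto_minus tendsto_l2_pairing conv_heat_contraction conv_heat_tendsto s L2)
  show ?thesis
    using LIMSEQ_unique[OF 1 2[folded eq]] by (simp add: mult.commute)
qed

lemma l2_inner_by_parts:
  assumes "has_weak_deriv i u u'" "has_weak_deriv i h h'" and i: "i \<in> Basis"
    and L2: "u \<in> L2" "u' \<in> L2" "h \<in> L2" "h' \<in> L2"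
  shows "l2_inner u' h = - l2_inner u h'"
  unfolding l2_inner_def
  by (rule weak_integral_by_parts[OF assms(1) has_weak_deriv_cnj[OF assms(2)] i L2(1,2) L2_cnj[OF L2(3)] L2_cnj[OF L2(4)]])

section \<open>Elliptic regularity\<close>

text \<open>\<open>H2\<close> asks for some weak derivative that is again weakly differentiable,
  while \<open>weak_deriv\<close> picks an arbitrary one. The two agree almost everywhere, so second
  derivatives carry over to the chosen representative.\<close>

lemma H2_weak_deriv:
  assumes h: "h \<in> H2" and i: "i \<in> Basis"
  shows "weak_deriv i h \<in> L2" "has_weak_deriv i h (weak_deriv i h)"
    and "j \<in> Basis \<Longrightarrow> weak_deriv j (weak_deriv i h) \<in> L2"
    and "j \<in> Basis \<Longrightarrow> has_weak_deriv j (weak_deriv i h) (weak_deriv j (weak_deriv i h))"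
proof -
  have hL2: "h \<in> L2" using h by (simp add: H2_def)
  obtain g where g: "g \<in> L2" "has_weak_deriv i h g" "\<And>j. j \<in> Basis \<Longrightarrow> \<exists>k\<in>L2. has_weak_deriv j g k"
    using h i by (auto simp: H2_def)
  show 1: "weak_deriv i h \<in> L2" "has_weak_deriv i h (weak_deriv i h)"
    by (rule weak_deriv_works[OF g(1,2)])+
  have ae: "AE x in lborel. weak_deriv i h x = g x"
    by (rule weak_deriv_eq_AE[OF g(1,2) i hL2])
  have "weak_deriv j (weak_deriv i h) \<in> L2 \<and> has_weak_deriv j (weak_deriv i h) (weak_deriv j (weak_deriv i h))"
    if j: "j \<in> Basis"
  proof -
    obtain k where k: "k \<in> L2" "has_weak_deriv j g k" using g(3)[OF j] by blast
    have "has_weak_deriv j (weak_deriv i h) k"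
      by (rule has_weak_deriv_cong_AE[OF k(2) j g(1) 1(1) k(1) k(1) ae]) simp
    then show ?thesis using weak_deriv_works[OF k(1)] by blast
  qed
  then show "j \<in> Basis \<Longrightarrow> weak_deriv j (weak_deriv i h) \<in> L2"
    "j \<in> Basis \<Longrightarrow> has_weak_deriv j (weak_deriv i h) (weak_deriv j (weak_deriv i h))" by auto
qed

lemma H2_L2: "h \<in> H2 \<Longrightarrow> h \<in> L2"
  by (simp add: H2_def)

lemma laplacian_L2: "h \<in> H2 \<Longrightarrow> laplacian h \<in> L2"
  unfolding laplacian_def by (intro L2_sum H2_weak_deriv)

text \<open>The converse of \<open>elliptic_regularity\<close> below; together they describe
  \<open>H2\<close> and the Laplacian through the heat flow alone.\<close>

lemma conv_heat_laplacian:
  assumes h: "h \<in> H2" and t: "t > 0"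
  shows "conv (heat t) (laplacian h) y = conv (heat' t) h y"
proof -
  have k: "sch (heat t :: 'a \<Rightarrow> real)" by (rule sch_heat[OF t])
  have "conv (heat t) (laplacian h) y = (\<Sum>i\<in>Basis. conv (heat t) (weak_deriv i (weak_deriv i h)) y)"
    unfolding laplacian_def by (intro conv_sum_right sch_real_L2 k H2_weak_deriv h)
  also have "\<dots> = (\<Sum>i\<in>Basis. conv (pd i (pd i (heat t))) h y)"
  proof (rule sum.cong[OF refl])
    fix i :: 'a assume i: "i \<in> Basis"
    note w = H2_weak_deriv[OF h i]
    show "conv (heat t) (weak_deriv i (weak_deriv i h)) y = conv (pd i (pd i (heat t))) h y"
      using conv_weak_deriv[OF w(4)[OF i] i w(1) w(3)[OF i] k]
        conv_weak_deriv[OF w(2) i H2_L2[OF h] w(1) sch_pd[OF k i]] by simp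
  qed
  also have "\<dots> = conv (heat' t) h y"
    unfolding heat'_eq_laplacian[OF t] by (intro conv_sum_left[symmetric] sch_real_L2 sch_pd k H2_L2 h)
  finally show ?thesis .
qed

lemma conv_sch_L2: "sch k \<Longrightarrow> v \<in> L2 \<Longrightarrow> conv k v \<in> L2"
  by (intro conv_L2 sch_integrable)

text \<open>The Hessian has the same \<open>L2\<close> norm as the Laplacian: one integration by
  parts in direction j and one in direction i, with commuting derivatives, turn each square of a
  mixed derivative into the product of the pure ones.\<close>

lemma sum_conv_second_derivs:
  assumes k: "sch k" and v: "v \<in> L2"
  shows "(\<Sum>i\<in>Basis. \<Sum>j\<in>Basis. (l2_norm (conv (pd j (pd i k)) v))\<^sup>2)
    = (l2_norm (conv (\<lambda>x. \<Sum>i\<in>Basis. pd i (pd i k) x) v))\<^sup>2"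
proof -
  let ?V = "\<lambda>i j. conv (pd j (pd i k)) v"
  have L: "?V i j \<in> L2" if "i \<in> Basis" "j \<in> Basis" for i j
    using that by (intro conv_sch_L2 sch_pd k v)
  have "l2_inner (?V i j) (?V i j) = l2_inner (?V i i) (?V j j)" if i: "i \<in> Basis" and j: "j \<in> Basis" for i j
  proof -
    have c: "pd j (pd j (pd i k)) = pd i (pd j (pd j k))"
      using sch_pd_commute[OF k j i] sch_pd_commute[OF sch_pd[OF k j] j i] by simp
    have "l2_inner (?V i j) (?V i j) = - l2_inner (conv (pd i k) v) (conv (pd j (pd j (pd i k))) v)"
      by (rule l2_inner_by_parts[where i = j]) (intro conv_has_weak_deriv conv_sch_L2 sch_pd k v i j)+
    moreover have "l2_inner (?V i i) (?V j j) = - l2_inner (conv (pd i k) v) (conv (pd i (pd j (pd j k))) v)"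
      by (rule l2_inner_by_parts[where i = i]) (intro conv_has_weak_deriv conv_sch_L2 sch_pd k v i j)+
    ultimately show ?thesis by (simp add: c)
  qed
  then have "(\<Sum>i\<in>Basis. \<Sum>j\<in>Basis. l2_inner (?V i j) (?V i j)) = (\<Sum>i\<in>Basis. \<Sum>j\<in>Basis. l2_inner (?V i i) (?V j j))"
    by (intro sum.cong refl) auto
  also have "\<dots> = l2_inner (\<lambda>x. \<Sum>i\<in>Basis. ?V i i x) (\<lambda>x. \<Sum>i\<in>Basis. ?V i i x)"
    by (simp add: l2_inner_sum_left l2_inner_sum_right L L2_sum)
  also have "(\<lambda>x. \<Sum>i\<in>Basis. ?V i i x) = conv (\<lambda>x. \<Sum>i\<in>Basis. pd i (pd i k) x) v"
    by (intro ext conv_sum_left[symmetric] sch_real_L2 sch_pd k v)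
  finally have "complex_of_real (\<Sum>i\<in>Basis. \<Sum>j\<in>Basis. (l2_norm (?V i j))\<^sup>2)
      = complex_of_real ((l2_norm (conv (\<lambda>x. \<Sum>i\<in>Basis. pd i (pd i k) x) v))\<^sup>2)"
    unfolding l2_inner_self of_real_sum .
  then show ?thesis by (simp only: of_real_eq_iff)
qed

text \<open>An interpolation inequality: first derivatives are Cauchy once the functions and their
  second derivatives are.\<close>

lemma conv_first_deriv:
  assumes k: "sch k" and v: "v \<in> L2" and i: "i \<in> Basis"
  shows "(l2_norm (conv (pd i k) v))\<^sup>2 \<le> l2_norm (conv k v) * l2_norm (conv (pd i (pd i k)) v)"
proof -
  have "l2_inner (conv (pd i k) v) (conv (pd i k) v) = - l2_inner (conv k v) (conv (pd i (pd i k)) v)"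
    by (rule l2_inner_by_parts[where i = i]) (intro conv_has_weak_deriv conv_sch_L2 sch_pd k v i)+
  then have "norm (complex_of_real ((l2_norm (conv (pd i k) v))\<^sup>2)) = norm (l2_inner (conv k v) (conv (pd i (pd i k)) v))"
    unfolding l2_inner_self by simp
  also have "\<dots> \<le> l2_norm (conv k v) * l2_norm (conv (pd i (pd i k)) v)"
    by (intro l2_inner_cauchy_schwarz conv_sch_L2 sch_pd k v i)
  finally show ?thesis by (simp add: norm_power)
qed

text \<open>Integrating by parts twice gives
  \<open>\<Sum>\<^sub>i\<^sub>j \<parallel>\<partial>\<^sub>i\<partial>\<^sub>j P\<^sub>s v - \<partial>\<^sub>i\<partial>\<^sub>j P\<^sub>r v\<parallel>\<^sup>2 = \<parallel>P\<^sub>s w - P\<^sub>r w\<parallel>\<^sup>2\<close> for the heat semigroup \<open>P\<close>, so that the second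
  derivatives of \<open>P\<^sub>s v\<close> form a Cauchy family as \<open>s\<close> tends to \<open>0\<close>.\<close>

theorem elliptic_regularity:
  fixes v w :: "'a::euclidean_space \<Rightarrow> complex"
  assumes v: "v \<in> L2" and w: "w \<in> L2"
    and vw: "\<And>r y. r > 0 \<Longrightarrow> conv (heat' r) v y = conv (heat r) w y"
  shows "v \<in> H2" and "AE x in lborel. laplacian v x = w x"
proof -
  define s where "s n = inverse (real (Suc n))" for n
  have "s n > 0" for n by (simp add: s_def)
  moreover have "s \<longlonglongrightarrow> 0" unfolding s_def[abs_def] by (rule LIMSEQ_inverse_real_of_nat)
  ultimately have s: "\<And>n. s n > 0" "s \<longlonglongrightarrow> 0" by auto
  define k :: "nat \<Rightarrow> 'a \<Rightarrow> real" where "k n = heat (s n)" for n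
  have k: "sch (k n)" for n unfolding k_def by (rule sch_heat[OF s(1)])
  \<comment> \<open>The difference of two heat kernels, written with the scalar -1 so that it falls
    under the closure rules of \<open>sch\<close>.\<close>
  define d where "d n m = (\<lambda>x. k n x + (- 1) * k m x)" for n m
  have d: "sch (d n m)" for n m unfolding d_def by (intro sch_add sch_scale k)
  have pd_d: "pd i (d n m) = (\<lambda>x. pd i (k n) x + (- 1) * pd i (k m) x)" for i n m
    unfolding d_def pd_add[OF sch_differentiable[OF k] sch_differentiable[OF sch_scale[OF k]]]
      pd_scale[OF sch_differentiable[OF k]] ..
  have pd2_d: "pd j (pd i (d n m)) = (\<lambda>x. pd j (pd i (k n)) x + (- 1) * pd j (pd i (k m)) x)" if "i \<in> Basis" for i j n m
    unfolding pd_d pd_add[OF sch_differentiable[OF sch_pd[OF k that]] sch_differentiable[OF sch_scale[OF sch_pd[OF k that]]]]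
      pd_scale[OF sch_differentiable[OF sch_pd[OF k that]]] ..
  have conv_d: "conv (\<lambda>x. f x + (- 1) * g x) v = (\<lambda>y. conv f v y - conv g v y)" if "sch f" "sch g" for f g
    using conv_diff_left[OF sch_real_L2[OF that(1)] sch_real_L2[OF that(2)] v] by auto
  have cv: "conv (d n m) v = (\<lambda>y. conv (k n) v y - conv (k m) v y)" for n m
    unfolding d_def by (rule conv_d[OF k k])
  have cv1: "conv (pd i (d n m)) v = (\<lambda>y. conv (pd i (k n)) v y - conv (pd i (k m)) v y)" if "i \<in> Basis" for i n m
    unfolding pd_d using that by (intro conv_d sch_pd k)
  have cv2: "conv (pd j (pd i (d n m))) v = (\<lambda>y. conv (pd j (pd i (k n))) v y - conv (pd j (pd i (k m))) v y)"
    if "i \<in> Basis" "j \<in> Basis" for i j n m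
    unfolding pd2_d[OF that(1)] using that by (intro conv_d sch_pd k)
  have lap_k: "(\<Sum>i\<in>Basis. conv (pd i (pd i (k n))) v y) = conv (k n) w y" for n y
  proof -
    have "(\<Sum>i\<in>Basis. conv (pd i (pd i (k n))) v y) = conv (heat' (s n)) v y"
      unfolding heat'_eq_laplacian[OF s(1)] k_def[symmetric]
      by (intro conv_sum_left[symmetric] sch_real_L2 sch_pd k v)
    then show ?thesis by (simp add: vw[OF s(1)] k_def)
  qed
  have lap_d: "conv (\<lambda>x. \<Sum>i\<in>Basis. pd i (pd i (d n m)) x) v = (\<lambda>y. conv (k n) w y - conv (k m) w y)" for n m
  proof
    fix y
    have "conv (\<lambda>x. \<Sum>i\<in>Basis. pd i (pd i (d n m)) x) v y = (\<Sum>i\<in>Basis. conv (pd i (pd i (d n m))) v y)"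
      by (intro conv_sum_left sch_real_L2 sch_pd d v)
    also have "\<dots> = (\<Sum>i\<in>Basis. conv (pd i (pd i (k n))) v y) - (\<Sum>i\<in>Basis. conv (pd i (pd i (k m))) v y)"
      by (simp add: cv2 sum_subtractf)
    also note lap_k
    also note lap_k
    finally show "conv (\<lambda>x. \<Sum>i\<in>Basis. pd i (pd i (d n m)) x) v y = conv (k n) w y - conv (k m) w y" .
  qed
  have Cau: "\<exists>N. \<forall>n\<ge>N. \<forall>m\<ge>N. l2_norm (\<lambda>x. conv (k n) u x - conv (k m) u x) < e" if u: "u \<in> L2" and e: "e > 0" for u e
  proof -
    obtain N where N: "\<And>n. n \<ge> N \<Longrightarrow> l2_norm (\<lambda>x. conv (k n) u x - u x) < e / 2"
      using LIMSEQ_D[OF conv_heat_tendsto[OF u s], of "e / 2"] e by (auto simp: k_def)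
    have "l2_norm (\<lambda>x. conv (k n) u x - conv (k m) u x) < e" if "n \<ge> N" "m \<ge> N" for n m
    proof -
      have L: "(\<lambda>x. conv (k n) u x - u x) \<in> L2" for n by (intro L2_diff conv_sch_L2 k u)
      have "l2_norm (\<lambda>x. (conv (k n) u x - u x) - (conv (k m) u x - u x))
          \<le> l2_norm (\<lambda>x. conv (k n) u x - u x) + l2_norm (\<lambda>x. conv (k m) u x - u x)"
        by (rule l2_norm_triangle_diff[OF L L])
      then show ?thesis using N[OF that(1)] N[OF that(2)] by simp
    qed
    then show ?thesis by blast
  qed
  \<comment> \<open>A single entry is at most the full Hessian, whose norm is that of the Laplacian;
    by \<open>vw\<close> the Laplacian of the smoothed \<open>v\<close> is the smoothed
    \<open>w\<close>.\<close>
  have le2: "l2_norm (\<lambda>x. conv (pd j (pd i (k n))) v x - conv (pd j (pd i (k m))) v x) \<le> l2_norm (\<lambda>x. conv (k n) w x - conv (k m) w x)"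
    if i: "i \<in> Basis" and j: "j \<in> Basis" for i j n m
  proof (rule power2_le_imp_le)
    have "(l2_norm (conv (pd j (pd i (d n m))) v))\<^sup>2 \<le> (\<Sum>j\<in>Basis. (l2_norm (conv (pd j (pd i (d n m))) v))\<^sup>2)"
      by (rule member_le_sum[OF j]) auto
    also have "\<dots> \<le> (\<Sum>i\<in>Basis. \<Sum>j\<in>Basis. (l2_norm (conv (pd j (pd i (d n m))) v))\<^sup>2)"
      by (rule member_le_sum[OF i, where f = "\<lambda>i. \<Sum>j\<in>Basis. (l2_norm (conv (pd j (pd i (d n m))) v))\<^sup>2"]) (auto intro: sum_nonneg)
    finally show "(l2_norm (\<lambda>x. conv (pd j (pd i (k n))) v x - conv (pd j (pd i (k m))) v x))\<^sup>2 \<le> (l2_norm (\<lambda>x. conv (k n) w x - conv (k m) w x))\<^sup>2"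
      unfolding sum_conv_second_derivs[OF d v] lap_d cv2[OF i j] .
  qed simp
  have exW: "\<exists>g\<in>L2. (\<lambda>n. l2_norm (\<lambda>x. conv (pd j (pd i (k n))) v x - g x)) \<longlonglongrightarrow> 0"
    if i: "i \<in> Basis" and j: "j \<in> Basis" for i j
  proof (rule L2_complete)
    show "conv (pd j (pd i (k n))) v \<in> L2" for n by (intro conv_sch_L2 sch_pd k v i j)
    show "\<exists>N. \<forall>n\<ge>N. \<forall>m\<ge>N. l2_norm (\<lambda>x. conv (pd j (pd i (k n))) v x - conv (pd j (pd i (k m))) v x) < e" if e: "e > 0" for e
    proof -
      obtain N where "\<forall>n\<ge>N. \<forall>m\<ge>N. l2_norm (\<lambda>x. conv (k n) w x - conv (k m) w x) < e"
        using Cau[OF w e] by blast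
      then have "\<forall>n\<ge>N. \<forall>m\<ge>N. l2_norm (\<lambda>x. conv (pd j (pd i (k n))) v x - conv (pd j (pd i (k m))) v x) < e"
        by (intro allI impI le_less_trans[OF le2[OF i j]]) simp
      then show ?thesis by (rule exI)
    qed
  qed
  define W where "W i j = (SOME g. g \<in> L2 \<and> (\<lambda>n. l2_norm (\<lambda>x. conv (pd j (pd i (k n))) v x - g x)) \<longlonglongrightarrow> 0)" for i j
  have W: "W i j \<in> L2" "(\<lambda>n. l2_norm (\<lambda>x. conv (pd j (pd i (k n))) v x - W i j x)) \<longlonglongrightarrow> 0"
    if "i \<in> Basis" "j \<in> Basis" for i j
    using someI_ex[OF exW[OF that, unfolded Bex_def]] unfolding W_def by auto
  have exU: "\<exists>g\<in>L2. (\<lambda>n. l2_norm (\<lambda>x. conv (pd i (k n)) v x - g x)) \<longlonglongrightarrow> 0" if i: "i \<in> Basis" for i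
  proof (rule L2_complete)
    show "conv (pd i (k n)) v \<in> L2" for n by (intro conv_sch_L2 sch_pd k v i)
    show "\<exists>N. \<forall>n\<ge>N. \<forall>m\<ge>N. l2_norm (\<lambda>x. conv (pd i (k n)) v x - conv (pd i (k m)) v x) < e" if e: "e > 0" for e
    proof -
      obtain N1 where N1: "\<And>n m. n \<ge> N1 \<Longrightarrow> m \<ge> N1 \<Longrightarrow> l2_norm (\<lambda>x. conv (k n) v x - conv (k m) v x) < e"
        using Cau[OF v e] by blast
      obtain N2 where N2: "\<And>n m. n \<ge> N2 \<Longrightarrow> m \<ge> N2 \<Longrightarrow> l2_norm (\<lambda>x. conv (k n) w x - conv (k m) w x) < e"
        using Cau[OF w e] by blast
      have "l2_norm (\<lambda>x. conv (pd i (k n)) v x - conv (pd i (k m)) v x) < e" if "n \<ge> max N1 N2" "m \<ge> max N1 N2" for n m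
      proof (rule power2_less_imp_less)
        have "(l2_norm (conv (pd i (d n m)) v))\<^sup>2 \<le> l2_norm (conv (d n m) v) * l2_norm (conv (pd i (pd i (d n m))) v)"
          by (rule conv_first_deriv[OF d v i])
        also have "\<dots> \<le> l2_norm (conv (d n m) v) * l2_norm (\<lambda>x. conv (k n) w x - conv (k m) w x)"
          using le2[OF i i, of n m] by (intro mult_left_mono) (simp_all add: cv2 i)
        also have "\<dots> < e * e"
          unfolding cv using N1[of n m] N2[of n m] that e by (intro mult_strict_mono) auto
        finally show "(l2_norm (\<lambda>x. conv (pd i (k n)) v x - conv (pd i (k m)) v x))\<^sup>2 < e\<^sup>2"
          by (simp add: cv1 i power2_eq_square)
      qed (use e in simp)
      then show ?thesis by blast
    qed
  qed
  define U where "U i = (SOME g. g \<in> L2 \<and> (\<lambda>n. l2_norm (\<lambda>x. conv (pd i (k n)) v x - g x)) \<longlonglongrightarrow> 0)" for i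
  have U: "U i \<in> L2" "(\<lambda>n. l2_norm (\<lambda>x. conv (pd i (k n)) v x - U i x)) \<longlonglongrightarrow> 0"
    if "i \<in> Basis" for i
    using someI_ex[OF exU[OF that, unfolded Bex_def]] unfolding U_def by auto
  have v_lim: "(\<lambda>n. l2_norm (\<lambda>x. conv (k n) v x - v x)) \<longlonglongrightarrow> 0"
    unfolding k_def by (rule conv_heat_tendsto[OF v s])
  have w1: "has_weak_deriv i v (U i)" if i: "i \<in> Basis" for i
    by (rule has_weak_deriv_limit[OF conv_has_weak_deriv[OF k v i] i _ _ v U(1)[OF i] v_lim U(2)[OF i]])
      (intro conv_sch_L2 sch_pd k v i)+
  have w2: "has_weak_deriv j (U i) (W i j)" if i: "i \<in> Basis" and j: "j \<in> Basis" for i j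
    by (rule has_weak_deriv_limit[OF conv_has_weak_deriv[OF sch_pd[OF k i] v j] j _ _ U(1)[OF i] W(1)[OF i j] U(2)[OF i] W(2)[OF i j]])
      (intro conv_sch_L2 sch_pd k v i j)+
  show H: "v \<in> H2"
    unfolding H2_def mem_Collect_eq
  proof (intro conjI v ballI)
    fix i :: 'a assume i: "i \<in> Basis"
    have "\<forall>j\<in>Basis. \<exists>h\<in>L2. has_weak_deriv j (U i) h"
      using w2[OF i] W(1)[OF i] by (intro ballI bexI) auto
    then show "\<exists>g\<in>L2. has_weak_deriv i v g \<and> (\<forall>j\<in>Basis. \<exists>h\<in>L2. has_weak_deriv j g h)"
      using w1[OF i] U(1)[OF i] by (intro bexI conjI)
  qed
  \<comment> \<open>\<open>laplacian\<close> is built from chosen representatives, so it is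
    identified with \<open>w\<close> through its heat convolutions and not through the limits
    \<open>W\<close> above.\<close>
  have "AE x in lborel. laplacian v x - w x = 0"
  proof (rule conv_heat_eq_0)
    show "(\<lambda>x. laplacian v x - w x) \<in> L2" by (intro L2_diff laplacian_L2 H w)
    show "conv (heat t) (\<lambda>x. laplacian v x - w x) y = 0" if t: "t > 0" for t y
      using conv_heat_laplacian[OF H t, of y] vw[OF t, of y]
      by (simp add: conv_diff_right sch_real_L2 sch_heat t laplacian_L2 H w)
  qed
  then show "AE x in lborel. laplacian v x = w x" by simp
qed

text \<open>Chosen weak derivatives are linear only up to null sets. The heat-flow characterisation
  is linear and delivers both the membership and the formula at once.\<close>

lemma H2_diff:
  assumes "f \<in> H2" "g \<in> H2"
  shows "(\<lambda>x. f x - g x) \<in> H2" and "AE x in lborel. laplacian (\<lambda>x. f x - g x) x = laplacian f x - laplacian g x"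
proof -
  have eq: "conv (heat' r) (\<lambda>x. f x - g x) y = conv (heat r) (\<lambda>x. laplacian f x - laplacian g x) y" if r: "r > 0" for r y
    using assms r by (simp add: conv_diff_right sch_real_L2 sch_heat sch_heat' H2_L2 laplacian_L2 conv_heat_laplacian)
  show "(\<lambda>x. f x - g x) \<in> H2" "AE x in lborel. laplacian (\<lambda>x. f x - g x) x = laplacian f x - laplacian g x"
    using elliptic_regularity[OF L2_diff[OF H2_L2[OF assms(1)] H2_L2[OF assms(2)]]
      L2_diff[OF laplacian_L2[OF assms(1)] laplacian_L2[OF assms(2)]] eq] by auto
qed

lemma conv_scale_right: "conv k (\<lambda>x. c * u x) y = c * conv k u y"
  unfolding conv_def mult_scaleR_right[symmetric] by (simp del: mult_scaleR_right)

lemma H2_scale: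
  assumes "f \<in> H2"
  shows "(\<lambda>x. c * f x) \<in> H2" and "AE x in lborel. laplacian (\<lambda>x. c * f x) x = c * laplacian f x"
proof -
  have eq: "conv (heat' r) (\<lambda>x. c * f x) y = conv (heat r) (\<lambda>x. c * laplacian f x) y" if r: "r > 0" for r y
    using assms r by (simp add: conv_scale_right conv_heat_laplacian)
  show "(\<lambda>x. c * f x) \<in> H2" "AE x in lborel. laplacian (\<lambda>x. c * f x) x = c * laplacian f x"
    using elliptic_regularity[OF L2_scale[OF H2_L2[OF assms]] L2_scale[OF laplacian_L2[OF assms]] eq] by auto
qed

lemma H2_gradient_inner:
  assumes f: "f \<in> H2" and h: "h \<in> H2"
  shows "(\<Sum>i\<in>Basis. l2_inner (weak_deriv i f) (weak_deriv i h)) = - l2_inner (laplacian f) h"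
proof -
  have "(\<Sum>i\<in>Basis. l2_inner (weak_deriv i f) (weak_deriv i h)) = (\<Sum>i\<in>Basis. - l2_inner (weak_deriv i (weak_deriv i f)) h)"
  proof (rule sum.cong[OF refl])
    fix i :: 'a assume i: "i \<in> Basis"
    note wf = H2_weak_deriv[OF f i] and wh = H2_weak_deriv[OF h i]
    show "l2_inner (weak_deriv i f) (weak_deriv i h) = - l2_inner (weak_deriv i (weak_deriv i f)) h"
      using l2_inner_by_parts[OF wf(4)[OF i] wh(2) i wf(1) wf(3)[OF i] H2_L2[OF h] wh(1)] by simp
  qed
  also have "\<dots> = - l2_inner (laplacian f) h"
    unfolding laplacian_def by (subst l2_inner_sum_left) (auto simp: sum_negf H2_weak_deriv f H2_L2 h)
  finally show ?thesis .
qed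

section \<open>Kernels subordinate to the heat kernel\<close>

lemma nn_integral_powr_exp_finite:
  assumes "a > -1" "c > 0"
  shows "(\<integral>\<^sup>+t. ennreal (indicator {0<..} t * (t powr a * exp (- (c * t)))) \<partial>lborel) < \<infinity>"
proof -
  define f where "f t = indicator {0<..} t *\<^sub>R (complex_of_real t powr (complex_of_real (a + 1) - 1) / of_real (exp (c * t)))" for t :: real
  have "(\<lambda>t. complex_of_real t powr (complex_of_real (a + 1) - 1) / of_real (exp (c * t))) absolutely_integrable_on {0<..}"
    using assms by (intro absolutely_integrable_Gamma_integral) auto
  then have "integrable lebesgue f" by (simp add: set_integrable_def f_def[abs_def])
  then have 1: "(\<integral>\<^sup>+t. ennreal (norm (f t)) \<partial>lebesgue) < \<infinity>" by (simp add: integrable_iff_bounded)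
  have eq: "norm (f t) = indicator {0<..} t * (t powr a * exp (- (c * t)))" for t
  proof (cases "t > 0")
    case True
    have "complex_of_real t powr (complex_of_real (a + 1) - 1) = complex_of_real (t powr a)"
      using True by (simp add: powr_of_real[symmetric])
    then show ?thesis
      using True by (simp add: f_def norm_divide exp_minus divide_inverse norm_mult norm_inverse)
  qed (simp add: f_def)
  show ?thesis using 1 unfolding eq by (subst (asm) nn_integral_completion)
qed

text \<open>The exponential bound concerns nonnegative times only, because the heat kernel vanishes
  at negative ones; continuity on the whole line provides measurability and the boundary value at
  0.\<close>

definition wt :: "(real \<Rightarrow> real) \<Rightarrow> bool" where
  "wt \<sigma> \<longleftrightarrow> continuous_on UNIV \<sigma> \<and> (\<exists>C c. 0 < c \<and> (\<forall>t\<ge>0. \<bar>\<sigma> t\<bar> \<le> C * exp (- (c * t))))"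

definition ker :: "(real \<Rightarrow> real) \<Rightarrow> 'a::euclidean_space \<Rightarrow> real" where
  "ker \<sigma> x = (LINT t|lborel. \<sigma> t * heat t x)"

text \<open>For positive \<open>c\<close> the Green function of -\<Delta> + c, as an extended
  nonnegative function so that it may be infinite at the origin. Multiples of it dominate every
  kernel \<open>ker\<close> with a weight in \<open>wt\<close>.\<close>

definition expker :: "real \<Rightarrow> 'a::euclidean_space \<Rightarrow> ennreal" where
  "expker c x = (\<integral>\<^sup>+t. ennreal (exp (- (c * t)) * heat t x) \<partial>lborel)"

lemma wt_measurable: "wt \<sigma> \<Longrightarrow> \<sigma> \<in> borel_measurable borel"
  by (auto simp: wt_def intro: borel_measurable_continuous_onI)

lemma heat_nonpos [simp]: "t \<le> 0 \<Longrightarrow> heat t x = 0"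
  by (simp add: heat_def)

lemma borel_measurable_expker [measurable]: "expker c \<in> borel_measurable borel"
  unfolding expker_def by measurable

lemma expker_minus [simp]: "expker c (- x) = expker c x"
  by (simp add: expker_def)

lemma ker_minus [simp]: "ker \<sigma> (- x) = ker \<sigma> x"
  by (simp add: ker_def)

lemma ker_commute: "ker \<sigma> (x - y) = ker \<sigma> (y - x)"
  by (metis ker_minus minus_diff_eq)

lemma borel_measurable_ker: "wt \<sigma> \<Longrightarrow> ker \<sigma> \<in> borel_measurable borel"
proof -
  assume "wt \<sigma>"
  then have [measurable]: "\<sigma> \<in> borel_measurable borel" by (rule wt_measurable)
  show ?thesis unfolding ker_def by measurable
qed

lemma nn_integral_heat: "t > 0 \<Longrightarrow> (\<integral>\<^sup>+x. ennreal (heat t (x::'a::euclidean_space)) \<partial>lborel) = 1"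
  using heat_integral[of t, where 'a='a] by (subst nn_integral_eq_integral) auto

lemma expker_integral:
  assumes "c > 0" shows "(\<integral>\<^sup>+x. expker c (x::'a::euclidean_space) \<partial>lborel) < \<infinity>"
proof -
  have "(\<integral>\<^sup>+x. expker c (x::'a) \<partial>lborel) = (\<integral>\<^sup>+t. (\<integral>\<^sup>+x. ennreal (exp (- (c * t)) * heat t (x::'a)) \<partial>lborel) \<partial>lborel)"
    unfolding expker_def by (rule lborel_pair.Fubini') measurable
  also have "\<dots> = (\<integral>\<^sup>+t. ennreal (indicator {0<..} t * (t powr 0 * exp (- (c * t)))) \<partial>lborel)"
  proof (rule nn_integral_cong)
    fix t :: real
    have "(\<integral>\<^sup>+x. ennreal (exp (- (c * t)) * heat t (x::'a)) \<partial>lborel) = ennreal (exp (- (c * t))) * (\<integral>\<^sup>+x. ennreal (heat t (x::'a)) \<partial>lborel)"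
      by (subst nn_integral_cmult[symmetric]) (auto simp: ennreal_mult)
    then show "(\<integral>\<^sup>+x. ennreal (exp (- (c * t)) * heat t (x::'a)) \<partial>lborel) = ennreal (indicator {0<..} t * (t powr 0 * exp (- (c * t))))"
      by (cases "t > 0") (auto simp: nn_integral_heat)
  qed
  also have "\<dots> < \<infinity>" by (rule nn_integral_powr_exp_finite) (use assms in auto)
  finally show ?thesis .
qed

text \<open>The dimension enters here: the weight \<open>t\<^bsup>-d/4\<^esup>\<close> is integrable at \<open>0\<close> only for \<open>d < 4\<close>.\<close>

lemma expker_square_integral:
  assumes c: "c > 0" and dim: "DIM('a::euclidean_space) < 4"
  shows "(\<integral>\<^sup>+x. (expker c (x::'a))\<^sup>2 \<partial>lborel) < \<infinity>"
proof -
  \<comment> \<open>Cauchy-Schwarz in time with weight \<rho>, applied to t powr p times the heat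
    kernel. The squared \<open>L2\<close> norm of the latter in space is t powr (2 p) times
    \<open>heat (2 t)\<close> at 0, which does not depend on t.\<close>
  define p where "p = real DIM('a) / 4"
  define \<rho> where "\<rho> t = indicator {0<..} t * (t powr (- p) * exp (- (c * t)))" for t :: real
  have [measurable]: "\<rho> \<in> borel_measurable borel" unfolding \<rho>_def by measurable
  define I where "I = (\<integral>\<^sup>+t. ennreal (\<rho> t) \<partial>lborel)"
  have I: "I < \<infinity>"
    unfolding I_def \<rho>_def by (rule nn_integral_powr_exp_finite) (use c dim in \<open>auto simp: p_def\<close>)
  have "(expker c x)\<^sup>2 \<le> I * (\<integral>\<^sup>+t. ennreal (\<rho> t) * (ennreal (t powr p * heat t x))\<^sup>2 \<partial>lborel)" for x :: 'a
  proof -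
    have "expker c x = (\<integral>\<^sup>+t. ennreal (\<rho> t) * ennreal (t powr p * heat t x) \<partial>lborel)"
      unfolding expker_def
    proof (rule nn_integral_cong)
      fix t :: real
      have "exp (- (c * t)) * heat t x = \<rho> t * (t powr p * heat t x)"
        by (cases "t > 0") (auto simp: \<rho>_def powr_minus)
      then show "ennreal (exp (- (c * t)) * heat t x) = ennreal (\<rho> t) * ennreal (t powr p * heat t x)"
        by (subst ennreal_mult[symmetric]) (auto simp: \<rho>_def)
    qed
    then show ?thesis
      unfolding I_def by (simp only:) (rule nn_weighted_cauchy_schwarz; measurable)
  qed
  then have "(\<integral>\<^sup>+x. (expker c (x::'a))\<^sup>2 \<partial>lborel)
      \<le> (\<integral>\<^sup>+x. I * (\<integral>\<^sup>+t. ennreal (\<rho> t) * (ennreal (t powr p * heat t (x::'a)))\<^sup>2 \<partial>lborel) \<partial>lborel)"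
    by (rule nn_integral_mono)
  also have "\<dots> = I * (\<integral>\<^sup>+x. (\<integral>\<^sup>+t. ennreal (\<rho> t) * (ennreal (t powr p * heat t (x::'a)))\<^sup>2 \<partial>lborel) \<partial>lborel)"
    by (rule nn_integral_cmult) measurable
  also have "(\<integral>\<^sup>+x. (\<integral>\<^sup>+t. ennreal (\<rho> t) * (ennreal (t powr p * heat t (x::'a)))\<^sup>2 \<partial>lborel) \<partial>lborel)
      = (\<integral>\<^sup>+t. (\<integral>\<^sup>+x. ennreal (\<rho> t) * (ennreal (t powr p * heat t (x::'a)))\<^sup>2 \<partial>lborel) \<partial>lborel)"
    by (rule lborel_pair.Fubini') measurable
  also have "\<dots> = (\<integral>\<^sup>+t. ennreal ((8 * pi) powr (- 2 * p)) * ennreal (\<rho> t) \<partial>lborel)"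
  proof (rule nn_integral_cong)
    fix t :: real
    show "(\<integral>\<^sup>+x. ennreal (\<rho> t) * (ennreal (t powr p * heat t (x::'a)))\<^sup>2 \<partial>lborel) = ennreal ((8 * pi) powr (- 2 * p)) * ennreal (\<rho> t)"
    proof (cases "t > 0")
      case t: True
      have "(\<integral>\<^sup>+x. ennreal (\<rho> t) * (ennreal (t powr p * heat t (x::'a)))\<^sup>2 \<partial>lborel)
          = (\<integral>\<^sup>+x. ennreal (\<rho> t * (t powr p)\<^sup>2) * ennreal ((norm (cpx (heat t) (x::'a)))\<^sup>2) \<partial>lborel)"
        by (simp add: ennreal_power ennreal_mult[symmetric] power_mult_distrib \<rho>_def mult.assoc)
      also have "\<dots> = ennreal (\<rho> t * (t powr p)\<^sup>2) * (\<integral>\<^sup>+x. ennreal ((norm (cpx (heat t) (x::'a)))\<^sup>2) \<partial>lborel)"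
        by (rule nn_integral_cmult) simp
      also have "(\<integral>\<^sup>+x. ennreal ((norm (cpx (heat t) (x::'a)))\<^sup>2) \<partial>lborel) = ennreal (heat (2 * t) (0::'a))"
        using sch_real_L2[OF sch_heat[OF t], where 'a='a] by (simp add: nn_l2_norm real_L2_def l2_norm_heat[OF t] del: norm_of_real)
      also have "ennreal (\<rho> t * (t powr p)\<^sup>2) * ennreal (heat (2 * t) (0::'a)) = ennreal (\<rho> t * ((t powr p)\<^sup>2 * heat (2 * t) (0::'a)))"
        by (subst ennreal_mult[symmetric]) (auto simp: \<rho>_def mult.assoc)
      also have "(t powr p)\<^sup>2 * heat (2 * t) (0::'a) = (8 * pi) powr (- 2 * p)"
      proof -
        have "heat (2 * t) (0::'a) = (8 * pi * t) powr (- 2 * p)"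
          using t by (simp add: heat_def p_def mult.assoc)
        also have "\<dots> = (8 * pi) powr (- 2 * p) * t powr (- 2 * p)" by (rule powr_mult)
        finally have h: "heat (2 * t) (0::'a) = (8 * pi) powr (- 2 * p) * t powr (- 2 * p)" .
        have "(t powr p)\<^sup>2 * t powr (- 2 * p) = t powr (p + p + - 2 * p)"
          by (simp only: power2_eq_square powr_add)
        also have "\<dots> = 1" using t by simp
        finally show ?thesis unfolding h by (metis mult.left_commute mult_1_right)
      qed
      finally show ?thesis by (simp add: ennreal_mult[symmetric] \<rho>_def mult.commute)
    qed (simp add: \<rho>_def)
  qed
  also have "\<dots> = ennreal ((8 * pi) powr (- 2 * p)) * I"
    unfolding I_def by (rule nn_integral_cmult) measurable
  finally have "(\<integral>\<^sup>+x. (expker c (x::'a))\<^sup>2 \<partial>lborel) \<le> I * (ennreal ((8 * pi) powr (- 2 * p)) * I)" .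
  also have "\<dots> < \<infinity>" using I by (simp add: ennreal_mult_less_top)
  finally show ?thesis .
qed

lemma wt_bound:
  assumes "wt \<sigma>"
  obtains C c where "C \<ge> 0" "c > 0" "\<And>t. t \<ge> 0 \<Longrightarrow> \<bar>\<sigma> t\<bar> \<le> C * exp (- (c * t))"
    "\<And>x::'a::euclidean_space. (\<integral>\<^sup>+t. ennreal \<bar>\<sigma> t * heat t x\<bar> \<partial>lborel) \<le> ennreal C * expker c x"
    "\<And>x::'a. ennreal \<bar>ker \<sigma> x\<bar> \<le> ennreal C * expker c x"
proof -
  have [measurable]: "\<sigma> \<in> borel_measurable borel" using assms by (rule wt_measurable)
  obtain C c where C: "c > 0" "\<And>t. t \<ge> 0 \<Longrightarrow> \<bar>\<sigma> t\<bar> \<le> C * exp (- (c * t))"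
    using assms by (auto simp: wt_def)
  have C0: "C \<ge> 0" using C(2)[of 0] by (simp add: order_trans[OF abs_ge_zero])
  have 1: "(\<integral>\<^sup>+t. ennreal \<bar>\<sigma> t * heat t x\<bar> \<partial>lborel) \<le> ennreal C * expker c x" for x :: 'a
  proof -
    have "(\<integral>\<^sup>+t. ennreal \<bar>\<sigma> t * heat t x\<bar> \<partial>lborel) \<le> (\<integral>\<^sup>+t. ennreal C * ennreal (exp (- (c * t)) * heat t x) \<partial>lborel)"
    proof (rule nn_integral_mono)
      fix t :: real
      have "\<bar>\<sigma> t * heat t x\<bar> \<le> C * (exp (- (c * t)) * heat t x)"
        by (cases "t > 0") (use mult_right_mono[OF C(2)[of t], of "heat t x"] in \<open>auto simp: abs_mult mult.assoc\<close>)
      then show "ennreal \<bar>\<sigma> t * heat t x\<bar> \<le> ennreal C * ennreal (exp (- (c * t)) * heat t x)"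
        using C0 by (simp add: ennreal_mult[symmetric])
    qed
    then show ?thesis unfolding expker_def by (subst nn_integral_cmult[symmetric]) auto
  qed
  have 2: "ennreal \<bar>ker \<sigma> x\<bar> \<le> ennreal C * expker c x" for x :: 'a
  proof (cases "integrable lborel (\<lambda>t. \<sigma> t * heat t x)")
    case True
    have "ennreal (norm (ker \<sigma> x)) \<le> (\<integral>\<^sup>+t. ennreal (norm (\<sigma> t * heat t x)) \<partial>lborel)"
      unfolding ker_def by (rule integral_norm_bound_ennreal[OF True])
    with 1[of x] show ?thesis by simp
  qed (simp add: ker_def not_integrable_integral_eq)
  show ?thesis using that[OF C0 C 1 2] by blast
qed

lemma ker_real_L2:
  assumes "wt \<sigma>" and dim: "DIM('a::euclidean_space) < 4"
  shows "real_L2 (ker \<sigma> :: 'a \<Rightarrow> real)"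
proof -
  obtain C c where C: "c > 0" "\<And>x::'a. ennreal \<bar>ker \<sigma> x\<bar> \<le> ennreal C * expker c x"
    using wt_bound[OF assms(1)] by metis
  have "(\<integral>\<^sup>+x. ennreal ((norm (cpx (ker \<sigma>) (x::'a)))\<^sup>2) \<partial>lborel) \<le> (\<integral>\<^sup>+x. (ennreal C)\<^sup>2 * (expker c (x::'a))\<^sup>2 \<partial>lborel)"
  proof (rule nn_integral_mono)
    fix x :: 'a
    have "(ennreal \<bar>ker \<sigma> x\<bar>)\<^sup>2 \<le> (ennreal C * expker c x)\<^sup>2" by (rule power_mono[OF C(2)]) simp
    then show "ennreal ((norm (cpx (ker \<sigma>) x))\<^sup>2) \<le> (ennreal C)\<^sup>2 * (expker c x)\<^sup>2"
      by (simp add: ennreal_power power_mult_distrib)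
  qed
  also have "\<dots> = (ennreal C)\<^sup>2 * (\<integral>\<^sup>+x. (expker c (x::'a))\<^sup>2 \<partial>lborel)" by (rule nn_integral_cmult) simp
  also have "\<dots> < \<infinity>"
    using expker_square_integral[OF C(1) dim] by (simp add: ennreal_mult_less_top power2_eq_square)
  finally show ?thesis
    using borel_measurable_ker[OF assms(1), where 'a='a] by (simp add: real_L2_def L2_iff)
qed

lemma nn_conv_expker_finite:
  assumes "c > 0" "DIM('a::euclidean_space) < 4" "u \<in> L2"
  shows "(\<integral>\<^sup>+x. expker c (y - x) * ennreal (norm (u (x::'a))) \<partial>lborel) < \<infinity>"
proof (rule nn_cauchy_schwarz_finite)
  have [measurable]: "u \<in> borel_measurable borel" using assms(3) by (rule L2_measurable)
  show "(\<lambda>x. ennreal (norm (u x))) \<in> borel_measurable lborel" by simp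
  have "(\<integral>\<^sup>+x. (expker c (y - x))\<^sup>2 \<partial>lborel) = (\<integral>\<^sup>+x. (expker c (x::'a))\<^sup>2 \<partial>lborel)"
    by (rule nn_integral_reflect) simp
  then show "(\<integral>\<^sup>+x. (expker c (y - x))\<^sup>2 \<partial>lborel) < \<infinity>"
    using expker_square_integral[OF assms(1,2)] by simp
  show "(\<integral>\<^sup>+x. (ennreal (norm (u x)))\<^sup>2 \<partial>lborel) < \<infinity>" by (rule L2_nn_finite[OF assms(3)])
qed simp

text \<open>By Fubini, convolution with a subordinate kernel is a weighted time integral of the heat
  flow, so derivatives of the flow in time can act on it.\<close>

lemma conv_ker:
  fixes u :: "'a::euclidean_space \<Rightarrow> complex"
  assumes \<sigma>: "wt \<sigma>" and dim: "DIM('a) < 4" and u: "u \<in> L2"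
  shows "conv (ker \<sigma>) u y = (LINT t|lborel. \<sigma> t *\<^sub>R conv (heat t) u y)"
    and "integrable lborel (\<lambda>t. \<sigma> t *\<^sub>R conv (heat t) u y)"
proof -
  have [measurable]: "u \<in> borel_measurable borel" "\<sigma> \<in> borel_measurable borel"
    using u \<sigma> by (auto intro: L2_measurable wt_measurable)
  obtain C c where C: "c > 0" "\<And>x::'a. (\<integral>\<^sup>+t. ennreal \<bar>\<sigma> t * heat t x\<bar> \<partial>lborel) \<le> ennreal C * expker c x"
    using wt_bound[OF \<sigma>] by metis
  have fin: "(\<integral>\<^sup>+x. (\<integral>\<^sup>+t. ennreal (norm ((\<sigma> t * heat t (y - x)) *\<^sub>R u x)) \<partial>lborel) \<partial>lborel) < \<infinity>"
  proof -
    have "(\<integral>\<^sup>+x. (\<integral>\<^sup>+t. ennreal (norm ((\<sigma> t * heat t (y - x)) *\<^sub>R u x)) \<partial>lborel) \<partial>lborel)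
        = (\<integral>\<^sup>+x. (\<integral>\<^sup>+t. ennreal \<bar>\<sigma> t * heat t (y - x)\<bar> \<partial>lborel) * ennreal (norm (u x)) \<partial>lborel)"
      by (simp add: nn_integral_multc[symmetric] ennreal_mult[symmetric])
    also have "\<dots> \<le> (\<integral>\<^sup>+x. ennreal C * (expker c (y - x) * ennreal (norm (u x))) \<partial>lborel)"
      unfolding mult.assoc[symmetric] by (intro nn_integral_mono mult_right_mono C) simp
    also have "\<dots> = ennreal C * (\<integral>\<^sup>+x. expker c (y - x) * ennreal (norm (u x)) \<partial>lborel)"
      by (rule nn_integral_cmult) measurable
    also have "\<dots> < \<infinity>" using nn_conv_expker_finite[OF C(1) dim u] by (simp add: ennreal_mult_less_top)
    finally show ?thesis .
  qed
  note F = fubini[OF lborel.sigma_finite_measure_axioms lborel.sigma_finite_measure_axioms _ fin]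
  have 1: "(LINT t|lborel. (\<sigma> t * heat t (y - x)) *\<^sub>R u x) = ker \<sigma> (y - x) *\<^sub>R u x" for x
    unfolding ker_def scaleR_conv_of_real integral_mult_left_zero integral_complex_of_real ..
  have 2: "(LINT x|lborel. (\<sigma> t * heat t (y - x)) *\<^sub>R u x) = \<sigma> t *\<^sub>R conv (heat t) u y" for t
    unfolding conv_def scaleR_scaleR[symmetric] by (rule integral_scaleR_right)
  have "(LINT x|lborel. (LINT t|lborel. (\<sigma> t * heat t (y - x)) *\<^sub>R u x)) = (LINT t|lborel. (LINT x|lborel. (\<sigma> t * heat t (y - x)) *\<^sub>R u x))"
    by (rule F) measurable
  then show "conv (ker \<sigma>) u y = (LINT t|lborel. \<sigma> t *\<^sub>R conv (heat t) u y)"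
    unfolding 1 2 conv_def[of "ker \<sigma>"] .
  have "integrable lborel (\<lambda>t. LINT x|lborel. (\<sigma> t * heat t (y - x)) *\<^sub>R u x)"
    by (rule F) measurable
  then show "integrable lborel (\<lambda>t. \<sigma> t *\<^sub>R conv (heat t) u y)" unfolding 2 .
qed

section \<open>Potentials\<close>

text \<open>\<open>source M g\<close> admits both \<open>f dx\<close> with \<open>f\<close> square-integrable and finite measures with a bounded density,
  so that Green potentials of both kinds are treated at once.\<close>

definition source :: "'a::euclidean_space measure \<Rightarrow> ('a \<Rightarrow> complex) \<Rightarrow> bool" where
  "source M g \<longleftrightarrow> sigma_finite_measure M \<and> sets M = sets borel \<and> g \<in> borel_measurable borel \<and>
     (\<forall>c>0. (\<integral>\<^sup>+x. (\<integral>\<^sup>+z. expker c (x - z) * ennreal (norm (g z)) \<partial>M)\<^sup>2 \<partial>lborel) < \<infinity>)"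

definition pot :: "(real \<Rightarrow> real) \<Rightarrow> 'a::euclidean_space measure \<Rightarrow> ('a \<Rightarrow> complex) \<Rightarrow> 'a \<Rightarrow> complex" where
  "pot \<sigma> M g x = (LINT z|M. ker \<sigma> (x - z) *\<^sub>R g z)"

lemma pot_lborel: "pot \<sigma> lborel g = conv (ker \<sigma>) g"
  by (simp add: pot_def conv_def fun_eq_iff)

lemma source_lborel:
  assumes "g \<in> L2" shows "source lborel g"
  unfolding source_def
proof (intro conjI allI impI)
  have [measurable]: "g \<in> borel_measurable borel" using assms by (rule L2_measurable)
  then show "g \<in> borel_measurable borel" .
  fix c :: real assume c: "c > 0"
  have "(\<integral>\<^sup>+x. (\<integral>\<^sup>+z. expker c (x - z) * ennreal (norm (g z)) \<partial>lborel)\<^sup>2 \<partial>lborel)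
      \<le> (\<integral>\<^sup>+x. expker c (x::'a) \<partial>lborel)\<^sup>2 * (\<integral>\<^sup>+x. (ennreal (norm (g x)))\<^sup>2 \<partial>lborel)"
    by (rule nn_young) auto
  also have "\<dots> < \<infinity>"
    using expker_integral[OF c, where 'a='a] L2_nn_finite[OF assms] by (simp add: ennreal_mult_less_top power2_eq_square)
  finally show "(\<integral>\<^sup>+x. (\<integral>\<^sup>+z. expker c (x - z) * ennreal (norm (g z)) \<partial>lborel)\<^sup>2 \<partial>lborel) < \<infinity>" .
qed (auto intro: lborel.sigma_finite_measure_axioms)

text \<open>Cauchy-Schwarz over the finite measure and Tonelli reduce the claim to the square
  integrability of \<open>expker\<close>, which is where the dimension comes in.\<close>

lemma source_finite:
  fixes g :: "'a::euclidean_space \<Rightarrow> complex"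
  assumes "finite_measure M" and sets [measurable_cong]: "sets M = sets borel"
    and [measurable]: "g \<in> borel_measurable borel" and B: "\<And>x. norm (g x) \<le> B" and dim: "DIM('a) < 4"
  shows "source M g"
  unfolding source_def
proof (intro conjI allI impI)
  interpret finite_measure M by fact
  show "sigma_finite_measure M" by (rule sigma_finite_measure_axioms)
  fix c :: real assume c: "c > 0"
  interpret pair_sigma_finite lborel M
    by (simp add: pair_sigma_finite_def sigma_finite_measure_axioms lborel.sigma_finite_measure_axioms)
  define I where "I = (\<integral>\<^sup>+x. (expker c (x::'a))\<^sup>2 \<partial>lborel)"
  define m where "m = (ennreal B)\<^sup>2 * emeasure M (space M)"
  have "(\<integral>\<^sup>+z. expker c (x - z) * ennreal (norm (g z)) \<partial>M)\<^sup>2 \<le> m * (\<integral>\<^sup>+z. (expker c (x - z))\<^sup>2 \<partial>M)" for x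
  proof -
    have "expker c (x - z) * ennreal (norm (g z)) \<le> ennreal B * expker c (x - z)" for z
      by (subst mult.commute) (intro mult_right_mono ennreal_leI B, simp)
    then have "(\<integral>\<^sup>+z. expker c (x - z) * ennreal (norm (g z)) \<partial>M)\<^sup>2 \<le> (\<integral>\<^sup>+z. ennreal B * expker c (x - z) \<partial>M)\<^sup>2"
      by (intro power_mono nn_integral_mono) auto
    also have "\<dots> = (ennreal B)\<^sup>2 * (\<integral>\<^sup>+z. 1 * expker c (x - z) \<partial>M)\<^sup>2"
      by (subst nn_integral_cmult) (auto simp: power_mult_distrib)
    also have "\<dots> \<le> (ennreal B)\<^sup>2 * ((\<integral>\<^sup>+z. 1 \<partial>M) * (\<integral>\<^sup>+z. 1 * (expker c (x - z))\<^sup>2 \<partial>M))"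
      by (intro mult_left_mono nn_weighted_cauchy_schwarz) auto
    finally show ?thesis by (simp add: m_def mult.assoc)
  qed
  then have "(\<integral>\<^sup>+x. (\<integral>\<^sup>+z. expker c (x - z) * ennreal (norm (g z)) \<partial>M)\<^sup>2 \<partial>lborel)
      \<le> (\<integral>\<^sup>+x. m * (\<integral>\<^sup>+z. (expker c (x - z))\<^sup>2 \<partial>M) \<partial>lborel)"
    by (intro nn_integral_mono)
  also have "\<dots> = m * (\<integral>\<^sup>+x. (\<integral>\<^sup>+z. (expker c (x - z))\<^sup>2 \<partial>M) \<partial>lborel)"
    by (rule nn_integral_cmult) measurable
  also have "(\<integral>\<^sup>+x. (\<integral>\<^sup>+z. (expker c (x - z))\<^sup>2 \<partial>M) \<partial>lborel) = (\<integral>\<^sup>+z. (\<integral>\<^sup>+x. (expker c (x - z))\<^sup>2 \<partial>lborel) \<partial>M)"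
    by (rule Fubini'[symmetric]) measurable
  also have "\<dots> = (\<integral>\<^sup>+z. I \<partial>M)"
    unfolding I_def by (intro nn_integral_cong nn_integral_translate) simp
  also have "\<dots> = I * emeasure M (space M)" by simp
  also have "m * (I * emeasure M (space M)) < \<infinity>"
  proof -
    have "emeasure M (space M) < \<infinity>" using emeasure_finite by (simp add: less_top[symmetric])
    moreover have "I < \<infinity>" unfolding I_def by (rule expker_square_integral[OF c dim])
    ultimately show ?thesis by (simp add: m_def ennreal_mult_less_top power2_eq_square)
  qed
  finally show "(\<integral>\<^sup>+x. (\<integral>\<^sup>+z. expker c (x - z) * ennreal (norm (g z)) \<partial>M)\<^sup>2 \<partial>lborel) < \<infinity>" .
qed (use sets in auto)

lemma norm_pot_le:
  fixes g :: "'a::euclidean_space \<Rightarrow> complex"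
  assumes S: "source M g" and \<sigma>: "wt \<sigma>"
    and C: "\<And>x::'a. ennreal \<bar>ker \<sigma> x\<bar> \<le> ennreal C * expker c x"
  shows "ennreal (norm (pot \<sigma> M g x)) \<le> ennreal C * (\<integral>\<^sup>+z. expker c (x - z) * ennreal (norm (g z)) \<partial>M)"
proof -
  have [measurable_cong]: "sets M = sets borel" and [measurable]: "g \<in> borel_measurable borel"
    "(ker \<sigma> :: 'a \<Rightarrow> real) \<in> borel_measurable borel"
    using S \<sigma> by (auto simp: source_def borel_measurable_ker)
  have "ennreal (norm (pot \<sigma> M g x)) \<le> (\<integral>\<^sup>+z. ennreal (norm (ker \<sigma> (x - z) *\<^sub>R g z)) \<partial>M)"
    by (cases "integrable M (\<lambda>z. ker \<sigma> (x - z) *\<^sub>R g z)")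
      (auto simp: pot_def not_integrable_integral_eq simp del: norm_scaleR intro: integral_norm_bound_ennreal)
  also have "\<dots> \<le> (\<integral>\<^sup>+z. ennreal C * (expker c (x - z) * ennreal (norm (g z))) \<partial>M)"
    unfolding mult.assoc[symmetric] norm_scaleR by (subst ennreal_mult) (auto intro!: nn_integral_mono mult_right_mono C)
  also have "\<dots> = ennreal C * (\<integral>\<^sup>+z. expker c (x - z) * ennreal (norm (g z)) \<partial>M)"
    by (rule nn_integral_cmult) measurable
  finally show ?thesis .
qed

lemma pot_L2:
  assumes S: "source M g" and \<sigma>: "wt \<sigma>"
  shows "pot \<sigma> M g \<in> L2"
proof -
  obtain C c where C: "c > 0" "\<And>x::'a. ennreal \<bar>ker \<sigma> x\<bar> \<le> ennreal C * expker c x"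
    using wt_bound[OF \<sigma>] by metis
  interpret sigma_finite_measure M using S by (simp add: source_def)
  have [measurable_cong]: "sets M = sets borel" and [measurable]: "g \<in> borel_measurable borel"
    "(ker \<sigma> :: 'a \<Rightarrow> real) \<in> borel_measurable borel"
    using S \<sigma> by (auto simp: source_def borel_measurable_ker)
  have [measurable]: "pot \<sigma> M g \<in> borel_measurable borel" unfolding pot_def by measurable
  have "(\<integral>\<^sup>+x. ennreal ((norm (pot \<sigma> M g x))\<^sup>2) \<partial>lborel)
      \<le> (\<integral>\<^sup>+x. (ennreal C)\<^sup>2 * (\<integral>\<^sup>+z. expker c (x - z) * ennreal (norm (g z)) \<partial>M)\<^sup>2 \<partial>lborel)"
  proof (rule nn_integral_mono)
    fix x :: 'a
    have "(ennreal (norm (pot \<sigma> M g x)))\<^sup>2 \<le> (ennreal C * (\<integral>\<^sup>+z. expker c (x - z) * ennreal (norm (g z)) \<partial>M))\<^sup>2"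
      by (rule power_mono[OF norm_pot_le[OF S \<sigma> C(2)]]) simp
    then show "ennreal ((norm (pot \<sigma> M g x))\<^sup>2) \<le> (ennreal C)\<^sup>2 * (\<integral>\<^sup>+z. expker c (x - z) * ennreal (norm (g z)) \<partial>M)\<^sup>2"
      by (simp add: ennreal_power power_mult_distrib)
  qed
  also have "\<dots> = (ennreal C)\<^sup>2 * (\<integral>\<^sup>+x. (\<integral>\<^sup>+z. expker c (x - z) * ennreal (norm (g z)) \<partial>M)\<^sup>2 \<partial>lborel)"
    by (rule nn_integral_cmult) measurable
  also have "\<dots> < \<infinity>" using S C(1) by (simp add: source_def ennreal_mult_less_top power2_eq_square)
  finally show ?thesis by (simp add: L2_iff)
qed

text \<open>Fubini moves the kernel from the source onto \<open>h\<close>. Kernels are even, so no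
  reflection appears, and continuity of the convolution makes its values meaningful on a singular
  measure.\<close>

lemma pot_pairing:
  assumes S: "source M g" and \<sigma>: "wt \<sigma>" and h: "h \<in> L2"
  shows "(LINT x|lborel. h x * pot \<sigma> M g x) = (LINT z|M. conv (ker \<sigma>) h z * g z)"
    and "integrable M (\<lambda>z. conv (ker \<sigma>) h z * g z)"
proof -
  obtain C c where C: "c > 0" "\<And>x::'a. ennreal \<bar>ker \<sigma> x\<bar> \<le> ennreal C * expker c x"
    using wt_bound[OF \<sigma>] by metis
  interpret sigma_finite_measure M using S by (simp add: source_def)
  have [measurable_cong]: "sets M = sets borel" and [measurable]: "g \<in> borel_measurable borel"
    "(ker \<sigma> :: 'a \<Rightarrow> real) \<in> borel_measurable borel" "h \<in> borel_measurable borel"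
    using S \<sigma> h by (auto simp: source_def borel_measurable_ker L2_measurable)
  have fin: "(\<integral>\<^sup>+x. (\<integral>\<^sup>+z. ennreal (norm (h x * (ker \<sigma> (x - z) *\<^sub>R g z))) \<partial>M) \<partial>lborel) < \<infinity>"
  proof -
    have "(\<integral>\<^sup>+x. (\<integral>\<^sup>+z. ennreal (norm (h x * (ker \<sigma> (x - z) *\<^sub>R g z))) \<partial>M) \<partial>lborel)
        \<le> (\<integral>\<^sup>+x. (\<integral>\<^sup>+z. (ennreal C * ennreal (norm (h x))) * (expker c (x - z) * ennreal (norm (g z))) \<partial>M) \<partial>lborel)"
    proof (intro nn_integral_mono)
      fix x z
      have "ennreal (norm (h x * (ker \<sigma> (x - z) *\<^sub>R g z))) = ennreal (norm (h x)) * (ennreal \<bar>ker \<sigma> (x - z)\<bar> * ennreal (norm (g z)))"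
        by (simp add: norm_mult ennreal_mult[symmetric] mult_ac)
      also have "\<dots> \<le> ennreal (norm (h x)) * ((ennreal C * expker c (x - z)) * ennreal (norm (g z)))"
        by (intro mult_left_mono mult_right_mono C) auto
      finally show "ennreal (norm (h x * (ker \<sigma> (x - z) *\<^sub>R g z))) \<le> (ennreal C * ennreal (norm (h x))) * (expker c (x - z) * ennreal (norm (g z)))"
        by (simp add: mult_ac)
    qed
    also have "\<dots> = ennreal C * (\<integral>\<^sup>+x. ennreal (norm (h x)) * (\<integral>\<^sup>+z. expker c (x - z) * ennreal (norm (g z)) \<partial>M) \<partial>lborel)"
      by (simp add: nn_integral_cmult mult.assoc)
    also have "\<dots> < \<infinity>"
    proof -
      have "(\<integral>\<^sup>+x. ennreal (norm (h x)) * (\<integral>\<^sup>+z. expker c (x - z) * ennreal (norm (g z)) \<partial>M) \<partial>lborel) < \<infinity>"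
        by (rule nn_cauchy_schwarz_finite) (use L2_nn_finite[OF h] S C(1) in \<open>auto simp: source_def\<close>)
      then show ?thesis by (simp add: ennreal_mult_less_top)
    qed
    finally show ?thesis .
  qed
  note F = fubini[OF lborel.sigma_finite_measure_axioms sigma_finite_measure_axioms _ fin]
  have 1: "(LINT z|M. h x * (ker \<sigma> (x - z) *\<^sub>R g z)) = h x * pot \<sigma> M g x" for x
    unfolding pot_def by (rule integral_mult_right_zero)
  have 2: "(LINT x|lborel. h x * (ker \<sigma> (x - z) *\<^sub>R g z)) = conv (ker \<sigma>) h z * g z" for z
  proof -
    have "(LINT x|lborel. h x * (ker \<sigma> (x - z) *\<^sub>R g z)) = (LINT x|lborel. (ker \<sigma> (z - x) *\<^sub>R h x) * g z)"
      by (simp add: ker_commute[of \<sigma> z])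
    then show ?thesis unfolding conv_def integral_mult_left_zero .
  qed
  have "(LINT x|lborel. (LINT z|M. h x * (ker \<sigma> (x - z) *\<^sub>R g z))) = (LINT z|M. (LINT x|lborel. h x * (ker \<sigma> (x - z) *\<^sub>R g z)))"
    by (rule F) measurable
  then show "(LINT x|lborel. h x * pot \<sigma> M g x) = (LINT z|M. conv (ker \<sigma>) h z * g z)"
    unfolding 1 2 .
  have "integrable M (\<lambda>z. LINT x|lborel. h x * (ker \<sigma> (x - z) *\<^sub>R g z))"
    by (rule F) measurable
  then show "integrable M (\<lambda>z. conv (ker \<sigma>) h z * g z)" unfolding 2 .
qed

section \<open>Integration by parts in the time variable\<close>

text \<open>Only one-sided limits at 0 are asked for, since the heat flow of an \<open>L2\<close>
  function is differentiable at positive times alone.\<close>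

lemma integral_FTC_Ioi:
  fixes F f :: "real \<Rightarrow> complex"
  assumes "\<And>t. t > 0 \<Longrightarrow> (F has_vector_derivative f t) (at t)" "\<And>t. t > 0 \<Longrightarrow> isCont f t"
    and "integrable lborel (\<lambda>t. indicator {0<..} t *\<^sub>R f t)"
    and A: "(F \<longlongrightarrow> A) (at_right 0)" and B: "(F \<longlongrightarrow> B) at_top"
  shows "(LINT t|lborel. indicator {0<..} t *\<^sub>R f t) = B - A"
proof -
  have [simp]: "einterval 0 \<infinity> = {0<..}" by (auto simp: einterval_def)
  have "(LBINT t=0..\<infinity>. f t) = B - A"
  proof (rule interval_integral_FTC_integrable)
    show "((F \<circ> real_of_ereal) \<longlongrightarrow> A) (at_right 0)"
      using A by (simp add: ereal_tendsto_simps zero_ereal_def)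
    show "((F \<circ> real_of_ereal) \<longlongrightarrow> B) (at_left \<infinity>)"
      using B by (simp add: ereal_tendsto_simps)
    show "set_integrable lborel (einterval 0 \<infinity>) f"
      using assms(3) by (simp add: set_integrable_def)
  qed (use assms(1,2) in \<open>auto simp: zero_ereal_def\<close>)
  then show ?thesis
    by (simp add: interval_lebesgue_integral_def set_lebesgue_integral_def)
qed

text \<open>Both sides are the derivative in \<open>r\<close> of the semigroup law
  \<open>conv_heat_heat\<close>.\<close>

lemma conv_heat_heat':
  assumes t: "t > 0" and r: "r > 0"
  shows "conv (heat t) (\<lambda>x. complex_of_real (heat' r (y - x))) z = complex_of_real (heat' (r + t) (y - z))"
proof -
  define f where "f x = complex_of_real (heat t (x - z))" for x
  have fL2: "f \<in> L2"
    unfolding f_def heat_commute[of t _ z] by (intro real_L2_reflect sch_real_L2 sch_heat t)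
  have 1: "((\<lambda>r. conv (heat r) f y) has_vector_derivative conv (heat' r) f y) (at r)"
    by (rule conv_heat_has_vector_derivative[OF fL2 r])
  have "((\<lambda>r. heat r (y - z)) has_real_derivative heat' (r + t) (y - z)) (at (r + t))"
    by (rule heat_has_real_derivative) (use r t in simp)
  then have "((\<lambda>r. heat (r + t) (y - z)) has_real_derivative heat' (r + t) (y - z)) (at r)"
    by (simp add: DERIV_shift)
  then have 2: "((\<lambda>r. complex_of_real (heat (r + t) (y - z))) has_vector_derivative complex_of_real (heat' (r + t) (y - z))) (at r)"
    by (intro has_vector_derivative_of_real) (simp add: has_real_derivative_iff_has_vector_derivative)
  have 3: "((\<lambda>r. conv (heat r) f y) has_vector_derivative complex_of_real (heat' (r + t) (y - z))) (at r)"
  proof (rule has_vector_derivative_transform_within_open[OF 2, of "{0<..}"])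
    show "complex_of_real (heat (q + t) (y - z)) = conv (heat q) f y" if "q \<in> {0<..}" for q
      unfolding f_def[abs_def] by (rule conv_heat_heat[symmetric]) (use that t in auto)
  qed (use r in auto)
  have "conv (heat' r) f y = complex_of_real (heat' (r + t) (y - z))"
    by (rule vector_derivative_unique_at[OF 1 3])
  then show ?thesis
    by (simp add: conv_def f_def scaleR_conv_of_real mult.commute heat_commute[of t z])
qed

text \<open>Integrate the time derivative of \<sigma> t times heat (r + t) w over positive times.
  The end at infinity vanishes by the decay of \<sigma>, the end at 0 leaves the term with \<sigma>
  0; positivity of \<open>r\<close> keeps the heat kernel smooth up to t = 0.\<close>

lemma conv_ker_heat':
  fixes y z :: "'a::euclidean_space"
  assumes \<sigma>: "wt \<sigma>" and \<sigma>': "wt \<sigma>'" and d: "\<And>t. t > 0 \<Longrightarrow> (\<sigma> has_real_derivative \<sigma>' t) (at t)"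
    and dim: "DIM('a) < 4" and r: "r > 0"
  shows "conv (ker \<sigma>) (\<lambda>x. complex_of_real (heat' r (y - x))) z
    = - complex_of_real (\<sigma> 0 * heat r (y - z)) - conv (ker \<sigma>') (\<lambda>x. complex_of_real (heat r (y - x))) z"
proof -
  have h': "(\<lambda>x. complex_of_real (heat' r (y - x))) \<in> L2" and h: "(\<lambda>x. complex_of_real (heat r (y - x))) \<in> L2"
    by (intro real_L2_reflect sch_real_L2 sch_heat sch_heat' r)+
  define w where "w = y - z"
  have conv_h: "conv (heat t) (\<lambda>x. complex_of_real (heat r (y - x))) z = complex_of_real (heat (r + t) w)" if "t > 0" for t
    using conv_heat_heat[OF that r, of y z] by (simp add: heat_commute[of r y] heat_commute[of _ y z] add.commute w_def)
  have a1: "\<sigma> t *\<^sub>R conv (heat t) (\<lambda>x. complex_of_real (heat' r (y - x))) z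
      = indicator {0<..} t *\<^sub>R complex_of_real (\<sigma> t * heat' (r + t) w)" for t
  proof (cases "t > 0")
    case True
    show ?thesis unfolding conv_heat_heat'[OF True r] using True by (simp add: w_def scaleR_conv_of_real)
  qed (simp add: conv_def)
  have a2: "\<sigma>' t *\<^sub>R conv (heat t) (\<lambda>x. complex_of_real (heat r (y - x))) z
      = indicator {0<..} t *\<^sub>R complex_of_real (\<sigma>' t * heat (r + t) w)" for t
    by (cases "t > 0") (auto simp: conv_h scaleR_conv_of_real, simp add: conv_def)
  define F where "F t = complex_of_real (\<sigma> t * heat (r + t) w)" for t
  define f where "f t = complex_of_real (\<sigma> t * heat' (r + t) w + \<sigma>' t * heat (r + t) w)" for t
  have i1: "integrable lborel (\<lambda>t. indicator {0<..} t *\<^sub>R complex_of_real (\<sigma> t * heat' (r + t) w))"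
    using conv_ker(2)[OF \<sigma> dim h', of z] unfolding a1 .
  have i2: "integrable lborel (\<lambda>t. indicator {0<..} t *\<^sub>R complex_of_real (\<sigma>' t * heat (r + t) w))"
    using conv_ker(2)[OF \<sigma>' dim h, of z] unfolding a2 .
  have hd: "((\<lambda>t. heat (r + t) w) has_real_derivative heat' (r + t) w) (at t)" if "t > - r" for t
  proof -
    have "((\<lambda>t. heat t w) has_real_derivative heat' (t + r) w) (at (t + r))"
      by (rule heat_has_real_derivative) (use that in simp)
    then have "((\<lambda>t. heat (t + r) w) has_real_derivative heat' (t + r) w) (at t)"
      by (simp only: DERIV_shift)
    then show ?thesis by (simp only: add.commute[of r])
  qed
  have hc: "isCont (\<lambda>t. heat (r + t) w) t" if "t > - r" for t
    using hd[OF that] by (rule DERIV_isCont)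
  have h'c: "isCont (\<lambda>t. heat' (r + t) w) t" if "t > 0" for t
    unfolding heat'_def using that r hc[of t] by (intro continuous_intros) auto
  have \<sigma>c: "isCont \<sigma> t" "isCont \<sigma>' t" for t
    using \<sigma> \<sigma>' by (auto simp: wt_def continuous_on_eq_continuous_at)
  have "(LINT t|lborel. indicator {0<..} t *\<^sub>R f t) = 0 - complex_of_real (\<sigma> 0 * heat r w)"
  proof (rule integral_FTC_Ioi)
    fix t :: real assume t: "t > 0"
    have "((\<lambda>t. \<sigma> t * heat (r + t) w) has_real_derivative \<sigma> t * heat' (r + t) w + \<sigma>' t * heat (r + t) w) (at t)"
      using d[OF t] hd[of t] t r by (auto intro!: derivative_eq_intros)
    then show "(F has_vector_derivative f t) (at t)"
      unfolding F_def f_def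
      by (intro has_vector_derivative_of_real) (simp add: has_real_derivative_iff_has_vector_derivative)
    show "isCont f t"
      unfolding f_def using t r by (intro continuous_intros \<sigma>c hc h'c) auto
  next
    show "integrable lborel (\<lambda>t. indicator {0<..} t *\<^sub>R f t)"
      using Bochner_Integration.integrable_add[OF i1 i2] by (simp add: f_def scaleR_add_right)
    have "isCont F 0"
      unfolding F_def using r by (intro continuous_intros \<sigma>c hc) auto
    then show "(F \<longlongrightarrow> complex_of_real (\<sigma> 0 * heat r w)) (at_right 0)"
      by (auto simp: F_def isCont_def filterlim_at_split)
    obtain C c where C: "c > 0" "C \<ge> 0" "\<And>t. t \<ge> 0 \<Longrightarrow> \<bar>\<sigma> t\<bar> \<le> C * exp (- (c * t))"
      using wt_bound[OF \<sigma>, where 'a='a] by metis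
    show "(F \<longlongrightarrow> 0) at_top"
    proof (rule Lim_null_comparison)
      have "(\<lambda>t. - (c * t)) = (\<lambda>t. (- c) * t)" by simp
      then have "filterlim (\<lambda>t. - (c * t)) at_bot at_top"
        using C(1) by (simp only:) (rule filterlim_tendsto_neg_mult_at_bot[OF tendsto_const _ filterlim_ident], simp)
      then have "((\<lambda>t. exp (- (c * t))) \<longlongrightarrow> 0) at_top"
        by (rule filterlim_compose[OF exp_at_bot])
      then show "((\<lambda>t. C * exp (- (c * t)) * heat r 0) \<longlongrightarrow> 0) at_top"
        by (auto intro!: tendsto_mult_left_zero tendsto_mult_right_zero)
      show "\<forall>\<^sub>F t in at_top. norm (F t) \<le> C * exp (- (c * t)) * heat r (0::'a)"
        using eventually_ge_at_top[of 0]
      proof eventually_elim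
        case (elim t)
        have "heat (r + t) w \<le> heat r (0::'a)"
        proof -
          have "(4 * pi * (r + t)) powr (- (real DIM('a) / 2)) \<le> (4 * pi * r) powr (- (real DIM('a) / 2))"
            using elim r by (intro powr_mono2') auto
          then have "heat (r + t) (0::'a) \<le> heat r (0::'a)" using r elim by (simp add: heat_def)
          then show ?thesis using heat_le[of "r + t" w] by linarith
        qed
        then show ?case
          using C(3)[OF elim] C(2) by (simp add: F_def abs_mult norm_mult mult_mono)
      qed
    qed
  qed
  also have "(LINT t|lborel. indicator {0<..} t *\<^sub>R f t)
      = (LINT t|lborel. indicator {0<..} t *\<^sub>R complex_of_real (\<sigma> t * heat' (r + t) w)) + (LINT t|lborel. indicator {0<..} t *\<^sub>R complex_of_real (\<sigma>' t * heat (r + t) w))"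
    using Bochner_Integration.integral_add[OF i1 i2] by (simp add: f_def scaleR_add_right)
  also have "\<dots> = conv (ker \<sigma>) (\<lambda>x. complex_of_real (heat' r (y - x))) z + conv (ker \<sigma>') (\<lambda>x. complex_of_real (heat r (y - x))) z"
    unfolding conv_ker(1)[OF \<sigma> dim h'] conv_ker(1)[OF \<sigma>' dim h] a1 a2 ..
  finally show ?thesis by (simp add: w_def algebra_simps)
qed

text \<open>The heat-smoothed form of the distributional identity: the Laplacian of
  \<open>ker \<sigma>\<close> is -\<sigma> 0 times the Dirac mass minus
  \<open>ker \<sigma>'\<close>. The integrability in \<open>i\<close> is required only if the Dirac
  term is present.\<close>

lemma conv_heat'_pot:
  fixes g :: "'a::euclidean_space \<Rightarrow> complex"
  assumes S: "source M g" and \<sigma>: "wt \<sigma>" and \<sigma>': "wt \<sigma>'"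
    and d: "\<And>t. t > 0 \<Longrightarrow> (\<sigma> has_real_derivative \<sigma>' t) (at t)"
    and dim: "DIM('a) < 4" and r: "r > 0"
    and i: "\<sigma> 0 \<noteq> 0 \<Longrightarrow> integrable M (\<lambda>z. heat r (y - z) *\<^sub>R g z)"
  shows "conv (heat' r) (pot \<sigma> M g) y
    = - (\<sigma> 0 *\<^sub>R (LINT z|M. heat r (y - z) *\<^sub>R g z)) - conv (heat r) (pot \<sigma>' M g) y"
proof -
  define h h' where "h x = complex_of_real (heat r (y - x))" and "h' x = complex_of_real (heat' r (y - x))" for x
  have L: "h' \<in> L2" "h \<in> L2"
    unfolding h_def h'_def by (intro real_L2_reflect sch_real_L2 sch_heat sch_heat' r)+
  have i': "integrable M (\<lambda>z. - (\<sigma> 0 *\<^sub>R (heat r (y - z) *\<^sub>R g z)))"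
    by (intro Bochner_Integration.integrable_minus integrable_scaleR_right i)
  have "conv (heat' r) (pot \<sigma> M g) y = (LINT x|lborel. h' x * pot \<sigma> M g x)"
    by (simp add: conv_def h'_def scaleR_conv_of_real)
  also have "\<dots> = (LINT z|M. conv (ker \<sigma>) h' z * g z)"
    by (rule pot_pairing(1)[OF S \<sigma> L(1)])
  also have "\<dots> = (LINT z|M. - (\<sigma> 0 *\<^sub>R (heat r (y - z) *\<^sub>R g z)) - conv (ker \<sigma>') h z * g z)"
  proof -
    have "conv (ker \<sigma>) h' z * g z = - (\<sigma> 0 *\<^sub>R (heat r (y - z) *\<^sub>R g z)) - conv (ker \<sigma>') h z * g z" for z
    proof -
      have e: "conv (ker \<sigma>) h' z = - complex_of_real (\<sigma> 0 * heat r (y - z)) - conv (ker \<sigma>') h z"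
        unfolding h'_def[abs_def] h_def[abs_def] by (rule conv_ker_heat'[OF \<sigma> \<sigma>' d dim r])
      show ?thesis unfolding e by (simp add: scaleR_conv_of_real algebra_simps)
    qed
    then show ?thesis by simp
  qed
  also have "\<dots> = (LINT z|M. - (\<sigma> 0 *\<^sub>R (heat r (y - z) *\<^sub>R g z))) - (LINT z|M. conv (ker \<sigma>') h z * g z)"
    by (rule Bochner_Integration.integral_diff[OF i' pot_pairing(2)[OF S \<sigma>' L(2)]])
  also have "(LINT z|M. conv (ker \<sigma>') h z * g z) = (LINT x|lborel. h x * pot \<sigma>' M g x)"
    by (rule pot_pairing(1)[OF S \<sigma>' L(2), symmetric])
  also have "\<dots> = conv (heat r) (pot \<sigma>' M g) y"
    by (simp add: conv_def h_def scaleR_conv_of_real)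
  finally show ?thesis
    unfolding Bochner_Integration.integral_minus integral_scaleR_right .
qed

text \<open>A weight vanishing at time 0 has no Dirac term, so the Laplacian of the potential is
  again a square-integrable potential even if the source is a singular measure.\<close>

lemma pot_H2:
  fixes g :: "'a::euclidean_space \<Rightarrow> complex"
  assumes S: "source M g" and \<sigma>: "wt \<sigma>" and \<sigma>': "wt \<sigma>'"
    and d: "\<And>t. t > 0 \<Longrightarrow> (\<sigma> has_real_derivative \<sigma>' t) (at t)"
    and dim: "DIM('a) < 4" and 0: "\<sigma> 0 = 0"
  shows "pot \<sigma> M g \<in> H2" "AE x in lborel. laplacian (pot \<sigma> M g) x = - pot \<sigma>' M g x"
proof -
  have eq: "conv (heat' r) (pot \<sigma> M g) y = conv (heat r) (\<lambda>x. - pot \<sigma>' M g x) y" if "r > 0" for r y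
    using conv_heat'_pot[OF S \<sigma> \<sigma>' d dim that] conv_scale_right[of "heat r" "-1" "pot \<sigma>' M g" y] 0 by simp
  show "pot \<sigma> M g \<in> H2" "AE x in lborel. laplacian (pot \<sigma> M g) x = - pot \<sigma>' M g x"
    using elliptic_regularity[OF pot_L2[OF S \<sigma>] L2_uminus[OF pot_L2[OF S \<sigma>']] eq] by auto
qed

section \<open>The Green function of \<open>-\<Delta> + 1\<close>\<close>

abbreviation exp_wt :: "real \<Rightarrow> real" where
  "exp_wt \<equiv> (\<lambda>t. exp (- t))"

lemma wt_exp: "wt exp_wt"
  unfolding wt_def by (auto intro!: continuous_intros exI[of _ 1])

lemma wt_uminus: "wt \<sigma> \<Longrightarrow> wt (\<lambda>t. - \<sigma> t)"
  unfolding wt_def by (auto intro!: continuous_intros)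

lemma ker_uminus: "ker (\<lambda>t. - \<sigma> t) = (\<lambda>x. - ker \<sigma> x)"
  by (rule ext) (simp add: ker_def)

text \<open>The weight exp (- t) has value 1 at 0 and is minus its own derivative, so the Dirac term
  returns \<open>f\<close> and the remaining term returns the potential itself.\<close>

lemma conv_ker_exp_H2:
  fixes f :: "'a::euclidean_space \<Rightarrow> complex"
  assumes f: "f \<in> L2" and dim: "DIM('a) < 4"
  shows "conv (ker exp_wt) f \<in> H2"
    and "AE x in lborel. laplacian (conv (ker exp_wt) f) x = conv (ker exp_wt) f x - f x"
proof -
  let ?u = "conv (ker exp_wt) f"
  have u: "?u \<in> L2" using pot_L2[OF source_lborel[OF f] wt_exp] by (simp add: pot_lborel)
  have eq: "conv (heat' r) ?u y = conv (heat r) (\<lambda>x. ?u x - f x) y" if r: "r > 0" for r y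
  proof -
    have rl: "real_L2 (heat r :: 'a \<Rightarrow> real)" by (intro sch_real_L2 sch_heat r)
    have "conv (heat' r) (pot exp_wt lborel f) y = - (1 *\<^sub>R (LINT z|lborel. heat r (y - z) *\<^sub>R f z)) - conv (heat r) (pot (\<lambda>t. - exp (- t)) lborel f) y"
    proof -
      have "(exp_wt has_real_derivative - exp (- t)) (at t)" for t
        by (auto intro!: derivative_eq_intros)
      then show ?thesis
        using conv_heat'_pot[OF source_lborel[OF f] wt_exp wt_uminus[OF wt_exp] _ dim r, of y]
          conv_integrable[OF rl f] by simp
    qed
    also have "pot (\<lambda>t. - exp (- t)) lborel f = (\<lambda>x. (- 1) * ?u x)"
      unfolding pot_lborel ker_uminus by (simp add: conv_def fun_eq_iff)
    finally show ?thesis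
      unfolding pot_lborel conv_scale_right conv_diff_right[OF rl u f] by (simp add: conv_def[of "heat r" f])
  qed
  show "?u \<in> H2" "AE x in lborel. laplacian ?u x = ?u x - f x"
    using elliptic_regularity[OF u L2_diff[OF u f] eq] by auto
qed

text \<open>Pairing with \<open>d\<close> equates the squared norm of the gradient with minus the
  squared norm of \<open>d\<close>.\<close>

lemma H2_laplacian_eq_self_imp_0:
  assumes d: "d \<in> H2" and ae: "AE x in lborel. laplacian d x = d x"
  shows "AE x in lborel. d x = 0"
proof -
  have "l2_inner (laplacian d) d = l2_inner d d"
    by (rule l2_inner_cong_AE) (use ae laplacian_L2[OF d] H2_L2[OF d] in \<open>auto simp: L2_measurable\<close>)
  then have "(\<Sum>i\<in>Basis. complex_of_real ((l2_norm (weak_deriv i d))\<^sup>2)) = - complex_of_real ((l2_norm d)\<^sup>2)"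
    using H2_gradient_inner[OF d d] by (simp only: l2_inner_self)
  then have "complex_of_real (\<Sum>i\<in>Basis. (l2_norm (weak_deriv i d))\<^sup>2) = complex_of_real (- (l2_norm d)\<^sup>2)"
    unfolding of_real_sum of_real_minus .
  then have "(\<Sum>i\<in>Basis. (l2_norm (weak_deriv i d))\<^sup>2) = - (l2_norm d)\<^sup>2"
    by (simp only: of_real_eq_iff)
  moreover have "0 \<le> (\<Sum>i\<in>Basis. (l2_norm (weak_deriv i d))\<^sup>2)" by (intro sum_nonneg) auto
  ultimately have "l2_norm d = 0" by (simp add: zero_le_power2 order_antisym)
  then show ?thesis using l2_norm_eq_0_iff[OF H2_L2[OF d]] by simp
qed

lemma H2_eq_conv_ker:
  fixes h :: "'a::euclidean_space \<Rightarrow> complex"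
  assumes h: "h \<in> H2" and dim: "DIM('a) < 4" and f: "f \<in> L2" and ae: "AE x in lborel. h x - laplacian h x = f x"
  shows "AE x in lborel. conv (ker exp_wt) f x = h x"
proof -
  let ?u = "conv (ker exp_wt) f"
  note u = conv_ker_exp_H2[OF f dim]
  have "AE x in lborel. h x - ?u x = 0"
  proof (rule H2_laplacian_eq_self_imp_0[OF H2_diff(1)[OF h u(1)]])
    show "AE x in lborel. laplacian (\<lambda>x. h x - ?u x) x = h x - ?u x"
      using H2_diff(2)[OF h u(1)] u(2) ae by eventually_elim (simp add: algebra_simps)
  qed
  then show ?thesis by auto
qed

section \<open>Continuous representatives of \<open>H2\<close> functions\<close>

lemma continuous_eq_AE_imp_eq:
  fixes f g :: "'a::euclidean_space \<Rightarrow> 'b::real_normed_vector"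
  assumes "continuous_on UNIV f" "continuous_on UNIV g" "AE x in lborel. f x = g x"
  shows "f = g"
proof (rule ccontr)
  assume "f \<noteq> g"
  then have ne: "{x. f x \<noteq> g x} \<noteq> {}" by auto
  have op: "open {x. f x \<noteq> g x}"
    using assms by (intro open_Collect_neq) auto
  have "AE x in lebesgue. f x = g x"
    using assms(3) by (simp add: AE_completion_iff)
  then have "negligible {x. f x \<noteq> g x}"
    by (auto simp: eventually_ae_filter_negligible intro: negligible_subset)
  then show False using open_not_negligible[OF op ne] by simp
qed

lemma cont_rep_eqI:
  fixes h :: "'a::euclidean_space \<Rightarrow> complex"
  assumes "continuous_on UNIV u" "AE x in lborel. u x = h x"
  shows "cont_rep h = u"
  unfolding cont_rep_def
proof (rule the_equality)
  fix v assume v: "continuous_on UNIV v \<and> (AE x in lborel. v x = h x)"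
  have "AE x in lborel. v x = u x" using conjunct2[OF v] assms(2) by eventually_elim simp
  then show "v = u" using v assms(1) by (intro continuous_eq_AE_imp_eq) auto
qed (use assms in auto)

text \<open>The Sobolev embedding for dimension below 4: h is the convolution of the
  square-integrable kernel of (-\<Delta> + 1)^(-1) with h - \<Delta> h, and such a convolution is
  bounded and continuous.\<close>

lemma cont_rep_H2:
  fixes h :: "'a::euclidean_space \<Rightarrow> complex"
  assumes h: "h \<in> H2" and dim: "DIM('a) < 4"
  shows cont_rep_eq_conv: "cont_rep h = conv (ker exp_wt) (\<lambda>x. h x - laplacian h x)"
    and continuous_cont_rep: "continuous_on UNIV (cont_rep h)"
    and cont_rep_AE: "AE x in lborel. cont_rep h x = h x"
    and bounded_cont_rep: "\<exists>B. \<forall>x. norm (cont_rep h x) \<le> B"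
proof -
  have f: "(\<lambda>x. h x - laplacian h x) \<in> L2" by (intro L2_diff H2_L2 laplacian_L2 h)
  have c: "continuous_on UNIV (conv (ker exp_wt) (\<lambda>x. h x - laplacian h x))"
    by (rule continuous_conv[OF ker_real_L2[OF wt_exp dim] f])
  have a: "AE x in lborel. conv (ker exp_wt) (\<lambda>x. h x - laplacian h x) x = h x"
    by (rule H2_eq_conv_ker[OF h dim f]) simp
  show eq: "cont_rep h = conv (ker exp_wt) (\<lambda>x. h x - laplacian h x)" by (rule cont_rep_eqI[OF c a])
  show "continuous_on UNIV (cont_rep h)" unfolding eq by (rule c)
  show "AE x in lborel. cont_rep h x = h x" unfolding eq by (rule a)
  show "\<exists>B. \<forall>x. norm (cont_rep h x) \<le> B"
    unfolding eq using conv_bound[OF ker_real_L2[OF wt_exp dim] f] by blast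
qed

lemma cont_rep_diff:
  fixes f h :: "'a::euclidean_space \<Rightarrow> complex"
  assumes "f \<in> H2" "h \<in> H2" "DIM('a) < 4"
  shows "cont_rep (\<lambda>x. f x - h x) = (\<lambda>x. cont_rep f x - cont_rep h x)"
proof (rule cont_rep_eqI)
  show "continuous_on UNIV (\<lambda>x. cont_rep f x - cont_rep h x)"
    using assms by (intro continuous_intros continuous_cont_rep)
  show "AE x in lborel. cont_rep f x - cont_rep h x = f x - h x"
    using cont_rep_AE[OF assms(1,3)] cont_rep_AE[OF assms(2,3)] by eventually_elim simp
qed

text \<open>Supplies the boundary value at time 0 in \<open>reproducing_pointwise\<close>; at a
  single point only the continuous representative can be the limit.\<close>

lemma conv_heat_tendsto_cont_rep:
  fixes h :: "'a::euclidean_space \<Rightarrow> complex"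
  assumes h: "h \<in> H2" and dim: "DIM('a) < 4"
  shows "((\<lambda>t. conv (heat t) h y) \<longlongrightarrow> cont_rep h y) (at_right 0)"
  unfolding tendsto_at_iff_sequentially
proof (intro allI impI)
  fix X :: "nat \<Rightarrow> real" assume X: "\<forall>i. X i \<in> {0<..} - {0}" "X \<longlonglongrightarrow> 0"
  obtain B where B: "\<And>x. norm (cont_rep h x) \<le> B" using bounded_cont_rep[OF h dim] by blast
  have "conv (heat (X n)) h y = conv (heat (X n)) (cont_rep h) y" for n
    by (rule conv_cong_AE)
      (use cont_rep_AE[OF h dim] continuous_cont_rep[OF h dim] H2_L2[OF h]
        in \<open>auto simp: L2_measurable intro: borel_measurable_continuous_onI\<close>)
  moreover have "(\<lambda>n. conv (heat (X n)) (cont_rep h) y) \<longlonglongrightarrow> cont_rep h y"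
    by (rule conv_heat_tendsto_bounded[OF continuous_cont_rep[OF h dim] B]) (use X in auto)
  ultimately show "((\<lambda>t. conv (heat t) h y) \<circ> X) \<longlonglongrightarrow> cont_rep h y"
    by (simp add: o_def)
qed

lemma ker_nonneg: "(\<And>t. 0 \<le> \<sigma> t) \<Longrightarrow> 0 \<le> ker \<sigma> x"
  by (simp add: ker_def)

lemma integrable_exp_powr:
  assumes "a > -1" "c > 0"
  shows "integrable lborel (\<lambda>t::real. indicator {0<..} t * (t powr a * exp (- (c * t))))"
  using nn_integral_powr_exp_finite[OF assms]
  by (subst integrable_iff_bounded) (auto simp: abs_mult)

text \<open>Away from the origin the Gaussian factor beats the singularity of the heat kernel at
  small times, which gives one integrable majorant for all points near \<open>x\<close>.\<close>

lemma continuous_ker_exp: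
  assumes dim: "DIM('a::euclidean_space) < 4"
  shows "continuous_on (- {0::'a}) (ker exp_wt)"
proof (rule continuous_on_sequentiallyI)
  fix s and x :: 'a assume s: "\<forall>n. s n \<in> - {0}" "x \<in> - {0}" "s \<longlonglongrightarrow> x"
  define \<rho> where "\<rho> = norm x / 2"
  have \<rho>: "\<rho> > 0" using s by (simp add: \<rho>_def)
  define p where "p = real DIM('a) / 2"
  \<comment> \<open>From exp (- u) <= 2 / u^2 with u = \<rho>^2 / (4 t): the gained factor t^2
    outweighs t powr (- p) because p < 2.\<close>
  define K where "K = (4 * pi) powr (- p) * (2 * (4 / \<rho>\<^sup>2)\<^sup>2)"
  have bound: "exp (- t) * heat t z \<le> K * (indicator {0<..} t * (t powr (2 - p) * exp (- (1 * t))))" if z: "norm z \<ge> \<rho>" for t and z :: 'a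
  proof (cases "t > 0")
    case t: True
    define u where "u = \<rho>\<^sup>2 / (4 * t)"
    have u: "u > 0" using t \<rho> by (simp add: u_def)
    have "\<rho>\<^sup>2 \<le> z \<bullet> z" using z \<rho> by (simp add: dot_square_norm power_mono)
    then have "u \<le> (1 / (4 * t)) * (z \<bullet> z)" using t by (simp add: u_def divide_right_mono)
    then have "exp (- (1 / (4 * t)) * (z \<bullet> z)) \<le> exp (- u)" by simp
    also have "\<dots> \<le> 2 / u\<^sup>2"
    proof -
      have "u\<^sup>2 \<le> 2 * exp u" using exp_lower_Taylor_quadratic[of u] u by simp
      then show ?thesis using u by (simp add: exp_minus field_simps)
    qed
    also have "2 / u\<^sup>2 = 2 * (4 / \<rho>\<^sup>2)\<^sup>2 * t powr 2"
      using t \<rho> by (simp add: u_def power_divide power_mult_distrib field_simps)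
    finally have e: "exp (- (1 / (4 * t)) * (z \<bullet> z)) \<le> 2 * (4 / \<rho>\<^sup>2)\<^sup>2 * t powr 2" .
    have "heat t z = (4 * pi) powr (- p) * t powr (- p) * exp (- (1 / (4 * t)) * (z \<bullet> z))"
      using t unfolding heat_def p_def[symmetric] by (simp add: powr_mult[symmetric])
    also have "\<dots> \<le> (4 * pi) powr (- p) * t powr (- p) * (2 * (4 / \<rho>\<^sup>2)\<^sup>2 * t powr 2)"
      by (intro mult_left_mono e) auto
    also have "\<dots> = K * (t powr (- p) * t powr 2)" by (simp only: K_def mult_ac)
    also have "t powr (- p) * t powr 2 = t powr (2 - p)"
      by (simp only: powr_add[symmetric]) simp
    finally show ?thesis using t by (simp add: mult_ac)
  qed simp
  have "\<forall>\<^sub>F n in sequentially. dist (s n) x < \<rho>" using s(3) \<rho> by (rule tendstoD)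
  then obtain n0 where n0: "\<And>n. n \<ge> n0 \<Longrightarrow> dist (s n) x < \<rho>" by (auto simp: eventually_sequentially)
  have far: "norm (s n) \<ge> \<rho>" if "n \<ge> n0" for n
    using n0[OF that] norm_triangle_ineq2[of x "s n"] by (simp add: \<rho>_def dist_norm norm_minus_commute)
  have "(\<lambda>n. ker exp_wt (s (n + n0))) \<longlonglongrightarrow> ker exp_wt x"
    unfolding ker_def
  proof (rule integral_dominated_convergence[where w = "\<lambda>t. K * (indicator {0<..} t * (t powr (2 - p) * exp (- (1 * t))))"])
    show "integrable lborel (\<lambda>t. K * (indicator {0<..} t * (t powr (2 - p) * exp (- (1 * t)))))"
      by (intro integrable_mult_right integrable_exp_powr) (use dim in \<open>auto simp: p_def\<close>)
    show "AE t in lborel. (\<lambda>n. exp (- t) * heat t (s (n + n0))) \<longlonglongrightarrow> exp (- t) * heat t x"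
    proof (rule AE_I2)
      fix t :: real
      have "(\<lambda>n. s (n + n0)) \<longlonglongrightarrow> x" by (rule LIMSEQ_ignore_initial_segment[OF s(3)])
      then show "(\<lambda>n. exp (- t) * heat t (s (n + n0))) \<longlonglongrightarrow> exp (- t) * heat t x"
        by (cases "t > 0") (auto intro!: tendsto_intros continuous_on_tendsto_compose[OF sch_continuous[OF sch_heat]])
    qed
    show "AE t in lborel. norm (exp (- t) * heat t (s (n + n0))) \<le> K * (indicator {0<..} t * (t powr (2 - p) * exp (- (1 * t))))" for n
      using bound[OF far[of "n + n0"]] by (intro AE_I2) simp
  qed auto
  then show "(\<lambda>n. ker exp_wt (s n)) \<longlonglongrightarrow> ker exp_wt x" by (rule LIMSEQ_offset)
qed

lemma is_green_01_ker:
  assumes dim: "DIM('a::euclidean_space) < 4"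
  shows "is_green_01 (ker exp_wt :: 'a \<Rightarrow> real)"
  unfolding is_green_01_def Let_def conv_def[symmetric]
proof (intro conjI allI ballI)
  show "continuous_on (- {0::'a}) (ker exp_wt)" by (rule continuous_ker_exp[OF dim])
  show "0 \<le> ker exp_wt x" for x :: 'a by (rule ker_nonneg) simp
  fix f :: "'a \<Rightarrow> complex" assume f: "f \<in> L2"
  show "AE x in lborel. integrable lborel (\<lambda>y. ker exp_wt (x - y) *\<^sub>R f y)"
    by (intro AE_I2 conv_integrable[OF ker_real_L2[OF wt_exp dim] f])
  have "(\<lambda>x. conv (ker exp_wt) f x) = conv (ker exp_wt) f" by simp
  then show "(\<lambda>x. conv (ker exp_wt) f x) \<in> H2" using conv_ker_exp_H2(1)[OF f dim] by simp
  show "AE x in lborel. - laplacian (\<lambda>x. conv (ker exp_wt) f x) x + conv (ker exp_wt) f x = f x"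
    using conv_ker_exp_H2(2)[OF f dim] by eventually_elim simp
qed

section \<open>Uniqueness of the Green function off the origin\<close>

text \<open>Any two candidates produce the same solution operator. If \<open>G\<close> exceeded
  \<open>G'\<close> by a fixed amount near \<open>x0\<close>, applying both to the indicator of a
  small ball around 0 would give different values at all points near \<open>x0\<close>, a set of
  positive measure.\<close>

lemma is_green_01_unique_le:
  fixes G G' :: "'a::euclidean_space \<Rightarrow> real"
  assumes G: "is_green_01 G" and G': "is_green_01 G'" and dim: "DIM('a) < 4" and x0: "x0 \<noteq> 0"
  shows "G x0 \<le> G' x0"
proof (rule ccontr)
  assume "\<not> G x0 \<le> G' x0"
  then have lt: "G' x0 < G x0" by simp
  define \<delta> where "\<delta> = (G x0 - G' x0) / 2"
  have \<delta>: "\<delta> > 0" using lt by (simp add: \<delta>_def)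
  have "continuous_on (- {0}) (\<lambda>x. G x - G' x)"
    using G G' by (intro continuous_intros) (auto simp: is_green_01_def)
  then have "isCont (\<lambda>x. G x - G' x) x0"
    using x0 by (subst (asm) continuous_on_eq_continuous_at) (auto simp: open_Compl)
  then obtain r where r: "r > 0" "\<And>x. dist x x0 < r \<Longrightarrow> dist (G x - G' x) (G x0 - G' x0) < \<delta>"
    unfolding continuous_at_eps_delta using \<delta> by (metis dist_commute)
  have gap: "G x - G' x \<ge> \<delta>" if "dist x x0 < r" for x
  proof -
    have "\<bar>(G x - G' x) - (G x0 - G' x0)\<bar> < \<delta>" using r(2)[OF that] by (simp add: dist_real_def)
    moreover have "G x0 - G' x0 = 2 * \<delta>" by (simp add: \<delta>_def)
    ultimately show ?thesis by linarith
  qed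
  \<comment> \<open>Radius r / 2 here and for \<open>x\<close> below, so that x - y stays within
    distance r of \<open>x0\<close>.\<close>
  define B where "B = ball (0::'a) (r / 2)"
  define f where "f = (\<lambda>y. complex_of_real (indicator B y))"
  have f: "f \<in> L2" unfolding f_def B_def by (rule L2_indicator_ball)
  have mu: "measure lborel B > 0" unfolding B_def using r(1) by (intro content_ball_pos) simp
  have sol: "AE x in lborel. integrable lborel (\<lambda>y. H (x - y) *\<^sub>R f y) \<and> (LINT y|lborel. H (x - y) *\<^sub>R f y) = conv (ker exp_wt) f x"
    if H: "is_green_01 H" for H
  proof -
    let ?u = "\<lambda>x. LINT y|lborel. H (x - y) *\<^sub>R f y"
    have u: "?u \<in> H2" "AE x in lborel. - laplacian ?u x + ?u x = f x"
      "AE x in lborel. integrable lborel (\<lambda>y. H (x - y) *\<^sub>R f y)"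
      using H f by (auto simp: is_green_01_def Let_def)
    have "AE x in lborel. conv (ker exp_wt) f x = ?u x"
      by (rule H2_eq_conv_ker[OF u(1) dim f]) (use u(2) in \<open>auto elim!: eventually_mono\<close>)
    with u(3) show ?thesis by eventually_elim auto
  qed
  have "AE x in lborel. \<not> dist x x0 < r / 2"
    using sol[OF G] sol[OF G']
  proof eventually_elim
    case (elim x)
    show ?case
    proof
      assume x: "dist x x0 < r / 2"
      have i: "integrable lborel (\<lambda>y. H (x - y) * indicator B y)" "complex_of_real (LINT y|lborel. H (x - y) * indicator B y) = conv (ker exp_wt) f x"
        if "integrable lborel (\<lambda>y. H (x - y) *\<^sub>R f y) \<and> (LINT y|lborel. H (x - y) *\<^sub>R f y) = conv (ker exp_wt) f x" for H
      proof -
        have e: "H (x - y) *\<^sub>R f y = complex_of_real (H (x - y) * indicator B y)" for y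
          by (simp add: f_def scaleR_conv_of_real)
        show "integrable lborel (\<lambda>y. H (x - y) * indicator B y)"
          using that unfolding e complex_of_real_integrable_eq by simp
        show "complex_of_real (LINT y|lborel. H (x - y) * indicator B y) = conv (ker exp_wt) f x"
          using that unfolding e integral_complex_of_real by simp
      qed
      have "complex_of_real (LINT y|lborel. G (x - y) * indicator B y) = complex_of_real (LINT y|lborel. G' (x - y) * indicator B y)"
        using i(2)[OF elim(1)] i(2)[OF elim(2)] by simp
      then have eq: "(LINT y|lborel. G (x - y) * indicator B y) = (LINT y|lborel. G' (x - y) * indicator B y)"
        by (simp only: of_real_eq_iff)
      note gi = i(1)[OF elim(1)] i(1)[OF elim(2)]
      have iB: "integrable lborel (indicator B :: 'a \<Rightarrow> real)"
        unfolding B_def by (intro integrable_real_indicator emeasure_lborel_ball_finite) auto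
      have "(LINT y|lborel. \<delta> * indicator B y) \<le> (LINT y|lborel. G (x - y) * indicator B y - G' (x - y) * indicator B y)"
      proof (rule integral_mono[OF integrable_mult_right[OF iB] Bochner_Integration.integrable_diff[OF gi]])
        fix y
        show "\<delta> * indicator B y \<le> G (x - y) * indicator B y - G' (x - y) * indicator B y"
        proof (cases "y \<in> B")
          case True
          have "dist (x - y) x0 \<le> dist x x0 + norm y" 
            using norm_triangle_ineq4[of "x - x0" y] by (simp add: dist_norm algebra_simps)
          then have "dist (x - y) x0 < r" using True x by (simp add: B_def)
          then show ?thesis using gap[of "x - y"] True by simp
        qed simp
      qed
      also have "\<dots> = 0"
        using eq by (simp add: Bochner_Integration.integral_diff[OF gi])
      finally have "(LINT y|lborel. \<delta> * indicator B y) \<le> 0" .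
      moreover have "(LINT y|lborel. \<delta> * indicator B y) = \<delta> * measure lborel B" by (simp add: B_def)
      ultimately show False using mult_pos_pos[OF \<delta> mu] by linarith
    qed
  qed
  then have "AE x in lborel. x \<notin> ball x0 (r / 2)"
    by (simp add: dist_commute)
  then have "emeasure lborel (ball x0 (r / 2)) = 0"
    by (subst (asm) AE_iff_measurable[of "ball x0 (r / 2)"]) auto
  moreover have "measure lborel (ball x0 (r / 2)) > 0" using r(1) by (intro content_ball_pos) simp
  ultimately show False by (simp add: measure_def)
qed

lemma green_01_eq:
  fixes x :: "'a::euclidean_space"
  assumes dim: "DIM('a) < 4" and x: "x \<noteq> 0"
  shows "green_01 x = ker exp_wt x"
proof -
  have 1: "is_green_01 (green_01 :: 'a \<Rightarrow> real)"
    unfolding green_01_def by (rule someI[of is_green_01]) (rule is_green_01_ker[OF dim])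
  show ?thesis
    by (intro antisym is_green_01_unique_le 1 is_green_01_ker dim x)
qed

text \<open>The exceptional point is a = y, where \<open>green_01\<close> takes its unspecified
  value at the origin.\<close>

lemma green_01_AE:
  fixes y :: "'a::euclidean_space"
  assumes dim: "DIM('a) < 4"
  shows "AE a in lborel. green_01 (y - a) = ker exp_wt (y - a)"
  using AE_lborel_singleton[of y] by eventually_elim (rule green_01_eq[OF dim], simp)

lemma borel_measurable_green_01:
  assumes dim: "DIM('a::euclidean_space) < 4"
  shows "(green_01 :: 'a \<Rightarrow> real) \<in> borel_measurable borel"
proof -
  have [measurable]: "(ker exp_wt :: 'a \<Rightarrow> real) \<in> borel_measurable borel" by (rule borel_measurable_ker[OF wt_exp])
  have "green_01 = (\<lambda>x::'a. if x = 0 then green_01 (0::'a) else ker exp_wt x)"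
    by (auto simp: fun_eq_iff green_01_eq[OF dim])
  also have "\<dots> \<in> borel_measurable borel" by measurable
  finally show ?thesis .
qed

section \<open>The resolvent kernel of \<open>-\<Delta> + \<epsilon>\<^sup>2\<Delta>\<^sup>2\<close>\<close>

lemma conv_cnj: "conv k (\<lambda>x. cnj (u x)) y = cnj (conv k u y)"
  unfolding conv_def by (subst Bochner_Integration.integral_cnj[symmetric]) simp

lemma H2_laplacian_symmetric:
  assumes f: "f \<in> H2" and h: "h \<in> H2"
  shows "l2_inner (laplacian f) h = l2_inner f (laplacian h)"
proof -
  have "- l2_inner (laplacian f) h = (\<Sum>i\<in>Basis. cnj (l2_inner (weak_deriv i h) (weak_deriv i f)))"
    unfolding H2_gradient_inner[OF f h, symmetric] by (intro sum.cong refl l2_inner_commute)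
  also have "\<dots> = cnj (- l2_inner (laplacian h) f)"
    unfolding H2_gradient_inner[OF h f, symmetric] by simp
  also have "\<dots> = - l2_inner f (laplacian h)"
    by (subst l2_inner_commute[of f]) simp
  finally show ?thesis by simp
qed

text \<open>The weight \<open>s\<close> is the inverse Laplace transform of \<open>\<lambda> \<mapsto> 1 / (\<epsilon>\<^sup>2 \<lambda>\<^sup>2 + \<lambda> + \<alpha>)\<close>. The lower bound on
  \<open>\<alpha>\<close> makes the roots of the denominator non-real.\<close>

locale green_params =
  fixes \<epsilon> \<alpha> :: real
  assumes eps: "0 < \<epsilon>" and alpha: "1 / (4 * \<epsilon>\<^sup>2) < \<alpha>"
begin

text \<open>The roots of \<epsilon>^2 \<lambda>^2 + \<lambda> + \<alpha> are -c + i \<omega> and -c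
  - i \<omega>, so \<open>s\<close> is a damped sine.\<close>

definition c :: real where "c = 1 / (2 * \<epsilon>\<^sup>2)"

definition \<omega> :: real where "\<omega> = sqrt (\<alpha> / \<epsilon>\<^sup>2 - c\<^sup>2)"

definition s :: "real \<Rightarrow> real" where
  "s t = exp (- (c * t)) * sin (\<omega> * t) / (\<epsilon>\<^sup>2 * \<omega>)"

definition s' :: "real \<Rightarrow> real" where
  "s' t = exp (- (c * t)) * (cos (\<omega> * t) - c / \<omega> * sin (\<omega> * t)) / \<epsilon>\<^sup>2"

lemma alpha_pos: "\<alpha> > 0"
  using alpha eps by (auto intro: less_trans[rotated])

lemma c_pos: "c > 0"
  using eps by (simp add: c_def)

lemma \<omega>_pos: "\<omega> > 0"
proof -
  have "c\<^sup>2 = (1 / (4 * \<epsilon>\<^sup>2)) / \<epsilon>\<^sup>2" by (simp add: c_def power2_eq_square)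
  also have "\<dots> < \<alpha> / \<epsilon>\<^sup>2" using alpha eps by (intro divide_strict_right_mono) auto
  finally show ?thesis by (simp add: \<omega>_def)
qed

lemma \<omega>_square: "c\<^sup>2 + \<omega>\<^sup>2 = \<alpha> / \<epsilon>\<^sup>2"
  using \<omega>_pos by (simp add: \<omega>_def)

lemma s_0 [simp]: "s 0 = 0" "s' 0 = 1 / \<epsilon>\<^sup>2"
  by (simp_all add: s_def s'_def)

lemma s_deriv: "(s has_real_derivative s' t) (at t)"
  unfolding s_def s'_def using eps \<omega>_pos
  by (auto intro!: derivative_eq_intros simp: field_simps)

lemma s'_deriv: "(s' has_real_derivative - (1 / \<epsilon>\<^sup>2) * s' t - (\<alpha> / \<epsilon>\<^sup>2) * s t) (at t)"
proof -
  define E S C where "E = exp (- (c * t))" and "S = sin (\<omega> * t)" and "C = cos (\<omega> * t)"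
  have e: "((\<lambda>t. exp (- (c * t))) has_real_derivative - c * E) (at t)"
    unfolding E_def by (auto intro!: derivative_eq_intros)
  have cs: "((\<lambda>t. cos (\<omega> * t) - c / \<omega> * sin (\<omega> * t)) has_real_derivative - \<omega> * S - c * C) (at t)"
    unfolding S_def C_def using \<omega>_pos by (auto intro!: derivative_eq_intros)
  have "(s' has_real_derivative ((- c * E) * (C - c / \<omega> * S) + (- \<omega> * S - c * C) * E) / \<epsilon>\<^sup>2) (at t)"
    using DERIV_cdivide[OF DERIV_mult[OF e cs], of "\<epsilon>\<^sup>2"]
    unfolding s'_def[abs_def] E_def S_def C_def by simp
  moreover have "((- c * E) * (C - c / \<omega> * S) + (- \<omega> * S - c * C) * E) / \<epsilon>\<^sup>2
      = - (1 / \<epsilon>\<^sup>2) * s' t - (\<alpha> / \<epsilon>\<^sup>2) * s t"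
  proof -
    have c2: "1 / \<epsilon>\<^sup>2 = 2 * c" by (simp add: c_def)
    \<comment> \<open>These names remove the division by \<omega>; what remains is polynomial and
      uses only 1 / \<epsilon>^2 = 2 c and c^2 + \<omega>^2 = \<alpha> / \<epsilon>^2.\<close>
    define T P R where "T = S / \<omega>" and "P = E * (C - c * T)" and "R = E * T"
    have S: "S = \<omega> * T" and cS: "c / \<omega> * S = c * T" using \<omega>_pos by (simp_all add: T_def)
    have 1: "s' t = P / \<epsilon>\<^sup>2" and 2: "s t = R / \<epsilon>\<^sup>2"
      unfolding P_def R_def cS[symmetric] by (simp_all add: T_def s_def s'_def E_def S_def C_def)
    have "(- c * E) * (C - c / \<omega> * S) + (- \<omega> * S - c * C) * E = - (2 * c) * P - (c\<^sup>2 + \<omega>\<^sup>2) * R"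
      unfolding cS P_def R_def by (simp add: S power2_eq_square algebra_simps)
    then show ?thesis
      unfolding 1 2 c2 \<omega>_square[symmetric] by (simp only: diff_divide_distrib times_divide_eq_right)
  qed
  ultimately show ?thesis by simp
qed

lemma wt_s: "wt s"
  unfolding wt_def
proof (intro conjI exI allI impI)
  show "continuous_on UNIV s"
    using s_deriv by (auto intro: continuous_at_imp_continuous_on DERIV_isCont)
  show "0 < c" by (rule c_pos)
  fix t :: real assume "0 \<le> t"
  have "\<bar>exp (- (c * t)) * sin (\<omega> * t)\<bar> \<le> exp (- (c * t))"
    by (simp add: abs_mult mult_left_le)
  then show "\<bar>s t\<bar> \<le> 1 / (\<epsilon>\<^sup>2 * \<omega>) * exp (- (c * t))"
    unfolding s_def abs_divide using eps \<omega>_pos by (simp add: divide_right_mono)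
qed

lemma wt_s': "wt s'"
  unfolding wt_def
proof (intro conjI exI allI impI)
  show "continuous_on UNIV s'"
    using s'_deriv by (auto intro: continuous_at_imp_continuous_on DERIV_isCont)
  show "0 < c" by (rule c_pos)
  fix t :: real assume "0 \<le> t"
  have "\<bar>cos (\<omega> * t) - c / \<omega> * sin (\<omega> * t)\<bar> \<le> \<bar>cos (\<omega> * t)\<bar> + \<bar>c / \<omega>\<bar> * \<bar>sin (\<omega> * t)\<bar>"
    by (metis abs_mult abs_triangle_ineq4)
  also have "\<dots> \<le> 1 + c / \<omega> * 1"
    using c_pos \<omega>_pos by (intro add_mono mult_mono) auto
  finally have le: "\<bar>cos (\<omega> * t) - c / \<omega> * sin (\<omega> * t)\<bar> \<le> 1 + c / \<omega> * 1" .
  have "\<bar>s' t\<bar> = exp (- (c * t)) * \<bar>cos (\<omega> * t) - c / \<omega> * sin (\<omega> * t)\<bar> / \<epsilon>\<^sup>2"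
    unfolding s'_def by (simp add: abs_mult)
  also have "\<dots> \<le> exp (- (c * t)) * (1 + c / \<omega> * 1) / \<epsilon>\<^sup>2"
    by (intro divide_right_mono mult_left_mono le) auto
  finally have "\<bar>s' t\<bar> \<le> exp (- (c * t)) * (1 + c / \<omega>) / \<epsilon>\<^sup>2" by simp
  then show "\<bar>s' t\<bar> \<le> (1 + c / \<omega>) / \<epsilon>\<^sup>2 * exp (- (c * t))" by (simp add: mult.commute)
qed

text \<open>Interpolates between the bounds y and 1 for the sine at nonnegative y; the negative
  power of \<omega> left over is what makes the kernel small for large \<alpha>.\<close>

lemma s_bound:
  assumes t: "t \<ge> 0"
  shows "\<bar>s t\<bar> \<le> \<omega> powr (- 1 / 4) / \<epsilon>\<^sup>2 * (t powr (3 / 4) * exp (- (c * t)))"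
proof -
  have sin_le: "\<bar>sin y\<bar> \<le> y powr (3 / 4)" if y: "y \<ge> 0" for y :: real
  proof (cases "y \<le> 1")
    case True
    have "\<bar>sin y\<bar> \<le> y" using abs_sin_x_le_abs_x[of y] y by simp
    also have "y = y powr 1" using y by simp
    also have "\<dots> \<le> y powr (3 / 4)"
      by (rule powr_mono') (use True y in auto)
    finally show ?thesis .
  next
    case False
    then have "1 \<le> y powr (3 / 4)" by (intro ge_one_powr_ge_zero) auto
    then show ?thesis using abs_sin_le_one[of y] by linarith
  qed
  have "\<omega> powr (3 / 4) / \<omega> = \<omega> powr (3 / 4 - 1)"
    using \<omega>_pos by (simp only: powr_diff) simp
  then have w: "\<omega> powr (3 / 4) / \<omega> = \<omega> powr (- 1 / 4)" by simp
  have "\<bar>s t\<bar> = exp (- (c * t)) * \<bar>sin (\<omega> * t)\<bar> / (\<epsilon>\<^sup>2 * \<omega>)"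
    unfolding s_def using \<omega>_pos by (simp add: abs_mult)
  also have "\<dots> \<le> exp (- (c * t)) * (\<omega> * t) powr (3 / 4) / (\<epsilon>\<^sup>2 * \<omega>)"
    using t \<omega>_pos eps by (intro divide_right_mono mult_left_mono sin_le) auto
  also have "(\<omega> * t) powr (3 / 4) = \<omega> powr (3 / 4) * t powr (3 / 4)" by (rule powr_mult)
  also have "exp (- (c * t)) * (\<omega> powr (3 / 4) * t powr (3 / 4)) / (\<epsilon>\<^sup>2 * \<omega>)
      = (\<omega> powr (3 / 4) / \<omega>) / \<epsilon>\<^sup>2 * (t powr (3 / 4) * exp (- (c * t)))" by (simp add: mult_ac)
  finally show ?thesis unfolding w .
qed

lemma heat_0_powr: "t > 0 \<Longrightarrow> heat t (0::'a::euclidean_space) = (4 * pi) powr (- (real DIM('a) / 2)) * t powr (- (real DIM('a) / 2))"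
  unfolding powr_mult[symmetric] by (simp add: heat_def)

text \<open>From \<open>\<bar>sin (\<omega> t)\<bar> \<le> (\<omega> t)\<^bsup>3/4\<^esup>\<close>; the exponent gives decay in \<open>\<omega>\<close> and integrability at \<open>0\<close> for \<open>d < 4\<close>.\<close>

definition kbound :: "'a::euclidean_space itself \<Rightarrow> real" where
  "kbound _ = 1 / \<epsilon>\<^sup>2 * (4 * pi) powr (- (real DIM('a) / 2)) *
     (LINT t|lborel. indicator {0<..} t * (t powr (3 / 4 - real DIM('a) / 2) * exp (- (c * t))))"

lemma s_heat_0:
  assumes dim: "DIM('a::euclidean_space) < 4"
  shows "integrable lborel (\<lambda>t. \<bar>s t\<bar> * heat t (0::'a))"
    and "(LINT t|lborel. \<bar>s t\<bar> * heat t (0::'a)) \<le> \<omega> powr (- 1 / 4) * kbound TYPE('a)"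
proof -
  define J where "J t = indicator {0<..} t * (t powr (3 / 4 - real DIM('a) / 2) * exp (- (c * t)))" for t :: real
  define A where "A = \<omega> powr (- 1 / 4) * (1 / \<epsilon>\<^sup>2 * (4 * pi) powr (- (real DIM('a) / 2)))"
  have J: "integrable lborel J"
    unfolding J_def by (rule integrable_exp_powr) (use dim c_pos in auto)
  have le: "\<bar>s t\<bar> * heat t (0::'a) \<le> A * J t" for t
  proof (cases "t > 0")
    case True
    have "\<bar>s t\<bar> * heat t (0::'a) \<le> (\<omega> powr (- 1 / 4) / \<epsilon>\<^sup>2 * (t powr (3 / 4) * exp (- (c * t)))) * heat t (0::'a)"
      using s_bound[of t] True by (intro mult_right_mono) auto
    also have "\<dots> = A * ((t powr (3 / 4) * t powr (- (real DIM('a) / 2))) * exp (- (c * t)))"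
      unfolding heat_0_powr[OF True] A_def by simp
    also have "t powr (3 / 4) * t powr (- (real DIM('a) / 2)) = t powr (3 / 4 - real DIM('a) / 2)"
      by (simp only: powr_add[symmetric]) simp
    finally show ?thesis using True by (simp add: J_def)
  qed (simp add: J_def)
  have [measurable]: "s \<in> borel_measurable borel" by (rule wt_measurable[OF wt_s])
  show i: "integrable lborel (\<lambda>t. \<bar>s t\<bar> * heat t (0::'a))"
    by (rule Bochner_Integration.integrable_bound[OF integrable_mult_right[OF J, of A]])
      (use le in \<open>auto intro: order_trans[OF _ abs_ge_self]\<close>)
  have "(LINT t|lborel. \<bar>s t\<bar> * heat t (0::'a)) \<le> (LINT t|lborel. A * J t)"
    by (intro integral_mono i integrable_mult_right J le)
  also have "\<dots> = \<omega> powr (- 1 / 4) * kbound TYPE('a)"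
    by (simp add: A_def kbound_def J_def)
  finally show "(LINT t|lborel. \<bar>s t\<bar> * heat t (0::'a)) \<le> \<omega> powr (- 1 / 4) * kbound TYPE('a)" .
qed

lemma abs_ker_s_le:
  fixes x :: "'a::euclidean_space"
  assumes dim: "DIM('a) < 4"
  shows "\<bar>ker s x\<bar> \<le> \<omega> powr (- 1 / 4) * kbound TYPE('a)"
proof -
  have "\<bar>ker s x\<bar> \<le> (LINT t|lborel. \<bar>s t * heat t x\<bar>)"
    unfolding ker_def by (rule integral_abs_bound)
  also have "\<dots> \<le> (LINT t|lborel. \<bar>s t\<bar> * heat t (0::'a))"
  proof (rule integral_mono_AE')
    show "AE t in lborel. \<bar>s t * heat t x\<bar> \<le> \<bar>s t\<bar> * heat t (0::'a)"
      by (intro AE_I2) (auto simp: abs_mult intro!: mult_left_mono heat_le)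
  qed (auto intro: s_heat_0 dim)
  finally show ?thesis using s_heat_0(2)[OF dim] by linarith
qed

lemma continuous_ker_s:
  assumes dim: "DIM('a::euclidean_space) < 4"
  shows "continuous_on UNIV (ker s :: 'a \<Rightarrow> real)"
proof (rule continuous_on_sequentiallyI)
  fix u and x :: 'a assume u: "u \<longlonglongrightarrow> x"
  have [measurable]: "s \<in> borel_measurable borel" by (rule wt_measurable[OF wt_s])
  show "(\<lambda>n. ker s (u n)) \<longlonglongrightarrow> ker s x"
    unfolding ker_def
  proof (rule integral_dominated_convergence[OF _ _ s_heat_0(1)[OF dim]])
    show "AE t in lborel. (\<lambda>n. s t * heat t (u n)) \<longlonglongrightarrow> s t * heat t x"
    proof (rule AE_I2)
      fix t :: real
      show "(\<lambda>n. s t * heat t (u n)) \<longlonglongrightarrow> s t * heat t x"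
        by (cases "t > 0") (auto intro!: tendsto_intros continuous_on_tendsto_compose[OF sch_continuous[OF sch_heat]] u)
    qed
    show "AE t in lborel. norm (s t * heat t (u n)) \<le> \<bar>s t\<bar> * heat t (0::'a)" for n
      by (intro AE_I2) (auto simp: abs_mult intro!: mult_left_mono heat_le)
  qed auto
qed

section \<open>Laplace transform of the weight and identification with the Fourier integral\<close>

lemma exp_neg_tendsto_0: "a > 0 \<Longrightarrow> ((\<lambda>t. exp (- (a * t))) \<longlongrightarrow> (0::real)) at_top"
proof -
  assume a: "a > 0"
  have "(\<lambda>t. - (a * t)) = (\<lambda>t. (- a) * t)" by simp
  then have "filterlim (\<lambda>t. - (a * t)) at_bot at_top"
    using a by (simp only:) (rule filterlim_tendsto_neg_mult_at_bot[OF tendsto_const _ filterlim_ident], simp)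
  then show ?thesis by (rule filterlim_compose[OF exp_at_bot])
qed

lemma wt_tendsto_0: "wt \<sigma> \<Longrightarrow> (\<sigma> \<longlongrightarrow> 0) at_top"
proof -
  assume "wt \<sigma>"
  then obtain C a where C: "0 < a" "\<And>t. t \<ge> 0 \<Longrightarrow> \<bar>\<sigma> t\<bar> \<le> C * exp (- (a * t))" by (auto simp: wt_def)
  show ?thesis
  proof (rule Lim_null_comparison)
    show "\<forall>\<^sub>F t in at_top. norm (\<sigma> t) \<le> C * exp (- (a * t))"
      using eventually_ge_at_top[of 0] by eventually_elim (simp add: C)
    show "((\<lambda>t. C * exp (- (a * t))) \<longlongrightarrow> 0) at_top"
      using tendsto_mult_right_zero[OF exp_neg_tendsto_0[OF C(1)]] by simp
  qed
qed

lemma laplace_transform_s: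
  assumes l: "l \<ge> 0"
  shows "(LINT t|lborel. indicator {0<..} t *\<^sub>R complex_of_real (s t * exp (- (l * t)))) = complex_of_real (1 / (\<epsilon>\<^sup>2 * l\<^sup>2 + l + \<alpha>))"
proof -
  define q where "q = \<epsilon>\<^sup>2 * l\<^sup>2 + l + \<alpha>"
  have q: "q > 0" using alpha_pos l by (simp add: q_def add_nonneg_pos)
  have sc: "isCont s t" for t using s_deriv by (rule DERIV_isCont)
  have int: "integrable lborel (\<lambda>t. indicator {0<..} t *\<^sub>R complex_of_real (s t * exp (- (l * t))))"
  proof (rule Bochner_Integration.integrable_bound)
    show "integrable lborel (\<lambda>t. \<omega> powr (- 1 / 4) / \<epsilon>\<^sup>2 * (indicator {0<..} t * (t powr (3 / 4) * exp (- (c * t)))))"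
      by (intro integrable_mult_right integrable_exp_powr) (use c_pos in auto)
    show "AE t in lborel. norm (indicator {0<..} t *\<^sub>R complex_of_real (s t * exp (- (l * t))))
        \<le> norm (\<omega> powr (- 1 / 4) / \<epsilon>\<^sup>2 * (indicator {0<..} t * (t powr (3 / 4) * exp (- (c * t)))))"
    proof (rule AE_I2)
      fix t :: real
      have "\<bar>s t\<bar> * exp (- (l * t)) \<le> (\<omega> powr (- 1 / 4) / \<epsilon>\<^sup>2 * (t powr (3 / 4) * exp (- (c * t)))) * 1" if "t > 0"
        using s_bound[of t] that l by (intro mult_mono) auto
      then show "norm (indicator {0<..} t *\<^sub>R complex_of_real (s t * exp (- (l * t))))
        \<le> norm (\<omega> powr (- 1 / 4) / \<epsilon>\<^sup>2 * (indicator {0<..} t * (t powr (3 / 4) * exp (- (c * t)))))"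
        by (cases "t > 0") (auto simp: norm_mult abs_mult)
    qed
    have [measurable]: "s \<in> borel_measurable borel" by (rule wt_measurable[OF wt_s])
    show "(\<lambda>t. indicator {0<..} t *\<^sub>R complex_of_real (s t * exp (- (l * t)))) \<in> borel_measurable lborel" by simp
  qed
  \<comment> \<open>An antiderivative of q s t exp (- l t), by the differential equation of
    \<open>s\<close>. Its value at 0 is -1 because \<epsilon>^2 s' 0 = 1 and s 0 = 0.\<close>
  define F where "F t = complex_of_real (- (\<epsilon>\<^sup>2 * s' t + (1 + \<epsilon>\<^sup>2 * l) * s t) * exp (- (l * t)))" for t
  define f where "f t = complex_of_real (q * (s t * exp (- (l * t))))" for t
  have "(LINT t|lborel. indicator {0<..} t *\<^sub>R f t) = 0 - (- 1)"
  proof (rule integral_FTC_Ioi)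
    fix t :: real
    define e where "e = exp (- (l * t))"
    have "((\<lambda>t. exp (- (l * t))) has_real_derivative - l * e) (at t)"
      unfolding e_def by (auto intro!: derivative_eq_intros)
    from DERIV_mult[OF DERIV_minus[OF DERIV_add[OF DERIV_cmult[OF s'_deriv, of "\<epsilon>\<^sup>2"] DERIV_cmult[OF s_deriv, of "1 + \<epsilon>\<^sup>2 * l"]]] this]
    have "((\<lambda>t. - (\<epsilon>\<^sup>2 * s' t + (1 + \<epsilon>\<^sup>2 * l) * s t) * exp (- (l * t))) has_real_derivative q * (s t * e)) (at t)"
      by (rule DERIV_cong) (use eps in \<open>simp add: e_def[symmetric] q_def field_simps power2_eq_square\<close>)
    then show "(F has_vector_derivative f t) (at t)"
      unfolding F_def f_def e_def
      by (intro has_vector_derivative_of_real) (simp add: has_real_derivative_iff_has_vector_derivative)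
    show "isCont f t" unfolding f_def by (intro continuous_intros sc)
  next
    show "integrable lborel (\<lambda>t. indicator {0<..} t *\<^sub>R f t)"
      using integrable_mult_right[OF int, of "complex_of_real q"] by (simp add: f_def)
    have "isCont s' 0" using s'_deriv by (rule DERIV_isCont)
    then have "isCont F 0" unfolding F_def by (intro continuous_intros sc)
    then show "(F \<longlongrightarrow> - 1) (at_right 0)"
      using eps by (auto simp: F_def isCont_def filterlim_at_split)
    have 1: "((\<lambda>t. - (\<epsilon>\<^sup>2 * s' t + (1 + \<epsilon>\<^sup>2 * l) * s t)) \<longlongrightarrow> - (\<epsilon>\<^sup>2 * 0 + (1 + \<epsilon>\<^sup>2 * l) * 0)) at_top"
      by (intro tendsto_intros wt_tendsto_0 wt_s wt_s')
    have "((\<lambda>t. - (\<epsilon>\<^sup>2 * s' t + (1 + \<epsilon>\<^sup>2 * l) * s t) * exp (- (l * t))) \<longlongrightarrow> 0) at_top"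
    proof (rule Lim_null_comparison)
      show "((\<lambda>t. \<bar>- (\<epsilon>\<^sup>2 * s' t + (1 + \<epsilon>\<^sup>2 * l) * s t)\<bar>) \<longlongrightarrow> 0) at_top"
        using tendsto_rabs[OF 1] by simp
      show "\<forall>\<^sub>F t in at_top. norm (- (\<epsilon>\<^sup>2 * s' t + (1 + \<epsilon>\<^sup>2 * l) * s t) * exp (- (l * t))) \<le> \<bar>- (\<epsilon>\<^sup>2 * s' t + (1 + \<epsilon>\<^sup>2 * l) * s t)\<bar>"
        using eventually_ge_at_top[of 0]
        by eventually_elim (use l in \<open>auto simp: abs_mult intro!: mult_left_le\<close>)
    qed
    from tendsto_of_real[OF this, where 'a = complex] show "(F \<longlongrightarrow> 0) at_top" unfolding F_def of_real_0 .
  qed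
  then have "complex_of_real q * (LINT t|lborel. indicator {0<..} t *\<^sub>R complex_of_real (s t * exp (- (l * t)))) = 1"
    by (simp add: f_def integral_mult_right_zero[symmetric] del: integral_mult_right_zero)
  then show ?thesis using q unfolding q_def[symmetric] by (simp add: field_simps)
qed

text \<open>Fubini in time and momentum: integrating over time first gives the Laplace transform of
  \<open>s\<close> at the square of norm p, integrating over momentum first gives a Gaussian Fourier
  integral, that is, the heat kernel. Absolute convergence is \<open>s_heat_0\<close>.\<close>

lemma green_eps_eq:
  fixes x :: "'a::euclidean_space"
  assumes dim: "DIM('a) < 4"
  shows "green_eps \<epsilon> \<alpha> x = complex_of_real (ker s x)"
proof -
  have [measurable]: "s \<in> borel_measurable borel" by (rule wt_measurable[OF wt_s])
  define d where "d = real DIM('a)"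
  define f where "f p t = (indicator {0<..} t * s t) *\<^sub>R (cis (p \<bullet> x) * complex_of_real (exp (- t * (p \<bullet> p))))" for p :: 'a and t :: real
  have [measurable]: "(\<lambda>p::'a. cis (p \<bullet> x)) \<in> borel_measurable borel" unfolding cis_conv_exp by measurable
  have cst: "(2 * pi) powr (- d) * (pi / t) powr (d / 2) = (4 * pi) powr (- (d / 2)) * t powr (- (d / 2))" if "t > 0" for t
  proof -
    have "(2 * pi) powr (- d) = (2 * pi) powr (2 * (- (d / 2)))" by simp
    also have "\<dots> = ((2 * pi) powr 2) powr (- (d / 2))" by (rule powr_powr[symmetric])
    also have "(2 * pi) powr 2 = (4 * pi) * pi" by (simp add: power2_eq_square)
    also have "((4 * pi) * pi) powr (- (d / 2)) = (4 * pi) powr (- (d / 2)) * pi powr (- (d / 2))" by (rule powr_mult)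
    finally have 1: "(2 * pi) powr (- d) = (4 * pi) powr (- (d / 2)) * pi powr (- (d / 2))" .
    have 2: "(pi / t) powr (d / 2) = pi powr (d / 2) * t powr (- (d / 2))"
      using that by (simp add: powr_divide powr_minus_divide)
    have 3: "pi powr (- (d / 2)) * pi powr (d / 2) = 1"
      by (simp only: powr_add[symmetric]) simp
    have "a * b * (b' * e) = a * e" if "b * b' = 1" for a b b' e :: real
      using that by algebra
    from this[OF 3] show ?thesis unfolding 1 2 .
  qed
  have cst': "(pi / t) powr (d / 2) = (2 * pi) powr d * heat t (0::'a)" if "t > 0" for t
  proof -
    have "(2 * pi) powr d * (2 * pi) powr (- d) = 1"
      by (simp only: powr_add[symmetric]) simp
    then show ?thesis
      unfolding heat_0_powr[OF that] d_def[symmetric] cst[OF that, symmetric] by (simp only: mult.assoc[symmetric] mult_1_left)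
  qed
  have fin: "(\<integral>\<^sup>+t. (\<integral>\<^sup>+p. ennreal (norm (f p t)) \<partial>lborel) \<partial>lborel) < \<infinity>"
  proof -
    have "(\<integral>\<^sup>+p. ennreal (norm (f p t)) \<partial>lborel) = ennreal ((2 * pi) powr d * (\<bar>s t\<bar> * heat t (0::'a)))" for t
    proof (cases "t > 0")
      case t: True
      have "(\<integral>\<^sup>+p. ennreal (norm (f p t)) \<partial>lborel) = (\<integral>\<^sup>+p. ennreal (\<bar>s t\<bar> * exp (- (t * (p \<bullet> p)))) \<partial>(lborel :: 'a measure))"
        using t by (simp add: f_def norm_mult)
      also have "\<dots> = ennreal (\<bar>s t\<bar> * (pi / t) powr (d / 2))"
        using gauss_integral[OF t, where 'a='a] by (subst nn_integral_eq_integral) (auto simp: d_def)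
      also have "(pi / t) powr (d / 2) = (2 * pi) powr d * heat t (0::'a)"
        by (rule cst'[OF t])
      finally show ?thesis by (simp add: mult_ac)
    qed (simp add: f_def)
    then have "(\<integral>\<^sup>+t. (\<integral>\<^sup>+p. ennreal (norm (f p t)) \<partial>lborel) \<partial>lborel) = (\<integral>\<^sup>+t. ennreal ((2 * pi) powr d * (\<bar>s t\<bar> * heat t (0::'a))) \<partial>lborel)"
      by simp
    also have "\<dots> = ennreal (LINT t|lborel. (2 * pi) powr d * (\<bar>s t\<bar> * heat t (0::'a)))"
      by (intro nn_integral_eq_integral integrable_mult_right s_heat_0(1)[OF dim] AE_I2) simp
    also have "\<dots> < \<infinity>" by simp
    finally show ?thesis .
  qed
  have 1: "(LINT t|lborel. f p t) = cis (p \<bullet> x) / complex_of_real (\<epsilon>\<^sup>2 * norm p ^ 4 + (norm p)\<^sup>2 + \<alpha>)" for p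
  proof -
    have "f p t = cis (p \<bullet> x) * (indicator {0<..} t *\<^sub>R complex_of_real (s t * exp (- ((p \<bullet> p) * t))))" for t
      by (simp add: f_def scaleR_conv_of_real mult_ac)
    then have "(LINT t|lborel. f p t) = cis (p \<bullet> x) * complex_of_real (1 / (\<epsilon>\<^sup>2 * (p \<bullet> p)\<^sup>2 + (p \<bullet> p) + \<alpha>))"
      by (simp only: integral_mult_right_zero laplace_transform_s inner_ge_zero)
    also have "\<epsilon>\<^sup>2 * (p \<bullet> p)\<^sup>2 + (p \<bullet> p) + \<alpha> = \<epsilon>\<^sup>2 * norm p ^ 4 + (norm p)\<^sup>2 + \<alpha>"
      by (simp add: dot_square_norm power_mult[symmetric])
    finally show ?thesis by simp
  qed
  have 2: "(LINT p|lborel. f p t) = complex_of_real ((2 * pi) powr d * (s t * heat t x))" for t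
  proof (cases "t > 0")
    case t: True
    have "(LINT p|lborel. f p t) = s t *\<^sub>R (LINT p|lborel. cis (p \<bullet> x) * complex_of_real (exp (- t * (p \<bullet> p))))"
      using t unfolding f_def by (subst integral_scaleR_right) simp
    also have "\<dots> = complex_of_real (s t * ((pi / t) powr (d / 2) * exp (- (x \<bullet> x) / (4 * t))))"
      unfolding gauss_fourier(2)[OF t] d_def by (simp add: scaleR_conv_of_real)
    also have "(pi / t) powr (d / 2) = (2 * pi) powr d * heat t (0::'a)"
      by (rule cst'[OF t])
    also have "(2 * pi) powr d * heat t (0::'a) * exp (- (x \<bullet> x) / (4 * t)) = (2 * pi) powr d * heat t x"
      using t by (simp add: heat_def)
    finally show ?thesis by (simp add: mult_ac)
  qed (simp add: f_def)
  have "(LINT t|lborel. (LINT p|lborel. f p t)) = (LINT p|lborel. (LINT t|lborel. f p t))"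
    by (rule fubini_eq[OF lborel.sigma_finite_measure_axioms lborel.sigma_finite_measure_axioms _ fin])
      (unfold f_def, measurable)
  then have A: "complex_of_real ((2 * pi) powr d * ker s x) = (LINT p|lborel. cis (p \<bullet> x) / complex_of_real (\<epsilon>\<^sup>2 * norm p ^ 4 + (norm p)\<^sup>2 + \<alpha>))"
    unfolding 1 2 ker_def integral_complex_of_real integral_mult_right_zero .
  have B: "1 / (2 * pi) ^ DIM('a) = 1 / (2 * pi) powr d"
    by (simp add: d_def powr_realpow)
  have "(1 / (2 * pi) powr d) * ((2 * pi) powr d * ker s x) = ker s x" by simp
  then show ?thesis
    unfolding green_eps_def B A[symmetric] of_real_mult[symmetric] by (rule arg_cong)
qed

text \<open>The kernel \<open>ker s\<close> inverts \<alpha> - \<Delta> + \<epsilon>^2 \<Delta>^2.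
  An \<open>H2\<close> function tolerates just one Laplacian, so in the fourth-order term the other
  one is carried by the weight, as \<open>s'\<close>.\<close>

lemma reproducing_pointwise:
  fixes h :: "'a::euclidean_space \<Rightarrow> complex"
  assumes h: "h \<in> H2" and dim: "DIM('a) < 4"
  shows "\<alpha> * conv (ker s) h y - conv (ker s) (laplacian h) y - \<epsilon>\<^sup>2 * conv (ker s') (laplacian h) y = cont_rep h y"
proof -
  define \<Phi> where "\<Phi> t = conv (heat t) h y" for t
  define \<Psi> where "\<Psi> t = conv (heat t) (laplacian h) y" for t
  note L = H2_L2[OF h] laplacian_L2[OF h]
  have \<Phi>d: "(\<Phi> has_vector_derivative \<Psi> t) (at t)" if "t > 0" for t
    using conv_heat_has_vector_derivative[OF L(1) that, of y] conv_heat_laplacian[OF h that, of y]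
    unfolding \<Phi>_def[abs_def] \<Psi>_def by simp
  have \<Phi>c: "isCont \<Phi> t" if "t > 0" for t
    using \<Phi>d[OF that] by (rule has_vector_derivative_continuous)
  have \<Psi>c: "isCont \<Psi> t" if "t > 0" for t
    using conv_heat_has_vector_derivative[OF L(2) that, of y] unfolding \<Psi>_def[abs_def]
    by (rule has_vector_derivative_continuous)
  have ind: "\<sigma> t *\<^sub>R conv (heat t) u y = indicator {0<..} t *\<^sub>R (\<sigma> t *\<^sub>R conv (heat t) u y)" for \<sigma> t u
    by (cases "t > 0") (auto simp: conv_def)
  have i1: "integrable lborel (\<lambda>t. indicator {0<..} t *\<^sub>R (s t *\<^sub>R \<Phi> t))"
    and i2: "integrable lborel (\<lambda>t. indicator {0<..} t *\<^sub>R (s t *\<^sub>R \<Psi> t))"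
    and i3: "integrable lborel (\<lambda>t. indicator {0<..} t *\<^sub>R (s' t *\<^sub>R \<Psi> t))"
    unfolding \<Phi>_def \<Psi>_def ind[symmetric] by (intro conv_ker(2) dim L wt_s wt_s')+
  have e1: "(LINT t|lborel. indicator {0<..} t *\<^sub>R (s t *\<^sub>R \<Phi> t)) = conv (ker s) h y"
    and e2: "(LINT t|lborel. indicator {0<..} t *\<^sub>R (s t *\<^sub>R \<Psi> t)) = conv (ker s) (laplacian h) y"
    and e3: "(LINT t|lborel. indicator {0<..} t *\<^sub>R (s' t *\<^sub>R \<Psi> t)) = conv (ker s') (laplacian h) y"
    unfolding \<Phi>_def \<Psi>_def ind[symmetric] by (intro conv_ker(1)[symmetric] dim L wt_s wt_s')+
  \<comment> \<open>Chosen so that w' = \<alpha> s and w 0 = -1. The derivative of w \<Phi> is then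
    exactly the integrand, and the boundary term at 0 is minus the continuous representative of
    \<open>h\<close>.\<close>
  define w where "w t = - (\<epsilon>\<^sup>2 * s' t + s t)" for t
  have wd: "(w has_real_derivative \<alpha> * s t) (at t)" for t
  proof -
    have "(w has_real_derivative - (\<epsilon>\<^sup>2 * (- (1 / \<epsilon>\<^sup>2) * s' t - (\<alpha> / \<epsilon>\<^sup>2) * s t) + s' t)) (at t)"
      unfolding w_def[abs_def] by (intro DERIV_minus DERIV_add DERIV_cmult s'_deriv s_deriv)
    then show ?thesis by (rule DERIV_cong) (use eps in \<open>simp add: field_simps\<close>)
  qed
  have wc: "isCont w t" and sc: "isCont s t" for t
    using wd s_deriv by (blast intro: DERIV_isCont)+
  define f where "f t = (\<alpha> * s t) *\<^sub>R \<Phi> t + w t *\<^sub>R \<Psi> t" for t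
  have feq: "indicator {0<..} t *\<^sub>R f t = complex_of_real \<alpha> * (indicator {0<..} t *\<^sub>R (s t *\<^sub>R \<Phi> t))
      - indicator {0<..} t *\<^sub>R (s t *\<^sub>R \<Psi> t) - complex_of_real (\<epsilon>\<^sup>2) * (indicator {0<..} t *\<^sub>R (s' t *\<^sub>R \<Psi> t))" for t
    by (simp add: f_def w_def scaleR_conv_of_real algebra_simps split: split_indicator)
  have fint: "integrable lborel (\<lambda>t. indicator {0<..} t *\<^sub>R f t)"
    unfolding feq by (intro Bochner_Integration.integrable_diff integrable_mult_right i1 i2 i3)
  have "(LINT t|lborel. indicator {0<..} t *\<^sub>R f t) = 0 - (- cont_rep h y)"
  proof (rule integral_FTC_Ioi[OF _ _ fint])
    fix t :: real assume t: "t > 0"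
    have "((\<lambda>t. w t *\<^sub>R \<Phi> t) has_vector_derivative w t *\<^sub>R \<Psi> t + (\<alpha> * s t) *\<^sub>R \<Phi> t) (at t)"
      by (rule has_vector_derivative_scaleR[OF wd \<Phi>d[OF t]])
    then show "((\<lambda>t. w t *\<^sub>R \<Phi> t) has_vector_derivative f t) (at t)" by (simp add: f_def add.commute)
    show "isCont f t"
      unfolding f_def by (intro continuous_intros wc sc \<Phi>c[OF t] \<Psi>c[OF t])
  next
    have "(w \<longlongrightarrow> w 0) (at_right 0)" using wc[of 0] by (simp add: isCont_def filterlim_at_split)
    moreover have "(\<Phi> \<longlongrightarrow> cont_rep h y) (at_right 0)"
      unfolding \<Phi>_def[abs_def] by (rule conv_heat_tendsto_cont_rep[OF h dim])
    ultimately have "((\<lambda>t. w t *\<^sub>R \<Phi> t) \<longlongrightarrow> w 0 *\<^sub>R cont_rep h y) (at_right 0)" by (rule tendsto_scaleR)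
    moreover have "w 0 = - 1" using eps by (simp add: w_def)
    ultimately show "((\<lambda>t. w t *\<^sub>R \<Phi> t) \<longlongrightarrow> - cont_rep h y) (at_right 0)" by simp
    have "((\<lambda>t. - (\<epsilon>\<^sup>2 * s' t + s t)) \<longlongrightarrow> - (\<epsilon>\<^sup>2 * 0 + 0)) at_top"
      by (intro tendsto_intros wt_tendsto_0 wt_s wt_s')
    then have w0: "(w \<longlongrightarrow> 0) at_top" by (simp add: w_def[abs_def])
    define B where "B = sqrt (heat 2 (0::'a)) * l2_norm h"
    have \<Phi>B: "norm (\<Phi> t) \<le> B" if t: "t \<ge> 1" for t
    proof -
      have "norm (\<Phi> t) \<le> l2_norm (cpx (heat t :: 'a \<Rightarrow> real)) * l2_norm h"
        unfolding \<Phi>_def by (rule conv_bound[OF sch_real_L2[OF sch_heat] L(1)]) (use t in simp)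
      also have "l2_norm (cpx (heat t :: 'a \<Rightarrow> real)) = sqrt (heat (2 * t) (0::'a))"
        using l2_norm_heat[of t, where 'a='a] t by (simp add: real_sqrt_unique)
      also have "heat (2 * t) (0::'a) \<le> heat 2 (0::'a)"
        unfolding heat_def using t by (auto intro!: powr_mono2')
      finally show ?thesis by (simp add: B_def mult_right_mono)
    qed
    show "((\<lambda>t. w t *\<^sub>R \<Phi> t) \<longlongrightarrow> 0) at_top"
    proof (rule Lim_null_comparison)
      show "((\<lambda>t. \<bar>w t\<bar> * B) \<longlongrightarrow> 0) at_top"
        using tendsto_mult_left_zero[OF tendsto_rabs_zero[OF w0]] by simp
      show "\<forall>\<^sub>F t in at_top. norm (w t *\<^sub>R \<Phi> t) \<le> \<bar>w t\<bar> * B"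
        using eventually_ge_at_top[of 1] by eventually_elim (simp add: \<Phi>B mult_left_mono)
    qed
  qed
  moreover have "(LINT t|lborel. indicator {0<..} t *\<^sub>R f t)
      = \<alpha> * conv (ker s) h y - conv (ker s) (laplacian h) y - complex_of_real (\<epsilon>\<^sup>2) * conv (ker s') (laplacian h) y"
    unfolding feq e1[symmetric] e2[symmetric] e3[symmetric]
    by (simp only: Bochner_Integration.integral_diff[OF Bochner_Integration.integrable_diff[OF integrable_mult_right[OF i1] i2] integrable_mult_right[OF i3]]
      Bochner_Integration.integral_diff[OF integrable_mult_right[OF i1] i2] integral_mult_right_zero)
  ultimately show ?thesis by simp
qed

end

section \<open>The unperturbed energy form\<close>

context green_params
begin

text \<open>The unperturbed form including the shift \<alpha>. Its gradient term is rewritten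
  through the Laplacian, so that bilinearity needs no statement about first derivatives.\<close>

definition E0 :: "('a::euclidean_space \<Rightarrow> complex) \<Rightarrow> ('a \<Rightarrow> complex) \<Rightarrow> complex" where
  "E0 f h = complex_of_real (\<epsilon>\<^sup>2) * l2_inner (laplacian f) (laplacian h) - l2_inner (laplacian f) h
     + complex_of_real \<alpha> * l2_inner f h"

text \<open>The diagonal of \<open>E0\<close> as a real number; here the gradient norms are kept,
  which makes nonnegativity visible.\<close>

definition e0 :: "('a::euclidean_space \<Rightarrow> complex) \<Rightarrow> real" where
  "e0 f = \<epsilon>\<^sup>2 * (l2_norm (laplacian f))\<^sup>2 + (\<Sum>i\<in>Basis. (l2_norm (weak_deriv i f))\<^sup>2) + \<alpha> * (l2_norm f)\<^sup>2"

lemma energy_form_E0: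
  assumes "f \<in> H2" "h \<in> H2"
  shows "energy_form \<epsilon> \<mu> f h + complex_of_real \<alpha> * l2_inner f h
    = E0 f h + signed_integral \<mu> (\<lambda>x. cont_rep f x * cnj (cont_rep h x))"
  unfolding energy_form_def E0_def H2_gradient_inner[OF assms] by simp

lemma E0_self: "f \<in> H2 \<Longrightarrow> E0 f f = complex_of_real (e0 f)"
proof -
  assume f: "f \<in> H2"
  have "E0 f f = complex_of_real (\<epsilon>\<^sup>2) * l2_inner (laplacian f) (laplacian f)
      + (\<Sum>i\<in>Basis. l2_inner (weak_deriv i f) (weak_deriv i f)) + complex_of_real \<alpha> * l2_inner f f"
    unfolding E0_def H2_gradient_inner[OF f f] by simp
  also have "\<dots> = complex_of_real (e0 f)"
    unfolding l2_inner_self e0_def by (simp only: of_real_add of_real_mult of_real_sum)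
  finally show ?thesis .
qed

lemma e0_nonneg: "0 \<le> e0 f"
  unfolding e0_def using alpha_pos by (intro add_nonneg_nonneg mult_nonneg_nonneg sum_nonneg) auto

lemma e0_ge: "\<epsilon>\<^sup>2 * (l2_norm (laplacian f))\<^sup>2 \<le> e0 f" "\<alpha> * (l2_norm f)\<^sup>2 \<le> e0 f"
proof -
  have "0 \<le> (\<Sum>i\<in>Basis. (l2_norm (weak_deriv i f))\<^sup>2)" by (intro sum_nonneg) auto
  moreover have "0 \<le> \<alpha> * (l2_norm f)\<^sup>2" "0 \<le> \<epsilon>\<^sup>2 * (l2_norm (laplacian f))\<^sup>2" using alpha_pos by auto
  ultimately show "\<epsilon>\<^sup>2 * (l2_norm (laplacian f))\<^sup>2 \<le> e0 f" "\<alpha> * (l2_norm f)\<^sup>2 \<le> e0 f"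
    unfolding e0_def by linarith+
qed

lemma E0_hermitian:
  assumes "f \<in> H2" "h \<in> H2" shows "E0 f h = cnj (E0 h f)"
proof -
  have 1: "l2_inner (laplacian f) h = cnj (l2_inner (laplacian h) f)"
    unfolding H2_laplacian_symmetric[OF assms] by (rule l2_inner_commute)
  show ?thesis
    unfolding E0_def 1 l2_inner_commute[of "laplacian f" "laplacian h"] l2_inner_commute[of f h] by simp
qed

lemma E0_diff_left:
  assumes f: "f \<in> H2" and g: "g \<in> H2" and h: "h \<in> H2"
  shows "E0 (\<lambda>x. f x - g x) h = E0 f h - E0 g h"
proof -
  note L = H2_L2[OF f] H2_L2[OF g] H2_L2[OF h] laplacian_L2[OF f] laplacian_L2[OF g] laplacian_L2[OF h]
    laplacian_L2[OF H2_diff(1)[OF f g]]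
  have lin: "l2_inner (laplacian (\<lambda>x. f x - g x)) u = l2_inner (laplacian f) u - l2_inner (laplacian g) u" if u: "u \<in> L2" for u
  proof -
    have lin: "l2_inner (laplacian (\<lambda>x. f x - g x)) u = l2_inner (\<lambda>x. laplacian f x - laplacian g x) u"
      by (rule l2_inner_cong_AE) (use L H2_diff(2)[OF f g] L2_measurable[OF u] L2_measurable[OF L2_diff[OF L(4,5)]] in \<open>auto simp: L2_measurable\<close>)
    then show ?thesis by (simp add: l2_inner_diff_left L u)
  qed
  then show ?thesis
    unfolding E0_def lin[OF L(3)] lin[OF L(6)] l2_inner_diff_left[OF L(1,2,3)] by (simp add: algebra_simps)
qed

lemma E0_scale_left:
  assumes f: "f \<in> H2" and h: "h \<in> H2"
  shows "E0 (\<lambda>x. a * f x) h = a * E0 f h"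
proof -
  note L = H2_L2[OF f] H2_L2[OF h] laplacian_L2[OF f] laplacian_L2[OF h] laplacian_L2[OF H2_scale(1)[OF f, of a]]
  have lin: "l2_inner (laplacian (\<lambda>x. a * f x)) u = a * l2_inner (laplacian f) u" if u: "u \<in> L2" for u
  proof -
    have lin: "l2_inner (laplacian (\<lambda>x. a * f x)) u = l2_inner (\<lambda>x. a * laplacian f x) u"
      by (rule l2_inner_cong_AE) (use L H2_scale(2)[OF f, of a] L2_measurable[OF u] L2_measurable[OF L2_scale[OF L(3), of a]] in \<open>auto simp: L2_measurable\<close>)
    then show ?thesis by (simp add: l2_inner_scale_left)
  qed
  then show ?thesis
    unfolding E0_def lin[OF L(2)] lin[OF L(4)] l2_inner_scale_left by (simp add: algebra_simps)
qed

lemma pot_s_H2: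
  fixes g :: "'a::euclidean_space \<Rightarrow> complex"
  assumes "source M g" "DIM('a) < 4"
  shows "pot s M g \<in> H2" "AE x in lborel. laplacian (pot s M g) x = - pot s' M g x"
  by (rule pot_H2[OF assms(1) wt_s wt_s' s_deriv assms(2) s_0(1)])+

text \<open>One Laplacian is evaluated on the potential and yields -pot s', the others are moved to
  \<open>h\<close>. Pairing everything on \<open>M\<close> leaves the left-hand side of
  \<open>reproducing_pointwise\<close> under the integral.\<close>

lemma E0_pot:
  fixes h :: "'a::euclidean_space \<Rightarrow> complex"
  assumes S: "source M g" and h: "h \<in> H2" and dim: "DIM('a) < 4"
  shows "E0 (pot s M g) h = (LINT z|M. g z * cnj (cont_rep h z))"
proof -
  note U = pot_s_H2[OF S dim]
  note L = H2_L2[OF h] laplacian_L2[OF h]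
  have pair: "l2_inner (pot \<sigma> M g) u = (LINT z|M. cnj (conv (ker \<sigma>) u z) * g z)"
    "integrable M (\<lambda>z. cnj (conv (ker \<sigma>) u z) * g z)" if "wt \<sigma>" "u \<in> L2" for \<sigma> u
  proof -
    have "l2_inner (pot \<sigma> M g) u = (LINT x|lborel. cnj (u x) * pot \<sigma> M g x)"
      by (simp add: l2_inner_def mult.commute)
    then show "l2_inner (pot \<sigma> M g) u = (LINT z|M. cnj (conv (ker \<sigma>) u z) * g z)"
      "integrable M (\<lambda>z. cnj (conv (ker \<sigma>) u z) * g z)"
      using pot_pairing[OF S that(1) L2_cnj[OF that(2)]] by (simp_all add: conv_cnj)
  qed
  have "l2_inner (laplacian (pot s M g)) (laplacian h) = l2_inner (\<lambda>x. - pot s' M g x) (laplacian h)"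
    by (rule l2_inner_cong_AE)
      (use U(2) L2_measurable[OF laplacian_L2[OF U(1)]] L2_measurable[OF pot_L2[OF S wt_s']] L in \<open>auto simp: L2_measurable\<close>)
  then have "E0 (pot s M g) h = - (complex_of_real (\<epsilon>\<^sup>2) * l2_inner (pot s' M g) (laplacian h))
      - l2_inner (pot s M g) (laplacian h) + complex_of_real \<alpha> * l2_inner (pot s M g) h"
    unfolding E0_def H2_laplacian_symmetric[OF U(1) h] by (simp add: l2_inner_uminus_left)
  also have "\<dots> = (LINT z|M. - (complex_of_real (\<epsilon>\<^sup>2) * (cnj (conv (ker s') (laplacian h) z) * g z))
      - cnj (conv (ker s) (laplacian h) z) * g z + complex_of_real \<alpha> * (cnj (conv (ker s) h z) * g z))"
    unfolding pair(1)[OF wt_s' L(2)] pair(1)[OF wt_s L(2)] pair(1)[OF wt_s L(1)]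
    by (simp only: Bochner_Integration.integral_add Bochner_Integration.integral_diff Bochner_Integration.integral_minus
      integral_mult_right_zero Bochner_Integration.integrable_diff Bochner_Integration.integrable_minus integrable_mult_right
      pair(2)[OF wt_s' L(2)] pair(2)[OF wt_s L(2)] pair(2)[OF wt_s L(1)])
  also have "\<dots> = (LINT z|M. g z * cnj (cont_rep h z))"
    unfolding reproducing_pointwise[OF h dim, symmetric] by (simp add: algebra_simps)
  finally show ?thesis .
qed

lemma norm_pot_s_le:
  fixes g :: "'a::euclidean_space \<Rightarrow> complex"
  assumes M: "finite_measure M" and sets: "sets M = sets borel"
    and g: "g \<in> borel_measurable borel" "\<And>x. norm (g x) \<le> B"
    and K: "\<And>x::'a. \<bar>ker s x\<bar> \<le> K"
  shows "integrable M (\<lambda>z. ker s (x - z) *\<^sub>R g z)" "norm (pot s M g x) \<le> K * B * measure M UNIV"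
proof -
  interpret finite_measure M by fact
  note [measurable_cong] = sets
  have [measurable]: "g \<in> borel_measurable borel" "(ker s :: 'a \<Rightarrow> real) \<in> borel_measurable borel"
    using g borel_measurable_ker[OF wt_s] by auto
  have K0: "0 \<le> K" using K[of 0] by linarith
  have le: "norm (ker s (x - z) *\<^sub>R g z) \<le> K * B" for z
    unfolding norm_scaleR real_norm_def by (intro mult_mono K g K0) auto
  show i: "integrable M (\<lambda>z. ker s (x - z) *\<^sub>R g z)"
    by (rule integrable_const_bound[of _ "K * B"]) (use le in auto)
  have "norm (pot s M g x) \<le> (LINT z|M. K * B)"
    unfolding pot_def by (rule Bochner_Integration.integral_norm_bound_integral[OF i]) (use le in auto)
  also have "\<dots> = K * B * measure M UNIV"
    using sets_eq_imp_space_eq[OF sets] by simp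
  finally show "norm (pot s M g x) \<le> K * B * measure M UNIV" .
qed

lemma continuous_pot_s:
  fixes g :: "'a::euclidean_space \<Rightarrow> complex"
  assumes M: "finite_measure M" and sets: "sets M = sets borel"
    and g: "g \<in> borel_measurable borel" "\<And>x. norm (g x) \<le> B" and dim: "DIM('a) < 4"
  shows "continuous_on UNIV (pot s M g)"
proof (rule continuous_on_sequentiallyI)
  fix u and x :: 'a assume u: "u \<longlonglongrightarrow> x"
  interpret finite_measure M by fact
  note [measurable_cong] = sets
  have [measurable]: "g \<in> borel_measurable borel" "(ker s :: 'a \<Rightarrow> real) \<in> borel_measurable borel"
    using g borel_measurable_ker[OF wt_s] by auto
  define K where "K = \<omega> powr (- 1 / 4) * kbound TYPE('a)"
  have K: "\<bar>ker s z\<bar> \<le> K" for z :: 'a unfolding K_def by (rule abs_ker_s_le[OF dim])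
  have K0: "0 \<le> K" using K[of 0] by linarith
  show "(\<lambda>n. pot s M g (u n)) \<longlonglongrightarrow> pot s M g x"
    unfolding pot_def
  proof (rule integral_dominated_convergence[where w = "\<lambda>_. K * B"])
    show "AE z in M. (\<lambda>n. ker s (u n - z) *\<^sub>R g z) \<longlonglongrightarrow> ker s (x - z) *\<^sub>R g z"
      by (intro AE_I2 tendsto_intros continuous_on_tendsto_compose[OF continuous_ker_s[OF dim]] u) auto
    show "AE z in M. norm (ker s (u n - z) *\<^sub>R g z) \<le> K * B" for n
      unfolding norm_scaleR real_norm_def by (intro AE_I2 mult_mono K g K0) auto
  qed auto
qed

text \<open>Point evaluation at \<open>y\<close> is represented by the potential of the Dirac measure at \<open>y\<close>.\<close>

lemma cont_rep_bound:
  fixes h :: "'a::euclidean_space \<Rightarrow> complex"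
  assumes h: "h \<in> H2" and dim: "DIM('a) < 4" and B: "0 < B" "ker s (0::'a) \<le> B"
  shows "(norm (cont_rep h y))\<^sup>2 \<le> B * e0 h"
proof -
  define M where "M = return borel y"
  define k where "k = pot s M (\<lambda>_. 1)"
  have M: "finite_measure M" "sets M = sets borel"
    unfolding M_def by (auto intro!: prob_space.finite_measure prob_space_return)
  have S: "source M (\<lambda>_. 1)" by (rule source_finite[OF M, where B = 1]) (use dim in auto)
  have [measurable]: "(ker s :: 'a \<Rightarrow> real) \<in> borel_measurable borel" by (rule borel_measurable_ker[OF wt_s])
  have k_eq: "k x = complex_of_real (ker s (x - y))" for x
    unfolding k_def pot_def M_def by (subst integral_return) (auto simp: scaleR_conv_of_real)
  have k: "k \<in> H2" unfolding k_def by (rule pot_s_H2[OF S dim])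
  have kc: "cont_rep k = k"
    by (rule cont_rep_eqI) (auto simp: k_def intro!: continuous_pot_s[OF M _ _ dim, where B = 1])
  have Ek: "E0 k f = cnj (cont_rep f y)" if f: "f \<in> H2" for f
  proof -
    have [measurable]: "cont_rep f \<in> borel_measurable borel"
      by (intro borel_measurable_continuous_onI continuous_cont_rep f dim)
    have "E0 k f = (LINT z|M. 1 * cnj (cont_rep f z))" unfolding k_def by (rule E0_pot[OF S f dim])
    also have "\<dots> = cnj (cont_rep f y)" unfolding M_def by (subst integral_return) auto
    finally show ?thesis .
  qed
  define H where "H = cont_rep h y"
  \<comment> \<open>Up to the replacement of ker s 0 by the upper bound \<open>B\<close>, the
    function v = a k is the projection of \<open>h\<close> onto the evaluation vector
    \<open>k\<close>. Nonnegativity of e0 (h - v) is then the Cauchy-Schwarz inequality, without any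
    division by ker s 0.\<close>
  define a where "a = H / complex_of_real B"
  define v where "v = (\<lambda>x. a * k x)"
  have v: "v \<in> H2" unfolding v_def by (rule H2_scale(1)[OF k])
  have hv: "(\<lambda>x. h x - v x) \<in> H2" by (rule H2_diff(1)[OF h v])
  have Ehk: "E0 h k = H" using E0_hermitian[OF h k] Ek[OF h] by (simp add: H_def)
  have Evh: "E0 v h = a * cnj H" unfolding v_def E0_scale_left[OF k h] Ek[OF h] H_def ..
  have Ehv: "E0 h v = cnj a * H" using E0_hermitian[OF h v] Evh by simp
  have Ekk: "E0 k k = complex_of_real (ker s (0::'a))" using Ek[OF k] by (simp add: kc k_eq)
  have Evv: "E0 v v = a * cnj a * complex_of_real (ker s (0::'a))"
  proof -
    have "E0 v v = a * E0 k v" unfolding v_def by (rule E0_scale_left[OF k v[unfolded v_def]])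
    also have "E0 k v = cnj (E0 v k)" by (rule E0_hermitian[OF k v])
    also have "E0 v k = a * E0 k k" unfolding v_def by (rule E0_scale_left[OF k k])
    finally show ?thesis by (simp add: Ekk)
  qed
  have "complex_of_real (e0 (\<lambda>x. h x - v x)) = E0 (\<lambda>x. h x - v x) (\<lambda>x. h x - v x)"
    by (rule E0_self[OF hv, symmetric])
  also have "\<dots> = E0 h (\<lambda>x. h x - v x) - E0 v (\<lambda>x. h x - v x)"
    by (rule E0_diff_left[OF h v hv])
  also have "E0 h (\<lambda>x. h x - v x) = cnj (E0 h h - E0 v h)"
    using E0_hermitian[OF h hv] E0_diff_left[OF h v h] by simp
  also have "E0 v (\<lambda>x. h x - v x) = cnj (E0 h v - E0 v v)"
    using E0_hermitian[OF v hv] E0_diff_left[OF h v v] by simp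
  finally have "complex_of_real (e0 (\<lambda>x. h x - v x))
      = complex_of_real (e0 h) - 2 * (cnj a * H) + a * cnj a * complex_of_real (ker s (0::'a))
        + (cnj a * H - a * cnj H)"
    unfolding E0_self[OF h] Evh Ehv Evv by (simp add: algebra_simps)
  also have "cnj a * H = complex_of_real ((norm H)\<^sup>2 / B)"
    unfolding a_def by (simp add: complex_norm_square[symmetric] mult.commute)
  also have "a * cnj H = complex_of_real ((norm H)\<^sup>2 / B)"
    unfolding a_def by (simp add: complex_norm_square[symmetric])
  also have "a * cnj a = complex_of_real ((norm H)\<^sup>2 / B\<^sup>2)"
    unfolding complex_norm_square[symmetric] a_def using B by (simp add: norm_divide power_divide)
  finally have "complex_of_real (e0 (\<lambda>x. h x - v x))
      = complex_of_real (e0 h - 2 * ((norm H)\<^sup>2 / B) + (norm H)\<^sup>2 / B\<^sup>2 * ker s (0::'a))"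
    by simp
  then have "0 \<le> e0 h - 2 * ((norm H)\<^sup>2 / B) + (norm H)\<^sup>2 / B\<^sup>2 * ker s (0::'a)"
    using e0_nonneg[of "\<lambda>x. h x - v x"] by (simp only: of_real_eq_iff)
  also have "\<dots> \<le> e0 h - 2 * ((norm H)\<^sup>2 / B) + (norm H)\<^sup>2 / B\<^sup>2 * B"
    using B by (intro add_left_mono mult_left_mono) auto
  also have "(norm H)\<^sup>2 / B\<^sup>2 * B = (norm H)\<^sup>2 / B"
    using B by (simp add: power2_eq_square)
  finally have "(norm H)\<^sup>2 / B \<le> e0 h" by simp
  then show ?thesis using B by (simp add: H_def field_simps)
qed

end

section \<open>Signed measures\<close>

lemma signed_measure_sums:
  "signed_measure \<mu> \<Longrightarrow> (\<And>i::nat. A i \<in> sets borel) \<Longrightarrow> disjoint_family A \<Longrightarrow> (\<lambda>i. \<mu> (A i)) sums \<mu> (\<Union>i. A i)"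
  unfolding signed_measure_def by blast

lemma signed_measure_empty:
  assumes "signed_measure \<mu>" shows "\<mu> {} = 0"
proof -
  have "(\<lambda>i::nat. \<mu> {}) sums \<mu> (\<Union>i::nat. {})"
    by (rule signed_measure_sums[OF assms]) (auto simp: disjoint_family_on_def)
  then have "summable (\<lambda>i::nat. \<mu> {})" by (rule sums_summable)
  then show ?thesis using summable_LIMSEQ_zero LIMSEQ_const_iff by blast
qed

lemma signed_measure_Un:
  assumes \<mu>: "signed_measure \<mu>" and "A \<in> sets borel" "B \<in> sets borel" "A \<inter> B = {}"
  shows "\<mu> (A \<union> B) = \<mu> A + \<mu> B"
proof -
  have "(\<lambda>i. \<mu> (binaryset A B i)) sums \<mu> (\<Union>i. binaryset A B i)"
    using assms by (intro signed_measure_sums[OF \<mu>]) (auto simp: binaryset_def disjoint_family_on_def)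
  moreover have "(\<lambda>i. \<mu> (binaryset A B i)) sums (\<mu> A + \<mu> B)"
    by (rule binaryset_sums[of \<mu>]) (rule signed_measure_empty[OF \<mu>])
  ultimately show ?thesis using sums_unique2 by (simp add: UN_binaryset_eq) blast
qed

lemma signed_measure_Diff:
  assumes "signed_measure \<mu>" "A \<in> sets borel" "B \<in> sets borel" "B \<subseteq> A"
  shows "\<mu> (A - B) = \<mu> A - \<mu> B"
proof -
  have "(A - B) \<union> B = A" using assms by auto
  moreover have "\<mu> ((A - B) \<union> B) = \<mu> (A - B) + \<mu> B"
    using assms by (intro signed_measure_Un) auto
  ultimately show ?thesis by simp
qed

definition positive_set :: "('a::topological_space set \<Rightarrow> real) \<Rightarrow> 'a set \<Rightarrow> bool" where
  "positive_set \<mu> P \<longleftrightarrow> P \<in> sets borel \<and> (\<forall>B\<in>sets borel. B \<subseteq> P \<longrightarrow> 0 \<le> \<mu> B)"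

lemma positive_set_UN:
  assumes \<mu>: "signed_measure \<mu>" and P: "\<And>i::nat. positive_set \<mu> (P i)"
  shows "positive_set \<mu> (\<Union>i. P i)"
  unfolding positive_set_def
proof (intro conjI ballI impI)
  have sets: "P i \<in> sets borel" for i using P by (simp add: positive_set_def)
  then show "(\<Union>i. P i) \<in> sets borel" by auto
  fix B assume B: "B \<in> sets borel" "B \<subseteq> (\<Union>i. P i)"
  have "range (disjointed P) \<subseteq> sets borel"
    by (rule sets.range_disjointed_sets) (use sets in auto)
  then have D: "disjointed P i \<in> sets borel" for i by auto
  have "(\<lambda>i. \<mu> (B \<inter> disjointed P i)) sums \<mu> (\<Union>i. B \<inter> disjointed P i)"
  proof (rule signed_measure_sums[OF \<mu>])
    show "disjoint_family (\<lambda>i. B \<inter> disjointed P i)"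
      using disjoint_family_disjointed[of P] unfolding disjoint_family_on_def by blast
  qed (use B D in auto)
  moreover have "(\<Union>i. B \<inter> disjointed P i) = B"
    using B(2) UN_disjointed_eq[of P] by auto
  moreover have "0 \<le> \<mu> (B \<inter> disjointed P i)" for i
  proof -
    have "B \<inter> disjointed P i \<subseteq> P i" "B \<inter> disjointed P i \<in> sets borel"
      using disjointed_subset[of P i] B(1) D by auto
    then show ?thesis using P[of i] unfolding positive_set_def by blast
  qed
  ultimately show "0 \<le> \<mu> B" using sums_le[OF _ sums_zero] by metis
qed

text \<open>An exhaustion: repeatedly remove a subset whose deficit is at least half of the largest
  possible one, measured with a cap at 1. The removed sets are disjoint, so their measures are
  summable and tend to 0; no negative subset can survive, and removing sets of nonpositive measure
  does not lower the total.\<close>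

lemma positive_subset_exists:
  assumes \<mu>: "signed_measure \<mu>" and D: "D \<in> sets borel"
  shows "\<exists>A. A \<subseteq> D \<and> positive_set \<mu> A \<and> \<mu> D \<le> \<mu> A"
proof -
  have ex: "\<exists>B\<in>sets borel. B \<subseteq> E \<and> \<mu> B \<le> 0 \<and> (\<forall>B'\<in>sets borel. B' \<subseteq> E \<longrightarrow> min 1 (- \<mu> B') \<le> 2 * (- \<mu> B))"
    if "E \<in> sets borel" for E
  proof -
    define t where "t = (SUP B\<in>{B\<in>sets borel. B \<subseteq> E}. min 1 (- \<mu> B))"
    have bdd: "bdd_above ((\<lambda>B. min 1 (- \<mu> B)) ` {B\<in>sets borel. B \<subseteq> E})" by (auto intro!: bdd_aboveI[of _ 1])
    have up: "min 1 (- \<mu> B') \<le> t" if "B' \<in> sets borel" "B' \<subseteq> E" for B'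
      unfolding t_def by (rule cSUP_upper[OF _ bdd]) (use that in auto)
    have t0: "0 \<le> t" using up[of "{}"] by (simp add: signed_measure_empty[OF \<mu>])
    show ?thesis
    proof (cases "t = 0")
      case True
      then show ?thesis using up by (intro bexI[of _ "{}"]) (auto simp: signed_measure_empty[OF \<mu>])
    next
      case False
      then have "t / 2 < t" using t0 by simp
      moreover have "a < t \<longleftrightarrow> (\<exists>B\<in>{B\<in>sets borel. B \<subseteq> E}. a < min 1 (- \<mu> B))" for a
        unfolding t_def by (rule less_cSUP_iff[OF _ bdd]) auto
      ultimately obtain B where B: "B \<in> sets borel" "B \<subseteq> E" "t / 2 < min 1 (- \<mu> B)" by blast
      then have "t \<le> 2 * (- \<mu> B)" "\<mu> B \<le> 0" using t0 by auto
      then show ?thesis using up B by (meson order_trans)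
    qed
  qed
  then obtain b where b: "\<And>E. E \<in> sets borel \<Longrightarrow> b E \<in> sets borel" "\<And>E. E \<in> sets borel \<Longrightarrow> b E \<subseteq> E"
    "\<And>E. E \<in> sets borel \<Longrightarrow> \<mu> (b E) \<le> 0"
    "\<And>E B'. E \<in> sets borel \<Longrightarrow> B' \<in> sets borel \<Longrightarrow> B' \<subseteq> E \<Longrightarrow> min 1 (- \<mu> B') \<le> 2 * (- \<mu> (b E))"
    by metis
  define F where "F n = ((\<lambda>E. E - b E) ^^ n) D" for n
  have F_Suc: "F (Suc n) = F n - b (F n)" for n by (simp add: F_def)
  have F0: "F 0 = D" by (simp add: F_def)
  have Fs: "F n \<in> sets borel" for n
    by (induction n) (auto simp: F0 F_Suc D intro: b)
  have F_anti: "F m \<subseteq> F n" if "n \<le> m" for n m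
    using that by (induction rule: dec_induct) (auto simp: F_Suc)
  have disj: "disjoint_family (\<lambda>n. b (F n))"
    unfolding disjoint_family_on_def
  proof (intro ballI impI)
    fix m n :: nat assume "m \<noteq> n"
    have *: "b (F m) \<inter> b (F n) = {}" if "m < n" for m n
      using F_anti[of "Suc m" n] that b(2)[OF Fs[of n]] by (auto simp: F_Suc)
    show "b (F m) \<inter> b (F n) = {}"
      using *[of m n] *[of n m] \<open>m \<noteq> n\<close> by (cases "m < n") auto
  qed
  have sums: "(\<lambda>n. \<mu> (b (F n))) sums \<mu> (\<Union>n. b (F n))"
    by (rule signed_measure_sums[OF \<mu> _ disj]) (intro b Fs)
  define U where "U = (\<Union>n. b (F n))"
  have Us: "U \<in> sets borel" unfolding U_def using b(1)[OF Fs] by auto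
  have UD: "U \<subseteq> D" unfolding U_def using b(2)[OF Fs] F_anti[of 0] by (auto simp: F0)
  have neg: "\<mu> U \<le> 0"
    using sums_le[OF _ sums sums_zero] b(3)[OF Fs] by (auto simp: U_def)
  have DU: "D - U \<subseteq> F n" for n
    by (induction n) (auto simp: F0 F_Suc U_def)
  have "positive_set \<mu> (D - U)"
    unfolding positive_set_def
  proof (intro conjI ballI impI)
    show "D - U \<in> sets borel" using D Us by auto
    fix B assume B: "B \<in> sets borel" "B \<subseteq> D - U"
    have "(\<lambda>n. 2 * (- \<mu> (b (F n)))) \<longlonglongrightarrow> 2 * (- 0)"
      by (intro tendsto_intros summable_LIMSEQ_zero sums_summable[OF sums])
    moreover have "min 1 (- \<mu> B) \<le> 2 * (- \<mu> (b (F n)))" for n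
      using B DU[of n] by (intro b Fs) auto
    ultimately have "min 1 (- \<mu> B) \<le> 0"
      by (intro LIMSEQ_le_const[of _ 0]) auto
    then show "0 \<le> \<mu> B" by simp
  qed
  moreover have "\<mu> D \<le> \<mu> (D - U)"
    using neg signed_measure_Diff[OF \<mu> D Us UD] by simp
  ultimately show ?thesis by (intro exI[of _ "D - U"] conjI) auto
qed

text \<open>The supremum of \<mu> over positive sets is attained by the union of a maximising
  sequence. A disjoint set of positive measure would contain a positive set, and adding that would
  exceed the supremum.\<close>

lemma hahn_decomposition:
  assumes \<mu>: "signed_measure \<mu>"
  shows "\<exists>P. P \<in> sets borel \<and> (\<forall>A \<in> sets borel. (A \<subseteq> P \<longrightarrow> \<mu> A \<ge> 0) \<and> (A \<inter> P = {} \<longrightarrow> \<mu> A \<le> 0))"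
proof -
  define S where "S = \<mu> ` {P. positive_set \<mu> P}"
  have pos0: "positive_set \<mu> {}" by (simp add: positive_set_def signed_measure_empty[OF \<mu>])
  have mono: "\<mu> (P i) \<le> \<mu> (\<Union>i. P i)" if P: "\<And>i::nat. positive_set \<mu> (P i)" for P i
  proof -
    have U: "positive_set \<mu> (\<Union>i. P i)" by (rule positive_set_UN[OF \<mu> P])
    have "P i \<in> sets borel" using P by (simp add: positive_set_def)
    then have "0 \<le> \<mu> ((\<Union>i. P i) - P i)" using U by (auto simp: positive_set_def)
    also have "\<dots> = \<mu> (\<Union>i. P i) - \<mu> (P i)"
      using U P by (intro signed_measure_Diff[OF \<mu>]) (auto simp: positive_set_def)
    finally show ?thesis by simp
  qed
  \<comment> \<open>Otherwise the union of positive sets with \<mu> (P n) > n would have a measure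
    above every integer, although \<mu> is real-valued.\<close>
  have bdd: "bdd_above S"
  proof (rule ccontr)
    assume "\<not> bdd_above S"
    then have "\<exists>P. positive_set \<mu> P \<and> real n < \<mu> P" for n :: nat
      unfolding bdd_above_def S_def by (auto simp: not_le)
    then obtain P where P: "\<And>n::nat. positive_set \<mu> (P n)" "\<And>n::nat. real n < \<mu> (P n)" by metis
    obtain n where "\<mu> (\<Union>i. P i) < real n" using reals_Archimedean2 by blast
    with P(2)[of n] mono[of P, OF P(1), of n] show False by simp
  qed
  have "\<exists>P. positive_set \<mu> P \<and> Sup S - inverse (real (Suc n)) < \<mu> P" for n
    using less_cSupE[of "Sup S - inverse (real (Suc n))" S] pos0 by (auto simp: S_def)
  then obtain P where P: "\<And>n::nat. positive_set \<mu> (P n)" "\<And>n. Sup S - inverse (real (Suc n)) < \<mu> (P n)" by metis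
  define Q where "Q = (\<Union>i. P i)"
  have Q: "positive_set \<mu> Q" unfolding Q_def by (rule positive_set_UN[OF \<mu> P(1)])
  have "Sup S \<le> \<mu> Q"
  proof (rule LIMSEQ_le_const2)
    show "(\<lambda>n. Sup S - inverse (real (Suc n))) \<longlonglongrightarrow> Sup S"
      using tendsto_diff[OF tendsto_const LIMSEQ_inverse_real_of_nat, of "Sup S"] by simp
    show "\<exists>N. \<forall>n\<ge>N. Sup S - inverse (real (Suc n)) \<le> \<mu> Q"
      unfolding Q_def by (intro exI[of _ 0] allI impI) (rule less_imp_le[OF less_le_trans[OF P(2) mono[of P, OF P(1)]]])
  qed
  have "\<mu> A \<le> 0" if A: "A \<in> sets borel" "A \<inter> Q = {}" for A
  proof (rule ccontr)
    assume "\<not> \<mu> A \<le> 0"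
    moreover obtain A' where A': "A' \<subseteq> A" "positive_set \<mu> A'" "\<mu> A \<le> \<mu> A'"
      using positive_subset_exists[OF \<mu> A(1)] by blast
    ultimately have "\<mu> A' > 0" by simp
    have "positive_set \<mu> (\<Union>i. if i = (0::nat) then Q else A')"
      by (rule positive_set_UN[OF \<mu>]) (auto simp: Q A')
    moreover have "(\<Union>i. if i = (0::nat) then Q else A') = Q \<union> A'"
      by (auto split: if_splits)
    ultimately have "\<mu> (Q \<union> A') \<in> S" by (simp add: S_def)
    then have "\<mu> (Q \<union> A') \<le> Sup S" by (rule cSup_upper[OF _ bdd])
    moreover have "\<mu> (Q \<union> A') = \<mu> Q + \<mu> A'"
      using A' A(2) Q by (intro signed_measure_Un[OF \<mu>]) (auto simp: positive_set_def)
    ultimately show False using \<open>\<mu> A' > 0\<close> \<open>Sup S \<le> \<mu> Q\<close> by simp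
  qed
  then show ?thesis using Q by (intro exI[of _ Q]) (auto simp: positive_set_def)
qed

lemma hahn_set:
  assumes "signed_measure \<mu>"
  shows "hahn_set \<mu> \<in> sets borel" "\<And>A. A \<in> sets borel \<Longrightarrow> A \<subseteq> hahn_set \<mu> \<Longrightarrow> 0 \<le> \<mu> A"
    "\<And>A. A \<in> sets borel \<Longrightarrow> A \<inter> hahn_set \<mu> = {} \<Longrightarrow> \<mu> A \<le> 0"
  using someI_ex[OF hahn_decomposition[OF assms]] unfolding hahn_set_def[symmetric] by auto

section \<open>Jordan parts as measures and integration against them\<close>

lemma measure_of_borel:
  fixes f :: "'a::topological_space set \<Rightarrow> ennreal"
  shows "sets (measure_of UNIV (sets borel) f) = sets borel" "space (measure_of UNIV (sets borel) f) = UNIV"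
  using sets.sigma_sets_eq[of "borel :: 'a measure"] sets.space_closed[of "borel :: 'a measure"]
  by (simp_all add: sets_measure_of_conv space_measure_of_conv)

lemma signed_measure_emeasure:
  fixes f :: "'a::topological_space set \<Rightarrow> real"
  assumes f: "signed_measure f" and pos: "\<And>A. A \<in> sets borel \<Longrightarrow> 0 \<le> f A" and A: "A \<in> sets borel"
  shows "emeasure (measure_of UNIV (sets borel) (\<lambda>A. ennreal (f A))) A = ennreal (f A)"
proof (rule emeasure_measure_of[OF refl])
  show "sets borel \<subseteq> Pow (UNIV :: 'a set)" by simp
  show "A \<in> sets (measure_of UNIV (sets borel) (\<lambda>A. ennreal (f A)))" using A by (simp add: measure_of_borel)
  show "positive (sets (measure_of UNIV (sets borel) (\<lambda>A. ennreal (f A)))) (\<lambda>A. ennreal (f A))"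
    by (simp add: positive_def signed_measure_empty[OF f])
  show "countably_additive (sets (measure_of UNIV (sets borel) (\<lambda>A. ennreal (f A)))) (\<lambda>A. ennreal (f A))"
    unfolding countably_additive_def measure_of_borel
  proof (intro allI impI)
    fix B :: "nat \<Rightarrow> 'a set" assume B: "range B \<subseteq> sets borel" "disjoint_family B"
    then have s: "(\<lambda>i. f (B i)) sums f (\<Union>i. B i)" by (intro signed_measure_sums[OF f]) auto
    have "(\<Sum>i. ennreal (f (B i))) = ennreal (\<Sum>i. f (B i))"
      by (rule suminf_ennreal2) (use B pos s in \<open>auto simp: sums_iff\<close>)
    then show "(\<Sum>i. ennreal (f (B i))) = ennreal (f (\<Union>i. B i))"
      using s by (simp add: sums_iff)
  qed
qed

lemma signed_measure_restrict:
  fixes \<mu> :: "'a::topological_space set \<Rightarrow> real"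
  assumes \<mu>: "signed_measure \<mu>" and H: "H \<in> sets borel"
  shows "signed_measure (\<lambda>A. \<mu> (A \<inter> H))" "signed_measure (\<lambda>A. - \<mu> (A - H))"
  unfolding signed_measure_def
proof (safe)
  fix A :: "nat \<Rightarrow> 'a set" assume A: "range A \<subseteq> sets borel" "disjoint_family A"
  have "(\<lambda>i. \<mu> (A i \<inter> H)) sums \<mu> (\<Union>i. A i \<inter> H)"
    by (rule signed_measure_sums[OF \<mu>]) (use A H in \<open>auto simp: disjoint_family_on_def\<close>)
  moreover have "(\<Union>i. A i \<inter> H) = \<Union> (range A) \<inter> H" by blast
  ultimately show "(\<lambda>i. \<mu> (A i \<inter> H)) sums \<mu> (\<Union> (range A) \<inter> H)" by simp
  have "(\<lambda>i. \<mu> (A i - H)) sums \<mu> (\<Union>i. A i - H)"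
    by (rule signed_measure_sums[OF \<mu>]) (use A H in \<open>auto simp: disjoint_family_on_def\<close>)
  moreover have "(\<Union>i. A i - H) = \<Union> (range A) - H" by blast
  ultimately show "(\<lambda>i. - \<mu> (A i - H)) sums - \<mu> (\<Union> (range A) - H)"
    using sums_minus by fastforce
qed

lemma sets_parts [simp, measurable_cong]:
  "sets (pos_part \<mu>) = sets borel" "sets (neg_part \<mu>) = sets borel" "sets (abs_measure \<mu>) = sets borel"
  by (simp_all add: pos_part_def neg_part_def abs_measure_def measure_of_borel)

lemma emeasure_parts:
  assumes \<mu>: "signed_measure \<mu>" and A: "A \<in> sets borel"
  shows "emeasure (pos_part \<mu>) A = ennreal (\<mu> (A \<inter> hahn_set \<mu>))" "0 \<le> \<mu> (A \<inter> hahn_set \<mu>)"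
    and "emeasure (neg_part \<mu>) A = ennreal (- \<mu> (A - hahn_set \<mu>))" "0 \<le> - \<mu> (A - hahn_set \<mu>)"
proof -
  note H = hahn_set[OF \<mu>]
  have p: "0 \<le> \<mu> (B \<inter> hahn_set \<mu>)" if "B \<in> sets borel" for B using that H by auto
  have n: "0 \<le> - \<mu> (B - hahn_set \<mu>)" if "B \<in> sets borel" for B using that H(1) H(3)[of "B - hahn_set \<mu>"] by auto
  show "0 \<le> \<mu> (A \<inter> hahn_set \<mu>)" "0 \<le> - \<mu> (A - hahn_set \<mu>)" using p n A by auto
  show "emeasure (pos_part \<mu>) A = ennreal (\<mu> (A \<inter> hahn_set \<mu>))"
    unfolding pos_part_def by (rule signed_measure_emeasure[OF signed_measure_restrict(1)[OF \<mu> H(1)] p A])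
  show "emeasure (neg_part \<mu>) A = ennreal (- \<mu> (A - hahn_set \<mu>))"
    unfolding neg_part_def by (rule signed_measure_emeasure[OF signed_measure_restrict(2)[OF \<mu> H(1)] n A])
qed

lemma space_parts [simp]: "space (pos_part \<mu>) = UNIV" "space (neg_part \<mu>) = UNIV" "space (abs_measure \<mu>) = UNIV"
  by (simp_all add: pos_part_def neg_part_def abs_measure_def measure_of_borel)

lemma finite_parts:
  assumes "signed_measure \<mu>"
  shows "finite_measure (pos_part \<mu>)" "finite_measure (neg_part \<mu>)"
  using emeasure_parts[OF assms, of UNIV] by (auto intro!: finite_measureI)

text \<open>Besides \<open>abs_measure\<close>, it serves to compare sums of Jordan parts of
  different signed measures.\<close>

definition measure_add :: "'a measure \<Rightarrow> 'a measure \<Rightarrow> 'a measure" where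
  "measure_add M N = measure_of (space M) (sets M) (\<lambda>A. emeasure M A + emeasure N A)"

lemma sets_measure_add [simp, measurable_cong]: "sets (measure_add M N) = sets M"
  by (simp add: measure_add_def)

lemma space_measure_add [simp]: "space (measure_add M N) = space M"
  by (simp add: measure_add_def)

lemma emeasure_measure_add:
  assumes "sets M = sets N" "A \<in> sets M"
  shows "emeasure (measure_add M N) A = emeasure M A + emeasure N A"
proof (rule emeasure_measure_of[OF measure_add_def sets.space_closed])
  show "A \<in> sets (measure_add M N)" using assms by simp
  show "positive (sets (measure_add M N)) (\<lambda>A. emeasure M A + emeasure N A)" by (simp add: positive_def)
  show "countably_additive (sets (measure_add M N)) (\<lambda>A. emeasure M A + emeasure N A)"
    unfolding countably_additive_def
  proof (intro allI impI)
    fix B :: "nat \<Rightarrow> _" assume B: "range B \<subseteq> sets (measure_add M N)" "disjoint_family B"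
    have "(\<Sum>i. emeasure M (B i) + emeasure N (B i)) = (\<Sum>i. emeasure M (B i)) + (\<Sum>i. emeasure N (B i))"
      by (rule suminf_add[symmetric]) auto
    then show "(\<Sum>i. emeasure M (B i) + emeasure N (B i)) = emeasure M (\<Union> (range B)) + emeasure N (\<Union> (range B))"
      using B assms(1) by (simp add: suminf_emeasure)
  qed
qed

lemma nn_integral_measure_add:
  fixes M N :: "'a measure"
  assumes s: "sets M = sets N" and f: "f \<in> borel_measurable M"
  shows "(\<integral>\<^sup>+x. f x \<partial>measure_add M N) = (\<integral>\<^sup>+x. f x \<partial>M) + (\<integral>\<^sup>+x. f x \<partial>N)"
  using f
proof (induction rule: borel_measurable_induct)
  case (cong f g)
  have "integral\<^sup>N X f = integral\<^sup>N X g" if "space X = space M" for X :: "'a measure"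
    using cong that by (intro nn_integral_cong) auto
  then show ?case using cong sets_eq_imp_space_eq[OF s] by simp
next
  case (set A)
  then show ?case using s by (simp add: emeasure_measure_add)
next
  case (mult u c)
  have [measurable]: "u \<in> borel_measurable M" "u \<in> borel_measurable N" using mult s by (auto cong: measurable_cong_sets)
  show ?case using mult by (simp add: nn_integral_cmult distrib_left)
next
  case (add u v)
  have [measurable]: "u \<in> borel_measurable M" "u \<in> borel_measurable N" "v \<in> borel_measurable M" "v \<in> borel_measurable N"
    using add s by (auto cong: measurable_cong_sets)
  show ?case using add by (simp add: nn_integral_add add_ac)
next
  case (seq U)
  have [measurable]: "U i \<in> borel_measurable M" "U i \<in> borel_measurable N" for i using seq s by (auto cong: measurable_cong_sets)
  have inc: "incseq (\<lambda>i. integral\<^sup>N M (U i))" "incseq (\<lambda>i. integral\<^sup>N N (U i))"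
    using seq by (auto simp: incseq_def le_fun_def intro!: nn_integral_mono)
  have "(\<integral>\<^sup>+x. (SUP i. U i) x \<partial>measure_add M N) = (SUP i. integral\<^sup>N (measure_add M N) (U i))"
    unfolding SUP_apply by (rule nn_integral_monotone_convergence_SUP) (use seq in auto)
  also have "\<dots> = (SUP i. integral\<^sup>N M (U i) + integral\<^sup>N N (U i))" by (simp add: seq)
  also have "\<dots> = (SUP i. integral\<^sup>N M (U i)) + (SUP i. integral\<^sup>N N (U i))"
    by (rule ennreal_SUP_add[OF inc])
  also have "(SUP i. integral\<^sup>N M (U i)) = (\<integral>\<^sup>+x. (SUP i. U i) x \<partial>M)"
    unfolding SUP_apply by (rule nn_integral_monotone_convergence_SUP[symmetric]) (use seq in auto)
  also have "(SUP i. integral\<^sup>N N (U i)) = (\<integral>\<^sup>+x. (SUP i. U i) x \<partial>N)"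
    unfolding SUP_apply by (rule nn_integral_monotone_convergence_SUP[symmetric]) (use seq in auto)
  finally show ?case .
qed

lemma integral_measure_add:
  fixes f :: "'a \<Rightarrow> complex"
  assumes s: "sets M = sets N" and f: "integrable M f" "integrable N f"
  shows "integrable (measure_add M N) f" "integral\<^sup>L (measure_add M N) f = integral\<^sup>L M f + integral\<^sup>L N f"
proof -
  have [measurable]: "f \<in> borel_measurable M" using f by auto
  show i: "integrable (measure_add M N) f"
    using f by (simp add: integrable_iff_bounded nn_integral_measure_add[OF s] cong: measurable_cong_sets)
  have real: "integral\<^sup>L (measure_add M N) g = integral\<^sup>L M g + integral\<^sup>L N g"
    if g: "integrable (measure_add M N) g" "integrable M g" "integrable N g" for g :: "'a \<Rightarrow> real"
  proof -
    have [measurable]: "g \<in> borel_measurable M" using g by auto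
    have fin: "(\<integral>\<^sup>+x. ennreal (g x) \<partial>M) < \<top>" "(\<integral>\<^sup>+x. ennreal (g x) \<partial>N) < \<top>"
      "(\<integral>\<^sup>+x. ennreal (- g x) \<partial>M) < \<top>" "(\<integral>\<^sup>+x. ennreal (- g x) \<partial>N) < \<top>"
      using g by (auto simp: real_integrable_def less_top)
    show ?thesis
      unfolding real_lebesgue_integral_def[OF g(1)] real_lebesgue_integral_def[OF g(2)] real_lebesgue_integral_def[OF g(3)]
      using fin by (simp add: nn_integral_measure_add[OF s] enn2real_plus)
  qed
  show "integral\<^sup>L (measure_add M N) f = integral\<^sup>L M f + integral\<^sup>L N f"
    using real[OF integrable_Re[OF i] integrable_Re[OF f(1)] integrable_Re[OF f(2)]]
      real[OF integrable_Im[OF i] integrable_Im[OF f(1)] integrable_Im[OF f(2)]] i f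
    by (simp add: complex_eq_iff)
qed

lemma abs_measure_eq: "abs_measure \<mu> = measure_add (pos_part \<mu>) (neg_part \<mu>)"
  by (simp add: abs_measure_def measure_add_def)

lemma finite_abs_measure:
  assumes "signed_measure \<mu>"
  shows "finite_measure (abs_measure \<mu>)" "measure (abs_measure \<mu>) UNIV = total_mass \<mu>"
proof -
  interpret p: finite_measure "pos_part \<mu>" by (rule finite_parts(1)[OF assms])
  interpret n: finite_measure "neg_part \<mu>" by (rule finite_parts(2)[OF assms])
  have "emeasure (abs_measure \<mu>) UNIV = emeasure (pos_part \<mu>) UNIV + emeasure (neg_part \<mu>) UNIV"
    unfolding abs_measure_eq by (rule emeasure_measure_add) auto
  also have "\<dots> = ennreal (total_mass \<mu>)"
    by (simp add: p.emeasure_eq_measure n.emeasure_eq_measure total_mass_def)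
  finally have e: "emeasure (abs_measure \<mu>) UNIV = ennreal (total_mass \<mu>)" .
  then show "finite_measure (abs_measure \<mu>)" by (intro finite_measureI) simp
  have "0 \<le> total_mass \<mu>" by (simp add: total_mass_def)
  then show "measure (abs_measure \<mu>) UNIV = total_mass \<mu>" using e by (simp add: measure_def)
qed

lemma bounded_integrable_finite:
  fixes f :: "'a::topological_space \<Rightarrow> complex"
  assumes "finite_measure M" "sets M = sets borel" "f \<in> borel_measurable borel" "\<And>x. norm (f x) \<le> B"
  shows "integrable M f"
proof -
  interpret finite_measure M by fact
  show ?thesis
    by (rule integrable_const_bound[of _ B]) (use assms in \<open>auto cong: measurable_cong_sets\<close>)
qed

lemma signed_integral_bounded:
  fixes f :: "'a::topological_space \<Rightarrow> complex"
  assumes "signed_measure \<mu>" "f \<in> borel_measurable borel" "\<And>x. norm (f x) \<le> B"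
  shows "signed_integral \<mu> f = integral\<^sup>L (pos_part \<mu>) f - integral\<^sup>L (neg_part \<mu>) f"
  unfolding signed_integral_def
  using bounded_integrable_finite[OF finite_parts(1)[OF assms(1)] _ assms(2,3)]
    bounded_integrable_finite[OF finite_parts(2)[OF assms(1)] _ assms(2,3)] by simp

lemma norm_signed_integral_le:
  fixes f :: "'a::topological_space \<Rightarrow> complex"
  assumes \<mu>: "signed_measure \<mu>" and f: "f \<in> borel_measurable borel" "\<And>x. norm (f x) \<le> B"
  shows "norm (signed_integral \<mu> f) \<le> (LINT x|abs_measure \<mu>. norm (f x))"
    and "norm (signed_integral \<mu> f) \<le> B * total_mass \<mu>"
proof -
  have B: "0 \<le> B" using f(2)[of undefined] norm_ge_zero order_trans by blast
  have i: "integrable (pos_part \<mu>) f" "integrable (neg_part \<mu>) f"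
    using bounded_integrable_finite[OF finite_parts(1)[OF \<mu>] _ f] bounded_integrable_finite[OF finite_parts(2)[OF \<mu>] _ f] by simp_all
  define g where "g x = complex_of_real (norm (f x))" for x
  have ig: "integrable (pos_part \<mu>) g" "integrable (neg_part \<mu>) g"
    unfolding g_def using i by (auto simp: complex_of_real_integrable_eq)
  have "complex_of_real (LINT x|abs_measure \<mu>. norm (f x)) = integral\<^sup>L (abs_measure \<mu>) g"
    unfolding g_def by (rule integral_complex_of_real[symmetric])
  also have "\<dots> = integral\<^sup>L (pos_part \<mu>) g + integral\<^sup>L (neg_part \<mu>) g"
    unfolding abs_measure_eq by (rule integral_measure_add(2)[OF _ ig]) simp
  also have "\<dots> = complex_of_real ((LINT x|pos_part \<mu>. norm (f x)) + (LINT x|neg_part \<mu>. norm (f x)))"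
    unfolding g_def by simp
  finally have eq: "(LINT x|abs_measure \<mu>. norm (f x)) = (LINT x|pos_part \<mu>. norm (f x)) + (LINT x|neg_part \<mu>. norm (f x))"
    by (simp only: of_real_eq_iff)
  show 1: "norm (signed_integral \<mu> f) \<le> (LINT x|abs_measure \<mu>. norm (f x))"
    unfolding signed_integral_bounded[OF \<mu> f] eq
    using norm_triangle_ineq4[of "integral\<^sup>L (pos_part \<mu>) f" "integral\<^sup>L (neg_part \<mu>) f"]
      integral_norm_bound[of "pos_part \<mu>" f] integral_norm_bound[of "neg_part \<mu>" f] by linarith
  interpret finite_measure "abs_measure \<mu>" by (rule finite_abs_measure[OF \<mu>])
  have "(LINT x|abs_measure \<mu>. norm (f x)) \<le> (LINT x|abs_measure \<mu>. B)"
    using bounded_integrable_finite[OF finite_abs_measure(1)[OF \<mu>] _ f] f(2)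
    by (intro integral_mono integrable_norm) auto
  also have "\<dots> = B * total_mass \<mu>" using finite_abs_measure(2)[OF \<mu>] by simp
  finally show "norm (signed_integral \<mu> f) \<le> B * total_mass \<mu>" using 1 by simp
qed

lemma signed_measure_diff:
  assumes "signed_measure m" "signed_measure \<mu>"
  shows "signed_measure (\<lambda>A. m A - \<mu> A)"
  using assms unfolding signed_measure_def by (auto intro: sums_diff)

text \<open>The Jordan parts of m - \<mu> are in general not the differences of the Jordan parts.
  Moving negative terms across, \<nu>+ + m- + \<mu>+ = \<nu>- + m+ + \<mu>- is an equality of finite
  measures and can be integrated.\<close>

lemma signed_integral_diff_measure:
  fixes f :: "'a::topological_space \<Rightarrow> complex"
  assumes m: "signed_measure m" and \<mu>: "signed_measure \<mu>"
    and f: "f \<in> borel_measurable borel" "\<And>x. norm (f x) \<le> B"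
  shows "signed_integral (\<lambda>A. m A - \<mu> A) f = signed_integral m f - signed_integral \<mu> f"
proof -
  define \<nu> where "\<nu> = (\<lambda>A. m A - \<mu> A)"
  have \<nu>: "signed_measure \<nu>" unfolding \<nu>_def by (rule signed_measure_diff[OF m \<mu>])
  have int: "integrable (pos_part \<kappa>) f" "integrable (neg_part \<kappa>) f" if "signed_measure \<kappa>" for \<kappa>
    using bounded_integrable_finite[OF finite_parts(1)[OF that] _ f] bounded_integrable_finite[OF finite_parts(2)[OF that] _ f] by simp_all
  have eq: "measure_add (measure_add (pos_part \<nu>) (neg_part m)) (pos_part \<mu>)
      = measure_add (measure_add (neg_part \<nu>) (pos_part m)) (neg_part \<mu>)"
  proof (rule measure_eqI)
    fix A assume "A \<in> sets (measure_add (measure_add (pos_part \<nu>) (neg_part m)) (pos_part \<mu>))"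
    then have A: "A \<in> sets borel" by simp
    have split: "\<kappa> A = \<kappa> (A \<inter> hahn_set \<kappa>) - (- \<kappa> (A - hahn_set \<kappa>))" if "signed_measure \<kappa>" for \<kappa>
    proof -
      have "\<kappa> (A \<inter> hahn_set \<kappa> \<union> (A - hahn_set \<kappa>)) = \<kappa> (A \<inter> hahn_set \<kappa>) + \<kappa> (A - hahn_set \<kappa>)"
        using A hahn_set(1)[OF that] by (intro signed_measure_Un[OF that]) auto
      then show ?thesis by (simp add: Int_Diff_Un)
    qed
    have "\<nu> A = m A - \<mu> A" by (simp add: \<nu>_def)
    then show "emeasure (measure_add (measure_add (pos_part \<nu>) (neg_part m)) (pos_part \<mu>)) A
        = emeasure (measure_add (measure_add (neg_part \<nu>) (pos_part m)) (neg_part \<mu>)) A"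
      using split[OF \<nu>] split[OF m] split[OF \<mu>] emeasure_parts[OF \<nu> A] emeasure_parts[OF m A] emeasure_parts[OF \<mu> A] A
      by (simp add: emeasure_measure_add ennreal_plus[symmetric] del: ennreal_plus)
  qed simp
  have "integral\<^sup>L (pos_part \<nu>) f + integral\<^sup>L (neg_part m) f + integral\<^sup>L (pos_part \<mu>) f
      = integral\<^sup>L (neg_part \<nu>) f + integral\<^sup>L (pos_part m) f + integral\<^sup>L (neg_part \<mu>) f"
    using arg_cong[OF eq, of "\<lambda>M. integral\<^sup>L M f"] int[OF \<nu>] int[OF m] int[OF \<mu>]
    by (simp add: integral_measure_add)
  then show ?thesis
    unfolding \<nu>_def[symmetric] signed_integral_bounded[OF \<nu> f] signed_integral_bounded[OF m f] signed_integral_bounded[OF \<mu> f]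
    by (simp add: algebra_simps)
qed

section \<open>Perturbation by a signed measure\<close>

lemma total_mass_nonneg [simp]: "0 \<le> total_mass \<mu>"
  by (simp add: total_mass_def)

lemma signed_integral_linear:
  fixes f g :: "'a::topological_space \<Rightarrow> complex"
  assumes \<mu>: "signed_measure \<mu>"
    and f: "f \<in> borel_measurable borel" "\<And>x. norm (f x) \<le> A"
    and g: "g \<in> borel_measurable borel" "\<And>x. norm (g x) \<le> B"
  shows "signed_integral \<mu> (\<lambda>x. f x + g x) = signed_integral \<mu> f + signed_integral \<mu> g"
    and "signed_integral \<mu> (\<lambda>x. f x - g x) = signed_integral \<mu> f - signed_integral \<mu> g"
proof -
  have i: "integrable (pos_part \<mu>) h" "integrable (neg_part \<mu>) h"
    if "h \<in> borel_measurable borel" "\<And>x. norm (h x) \<le> C" for h :: "'a \<Rightarrow> complex" and C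
    using bounded_integrable_finite[OF finite_parts(1)[OF \<mu>] _ that] bounded_integrable_finite[OF finite_parts(2)[OF \<mu>] _ that] by simp_all
  note i = i[OF f] i[OF g]
  show "signed_integral \<mu> (\<lambda>x. f x + g x) = signed_integral \<mu> f + signed_integral \<mu> g"
    "signed_integral \<mu> (\<lambda>x. f x - g x) = signed_integral \<mu> f - signed_integral \<mu> g"
    using i unfolding signed_integral_def by simp_all
qed

context green_params
begin

definition spot :: "('a::euclidean_space set \<Rightarrow> real) \<Rightarrow> ('a \<Rightarrow> complex) \<Rightarrow> 'a \<Rightarrow> complex" where
  "spot \<mu> g x = signed_integral \<mu> (\<lambda>y. ker s (x - y) *\<^sub>R g y)"

lemma spot:
  fixes g :: "'a::euclidean_space \<Rightarrow> complex"
  assumes \<mu>: "signed_measure \<mu>" and dim: "DIM('a) < 4"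
    and g: "g \<in> borel_measurable borel" "\<And>x. norm (g x) \<le> A"
  shows spot_eq: "spot \<mu> g = (\<lambda>x. pot s (pos_part \<mu>) g x - pot s (neg_part \<mu>) g x)"
    and spot_H2: "spot \<mu> g \<in> H2"
    and continuous_spot: "continuous_on UNIV (spot \<mu> g)"
    and norm_spot_le: "(\<And>x::'a. \<bar>ker s x\<bar> \<le> K) \<Longrightarrow> norm (spot \<mu> g x) \<le> K * A * total_mass \<mu>"
    and E0_spot: "h \<in> H2 \<Longrightarrow> E0 (spot \<mu> g) h = signed_integral \<mu> (\<lambda>z. g z * cnj (cont_rep h z))"
proof -
  note fin = finite_parts[OF \<mu>]
  have ker: "\<bar>ker s x\<bar> \<le> \<omega> powr (- 1 / 4) * kbound TYPE('a)" for x :: 'a by (rule abs_ker_s_le[OF dim])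
  show eq: "spot \<mu> g = (\<lambda>x. pot s (pos_part \<mu>) g x - pot s (neg_part \<mu>) g x)"
    unfolding spot_def signed_integral_def pot_def
    using norm_pot_s_le(1)[OF fin(1) _ g ker] norm_pot_s_le(1)[OF fin(2) _ g ker] by (simp add: fun_eq_iff)
  have S: "source (pos_part \<mu>) g" "source (neg_part \<mu>) g"
    by (rule source_finite[OF _ _ g dim], use fin in simp_all)+
  note P = pot_s_H2(1)[OF S(1) dim] pot_s_H2(1)[OF S(2) dim]
  show "spot \<mu> g \<in> H2" unfolding eq by (rule H2_diff(1)[OF P])
  show "continuous_on UNIV (spot \<mu> g)"
    unfolding eq by (intro continuous_intros continuous_pot_s[OF _ _ g dim] fin) auto
  show "norm (spot \<mu> g x) \<le> K * A * total_mass \<mu>" if K: "\<And>x::'a. \<bar>ker s x\<bar> \<le> K"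
  proof -
    have "norm (spot \<mu> g x) \<le> norm (pot s (pos_part \<mu>) g x) + norm (pot s (neg_part \<mu>) g x)"
      unfolding eq by (rule norm_triangle_ineq4)
    also have "\<dots> \<le> K * A * measure (pos_part \<mu>) UNIV + K * A * measure (neg_part \<mu>) UNIV"
      by (intro add_mono norm_pot_s_le(2)[OF _ _ g K] fin) auto
    finally show ?thesis by (simp add: total_mass_def distrib_left)
  qed
  show "E0 (spot \<mu> g) h = signed_integral \<mu> (\<lambda>z. g z * cnj (cont_rep h z))" if h: "h \<in> H2"
  proof -
    obtain C where C: "\<And>x. norm (cont_rep h x) \<le> C" using bounded_cont_rep[OF h dim] by blast
    have [measurable]: "g \<in> borel_measurable borel" "cont_rep h \<in> borel_measurable borel"
      using g by (auto intro: borel_measurable_continuous_onI continuous_cont_rep h dim)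
    have b: "norm (g z * cnj (cont_rep h z)) \<le> A * C" for z
      unfolding norm_mult using g(2)[of z] C[of z] order_trans[OF norm_ge_zero g(2)[of z]] by (intro mult_mono) auto
    have "E0 (spot \<mu> g) h = E0 (pot s (pos_part \<mu>) g) h - E0 (pot s (neg_part \<mu>) g) h"
      unfolding eq by (rule E0_diff_left[OF P h])
    also have "\<dots> = signed_integral \<mu> (\<lambda>z. g z * cnj (cont_rep h z))"
      unfolding E0_pot[OF S(1) h dim] E0_pot[OF S(2) h dim]
      by (rule signed_integral_bounded[OF \<mu> _ b, symmetric]) measurable
    finally show ?thesis .
  qed
qed

definition weak_solution :: "('a::euclidean_space set \<Rightarrow> real) \<Rightarrow> ('a \<Rightarrow> complex) \<Rightarrow> ('a \<Rightarrow> complex) \<Rightarrow> bool" where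
  "weak_solution \<mu> u f \<longleftrightarrow> u \<in> H2 \<and>
     (\<forall>h\<in>H2. E0 u h + signed_integral \<mu> (\<lambda>x. cont_rep u x * cnj (cont_rep h x)) = l2_inner f h)"

text \<open>The multiple \<alpha> u in the graph of the shifted operator is absorbed into
  \<open>E0\<close>, so that from here on only the weak equation matters.\<close>

lemma shifted_iff_weak_solution:
  assumes f: "f \<in> L2"
  shows "(u, f) \<in> shifted (schroedinger \<epsilon> \<mu>) \<alpha> \<longleftrightarrow> weak_solution \<mu> u f"
proof -
  have "(\<lambda>x. f x - complex_of_real \<alpha> * u x) \<in> L2 \<and>
      (energy_form \<epsilon> \<mu> u h = l2_inner (\<lambda>x. f x - complex_of_real \<alpha> * u x) h
      \<longleftrightarrow> E0 u h + signed_integral \<mu> (\<lambda>x. cont_rep u x * cnj (cont_rep h x)) = l2_inner f h)"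
    if u: "u \<in> H2" and h: "h \<in> H2" for h
  proof
    note L = H2_L2[OF u] H2_L2[OF h] L2_scale[OF H2_L2[OF u], of "complex_of_real \<alpha>"]
    show "(\<lambda>x. f x - complex_of_real \<alpha> * u x) \<in> L2" by (rule L2_diff[OF f L(3)])
    show "energy_form \<epsilon> \<mu> u h = l2_inner (\<lambda>x. f x - complex_of_real \<alpha> * u x) h
      \<longleftrightarrow> E0 u h + signed_integral \<mu> (\<lambda>x. cont_rep u x * cnj (cont_rep h x)) = l2_inner f h"
      unfolding energy_form_E0[OF u h, symmetric] l2_inner_diff_left[OF f L(3,2)] l2_inner_scale_left
      by (simp add: eq_diff_eq)
  qed
  then show ?thesis
    unfolding shifted_def schroedinger_def form_operator_def weak_solution_def by blast
qed

end

section \<open>Solvability and uniform bounds under a smallness condition\<close>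

text \<open>The single constant \<open>B\<close> bounds the kernel in supremum norm and, as it also
  bounds the value at 0, the point evaluations. Since \<open>B\<close> is a parameter and not
  defined from \<mu>, estimates in terms of \<open>B\<close> are shared by all measures satisfying
  the condition.\<close>

locale perturbed = green_params \<epsilon> \<alpha> for \<epsilon> \<alpha> :: real +
  fixes B :: real and \<mu> :: "'a::euclidean_space set \<Rightarrow> real"
  assumes dim: "DIM('a) < 4" and B_pos: "0 < B" and ker_le: "\<And>x::'a. \<bar>ker s x\<bar> \<le> B"
    and signed: "signed_measure \<mu>" and small: "B * total_mass \<mu> \<le> 1 / 2"
begin

lemma borel_measurable_cont_rep: "h \<in> H2 \<Longrightarrow> (cont_rep h :: 'a \<Rightarrow> complex) \<in> borel_measurable borel"
  by (intro borel_measurable_continuous_onI continuous_cont_rep dim)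

lemma B_e0_nonneg [simp]: "0 \<le> B * e0 h"
  using B_pos e0_nonneg[of h] by simp

lemma norm_cont_rep_le:
  fixes h :: "'a \<Rightarrow> complex"
  assumes "h \<in> H2" shows "norm (cont_rep h y) \<le> sqrt (B * e0 h)"
proof -
  have "ker s (0::'a) \<le> B" using ker_le[of 0] by linarith
  then show ?thesis using cont_rep_bound[OF assms dim B_pos] by (intro real_le_rsqrt)
qed

text \<open>The perturbation is form-bounded with relative bound 1/2: the pointwise bound B * e0 h
  for the square, times the total mass. This is the coercivity of the perturbed form.\<close>

lemma norm_signed_integral_square_le:
  assumes h: "h \<in> H2"
  shows "norm (signed_integral \<mu> (\<lambda>x. cont_rep h x * cnj (cont_rep h x))) \<le> e0 h / 2"
proof -
  note [measurable] = borel_measurable_cont_rep[OF h]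
  have "norm (cont_rep h x * cnj (cont_rep h x)) \<le> sqrt (B * e0 h) * sqrt (B * e0 h)" for x :: 'a
    unfolding norm_mult complex_mod_cnj by (intro mult_mono norm_cont_rep_le h real_sqrt_ge_zero B_e0_nonneg norm_ge_zero)
  then have "norm (signed_integral \<mu> (\<lambda>x. cont_rep h x * cnj (cont_rep h x))) \<le> sqrt (B * e0 h) * sqrt (B * e0 h) * total_mass \<mu>"
    by (intro norm_signed_integral_le(2)[OF signed]) measurable
  also have "\<dots> = e0 h * (B * total_mass \<mu>)"
    using B_pos e0_nonneg[of h] by simp
  also have "\<dots> \<le> e0 h * (1 / 2)"
    using e0_nonneg small by (intro mult_left_mono)
  finally show ?thesis by simp
qed

lemma weak_solution_exists:
  assumes f: "f \<in> L2"
  shows "\<exists>u. weak_solution \<mu> u f"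
proof -
  define u0 where "u0 = conv (ker s) f"
  have kl: "real_L2 (ker s :: 'a \<Rightarrow> real)" by (rule ker_real_L2[OF wt_s dim])
  have u0_c: "continuous_on UNIV u0" unfolding u0_def by (rule continuous_conv[OF kl f])
  have u0_b: "norm (u0 x) \<le> l2_norm (cpx (ker s :: 'a \<Rightarrow> real)) * l2_norm f" for x
    unfolding u0_def by (rule conv_bound[OF kl f])
  have u0_H2: "u0 \<in> H2" unfolding u0_def pot_lborel[symmetric] by (rule pot_s_H2(1)[OF source_lborel[OF f] dim])
  have u0_E: "E0 u0 h = l2_inner f h" if h: "h \<in> H2" for h
  proof -
    have "E0 u0 h = l2_inner f (cont_rep h)"
      unfolding u0_def pot_lborel[symmetric] E0_pot[OF source_lborel[OF f] h dim] l2_inner_def ..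
    also have "\<dots> = l2_inner f h"
      by (rule l2_inner_cong_AE)
        (use f h cont_rep_AE[OF h dim] borel_measurable_cont_rep[OF h] L2_measurable[OF H2_L2[OF h]] in \<open>auto simp: L2_measurable\<close>)
    finally show ?thesis .
  qed
  have bm: "apply_bcontfun v \<in> borel_measurable borel" for v :: "'a \<Rightarrow>\<^sub>C complex"
    by (intro borel_measurable_continuous_onI continuous_on_apply_bcontfun)
  have bb: "norm (apply_bcontfun v x) \<le> norm v" for v :: "'a \<Rightarrow>\<^sub>C complex" and x by (rule norm_bounded)
  \<comment> \<open>A fixed point solves u = u0 - spot \<mu> u. In supremum norm
    \<open>spot \<mu>\<close> has operator norm at most B * total_mass \<mu> <= 1/2, and its
    argument needs no regularity beyond measurability and boundedness.\<close>
  define T where "T v = Bcontfun (\<lambda>x. u0 x - spot \<mu> (apply_bcontfun v) x)" for v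
  have T: "apply_bcontfun (T v) x = u0 x - spot \<mu> (apply_bcontfun v) x" for v x
  proof -
    have "(\<lambda>x. u0 x - spot \<mu> (apply_bcontfun v) x) \<in> bcontfun"
    proof (rule bcontfun_normI)
      show "continuous_on UNIV (\<lambda>x. u0 x - spot \<mu> (apply_bcontfun v) x)"
        by (intro continuous_intros u0_c continuous_spot[OF signed dim bm bb])
      show "norm (u0 x - spot \<mu> (apply_bcontfun v) x)
          \<le> l2_norm (cpx (ker s :: 'a \<Rightarrow> real)) * l2_norm f + B * norm v * total_mass \<mu>" for x
        by (intro norm_triangle_le_diff add_mono u0_b norm_spot_le[OF signed dim bm bb] ker_le)
    qed
    then show ?thesis unfolding T_def by (subst Bcontfun_inverse) auto
  qed
  have "dist (T v) (T w) \<le> 1 / 2 * dist v w" for v w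
  proof (rule dist_bound)
    fix x
    have d: "norm (apply_bcontfun w y - apply_bcontfun v y) \<le> dist v w" for y
      using dist_bounded[of v y w] by (simp add: dist_norm norm_minus_commute)
    have dm: "(\<lambda>y. apply_bcontfun w y - apply_bcontfun v y) \<in> borel_measurable borel"
      by (intro borel_measurable_diff bm)
    have k: "(\<lambda>y. ker s (x - y) *\<^sub>R apply_bcontfun v y) \<in> borel_measurable borel"
      "norm (ker s (x - y) *\<^sub>R apply_bcontfun v y) \<le> B * norm v" for v :: "'a \<Rightarrow>\<^sub>C complex" and y
    proof -
      have [measurable]: "(ker s :: 'a \<Rightarrow> real) \<in> borel_measurable borel" by (rule borel_measurable_ker[OF wt_s])
      note [measurable] = bm[of v]
      show "(\<lambda>y. ker s (x - y) *\<^sub>R apply_bcontfun v y) \<in> borel_measurable borel" by measurable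
      show "norm (ker s (x - y) *\<^sub>R apply_bcontfun v y) \<le> B * norm v"
        unfolding norm_scaleR real_norm_def using B_pos by (intro mult_mono ker_le bb) auto
    qed
    have "apply_bcontfun (T v) x - apply_bcontfun (T w) x = spot \<mu> (apply_bcontfun w) x - spot \<mu> (apply_bcontfun v) x"
      by (simp add: T)
    also have "\<dots> = spot \<mu> (\<lambda>y. apply_bcontfun w y - apply_bcontfun v y) x"
      unfolding spot_def scaleR_diff_right by (rule signed_integral_linear(2)[OF signed k k, symmetric])
    also have "norm \<dots> \<le> B * dist v w * total_mass \<mu>"
      by (rule norm_spot_le[OF signed dim dm d ker_le])
    also have "\<dots> = (B * total_mass \<mu>) * dist v w" by simp
    also have "\<dots> \<le> 1 / 2 * dist v w" using small by (intro mult_right_mono) auto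
    finally show "dist (apply_bcontfun (T v) x) (apply_bcontfun (T w) x) \<le> 1 / 2 * dist v w"
      by (simp add: dist_norm)
  qed
  then obtain v where v: "T v = v" using banach_fix_type[of "1/2" T] by auto
  define u where "u = apply_bcontfun v"
  have um: "u \<in> borel_measurable borel" and ub: "norm (u x) \<le> norm v" for x
    unfolding u_def by (rule bm, rule bb)
  \<comment> \<open>The equation holds at every point, so \<open>u\<close> inherits
    \<open>H2\<close> from its right-hand side and, being continuous, is its own continuous
    representative.\<close>
  have u_eq: "u = (\<lambda>x. u0 x - spot \<mu> u x)" using T[of v] by (simp add: v u_def fun_eq_iff)
  have sH: "spot \<mu> u \<in> H2" by (rule spot_H2[OF signed dim um ub])
  have "u \<in> H2" using H2_diff(1)[OF u0_H2 sH] by (simp add: u_eq[symmetric])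
  moreover have "cont_rep u = u" by (rule cont_rep_eqI) (auto simp: u_def)
  moreover have "E0 u h = l2_inner f h - signed_integral \<mu> (\<lambda>x. u x * cnj (cont_rep h x))" if h: "h \<in> H2" for h
    by (subst u_eq) (simp only: E0_diff_left[OF u0_H2 sH h] u0_E[OF h] E0_spot[OF signed dim um ub h])
  ultimately show ?thesis unfolding weak_solution_def by (intro exI[of _ u]) simp
qed

text \<open>Test the equation with \<open>u\<close> itself and absorb the measure term, at most half
  of the energy. Since \<alpha> times the squared norm of \<open>u\<close> is at most e0 u, one
  factor of the norm cancels.\<close>

lemma weak_solution_energy_le:
  assumes u: "weak_solution \<mu> u f" and f: "f \<in> L2"
  shows "e0 u \<le> 2 * (l2_norm f * l2_norm u)" "l2_norm u \<le> 2 / \<alpha> * l2_norm f" "e0 u \<le> 4 / \<alpha> * (l2_norm f)\<^sup>2"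
proof -
  have uH: "u \<in> H2" using u by (simp add: weak_solution_def)
  have "complex_of_real (e0 u) = l2_inner f u - signed_integral \<mu> (\<lambda>x. cont_rep u x * cnj (cont_rep u x))"
    using u uH unfolding weak_solution_def E0_self[OF uH, symmetric] by (auto simp: eq_diff_eq)
  then have "norm (complex_of_real (e0 u)) \<le> norm (l2_inner f u) + norm (signed_integral \<mu> (\<lambda>x. cont_rep u x * cnj (cont_rep u x)))"
    by (simp only: norm_triangle_ineq4)
  also have "\<dots> \<le> l2_norm f * l2_norm u + e0 u / 2"
    by (intro add_mono l2_inner_cauchy_schwarz f H2_L2 uH norm_signed_integral_square_le)
  finally show e: "e0 u \<le> 2 * (l2_norm f * l2_norm u)" using e0_nonneg[of u] by simp
  have "l2_norm u * (\<alpha> * l2_norm u) \<le> l2_norm u * (2 * l2_norm f)"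
    using e0_ge(2)[of u] e by (simp add: power2_eq_square mult_ac)
  then have "\<alpha> * l2_norm u \<le> 2 * l2_norm f"
    using alpha_pos by (cases "l2_norm u = 0") (auto simp: less_le)
  then show n: "l2_norm u \<le> 2 / \<alpha> * l2_norm f" using alpha_pos by (simp add: field_simps)
  have "e0 u \<le> 2 * (l2_norm f * (2 / \<alpha> * l2_norm f))"
    by (rule order_trans[OF e]) (intro mult_left_mono n, auto)
  then show "e0 u \<le> 4 / \<alpha> * (l2_norm f)\<^sup>2" by (simp add: power2_eq_square)
qed

text \<open>Controls the density u - \<Delta> u that represents \<open>u\<close> as a convolution
  with the Green function of -\<Delta> + 1. The constant depends on \<epsilon> and \<alpha> only,
  which is the source of uniformity in \<open>n\<close>.\<close>

lemma weak_solution_laplacian_le: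
  assumes u: "weak_solution \<mu> u f" and f: "f \<in> L2"
  shows "l2_norm (\<lambda>x. u x - laplacian u x) \<le> (2 / \<alpha> + 2 / (\<epsilon> * sqrt \<alpha>)) * l2_norm f"
proof -
  have uH: "u \<in> H2" using u by (simp add: weak_solution_def)
  have "(\<epsilon> * l2_norm (laplacian u))\<^sup>2 \<le> 4 / \<alpha> * (l2_norm f)\<^sup>2"
    using e0_ge(1)[of u] weak_solution_energy_le(3)[OF u f] by (simp add: power_mult_distrib)
  also have "\<dots> = (2 / sqrt \<alpha> * l2_norm f)\<^sup>2"
    using alpha_pos by (simp add: power_mult_distrib power_divide)
  finally have "\<epsilon> * l2_norm (laplacian u) \<le> 2 / sqrt \<alpha> * l2_norm f"
    by (rule power2_le_imp_le) (use alpha_pos in auto)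
  then have "\<epsilon> * l2_norm (laplacian u) / \<epsilon> \<le> (2 / sqrt \<alpha> * l2_norm f) / \<epsilon>"
    by (rule divide_right_mono) (use eps in simp)
  then have "l2_norm (laplacian u) \<le> 2 / (\<epsilon> * sqrt \<alpha>) * l2_norm f" using eps by (simp add: mult.commute)
  moreover have "l2_norm (\<lambda>x. u x - laplacian u x) \<le> l2_norm u + l2_norm (laplacian u)"
    by (intro l2_norm_triangle_diff H2_L2 laplacian_L2 uH)
  ultimately show ?thesis using weak_solution_energy_le(2)[OF u f] by (simp add: distrib_right)
qed

lemma weak_solution_unique:
  assumes u: "weak_solution \<mu> u f" and v: "weak_solution \<mu> v f" and f: "f \<in> L2"
  shows "AE x in lborel. u x = v x"
proof -
  have uH: "u \<in> H2" and vH: "v \<in> H2" using u v by (simp_all add: weak_solution_def)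
  have w: "weak_solution \<mu> (\<lambda>x. u x - v x) (\<lambda>_. 0)"
    unfolding weak_solution_def
  proof (intro conjI ballI)
    show "(\<lambda>x. u x - v x) \<in> H2" by (rule H2_diff(1)[OF uH vH])
    fix h :: "'a \<Rightarrow> complex" assume h: "h \<in> H2"
    note m = borel_measurable_cont_rep[OF uH] borel_measurable_cont_rep[OF vH] borel_measurable_cont_rep[OF h]
    note [measurable] = m
    have b: "norm (cont_rep w x * cnj (cont_rep h x)) \<le> sqrt (B * e0 w) * sqrt (B * e0 h)" if "w \<in> H2" for w and x :: 'a
      unfolding norm_mult complex_mod_cnj by (intro mult_mono norm_cont_rep_le that h real_sqrt_ge_zero B_e0_nonneg norm_ge_zero)
    have "signed_integral \<mu> (\<lambda>x. cont_rep u x * cnj (cont_rep h x) - cont_rep v x * cnj (cont_rep h x))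
        = signed_integral \<mu> (\<lambda>x. cont_rep u x * cnj (cont_rep h x)) - signed_integral \<mu> (\<lambda>x. cont_rep v x * cnj (cont_rep h x))"
      by (rule signed_integral_linear(2)[OF signed _ b[OF uH] _ b[OF vH]]) measurable
    moreover have "E0 u h + signed_integral \<mu> (\<lambda>x. cont_rep u x * cnj (cont_rep h x)) = E0 v h + signed_integral \<mu> (\<lambda>x. cont_rep v x * cnj (cont_rep h x))"
      using u v h by (simp add: weak_solution_def)
    ultimately show "E0 (\<lambda>x. u x - v x) h + signed_integral \<mu> (\<lambda>x. cont_rep (\<lambda>x. u x - v x) x * cnj (cont_rep h x)) = l2_inner (\<lambda>_. 0) h"
      unfolding E0_diff_left[OF uH vH h] cont_rep_diff[OF uH vH dim] left_diff_distrib
      by (simp add: l2_inner_def add_diff_eq diff_add_eq diff_diff_eq)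
  qed
  have "l2_norm (\<lambda>x. u x - v x) = 0"
    using weak_solution_energy_le(2)[OF w] by (simp add: order_antisym)
  then show ?thesis
    using l2_norm_eq_0_iff[OF L2_diff[OF H2_L2[OF uH] H2_L2[OF vH]]] by simp
qed

lemma boundedly_invertible_shifted: "boundedly_invertible (shifted (schroedinger \<epsilon> \<mu>) \<alpha>)"
  unfolding boundedly_invertible_def
proof (intro exI[of _ "2 / \<alpha>"] ballI)
  fix f :: "'a \<Rightarrow> complex" assume f: "f \<in> L2"
  obtain u where u: "weak_solution \<mu> u f" using weak_solution_exists[OF f] by blast
  show "\<exists>u\<in>L2. (u, f) \<in> shifted (schroedinger \<epsilon> \<mu>) \<alpha> \<and> l2_norm u \<le> 2 / \<alpha> * l2_norm f \<and>
      (\<forall>u'. (u', f) \<in> shifted (schroedinger \<epsilon> \<mu>) \<alpha> \<longrightarrow> (AE x in lborel. u' x = u x))"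
    unfolding shifted_iff_weak_solution[OF f]
  proof (intro bexI[of _ u] conjI allI impI)
    show "u \<in> L2" using u by (simp add: weak_solution_def H2_L2)
  qed (use u weak_solution_energy_le(2)[OF u f] weak_solution_unique[OF _ u f] in auto)
qed

lemma weak_solution_resolvent:
  assumes f: "f \<in> L2"
  shows "weak_solution \<mu> (resolvent (schroedinger \<epsilon> \<mu>) \<alpha> f) f"
  using someI_ex[OF weak_solution_exists[OF f]]
  unfolding resolvent_def op_inverse_def shifted_iff_weak_solution[OF f] .

end

section \<open>Comparison of the resolvents\<close>

text \<open>The majorant \<open>g\<close> will be the inner integral of the theorem as a function of
  \<open>x\<close>, whose measurability is not established. The constant is therefore moved to the
  side of the measurable \<open>f\<close>.\<close>

lemma nn_integral_le_cmult:
  assumes [measurable]: "f \<in> borel_measurable M" and D: "0 < D" and le: "\<And>x. f x \<le> ennreal D * g x"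
  shows "(\<integral>\<^sup>+x. f x \<partial>M) \<le> ennreal D * (\<integral>\<^sup>+x. g x \<partial>M)"
proof -
  have inv: "ennreal D * ennreal (1 / D) = 1" using D by (simp add: ennreal_mult[symmetric])
  have "ennreal (1 / D) * f x \<le> g x" for x
  proof -
    have "ennreal (1 / D) * f x \<le> ennreal (1 / D) * (ennreal D * g x)" by (intro mult_left_mono le) auto
    also have "\<dots> = g x" using inv by (simp add: mult.assoc[symmetric] mult.commute)
    finally show ?thesis .
  qed
  then have "(\<integral>\<^sup>+x. ennreal (1 / D) * f x \<partial>M) \<le> (\<integral>\<^sup>+x. g x \<partial>M)" by (intro nn_integral_mono)
  then have "ennreal D * (ennreal (1 / D) * (\<integral>\<^sup>+x. f x \<partial>M)) \<le> ennreal D * (\<integral>\<^sup>+x. g x \<partial>M)"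
    by (intro mult_left_mono) (simp_all add: nn_integral_cmult)
  then show ?thesis by (simp add: mult.assoc[symmetric] inv)
qed

lemma square_integral_le:
  assumes "finite_measure M" and f: "f \<in> borel_measurable M"
  shows "ennreal ((LINT x|M. norm (f x))\<^sup>2) \<le> ennreal (measure M (space M)) * (\<integral>\<^sup>+x. ennreal ((norm (f x))\<^sup>2) \<partial>M)"
proof -
  interpret finite_measure M by fact
  note [measurable] = f
  have "ennreal (LINT x|M. norm (f x)) \<le> (\<integral>\<^sup>+x. ennreal (norm (f x)) \<partial>M)"
    by (cases "integrable M (\<lambda>x. norm (f x))") (auto simp: nn_integral_eq_integral not_integrable_integral_eq)
  then have "ennreal ((LINT x|M. norm (f x))\<^sup>2) \<le> (\<integral>\<^sup>+x. 1 * ennreal (norm (f x)) \<partial>M)\<^sup>2"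
    by (simp add: ennreal_power[symmetric] power_mono)
  also have "\<dots> \<le> (\<integral>\<^sup>+x. 1\<^sup>2 \<partial>M) * (\<integral>\<^sup>+x. (ennreal (norm (f x)))\<^sup>2 \<partial>M)"
    by (rule Cauchy_Schwarz_nn_integral) auto
  finally show ?thesis by (simp add: ennreal_power emeasure_eq_measure)
qed

lemma op_norm_square_le:
  assumes "\<And>f. f \<in> L2 \<Longrightarrow> l2_norm f \<le> 1 \<Longrightarrow> ennreal ((l2_norm (T f))\<^sup>2) \<le> X"
  shows "(op_norm T)\<^sup>2 \<le> X"
proof (cases X)
  case (real x)
  have "ennreal (l2_norm (T f)) \<le> ennreal (sqrt x)" if "f \<in> L2" "l2_norm f \<le> 1" for f
    using assms[OF that] real by (intro ennreal_leI real_le_rsqrt) simp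
  then have "op_norm T \<le> ennreal (sqrt x)" unfolding op_norm_def by (intro SUP_least) auto
  then have "(op_norm T)\<^sup>2 \<le> (ennreal (sqrt x))\<^sup>2" by (intro power_mono) auto
  then show ?thesis using real by (simp add: ennreal_power)
qed simp

context green_params
begin

section \<open>Factoring the potential through the double kernel\<close>

text \<open>Fubini is applied to the double kernel multiplied by \<phi> a, which is absolutely
  integrable over \<open>M\<close> times Lebesgue measure. Integrability of the kernel alone in
  \<open>y\<close> is recovered by dividing, hence only where \<phi> a is nonzero.\<close>

lemma green_product_fubini:
  fixes \<phi> :: "'a::euclidean_space \<Rightarrow> complex"
  assumes dim: "DIM('a) < 4" and M: "finite_measure M" "sets M = sets borel" and \<phi>: "\<phi> \<in> L2"
  defines "k \<equiv> \<lambda>x a. LINT y|M. complex_of_real (green_01 (y - a)) * green_eps \<epsilon> \<alpha> (x - y)"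
  shows "k x \<in> borel_measurable borel"
    and "AE a in lborel. \<phi> a \<noteq> 0 \<longrightarrow> integrable M (\<lambda>y. complex_of_real (green_01 (y - a)) * green_eps \<epsilon> \<alpha> (x - y))"
    and "integrable lborel (\<lambda>a. k x a * \<phi> a)"
    and "pot s M (conv (ker exp_wt) \<phi>) x = (LINT a|lborel. k x a * \<phi> a)"
proof -
  interpret finite_measure M by fact
  note [measurable_cong] = M(2)
  define K where "K y a = complex_of_real (green_01 (y - a)) * complex_of_real (ker s (x - y))" for y a
  define H where "H y a = K y a * \<phi> a" for y a
  have k_eq: "k x = (\<lambda>a. LINT y|M. K y a)" unfolding k_def K_def green_eps_eq[OF dim] ..
  have [measurable]: "(ker s :: 'a \<Rightarrow> real) \<in> borel_measurable borel" "\<phi> \<in> borel_measurable borel"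
    "(green_01 :: 'a \<Rightarrow> real) \<in> borel_measurable borel"
    using borel_measurable_ker[OF wt_s] L2_measurable[OF \<phi>] borel_measurable_green_01[OF dim] by auto
  have Km [measurable]: "case_prod K \<in> borel_measurable (M \<Otimes>\<^sub>M lborel)" unfolding K_def by measurable
  have Hm: "case_prod H \<in> borel_measurable (M \<Otimes>\<^sub>M lborel)" unfolding H_def by measurable
  show "k x \<in> borel_measurable borel"
    unfolding k_eq K_def by measurable
  have kl: "real_L2 (ker exp_wt :: 'a \<Rightarrow> real)" by (rule ker_real_L2[OF wt_exp dim])
  define A where "A = l2_norm (cpx (ker exp_wt :: 'a \<Rightarrow> real)) * l2_norm \<phi>"
  define C where "C = \<omega> powr (- 1 / 4) * kbound TYPE('a)"
  have C: "\<bar>ker s z\<bar> \<le> C" for z :: 'a unfolding C_def by (rule abs_ker_s_le[OF dim])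
  \<comment> \<open>For each fixed \<open>y\<close> the unspecified value of \<open>green_01\<close>
    matters only at a = y, a null set. Cauchy-Schwarz then bounds the integral over \<open>a\<close>
    uniformly in \<open>y\<close>, even if \<open>M\<close> has atoms.\<close>
  have inner: "(\<integral>\<^sup>+a. ennreal (norm (H y a)) \<partial>lborel) \<le> ennreal (C * A)" for y
  proof -
    have L: "(\<lambda>a. complex_of_real (ker exp_wt (y - a))) \<in> L2" "l2_norm (\<lambda>a. complex_of_real (ker exp_wt (y - a))) = l2_norm (cpx (ker exp_wt :: 'a \<Rightarrow> real))"
      using L2_reflect[of "cpx (ker exp_wt :: 'a \<Rightarrow> real)" y] kl by (auto simp: real_L2_def)
    note [measurable] = L2_measurable[OF L(1)]
    have "(\<integral>\<^sup>+a. ennreal (norm (H y a)) \<partial>lborel)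
        \<le> (\<integral>\<^sup>+a. ennreal C * ennreal (norm (complex_of_real (ker exp_wt (y - a))) * norm (\<phi> a)) \<partial>lborel)"
    proof (rule nn_integral_mono_AE, use green_01_AE[OF dim, of y] in eventually_elim)
      fix a assume a: "green_01 (y - a) = ker exp_wt (y - a)"
      have "norm (H y a) = \<bar>ker s (x - y)\<bar> * (norm (complex_of_real (ker exp_wt (y - a))) * norm (\<phi> a))"
        by (simp add: H_def K_def a norm_mult)
      also have "\<dots> \<le> C * (norm (complex_of_real (ker exp_wt (y - a))) * norm (\<phi> a))"
        by (intro mult_right_mono C) auto
      finally show "ennreal (norm (H y a)) \<le> ennreal C * ennreal (norm (complex_of_real (ker exp_wt (y - a))) * norm (\<phi> a))"
        by (subst ennreal_mult''[symmetric]) (auto intro: ennreal_leI)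
    qed
    also have "\<dots> = ennreal C * (\<integral>\<^sup>+a. ennreal (norm (complex_of_real (ker exp_wt (y - a))) * norm (\<phi> a)) \<partial>lborel)"
      by (rule nn_integral_cmult) measurable
    also have "\<dots> \<le> ennreal C * ennreal A"
      using nn_cauchy_schwarz_L2[OF L(1) \<phi>] by (intro mult_left_mono) (simp_all add: L(2) A_def)
    finally show ?thesis by (simp add: ennreal_mult''[symmetric] A_def)
  qed
  have "(\<integral>\<^sup>+y. (\<integral>\<^sup>+a. ennreal (norm (H y a)) \<partial>lborel) \<partial>M) \<le> (\<integral>\<^sup>+y. ennreal (C * A) \<partial>M)"
    by (intro nn_integral_mono inner)
  also have "\<dots> < \<infinity>" by (simp add: emeasure_eq_measure ennreal_mult_less_top)
  finally have fin: "(\<integral>\<^sup>+y. (\<integral>\<^sup>+a. ennreal (norm (H y a)) \<partial>lborel) \<partial>M) < \<infinity>" .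
  note F = sigma_finite_measure_axioms lborel.sigma_finite_measure_axioms Hm fin
  show "AE a in lborel. \<phi> a \<noteq> 0 \<longrightarrow> integrable M (\<lambda>y. complex_of_real (green_01 (y - a)) * green_eps \<epsilon> \<alpha> (x - y))"
    using fubini_AE_snd[OF F]
  proof eventually_elim
    case (elim a)
    show ?case
    proof
      assume "\<phi> a \<noteq> 0"
      then have "K y a = H y a * inverse (\<phi> a)" for y by (simp add: H_def)
      then have "integrable M (\<lambda>y. K y a)" using integrable_mult_left[OF elim, of "inverse (\<phi> a)"] by simp
      then show "integrable M (\<lambda>y. complex_of_real (green_01 (y - a)) * green_eps \<epsilon> \<alpha> (x - y))"
        by (simp only: K_def green_eps_eq[OF dim])
    qed
  qed
  have kH: "(\<lambda>a. k x a * \<phi> a) = (\<lambda>a. LINT y|M. H y a)" by (simp add: k_eq H_def)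
  show "integrable lborel (\<lambda>a. k x a * \<phi> a)" unfolding kH by (rule fubini_integrable_snd[OF F])
  have "ker s (x - y) *\<^sub>R conv (ker exp_wt) \<phi> y = (LINT a|lborel. H y a)" for y
  proof -
    have [measurable]: "(ker exp_wt :: 'a \<Rightarrow> real) \<in> borel_measurable borel" by (rule borel_measurable_ker[OF wt_exp])
    have "conv (ker exp_wt) \<phi> y = (LINT a|lborel. complex_of_real (green_01 (y - a)) * \<phi> a)"
      unfolding conv_def scaleR_conv_of_real
      by (rule integral_cong_AE) (use green_01_AE[OF dim, of y] in auto)
    then show ?thesis
      by (simp add: H_def K_def scaleR_conv_of_real mult_ac integral_mult_right_zero[symmetric] del: integral_mult_right_zero)
  qed
  then have "pot s M (conv (ker exp_wt) \<phi>) x = (LINT y|M. LINT a|lborel. H y a)" by (simp add: pot_def)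
  then show "pot s M (conv (ker exp_wt) \<phi>) x = (LINT a|lborel. k x a * \<phi> a)"
    unfolding kH fubini_eq[OF F] .
qed

text \<open>Writing \<open>v\<close> as the Green potential of v - \<Delta> v makes
  \<open>spot\<close> an integral in \<open>a\<close> against the double kernel, to which
  Cauchy-Schwarz applies.\<close>

lemma spot_cont_rep_square_le:
  fixes v :: "'a::euclidean_space \<Rightarrow> complex"
  assumes dim: "DIM('a) < 4" and \<nu>: "signed_measure \<nu>" and v: "v \<in> H2"
  shows "ennreal ((norm (spot \<nu> (cont_rep v) x))\<^sup>2) \<le> ennreal ((l2_norm (\<lambda>x. v x - laplacian v x))\<^sup>2) *
     (\<integral>\<^sup>+a. ennreal ((norm (signed_integral \<nu>
        (\<lambda>y. complex_of_real (green_01 (y - a)) * green_eps \<epsilon> \<alpha> (x - y))))\<^sup>2) \<partial>lborel)"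
proof -
  define \<phi> where "\<phi> = (\<lambda>x. v x - laplacian v x)"
  have \<phi>: "\<phi> \<in> L2" unfolding \<phi>_def by (intro L2_diff H2_L2 laplacian_L2 v)
  define k where "k M a = (LINT y|M. complex_of_real (green_01 (y - a)) * green_eps \<epsilon> \<alpha> (x - y))" for M a
  define S where "S a = signed_integral \<nu> (\<lambda>y. complex_of_real (green_01 (y - a)) * green_eps \<epsilon> \<alpha> (x - y))" for a
  note P = green_product_fubini[OF dim finite_parts(1)[OF \<nu>] sets_parts(1) \<phi>, of x, folded k_def]
  note N = green_product_fubini[OF dim finite_parts(2)[OF \<nu>] sets_parts(2) \<phi>, of x, folded k_def]
  have [measurable]: "k (pos_part \<nu>) \<in> borel_measurable borel" "k (neg_part \<nu>) \<in> borel_measurable borel" "\<phi> \<in> borel_measurable borel"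
    using P(1) N(1) L2_measurable[OF \<phi>] by (simp_all add: k_def[abs_def])
  obtain A where A: "\<And>x. norm (cont_rep v x) \<le> A" using bounded_cont_rep[OF v dim] by blast
  have vm: "cont_rep v \<in> borel_measurable borel"
    by (intro borel_measurable_continuous_onI continuous_cont_rep v dim)
  \<comment> \<open>Where \<phi> a = 0 one of the Jordan parts may fail to be integrable, and there
    \<open>signed_integral\<close> is 0 by convention while the difference of the two integrals need
    not be. Setting \<open>k'\<close> to 0 there does not change k' * \<phi> and keeps it below
    \<open>S\<close>.\<close>
  define k' where "k' a = (if \<phi> a = 0 then 0 else k (pos_part \<nu>) a - k (neg_part \<nu>) a)" for a
  have [measurable]: "k' \<in> borel_measurable borel" unfolding k'_def by measurable
  have "AE a in lborel. norm (k' a) \<le> norm (S a)"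
    using P(2) N(2) by eventually_elim (auto simp: k'_def S_def signed_integral_def k_def)
  then have k'_le: "(\<integral>\<^sup>+a. (ennreal (norm (k' a)))\<^sup>2 \<partial>lborel) \<le> (\<integral>\<^sup>+a. ennreal ((norm (S a))\<^sup>2) \<partial>lborel)"
    by (intro nn_integral_mono_AE) (auto simp: ennreal_power elim!: eventually_mono intro!: ennreal_leI power_mono)
  have "spot \<nu> (cont_rep v) x = (LINT a|lborel. k (pos_part \<nu>) a * \<phi> a) - (LINT a|lborel. k (neg_part \<nu>) a * \<phi> a)"
    unfolding spot_eq[OF \<nu> dim vm A] unfolding cont_rep_eq_conv[OF v dim] \<phi>_def[symmetric] P(4) N(4) ..
  also have "\<dots> = (LINT a|lborel. k' a * \<phi> a)"
    unfolding Bochner_Integration.integral_diff[OF P(3) N(3), symmetric]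
    by (rule Bochner_Integration.integral_cong) (auto simp: k'_def left_diff_distrib)
  finally have F: "spot \<nu> (cont_rep v) x = (LINT a|lborel. k' a * \<phi> a)" .
  have "(\<lambda>a. k' a * \<phi> a) = (\<lambda>a. k (pos_part \<nu>) a * \<phi> a - k (neg_part \<nu>) a * \<phi> a)"
    by (auto simp: k'_def left_diff_distrib)
  then have "integrable lborel (\<lambda>a. k' a * \<phi> a)"
    using Bochner_Integration.integrable_diff[OF P(3) N(3)] by simp
  then have "ennreal (norm (spot \<nu> (cont_rep v) x)) \<le> (\<integral>\<^sup>+a. ennreal (norm (k' a * \<phi> a)) \<partial>lborel)"
    unfolding F by (rule integral_norm_bound_ennreal)
  also have "\<dots> = (\<integral>\<^sup>+a. ennreal (norm (k' a)) * ennreal (norm (\<phi> a)) \<partial>lborel)"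
    by (simp add: norm_mult ennreal_mult)
  finally have "(ennreal (norm (spot \<nu> (cont_rep v) x)))\<^sup>2 \<le> (\<integral>\<^sup>+a. ennreal (norm (k' a)) * ennreal (norm (\<phi> a)) \<partial>lborel)\<^sup>2"
    by (intro power_mono) auto
  also have "\<dots> \<le> (\<integral>\<^sup>+a. (ennreal (norm (k' a)))\<^sup>2 \<partial>lborel) * (\<integral>\<^sup>+a. (ennreal (norm (\<phi> a)))\<^sup>2 \<partial>lborel)"
    by (rule Cauchy_Schwarz_nn_integral) auto
  also have "(\<integral>\<^sup>+a. (ennreal (norm (\<phi> a)))\<^sup>2 \<partial>lborel) = ennreal ((l2_norm \<phi>)\<^sup>2)"
    using nn_l2_norm[OF \<phi>] by (simp add: ennreal_power)
  also have "(\<integral>\<^sup>+a. (ennreal (norm (k' a)))\<^sup>2 \<partial>lborel) * ennreal ((l2_norm \<phi>)\<^sup>2)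
      \<le> (\<integral>\<^sup>+a. ennreal ((norm (S a))\<^sup>2) \<partial>lborel) * ennreal ((l2_norm \<phi>)\<^sup>2)"
    by (intro mult_right_mono k'_le) auto
  finally show ?thesis unfolding S_def \<phi>_def by (simp add: ennreal_power mult.commute)
qed

end

section \<open>Comparison of the solutions for two measures\<close>

context perturbed
begin

text \<open>Subtracting the weak equations leaves the mismatch of the two measures on
  \<open>v\<close>, and \<open>F\<close> is the potential whose form cancels it. What remains is
  that z = v - u - F satisfies E0 z h + \<mu>(z h) = - \<mu>(F h), tested with h = z.\<close>

lemma weak_solution_difference:
  assumes \<kappa>: "signed_measure \<kappa>" and u: "weak_solution \<mu> u f" and v: "weak_solution \<kappa> v f"
  defines "F \<equiv> spot (\<lambda>A. \<mu> A - \<kappa> A) (cont_rep v)"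
  shows "F \<in> H2" "continuous_on UNIV F"
    and "\<alpha> * (l2_norm (\<lambda>x. v x - u x - F x))\<^sup>2 \<le> 4 * B * (LINT x|abs_measure \<mu>. norm (F x))\<^sup>2"
proof -
  define \<nu> where "\<nu> = (\<lambda>A. \<mu> A - \<kappa> A)"
  have \<nu>: "signed_measure \<nu>" unfolding \<nu>_def by (rule signed_measure_diff[OF signed \<kappa>])
  have uH: "u \<in> H2" and vH: "v \<in> H2" using u v by (simp_all add: weak_solution_def)
  note vm = borel_measurable_cont_rep[OF vH]
  note F_spot = F_def[folded \<nu>_def]
  show FH: "F \<in> H2" unfolding F_spot by (rule spot_H2[OF \<nu> dim vm norm_cont_rep_le[OF vH]])
  show Fc: "continuous_on UNIV F" unfolding F_spot by (rule continuous_spot[OF \<nu> dim vm norm_cont_rep_le[OF vH]])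
  have cF: "cont_rep F = F" by (rule cont_rep_eqI[OF Fc]) simp
  define z where "z = (\<lambda>x. v x - u x - F x)"
  have wH: "(\<lambda>x. v x - u x) \<in> H2" by (rule H2_diff(1)[OF vH uH])
  have zH: "z \<in> H2" unfolding z_def by (rule H2_diff(1)[OF wH FH])
  have cz: "cont_rep z = (\<lambda>x. cont_rep v x - cont_rep u x - F x)"
    unfolding z_def cont_rep_diff[OF wH FH dim] cont_rep_diff[OF vH uH dim] cF ..
  define Q where "Q \<rho> w = signed_integral \<rho> (\<lambda>x. cont_rep w x * cnj (cont_rep z x))" for \<rho> and w :: "'a \<Rightarrow> complex"
  have b: "norm (cont_rep w x * cnj (cont_rep z x)) \<le> sqrt (B * e0 w) * sqrt (B * e0 z)"
    and bm: "(\<lambda>x. cont_rep w x * cnj (cont_rep z x)) \<in> borel_measurable borel" if "w \<in> H2" for w and x :: 'a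
  proof -
    show "norm (cont_rep w x * cnj (cont_rep z x)) \<le> sqrt (B * e0 w) * sqrt (B * e0 z)"
      unfolding norm_mult complex_mod_cnj by (intro mult_mono norm_cont_rep_le that zH real_sqrt_ge_zero B_e0_nonneg norm_ge_zero)
    note [measurable] = borel_measurable_cont_rep[OF that] borel_measurable_cont_rep[OF zH]
    show "(\<lambda>x. cont_rep w x * cnj (cont_rep z x)) \<in> borel_measurable borel" by measurable
  qed
  have Ez: "E0 z z = E0 v z - E0 u z - E0 F z"
    unfolding z_def E0_diff_left[OF wH FH zH[unfolded z_def]] E0_diff_left[OF vH uH zH[unfolded z_def]] ..
  have Ev: "E0 v z = E0 u z + Q \<mu> u - Q \<kappa> v"
    using u v zH by (simp add: weak_solution_def Q_def eq_diff_eq)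
  have EF: "E0 F z = Q \<mu> v - Q \<kappa> v"
    unfolding F_spot E0_spot[OF \<nu> dim vm norm_cont_rep_le[OF vH] zH] unfolding \<nu>_def Q_def
    by (rule signed_integral_diff_measure[OF signed \<kappa> bm b]) (rule vH)+
  have Qz: "Q \<mu> z = Q \<mu> v - Q \<mu> u - Q \<mu> F"
  proof -
    have "Q \<mu> (\<lambda>x. v x - u x) = Q \<mu> v - Q \<mu> u"
      unfolding Q_def cont_rep_diff[OF vH uH dim] left_diff_distrib
      by (rule signed_integral_linear(2)[OF signed bm b bm b]) (rule uH vH)+
    moreover have "Q \<mu> z = Q \<mu> (\<lambda>x. v x - u x) - Q \<mu> F"
    proof -
      have "Q \<mu> z = signed_integral \<mu> (\<lambda>x. cont_rep (\<lambda>x. v x - u x) x * cnj (cont_rep z x) - cont_rep F x * cnj (cont_rep z x))"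
        unfolding Q_def left_diff_distrib[symmetric] by (simp add: cz cF cont_rep_diff[OF vH uH dim])
      also have "\<dots> = Q \<mu> (\<lambda>x. v x - u x) - Q \<mu> F"
        unfolding Q_def by (rule signed_integral_linear(2)[OF signed bm b bm b]) (rule wH FH)+
      finally show ?thesis .
    qed
    ultimately show ?thesis by simp
  qed
  have "E0 z z = - Q \<mu> z - Q \<mu> F" unfolding Ez Ev EF Qz by simp
  then have "norm (complex_of_real (e0 z)) \<le> norm (Q \<mu> z) + norm (Q \<mu> F)"
    unfolding E0_self[OF zH] using norm_triangle_ineq4[of "- Q \<mu> z" "Q \<mu> F"] by simp
  moreover have "norm (Q \<mu> z) \<le> e0 z / 2" unfolding Q_def by (rule norm_signed_integral_square_le[OF zH])
  ultimately have e: "e0 z \<le> 2 * norm (Q \<mu> F)" using e0_nonneg[of z] by simp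
  define J where "J = (LINT x|abs_measure \<mu>. norm (F x))"
  have J0: "0 \<le> J" unfolding J_def by (rule Bochner_Integration.integral_nonneg) auto
  have Fm: "F \<in> borel_measurable borel" by (rule borel_measurable_continuous_onI[OF Fc])
  have Fb: "norm (F x) \<le> sqrt (B * e0 F)" for x using norm_cont_rep_le[OF FH, of x] by (simp add: cF)
  note fin = finite_abs_measure(1)[OF signed]
  have "norm (Q \<mu> F) \<le> (LINT x|abs_measure \<mu>. norm (cont_rep F x * cnj (cont_rep z x)))"
    unfolding Q_def by (rule norm_signed_integral_le(1)[OF signed bm[OF FH] b[OF FH]])
  also have "\<dots> \<le> (LINT x|abs_measure \<mu>. norm (F x) * sqrt (B * e0 z))"
  proof (rule integral_mono)
    show "integrable (abs_measure \<mu>) (\<lambda>x. norm (cont_rep F x * cnj (cont_rep z x)))"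
      by (rule integrable_norm[OF bounded_integrable_finite[OF fin _ bm[OF FH] b[OF FH]]]) simp
    show "integrable (abs_measure \<mu>) (\<lambda>x. norm (F x) * sqrt (B * e0 z))"
      by (rule integrable_mult_left[OF integrable_norm[OF bounded_integrable_finite[OF fin _ Fm Fb]]]) simp
    show "norm (cont_rep F x * cnj (cont_rep z x)) \<le> norm (F x) * sqrt (B * e0 z)" for x
      unfolding norm_mult complex_mod_cnj cF by (intro mult_left_mono norm_cont_rep_le zH norm_ge_zero)
  qed
  also have "\<dots> = J * sqrt (B * e0 z)" unfolding J_def by simp
  finally have "e0 z \<le> 2 * J * sqrt (B * e0 z)" using e by simp
  \<comment> \<open>Squaring removes the root, after which one factor e0 z cancels.\<close>
  then have "(e0 z)\<^sup>2 \<le> (2 * J * sqrt (B * e0 z))\<^sup>2" by (intro power_mono e0_nonneg)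
  also have "\<dots> = 4 * B * J\<^sup>2 * e0 z" using B_e0_nonneg[of z] by (simp add: power_mult_distrib)
  finally have "e0 z * e0 z \<le> 4 * B * J\<^sup>2 * e0 z" by (simp add: power2_eq_square)
  then have "e0 z \<le> 4 * B * J\<^sup>2"
    using e0_nonneg[of z] B_pos by (cases "e0 z = 0") auto
  then show "\<alpha> * (l2_norm (\<lambda>x. v x - u x - F x))\<^sup>2 \<le> 4 * B * (LINT x|abs_measure \<mu>. norm (F x))\<^sup>2"
    using e0_ge(2)[of z] unfolding z_def[symmetric] J_def[symmetric] by simp
qed

text \<open>\<open>D\<close> is the squared bound for v - \<Delta> v. The factor 2 comes from (a +
  b)^2 <= 2 a^2 + 2 b^2 applied to F + z; for \<open>z\<close> it multiplies 4 B / \<alpha>, and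
  Cauchy-Schwarz over the total variation of \<mu> contributes the total mass. The second measure
  \<kappa> enters neither constant.\<close>

lemma resolvent_difference_le:
  fixes \<kappa> :: "'a set \<Rightarrow> real"
  assumes \<kappa>: "perturbed \<epsilon> \<alpha> B \<kappa>"
  defines "D \<equiv> (2 / \<alpha> + 2 / (\<epsilon> * sqrt \<alpha>))\<^sup>2"
    and "I \<equiv> \<lambda>x. \<integral>\<^sup>+a. ennreal ((norm (signed_integral (\<lambda>A. \<mu> A - \<kappa> A)
        (\<lambda>y. complex_of_real (green_01 (y - a)) * green_eps \<epsilon> \<alpha> (x - y))))\<^sup>2) \<partial>lborel"
  shows "(op_norm (\<lambda>f x. resolvent (schroedinger \<epsilon> \<kappa>) \<alpha> f x - resolvent (schroedinger \<epsilon> \<mu>) \<alpha> f x))\<^sup>2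
    \<le> ennreal (2 * D) * (\<integral>\<^sup>+x. I x \<partial>lborel)
      + ennreal (8 * B * total_mass \<mu> / \<alpha> * D) * (\<integral>\<^sup>+x. I x \<partial>abs_measure \<mu>)"
proof (rule op_norm_square_le)
  interpret \<kappa>: perturbed \<epsilon> \<alpha> B \<kappa> by fact
  have "0 < 2 / \<alpha> + 2 / (\<epsilon> * sqrt \<alpha>)" using eps alpha_pos by (intro add_pos_pos divide_pos_pos mult_pos_pos) auto
  then have D: "0 < D" unfolding D_def by (rule zero_less_power)
  fix f :: "'a \<Rightarrow> complex" assume f: "f \<in> L2" "l2_norm f \<le> 1"
  define u where "u = resolvent (schroedinger \<epsilon> \<mu>) \<alpha> f"
  define v where "v = resolvent (schroedinger \<epsilon> \<kappa>) \<alpha> f"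
  have u: "weak_solution \<mu> u f" unfolding u_def by (rule weak_solution_resolvent[OF f(1)])
  have v: "weak_solution \<kappa> v f" unfolding v_def by (rule \<kappa>.weak_solution_resolvent[OF f(1)])
  have uH: "u \<in> H2" and vH: "v \<in> H2" using u v by (simp_all add: weak_solution_def)
  define F where "F = spot (\<lambda>A. \<mu> A - \<kappa> A) (cont_rep v)"
  note diff = weak_solution_difference[OF \<kappa>.signed u v, folded F_def]
  have Fm [measurable]: "F \<in> borel_measurable borel" by (rule borel_measurable_continuous_onI[OF diff(2)])
  have FI: "ennreal ((norm (F x))\<^sup>2) \<le> ennreal D * I x" for x
  proof -
    have "l2_norm (\<lambda>x. v x - laplacian v x) \<le> (2 / \<alpha> + 2 / (\<epsilon> * sqrt \<alpha>)) * 1"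
      by (rule order_trans[OF \<kappa>.weak_solution_laplacian_le[OF v f(1)]], intro mult_left_mono f(2))
        (use eps alpha_pos in auto)
    then have "(l2_norm (\<lambda>x. v x - laplacian v x))\<^sup>2 \<le> D" unfolding D_def by (intro power_mono) auto
    then have "ennreal ((l2_norm (\<lambda>x. v x - laplacian v x))\<^sup>2) * I x \<le> ennreal D * I x"
      by (intro mult_right_mono ennreal_leI) auto
    then show ?thesis
      using spot_cont_rep_square_le[OF dim signed_measure_diff[OF signed \<kappa>.signed] vH, of x]
      unfolding F_def I_def by (rule order_trans[rotated])
  qed
  define z where "z = (\<lambda>x. v x - u x - F x)"
  have zL: "z \<in> L2" and FL: "F \<in> L2" unfolding z_def by (intro L2_diff[OF L2_diff] H2_L2 uH vH diff(1))+
  have "l2_norm (\<lambda>x. v x - u x) = l2_norm (\<lambda>x. F x + z x)" by (simp add: z_def)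
  also have "\<dots> \<le> l2_norm F + l2_norm z" by (rule l2_norm_triangle[OF FL zL])
  finally have "(l2_norm (\<lambda>x. v x - u x))\<^sup>2 \<le> (l2_norm F + l2_norm z)\<^sup>2" by (intro power_mono) auto
  also have "\<dots> \<le> 2 * (l2_norm F)\<^sup>2 + 2 * (l2_norm z)\<^sup>2"
    using sum_squares_bound[of "l2_norm F" "l2_norm z"] by (simp add: power2_sum)
  also have "(l2_norm z)\<^sup>2 \<le> 4 * B / \<alpha> * (LINT x|abs_measure \<mu>. norm (F x))\<^sup>2"
    using diff(3) alpha_pos unfolding z_def by (simp add: field_simps)
  finally have "ennreal ((l2_norm (\<lambda>x. v x - u x))\<^sup>2)
      \<le> ennreal (2 * (l2_norm F)\<^sup>2 + 8 * B / \<alpha> * (LINT x|abs_measure \<mu>. norm (F x))\<^sup>2)"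
    by (intro ennreal_leI) simp
  also have "\<dots> = ennreal (2 * (l2_norm F)\<^sup>2) + ennreal (8 * B / \<alpha> * (LINT x|abs_measure \<mu>. norm (F x))\<^sup>2)"
    by (rule ennreal_plus) (use B_pos alpha_pos in auto)
  also have "\<dots> = ennreal 2 * ennreal ((l2_norm F)\<^sup>2) + ennreal (8 * B / \<alpha>) * ennreal ((LINT x|abs_measure \<mu>. norm (F x))\<^sup>2)"
    by (intro arg_cong2[of _ _ _ _ "(+)"] ennreal_mult) (use B_pos alpha_pos in auto)
  also have "\<dots> \<le> ennreal 2 * (ennreal D * (\<integral>\<^sup>+x. I x \<partial>lborel))
      + ennreal (8 * B / \<alpha>) * (ennreal (total_mass \<mu>) * (ennreal D * (\<integral>\<^sup>+x. I x \<partial>abs_measure \<mu>)))"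
  proof (intro add_mono mult_left_mono)
    show "ennreal ((l2_norm F)\<^sup>2) \<le> ennreal D * (\<integral>\<^sup>+x. I x \<partial>lborel)"
      unfolding nn_l2_norm[OF FL, symmetric] by (rule nn_integral_le_cmult[OF _ D FI]) measurable
    have "ennreal ((LINT x|abs_measure \<mu>. norm (F x))\<^sup>2) \<le> ennreal (total_mass \<mu>) * (\<integral>\<^sup>+x. ennreal ((norm (F x))\<^sup>2) \<partial>abs_measure \<mu>)"
      using square_integral_le[OF finite_abs_measure(1)[OF signed], of F] finite_abs_measure(2)[OF signed] Fm
      by (simp cong: measurable_cong_sets)
    also have "\<dots> \<le> ennreal (total_mass \<mu>) * (ennreal D * (\<integral>\<^sup>+x. I x \<partial>abs_measure \<mu>))"
      by (rule mult_left_mono[OF nn_integral_le_cmult[OF _ D FI]]) (simp_all cong: measurable_cong_sets)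
    finally show "ennreal ((LINT x|abs_measure \<mu>. norm (F x))\<^sup>2) \<le> ennreal (total_mass \<mu>) * (ennreal D * (\<integral>\<^sup>+x. I x \<partial>abs_measure \<mu>))" .
  qed auto
  also have "\<dots> = ennreal (2 * D) * (\<integral>\<^sup>+x. I x \<partial>lborel)
      + ennreal (8 * B * total_mass \<mu> / \<alpha> * D) * (\<integral>\<^sup>+x. I x \<partial>abs_measure \<mu>)"
  proof -
    have "ennreal (8 * B * total_mass \<mu> / \<alpha> * D) = ennreal (8 * B / \<alpha>) * ennreal (total_mass \<mu>) * ennreal D"
      using B_pos alpha_pos D by (simp add: ennreal_mult[symmetric])
    moreover have "ennreal (2 * D) = ennreal 2 * ennreal D"
      using D by (intro ennreal_mult) auto
    ultimately show ?thesis by (simp only: mult.assoc)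
  qed
  finally show "ennreal ((l2_norm (\<lambda>x. resolvent (schroedinger \<epsilon> \<kappa>) \<alpha> f x - resolvent (schroedinger \<epsilon> \<mu>) \<alpha> f x))\<^sup>2)
    \<le> ennreal (2 * D) * (\<integral>\<^sup>+x. I x \<partial>lborel)
      + ennreal (8 * B * total_mass \<mu> / \<alpha> * D) * (\<integral>\<^sup>+x. I x \<partial>abs_measure \<mu>)"
    unfolding u_def v_def .
qed

end

section \<open>Choice of the threshold for \<alpha>\<close>

text \<open>\<open>kbound\<close> depends on \<epsilon> and the dimension but not on \<alpha>, while
  \<omega> grows like the square root of \<alpha>; hence the bound \<omega> powr (- 1/4) * kbound on
  the kernel tends to 0.\<close>

lemma ker_s_eventually_small:
  assumes eps: "0 < \<epsilon>" and B: "0 < B" and dim: "DIM('a::euclidean_space) < 4"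
  shows "\<exists>\<alpha>\<^sub>0>0. \<forall>\<alpha>>\<alpha>\<^sub>0. green_params \<epsilon> \<alpha> \<and> (\<forall>x::'a. \<bar>ker (green_params.s \<epsilon> \<alpha>) x\<bar> \<le> B)"
proof -
  define K where "K = green_params.kbound \<epsilon> TYPE('a)"
  have "filterlim (\<lambda>\<alpha>. - (green_params.c \<epsilon>)\<^sup>2 + (1 / \<epsilon>\<^sup>2) * \<alpha>) at_top at_top"
    using eps by (intro filterlim_tendsto_add_at_top[OF tendsto_const] filterlim_tendsto_pos_mult_at_top[OF tendsto_const] filterlim_ident) auto
  then have "((\<lambda>\<alpha>. sqrt (- (green_params.c \<epsilon>)\<^sup>2 + (1 / \<epsilon>\<^sup>2) * \<alpha>) powr (- 1 / 4) * K) \<longlongrightarrow> 0 * K) at_top"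
    by (intro tendsto_mult tendsto_const tendsto_neg_powr filterlim_compose[OF sqrt_at_top]) auto
  then have "eventually (\<lambda>\<alpha>. sqrt (- (green_params.c \<epsilon>)\<^sup>2 + (1 / \<epsilon>\<^sup>2) * \<alpha>) powr (- 1 / 4) * K < B) at_top"
    using B by (intro order_tendstoD(2)) auto
  then obtain N where N: "\<And>\<alpha>. N \<le> \<alpha> \<Longrightarrow> sqrt (- (green_params.c \<epsilon>)\<^sup>2 + (1 / \<epsilon>\<^sup>2) * \<alpha>) powr (- 1 / 4) * K < B"
    unfolding eventually_at_top_linorder by blast
  show ?thesis
  proof (intro exI[of _ "max (1 / (4 * \<epsilon>\<^sup>2)) N"] conjI allI impI)
    show "0 < max (1 / (4 * \<epsilon>\<^sup>2)) N" using eps by (simp add: less_max_iff_disj)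
    fix \<alpha> assume \<alpha>: "max (1 / (4 * \<epsilon>\<^sup>2)) N < \<alpha>"
    show "green_params \<epsilon> \<alpha>" using \<alpha> eps by unfold_locales auto
    then interpret green_params \<epsilon> \<alpha> .
    fix x :: 'a
    have "\<bar>ker s x\<bar> \<le> \<omega> powr (- 1 / 4) * K" unfolding K_def by (rule abs_ker_s_le[OF dim])
    also have "\<dots> < B" using N[of \<alpha>] \<alpha> by (simp add: \<omega>_def)
    finally show "\<bar>ker s x\<bar> \<le> B" by simp
  qed
qed

theorem mainTheorem4:
  fixes \<epsilon> :: real
    and m :: "'a::euclidean_space set \<Rightarrow> real"
    and \<mu> :: "nat \<Rightarrow> 'a set \<Rightarrow> real"
  assumes "DIM('a) \<in> {1, 2, 3}"
    and "\<epsilon> > 0"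
    and "signed_measure m"
    and "\<And>n. signed_measure (\<mu> n)"
    and "weakly_converges \<mu> m"
    and "bdd_above (range (\<lambda>n. total_mass (\<mu> n)))"
  shows "\<exists>\<alpha>\<^sub>0 > 0. \<forall>\<alpha> > \<alpha>\<^sub>0.
     boundedly_invertible (shifted (schroedinger \<epsilon> m) \<alpha>) \<and>
     (\<forall>n. boundedly_invertible (shifted (schroedinger \<epsilon> (\<mu> n)) \<alpha>)) \<and>
     (\<exists>C\<^sub>1 C\<^sub>2 :: real. 0 \<le> C\<^sub>1 \<and> 0 \<le> C\<^sub>2 \<and>
       (\<forall>n.
         (op_norm (\<lambda>f x. resolvent (schroedinger \<epsilon> (\<mu> n)) \<alpha> f x
                        - resolvent (schroedinger \<epsilon> m) \<alpha> f x))\<^sup>2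
         \<le> ennreal C\<^sub>1 *
             (\<integral>\<^sup>+x. (\<integral>\<^sup>+a. ennreal ((norm (signed_integral (\<lambda>A. m A - \<mu> n A)
                (\<lambda>y. complex_of_real (green_01 (y - a)) * green_eps \<epsilon> \<alpha> (x - y))))\<^sup>2)
              \<partial>lborel) \<partial>lborel)
           + ennreal C\<^sub>2 *
             (\<integral>\<^sup>+x. (\<integral>\<^sup>+a. ennreal ((norm (signed_integral (\<lambda>A. m A - \<mu> n A)
                (\<lambda>y. complex_of_real (green_01 (y - a)) * green_eps \<epsilon> \<alpha> (x - y))))\<^sup>2)
              \<partial>lborel) \<partial>abs_measure m)))"
proof -
  have dim: "DIM('a) < 4" using assms(1) by auto
  obtain b where b: "\<And>n. total_mass (\<mu> n) \<le> b" using assms(6) by (auto simp: bdd_above_def)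
  \<comment> \<open>A common bound for all total masses; adding 1 makes it positive. With B = 1 / (2
    L) the product of \<open>B\<close> and any of these masses is at most 1/2.\<close>
  define L where "L = max b (total_mass m) + 1"
  have L: "0 < L" "total_mass m \<le> L" "\<And>n. total_mass (\<mu> n) \<le> L"
    using b total_mass_nonneg[of m] unfolding L_def by (auto simp: add_increasing2 le_max_iff_disj add_nonneg_pos intro: order_trans)
  define B where "B = 1 / (2 * L)"
  have B: "0 < B" using L by (simp add: B_def)
  obtain \<alpha>\<^sub>0 where \<alpha>\<^sub>0: "\<alpha>\<^sub>0 > 0"
    "\<And>\<alpha>. \<alpha> > \<alpha>\<^sub>0 \<Longrightarrow> green_params \<epsilon> \<alpha> \<and> (\<forall>x::'a. \<bar>ker (green_params.s \<epsilon> \<alpha>) x\<bar> \<le> B)"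
    using ker_s_eventually_small[OF assms(2) B dim] by blast
  show ?thesis
  proof (rule exI[of _ \<alpha>\<^sub>0], intro conjI allI impI \<alpha>\<^sub>0(1))
    fix \<alpha> assume \<alpha>: "\<alpha> > \<alpha>\<^sub>0"
    have pert: "perturbed \<epsilon> \<alpha> B \<kappa>" if "signed_measure \<kappa>" "total_mass \<kappa> \<le> L" for \<kappa> :: "'a set \<Rightarrow> real"
      using \<alpha>\<^sub>0(2)[OF \<alpha>] that L(1) B dim
      by (auto simp: perturbed_def perturbed_axioms_def B_def divide_le_eq)
    interpret m: perturbed \<epsilon> \<alpha> B m by (rule pert[OF assms(3) L(2)])
    have \<mu>: "perturbed \<epsilon> \<alpha> B (\<mu> n)" for n by (rule pert[OF assms(4) L(3)])
    show "boundedly_invertible (shifted (schroedinger \<epsilon> m) \<alpha>)" by (rule m.boundedly_invertible_shifted)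
    show "boundedly_invertible (shifted (schroedinger \<epsilon> (\<mu> n)) \<alpha>)" for n
      by (rule perturbed.boundedly_invertible_shifted[OF \<mu>])
    show "\<exists>C\<^sub>1 C\<^sub>2 :: real. 0 \<le> C\<^sub>1 \<and> 0 \<le> C\<^sub>2 \<and>
       (\<forall>n.
         (op_norm (\<lambda>f x. resolvent (schroedinger \<epsilon> (\<mu> n)) \<alpha> f x
                        - resolvent (schroedinger \<epsilon> m) \<alpha> f x))\<^sup>2
         \<le> ennreal C\<^sub>1 *
             (\<integral>\<^sup>+x. (\<integral>\<^sup>+a. ennreal ((norm (signed_integral (\<lambda>A. m A - \<mu> n A)
                (\<lambda>y. complex_of_real (green_01 (y - a)) * green_eps \<epsilon> \<alpha> (x - y))))\<^sup>2)
              \<partial>lborel) \<partial>lborel)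
           + ennreal C\<^sub>2 *
             (\<integral>\<^sup>+x. (\<integral>\<^sup>+a. ennreal ((norm (signed_integral (\<lambda>A. m A - \<mu> n A)
                (\<lambda>y. complex_of_real (green_01 (y - a)) * green_eps \<epsilon> \<alpha> (x - y))))\<^sup>2)
              \<partial>lborel) \<partial>abs_measure m))"
    \<comment> \<open>The two witnesses are fixed by the nonnegativity claims below. They depend on
      \<epsilon>, \<alpha>, the mass of \<open>m\<close> and the common \<open>B\<close>, but not on
      \<open>n\<close>.\<close>
    proof (rule exI, rule exI, intro conjI allI)
      show "0 \<le> 2 * (2 / \<alpha> + 2 / (\<epsilon> * sqrt \<alpha>))\<^sup>2"
        "0 \<le> 8 * B * total_mass m / \<alpha> * (2 / \<alpha> + 2 / (\<epsilon> * sqrt \<alpha>))\<^sup>2"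
        using B m.alpha_pos by (auto intro!: mult_nonneg_nonneg divide_nonneg_nonneg)
    qed (rule m.resolvent_difference_le[OF \<mu>])
  qed
qed

end
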